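(* Let $u$ be a radial solution of $S_k(D^2u)=g(u)$ in $B_1$. Then $u$ is semistable if and only if $$\int_{B_1}\left(\frac{u'}{|x|}\right)^{k+1}\left\{\big||x|\nabla\eta\big|^2+\left(\frac{k-1}{k+1}\right)(x,\nabla\eta^2)-\left(\frac{2n-k-1}{k+1}\right)\eta^2\right\}dx\geq 0$$ for every radially symmetric function $\eta\in H_c^1(B_1)\cap L_{loc}^{\infty}(B_1)$.
   Context: $n$ is a positive integer, $k\in\{1,\dots,n\}$, $B_1$ is the open unit ball of $\mathbb{R}^n$, $c_{n,k}=\binom{n}{k}/n$, $(\cdot,\cdot)$ is the Euclidean inner product, and $g:\mathbb{R}\to\mathbb{R}$ is a positive $C^1$ function. A function is radial if $u(x)=u(r)$, $r=|x|$; $u'$ is its derivative in $r$. $H^1_c(B_1)$ is the set of $H^1(B_1)$ functions with compact support in $B_1$. $S_k(D^2u)=\sigma_k(\lambda(D^2u))$ is the $k$-th elementary symmetric function of the eigenvalues of the Hessian $D^2u$, and $S_k^{ij}(D^2u)=\frac{\partial}{\partial u_{ij}}S_k(D^2u)$, where $u_i=u_{x_i}$, $u_{ij}=u_{x_ix_j}$. For radial $u$, with $\lambda_1=u''$ and $\lambda_2=u'/r$, one has at $x\neq0$ $$S_k^{ij}(D^2u)=k\,c_{n,k}\left(\lambda_2^{k-1}\delta_{ij}+\frac{k-1}{n-1}\lambda_2^{k-2}(\lambda_1-\lambda_2)\Big(\delta_{ij}-\frac{x_ix_j}{|x|^2}\Big)\right)$$ (the second term is absent when $k=1$). Classical solution: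 $u\in C^2(B_1)\cap C(\overline{B_1})$, $u=0$ on $\partial B_1$, $\sigma_i(\lambda(D^2u))>0$ in $B_1$ for $i=1,\dots,k$, and $S_k(D^2u)=g(u)$ in $B_1$. Weak solution: $u\in L^{k+1}(B_1)$, $\int_{B_1}\sum u_iu_jS_k^{ij}(D^2u)<\infty$, $g(u)\in L^1(B_1)$ and $\int_{B_1}\{\frac1k\sum u_i\eta_jS_k^{ij}(D^2u)+g(u)\eta\}=0$ for all $\eta\in C_c^1(B_1)$ (for radial $u$, $\sum u_iu_jS_k^{ij}(D^2u)=k\,c_{n,k}(u'/r)^{k-1}(u')^2$ and $\sum u_i\eta_jS_k^{ij}(D^2u)=k\,c_{n,k}(u'/r)^k(x,\nabla\eta)$, which do not involve $u''$). "Solution" means classical or weak solution. Radial solutions are understood with $u'\ge0$ (weak radial solutions are then $C^2$ functions of $r$ on $(0,1]$). A solution $u$ is semistable if $\int_{B_1}\{\sum\varphi_i\varphi_jS_k^{ij}(D^2u)+g'(u)\varphi^2\}dx\ge0$ for all $\varphi\in C_c^1(B_1\setminus\{0\})$ ($\varphi$ not necessarily radial). *)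

theory Defs
  imports "HOL-Analysis.Analysis" "HOL-Computational_Algebra.Polynomial"
begin

section \<open>The k-Hessian operator\<close>

text \<open>
  Points of \<open>n\<close>-space are vectors \<open>x :: real^'n\<close>, with \<open>n = CARD('n)\<close>.
\<close>

definition partial :: "'n \<Rightarrow> (real^'n::finite \<Rightarrow> real) \<Rightarrow> real^'n \<Rightarrow> real" where
  "partial i f x = frechet_derivative f (at x) (axis i 1)"

definition grad :: "(real^'n::finite \<Rightarrow> real) \<Rightarrow> real^'n \<Rightarrow> real^'n" where
  "grad f x = (\<chi> i. partial i f x)"

definition hessian :: "(real^'n::finite \<Rightarrow> real) \<Rightarrow> real^'n \<Rightarrow> real^'n^'n" where
  "hessian f x = (\<chi> i j. partial j (partial i f) x)"

definition C1_on :: "(real^'n::finite) set \<Rightarrow> (real^'n \<Rightarrow> real) \<Rightarrow> bool" where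
  "C1_on S f \<longleftrightarrow> (\<forall>x\<in>S. f differentiable (at x)) \<and> (\<forall>i. continuous_on S (partial i f))"

definition C2_on :: "(real^'n::finite) set \<Rightarrow> (real^'n \<Rightarrow> real) \<Rightarrow> bool" where
  "C2_on S f \<longleftrightarrow> C1_on S f \<and> (\<forall>i. C1_on S (partial i f))"

definition charpoly :: "real^'n^'n::finite \<Rightarrow> complex poly" where
  "charpoly A = det (\<chi> i j. (if i = j then [:0, 1:] else 0) - [:complex_of_real (A $ i $ j):])"

text \<open>
  The eigenvalues, listed with algebraic multiplicity. The list is unique up to order, which
  is irrelevant below. Complex eigenvalues are admitted because differentiating with respect
  to a single matrix entry leaves the space of symmetric matrices.
\<close>

definition eigenvalues :: "real^'n^'n::finite \<Rightarrow> complex^'n" where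
  "eigenvalues A = (SOME l. charpoly A = (\<Prod>i\<in>UNIV. [:- (l $ i), 1:]))"

definition elem_sym :: "nat \<Rightarrow> complex^'n::finite \<Rightarrow> complex" where
  "elem_sym k l = (\<Sum>I | I \<subseteq> UNIV \<and> card I = k. \<Prod>i\<in>I. l $ i)"

text \<open>
  The elementary symmetric functions of the eigenvalues of a real matrix are real
  (up to sign they are coefficients of its characteristic polynomial), so \<open>Re\<close> is
  merely a change of type.
\<close>

definition S :: "nat \<Rightarrow> real^'n^'n::finite \<Rightarrow> real" where
  "S k A = Re (elem_sym k (eigenvalues A))"

text \<open>
  The derivative of \<open>S k\<close> with respect to the \<open>(i,j)\<close> entry, all entries being treated as
  independent variables.
\<close>

definition Sij :: "nat \<Rightarrow> real^'n^'n::finite \<Rightarrow> 'n \<Rightarrow> 'n \<Rightarrow> real" where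
  "Sij k A i j = deriv (\<lambda>t. S k (A + t *\<^sub>R axis i (axis j 1))) 0"


section \<open>Function spaces\<close>

definition C1_c :: "(real^'n::finite) set \<Rightarrow> (real^'n \<Rightarrow> real) \<Rightarrow> bool" where
  "C1_c W f \<longleftrightarrow> C1_on UNIV f \<and> compact (closure {x. f x \<noteq> 0}) \<and> closure {x. f x \<noteq> 0} \<subseteq> W"

definition L1_loc :: "(real^'n::finite) set \<Rightarrow> (real^'n \<Rightarrow> 'b::{banach, second_countable_topology}) \<Rightarrow> bool"
  where "L1_loc W f \<longleftrightarrow> (\<forall>K. compact K \<and> K \<subseteq> W \<longrightarrow> set_integrable lebesgue K f)"

definition has_weak_grad ::
    "(real^'n::finite) set \<Rightarrow> (real^'n \<Rightarrow> real) \<Rightarrow> (real^'n \<Rightarrow> real^'n) \<Rightarrow> bool" where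
  "has_weak_grad W f G \<longleftrightarrow> L1_loc W f \<and> L1_loc W G \<and>
     (\<forall>\<psi> i. C1_c W \<psi> \<longrightarrow>
        (LINT x|lebesgue_on W. f x * partial i \<psi> x) = - (LINT x|lebesgue_on W. G x $ i * \<psi> x))"

text \<open>The weak gradient is unique up to null sets.\<close>

definition weak_grad :: "(real^'n::finite) set \<Rightarrow> (real^'n \<Rightarrow> real) \<Rightarrow> real^'n \<Rightarrow> real^'n" where
  "weak_grad W f = (SOME G. has_weak_grad W f G)"

definition H1 :: "(real^'n::finite) set \<Rightarrow> (real^'n \<Rightarrow> real) set" where
  "H1 W = {f. f \<in> borel_measurable (lebesgue_on W) \<and> integrable (lebesgue_on W) (\<lambda>x. (f x)\<^sup>2) \<and>
     (\<exists>G. has_weak_grad W f G \<and> integrable (lebesgue_on W) (\<lambda>x. (norm (G x))\<^sup>2))}"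

definition H1_c :: "(real^'n::finite) set \<Rightarrow> (real^'n \<Rightarrow> real) set" where
  "H1_c W = {f \<in> H1 W. \<exists>K. compact K \<and> K \<subseteq> W \<and> (AE x in lebesgue_on W. x \<notin> K \<longrightarrow> f x = 0)}"

definition Linf_loc :: "(real^'n::finite) set \<Rightarrow> (real^'n \<Rightarrow> real) set" where
  "Linf_loc W = {f. f \<in> borel_measurable (lebesgue_on W) \<and>
     (\<forall>K. compact K \<and> K \<subseteq> W \<longrightarrow> (\<exists>M. AE x in lebesgue_on K. \<bar>f x\<bar> \<le> M))}"

definition radially_symmetric :: "(real^'n::finite) set \<Rightarrow> (real^'n \<Rightarrow> real) \<Rightarrow> bool" where
  "radially_symmetric W f \<longleftrightarrow> (\<exists>h. AE x in lebesgue_on W. f x = h (norm x))"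

text \<open>
  The integral of \<open>f\<close> exists in \<open>(-\<infinity>, \<infinity>]\<close> and is nonnegative. The library integral
  of a non-integrable function is \<open>0\<close>, so it would make the inequality hold for the wrong reason
  when the integral diverges; for singular solutions the value \<open>+\<infinity>\<close> can occur.
\<close>

definition integral_nonneg :: "'a measure \<Rightarrow> ('a \<Rightarrow> real) \<Rightarrow> bool" where
  "integral_nonneg M f \<longleftrightarrow> f \<in> borel_measurable M \<and>
     (\<integral>\<^sup>+ x. ennreal (- f x) \<partial>M) < \<infinity> \<and>
     (\<integral>\<^sup>+ x. ennreal (- f x) \<partial>M) \<le> (\<integral>\<^sup>+ x. ennreal (f x) \<partial>M)"

definition loc_abs_continuous :: "real set \<Rightarrow> (real \<Rightarrow> real) \<Rightarrow> bool" where
  "loc_abs_continuous J v \<longleftrightarrow>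
     (AE t in lebesgue_on J. v differentiable (at t)) \<and>
     (\<forall>a b. a \<le> b \<and> {a..b} \<subseteq> J \<longrightarrow>
        set_integrable lebesgue {a..b} (deriv v) \<and>
        v b - v a = (LINT t:{a..b}|lebesgue. deriv v t))"


section \<open>Solutions and semistability\<close>

abbreviation B1 :: "(real^'n::finite) set" where
  "B1 \<equiv> ball 0 1"

definition c_nk :: "nat \<Rightarrow> nat \<Rightarrow> real" where
  "c_nk n k = real (n choose k) / real n"

definition classical_solution :: "nat \<Rightarrow> (real \<Rightarrow> real) \<Rightarrow> (real^'n::finite \<Rightarrow> real) \<Rightarrow> bool" where
  "classical_solution k g u \<longleftrightarrow>
     C2_on B1 u \<and> continuous_on (cball 0 1) u \<and> (\<forall>x\<in>sphere 0 1. u x = 0) \<and>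
     (\<forall>x\<in>B1. \<forall>i\<in>{1..k}. S i (hessian u x) > 0) \<and>
     (\<forall>x\<in>B1. S k (hessian u x) = g (u x))"

text \<open>
  \<open>v\<close> is a profile of \<open>u\<close>, and \<open>u'\<close> is \<open>deriv v\<close>. Values of \<open>v\<close> outside \<open>[0,1)\<close> are irrelevant.
\<close>

definition radial_profile :: "(real^'n::finite \<Rightarrow> real) \<Rightarrow> (real \<Rightarrow> real) \<Rightarrow> bool" where
  "radial_profile u v \<longleftrightarrow> (\<forall>x\<in>B1. u x = v (norm x))"

text \<open>
  Weak solutions are only required to have one derivative in \<open>r\<close>, in the weak sense: \<open>u\<close> is its
  absolutely continuous representative. Accordingly the terms \<open>\<Sum> u\<^sub>i u\<^sub>j S\<^sub>k\<^sup>i\<^sup>j(D\<^sup>2u)\<close>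
  and \<open>\<Sum> u\<^sub>i \<eta>\<^sub>j S\<^sub>k\<^sup>i\<^sup>j(D\<^sup>2u)\<close> are written in their radial form, which does not involve second
  derivatives:
  \<open>k c\<^sub>n\<^sub>k (u'/r)\<^sup>k\<^sup>-\<^sup>1 (u')\<^sup>2\<close> and \<open>k c\<^sub>n\<^sub>k (u'/r)\<^sup>k (x,\<nabla>\<eta>)\<close>.
\<close>

definition weak_radial_solution ::
    "nat \<Rightarrow> (real \<Rightarrow> real) \<Rightarrow> (real^'n::finite \<Rightarrow> real) \<Rightarrow> (real \<Rightarrow> real) \<Rightarrow> bool" where
  "weak_radial_solution k g u v \<longleftrightarrow>
     loc_abs_continuous {0<..<1} v \<and>
     u \<in> borel_measurable (lebesgue_on B1) \<and>
     integrable (lebesgue_on B1) (\<lambda>x. \<bar>u x\<bar> ^ (k + 1)) \<and>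
     integrable (lebesgue_on (B1 :: (real^'n) set))
       (\<lambda>x. k * c_nk CARD('n) k * (deriv v (norm x) / norm x) ^ (k - 1) * (deriv v (norm x))\<^sup>2) \<and>
     integrable (lebesgue_on B1) (\<lambda>x. g (u x)) \<and>
     (\<forall>\<eta>. C1_c B1 \<eta> \<longrightarrow>
        (LINT x|lebesgue_on B1.
           1 / k * (k * c_nk CARD('n) k * (deriv v (norm x) / norm x) ^ k * (x \<bullet> grad \<eta> x))
           + g (u x) * \<eta> x) = 0)"

text \<open>For an absolutely continuous \<open>v\<close> the last condition says \<open>v' \<ge> 0\<close> almost everywhere.\<close>

definition radial_solution ::
    "nat \<Rightarrow> (real \<Rightarrow> real) \<Rightarrow> (real^'n::finite \<Rightarrow> real) \<Rightarrow> (real \<Rightarrow> real) \<Rightarrow> bool" where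
  "radial_solution k g u v \<longleftrightarrow>
     radial_profile u v \<and>
     (classical_solution k g u \<or> weak_radial_solution k g u v) \<and>
     (\<forall>r\<in>{0<..<1}. v differentiable (at r) \<longrightarrow> deriv v r \<ge> 0)"

definition semistable :: "nat \<Rightarrow> (real \<Rightarrow> real) \<Rightarrow> (real^'n::finite \<Rightarrow> real) \<Rightarrow> bool" where
  "semistable k g u \<longleftrightarrow>
     (\<forall>\<phi>. C1_c (B1 - {0}) \<phi> \<longrightarrow>
        (LINT x|lebesgue_on B1.
           (\<Sum>i\<in>UNIV. \<Sum>j\<in>UNIV. partial i \<phi> x * partial j \<phi> x * Sij k (hessian u x) i j)
           + deriv g (u x) * (\<phi> x)\<^sup>2) \<ge> 0)"

end

theory Submission
  imports Defs "HOL-Computational_Algebra.Fundamental_Theorem_Algebra" "HOL-Real_Asymp.Real_Asymp"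
begin

text \<open>
  Let \<open>u' = r q\<close>. For a radial function the equation reads \<open>c (n q\<^sup>k + k q\<^sup>k\<^sup>-\<^sup>1 r q') = g(v)\<close>, that is, the flux
  \<open>r\<^sup>n q\<^sup>k\<close> has the derivative \<open>r\<^sup>n\<^sup>-\<^sup>1 g(v) / c\<close>, where \<open>c = c\<^sub>n\<^sub>k\<close>. The locale \<open>radial_core\<close> collects what is used of a
  solution: this equation with \<open>q > 0\<close>, a flux that vanishes at the origin, and finite energy there.
  Classical solutions have these properties by a direct computation (\<open>radial_core_classical\<close>). For weak
  solutions \<open>q\<close> is at first known almost everywhere only; the weak equation identifies the flux with the
  primitive of \<open>r\<^sup>n\<^sup>-\<^sup>1 g(v)\<close>, and this makes \<open>q\<close> continuously differentiable (\<open>radial_core_weak\<close>).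

  The Hessian at \<open>x \<noteq> 0\<close> is \<open>q I + r q' e e\<^sup>T\<close> with \<open>e = x/r\<close>. The quadratic form of \<open>S\<^sub>k\<^sup>i\<^sup>j\<close> is then
  \<open>k c q\<^sup>k\<^sup>-\<^sup>1\<close> times the square of the radial derivative plus a nonnegative tangential part
  (\<open>Sij_radial_matrix\<close>). The tangential part vanishes on radial test functions, so that semistability amounts to an
  inequality along rays, which is the inequality \<open>Q_nonneg\<close> for test functions \<open>h\<close> on \<open>(0,1)\<close>
  (\<open>semistable_iff_Q_nonneg\<close>). Substituting \<open>h = u' \<eta>\<close>
  and integrating by parts, the differentiated equation removes \<open>g'\<close> and leaves the inequality
  \<open>J_nonneg\<close> with the weight \<open>q\<^sup>k\<^sup>+\<^sup>1\<close> (\<open>Q_nonneg_iff_J_nonneg\<close>). This is the asserted inequality for \<open>C\<^sup>1\<close> functions \<open>\<eta>\<close>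
  that vanish near the origin.

  It remains to admit bounded \<open>\<eta>\<close> of class \<open>H\<^sup>1\<close> with compact support that need not vanish near the origin. The inequality
  itself forces the weight to be integrable at the origin (\<open>weight_integrable_origin\<close>): for \<open>n < 2k\<close>
  the flux bounds \<open>q\<close>, and for \<open>n \<ge> 2k\<close> suitable test functions make the form negative near the origin.
  As \<open>\<eta>\<close> is bounded, the negative part of the integrand is then integrable, and cut-offs at the
  origin can be removed by dominated convergence (\<open>weighted_form_nonneg\<close>); the integral of the positive part may be infinite.
\<close>

section \<open>Rank one perturbations of determinants\<close>


definition outer :: "'a::times^'n \<Rightarrow> 'a^'n \<Rightarrow> 'a^'n^'n" where
  "outer a b = (\<chi> i j. a $ i * b $ j)"

definition replace_row :: "'a^'n^'n \<Rightarrow> 'n \<Rightarrow> 'a^'n \<Rightarrow> 'a^'n^'n" where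
  "replace_row M i b = (\<chi> l. if l = i then b else M $ l)"

text \<open>The difference is linear in the first power of the perturbation: all higher terms of the
  multilinear expansion contain two rows proportional to \<open>b\<close>.\<close>

lemma det_add_outer:
  fixes M :: "'a::comm_ring_1^'n^'n::finite"
  shows "det (M + outer a b) = det M + (\<Sum>i\<in>UNIV. a $ i * det (replace_row M i b))"
proof -
  define P where "P T = (\<chi> l. if l \<in> T then M $ l + a $ l *s b else M $ l)" for T :: "'n set"
  have main: "det (P T) = det M + (\<Sum>i\<in>T. a $ i * det (replace_row M i b))" if "finite T" for T
    using that
  proof (induction T rule: finite_induct)
    case empty
    show ?case by (simp add: P_def)
  next
    case (insert k T)
    (* once row k equals b, the multiples of b in the other rows do not change the determinant *)
    have aux: "det (replace_row (P T') k b) = det (replace_row M k b)" if "finite T'" "k \<notin> T'" for T'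
      using that
    proof (induction T' rule: finite_induct)
      case empty
      show ?case by (simp add: P_def replace_row_def)
    next
      case (insert j T')
      have jk: "j \<noteq> k" using insert by auto
      let ?A = "replace_row (P T') k b"
      have "row j ?A = M $ j" "row k ?A = b"
        using jk insert by (auto simp: row_def replace_row_def P_def vec_eq_iff)
      moreover have "replace_row (P (insert j T')) k b = (\<chi> l. if l = j then M $ j + a $ j *s b else row l ?A)"
        using jk insert by (auto simp: row_def replace_row_def P_def vec_eq_iff)
      ultimately have "replace_row (P (insert j T')) k b
          = (\<chi> l. if l = j then row j ?A + a $ j *s row k ?A else row l ?A)"
        by metis
      then have "det (replace_row (P (insert j T')) k b) = det ?A"
        using det_row_operation[OF jk, of ?A "a $ j"] by simp
      then show ?case using insert by simp
    qed
    have "det (P (insert k T)) = det (\<chi> l. if l = k then M $ k + a $ k *s b else P T $ l)"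
      by (rule arg_cong[of _ _ det]) (auto simp: P_def vec_eq_iff)
    also have "\<dots> = det (\<chi> l. if l = k then M $ k else P T $ l) + det (\<chi> l. if l = k then a $ k *s b else P T $ l)"
      by (rule det_row_add)
    also have "det (\<chi> l. if l = k then a $ k *s b else P T $ l) = a $ k * det (\<chi> l. if l = k then b else P T $ l)"
      by (rule det_row_mul)
    also have "(\<chi> l. if l = k then M $ k else P T $ l) = P T"
      using insert by (auto simp: P_def vec_eq_iff)
    also have "(\<chi> l. if l = k then b else P T $ l) = replace_row (P T) k b"
      by (simp add: replace_row_def)
    finally show ?case using insert aux[OF insert(1,2)] by (simp add: algebra_simps)
  qed
  have "P UNIV = M + outer a b" by (auto simp: P_def outer_def vec_eq_iff)
  then show ?thesis using main[of UNIV] by simp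
qed

lemma det_replace_row_sum:
  fixes M :: "'a::comm_ring_1^'n^'n::finite"
  shows "(\<Sum>j\<in>UNIV. b $ j * det (replace_row M i (axis j 1))) = det (replace_row M i b)"
proof -
  have "b = (\<Sum>j\<in>UNIV. b $ j *s axis j 1)"
    by (simp add: vec_eq_iff axis_def if_distrib cong: if_cong)
  then have "det (replace_row M i b) = det (\<chi> l. if l = i then (\<Sum>j\<in>UNIV. b $ j *s axis j 1) else M $ l)"
    unfolding replace_row_def by metis
  also have "\<dots> = (\<Sum>j\<in>UNIV. det (\<chi> l. if l = i then b $ j *s axis j 1 else M $ l))"
    by (rule det_linear_row_sum) simp
  also have "\<dots> = (\<Sum>j\<in>UNIV. b $ j * det (replace_row M i (axis j 1)))"
    unfolding replace_row_def by (intro sum.cong refl det_row_mul)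
  finally show ?thesis by simp
qed

lemma det_replace_row_unit:
  fixes b :: "'a::comm_ring_1^'n::finite"
  shows "det (replace_row (mat 1) i b) = b $ i"
proof -
  have "b $ j * det (replace_row (mat 1) i (axis j 1)) = (if j = i then b $ i else 0)" for j
  proof (cases "j = i")
    case True
    have "replace_row (mat 1) i (axis i 1) = (mat 1 :: 'a^'n^'n)"
      by (auto simp: replace_row_def vec_eq_iff mat_def axis_def)
    then show ?thesis using True by simp
  next
    case False
    have "row i (replace_row (mat 1) i (axis j 1)) = row j (replace_row (mat 1 :: 'a^'n^'n) i (axis j 1))"
      using False by (auto simp: row_def replace_row_def vec_eq_iff mat_def axis_def)
    then have "det (replace_row (mat 1 :: 'a^'n^'n) i (axis j 1)) = 0"
      using det_identical_rows False by metis
    then show ?thesis using False by simp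
  qed
  then show ?thesis using det_replace_row_sum[of b "mat 1" i] by simp
qed

lemma det_one_minus_outer:
  fixes a b :: "'a::comm_ring_1^'n::finite"
  shows "det (mat 1 - outer a b) = 1 - (\<Sum>i\<in>UNIV. a $ i * b $ i)"
proof -
  have "mat 1 - outer a b = mat 1 + outer (- a) b" by (simp add: outer_def vec_eq_iff)
  then show ?thesis unfolding \<open>mat 1 - outer a b = _\<close> det_add_outer by (simp add: det_replace_row_unit sum_negf)
qed

section \<open>Eigenvalues and the characteristic polynomial\<close>

definition cp_mat :: "real^'n^'n::finite \<Rightarrow> complex poly^'n^'n" where
  "cp_mat A = (\<chi> i j. (if i = j then [:0, 1:] else 0) - [:complex_of_real (A $ i $ j):])"

lemma charpoly_eq: "charpoly A = det (cp_mat A)"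
  by (simp add: charpoly_def cp_mat_def)

lemma prod_coeff_top:
  fixes f :: "'i \<Rightarrow> 'a::comm_semiring_1 poly"
  assumes "finite I" "\<And>i. i \<in> I \<Longrightarrow> degree (f i) \<le> 1"
  shows "degree (prod f I) \<le> card I \<and> coeff (prod f I) (card I) = (\<Prod>i\<in>I. coeff (f i) 1)"
  using assms
proof (induction I rule: finite_induct)
  case empty
  then show ?case by simp
next
  case (insert x I)
  then have IH: "degree (prod f I) \<le> card I" "coeff (prod f I) (card I) = (\<Prod>i\<in>I. coeff (f i) 1)" "degree (f x) \<le> 1"
    by auto
  have "degree (f x * prod f I) \<le> 1 + card I"
    using degree_mult_le[of "f x" "prod f I"] IH by linarith
  moreover have "coeff (f x * prod f I) (1 + card I) = coeff (f x) 1 * coeff (prod f I) (card I)"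
  proof -
    have "coeff (f x * prod f I) (1 + card I) = (\<Sum>i\<le>1 + card I. coeff (f x) i * coeff (prod f I) (1 + card I - i))"
      by (rule coeff_mult)
    also have "\<dots> = (\<Sum>i\<in>{1}. coeff (f x) i * coeff (prod f I) (1 + card I - i))"
    proof (rule sum.mono_neutral_right)
      show "\<forall>i\<in>{..1 + card I} - {1}. coeff (f x) i * coeff (prod f I) (1 + card I - i) = 0"
      proof
        fix i assume i: "i \<in> {..1 + card I} - {1}"
        show "coeff (f x) i * coeff (prod f I) (1 + card I - i) = 0"
        proof (cases "i = 0")
          case True
          then show ?thesis using IH(1) coeff_eq_0[of "prod f I" "1 + card I"] by simp
        next
          case False
          then have "degree (f x) < i" using i IH(3) by simp
          then show ?thesis by (simp add: coeff_eq_0)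
        qed
      qed
    qed auto
    finally show ?thesis by simp
  qed
  ultimately show ?case using insert IH by simp
qed

lemma charpoly_monic:
  fixes A :: "real^'n^'n::finite"
  shows "degree (charpoly A) = CARD('n) \<and> coeff (charpoly A) (CARD('n)) = 1"
proof -
  let ?t = "\<lambda>p. \<Prod>i\<in>UNIV. cp_mat A $ i $ p i"
  have d: "degree (cp_mat A $ i $ j) \<le> 1" for i j
    by (auto simp: cp_mat_def intro!: degree_diff_le)
  have t: "degree (?t p) \<le> CARD('n)" "coeff (?t p) CARD('n) = (\<Prod>i\<in>UNIV. coeff (cp_mat A $ i $ p i) 1)" for p
    using prod_coeff_top[of UNIV "\<lambda>i. cp_mat A $ i $ p i"] d by auto
  have c1: "coeff (cp_mat A $ i $ j) 1 = (mat 1 :: complex^'n^'n) $ i $ j" for i j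
    by (auto simp: cp_mat_def mat_def)
  have sgn: "of_int (sign p) * q = smult (of_int (sign p)) q" for p and q :: "complex poly"
    by (simp add: of_int_poly)
  have "degree (det (cp_mat A)) \<le> CARD('n)"
    unfolding det_def sgn by (intro degree_sum_le finite_permutations finite order.trans[OF degree_smult_le t(1)])
  moreover have "coeff (det (cp_mat A)) (CARD('n)) = det (mat 1 :: complex^'n^'n)"
    unfolding det_def sgn by (simp add: coeff_sum t(2) c1[simplified])
  ultimately show ?thesis
    unfolding charpoly_eq by (metis det_I le_antisym le_degree zero_neq_one)
qed

lemma charpoly_splits:
  fixes A :: "real^'n^'n::finite"
  shows "charpoly A = (\<Prod>i\<in>UNIV. [:- (eigenvalues A $ i), 1:])"
proof -
  have "charpoly A \<noteq> 0" using charpoly_monic[of A] by auto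
  then obtain M where M: "size M = degree (charpoly A)"
      "charpoly A = smult (lead_coeff (charpoly A)) (\<Prod>x\<in>#M. [:-x, 1:])"
    using alg_closed_imp_factorization by blast
  obtain xs where xs: "mset xs = M" using ex_mset by blast
  have len: "length xs = CARD('n)" using M(1) charpoly_monic[of A] xs by auto
  obtain f :: "'n \<Rightarrow> nat" where f: "bij_betw f UNIV {..<CARD('n)}"
    using finite_same_card_bij[of "UNIV :: 'n set" "{..<CARD('n)}"] by auto
  have "(\<Prod>x\<in>#M. [:-x, 1:]) = (\<Prod>x\<leftarrow>xs. [:-x, 1:])"
    unfolding xs[symmetric] mset_map[symmetric] prod_mset_prod_list ..
  also have "\<dots> = (\<Prod>l<CARD('n). [:- (xs ! l), 1:])"
    by (simp add: prod.list_conv_set_nth len lessThan_atLeast0)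
  also have "\<dots> = (\<Prod>i\<in>UNIV. [:- (xs ! f i), 1:])"
    using prod.reindex_bij_betw[OF f, of "\<lambda>l. [:- (xs ! l), 1:]"] by simp
  finally have "charpoly A = (\<Prod>i\<in>UNIV. [:- ((\<chi> i. xs ! f i) $ i), 1:])"
    using M(2) charpoly_monic[of A] by simp
  then show ?thesis unfolding eigenvalues_def by (rule someI)
qed

text \<open>Vieta's formula. The coefficient does not depend on the enumeration of the eigenvalues that the
  definition of \<^term>\<open>S\<close> selects.\<close>

lemma S_charpoly:
  fixes A :: "real^'n^'n::finite"
  assumes "k \<le> CARD('n)"
  shows "S k A = Re ((-1) ^ k * coeff (charpoly A) (CARD('n) - k))"
proof -
  let ?l = "eigenvalues A" and ?n = "CARD('n)"
  have "charpoly A = (\<Prod>i\<in>UNIV. [:- (?l $ i):] + [:0, 1:])"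
    by (simp add: charpoly_splits)
  also have "\<dots> = (\<Sum>X\<in>Pow UNIV. (\<Prod>i\<in>X. [:- (?l $ i):]) * (\<Prod>i\<in>UNIV - X. [:0, 1:]))"
    by (rule prod_add) simp
  also have "\<dots> = (\<Sum>X\<in>Pow UNIV. monom ((-1) ^ card X * (\<Prod>i\<in>X. ?l $ i)) (?n - card X))"
  proof (rule sum.cong[OF refl])
    fix X :: "'n set"
    have "(\<Prod>i\<in>X. [:- (?l $ i):]) = [:\<Prod>i\<in>X. - (?l $ i):]"
      by (induction X rule: infinite_finite_induct) auto
    then show "(\<Prod>i\<in>X. [:- (?l $ i):]) * (\<Prod>i\<in>UNIV - X. [:0, 1:]) = monom ((-1) ^ card X * (\<Prod>i\<in>X. ?l $ i)) (?n - card X)"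
      by (simp add: prod_uminus monom_altdef card_Diff_subset)
  qed
  finally have "coeff (charpoly A) (?n - k) = (\<Sum>X\<in>Pow UNIV. if card X = k then (-1) ^ k * (\<Prod>i\<in>X. ?l $ i) else 0)"
  proof (simp add: coeff_sum, intro sum.cong refl)
    fix X :: "'n set"
    have "card X \<le> ?n" by (simp add: card_mono)
    then have "(?n - card X = ?n - k) = (card X = k)" using assms by linarith
    then show "(if ?n - card X = ?n - k then (- 1) ^ card X * (\<Prod>i\<in>X. ?l $ i) else 0) =
        (if card X = k then (- 1) ^ k * (\<Prod>i\<in>X. ?l $ i) else 0)" by simp
  qed
  also have "\<dots> = (\<Sum>X | X \<subseteq> UNIV \<and> card X = k. (-1) ^ k * (\<Prod>i\<in>X. ?l $ i))"
    by (rule sum.mono_neutral_cong_right) auto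
  also have "\<dots> = (-1) ^ k * elem_sym k ?l"
    by (simp add: elem_sym_def sum_distrib_left)
  finally have "(-1) ^ k * coeff (charpoly A) (?n - k) = (-1) ^ k * ((-1) ^ k * elem_sym k ?l)" by simp
  then show ?thesis by (simp add: S_def flip: mult.assoc)
qed

lemma cp_mat_add_outer:
  "cp_mat (A + outer a b) = cp_mat A + outer (\<chi> i. [:- complex_of_real (a $ i):]) (\<chi> i. [:complex_of_real (b $ i):])"
  by (auto simp: cp_mat_def outer_def vec_eq_iff)

text \<open>The determinant is affine in every single entry of a matrix, so that the derivative in the
  direction of that entry is exact.\<close>

lemma Sij_eq:
  fixes A :: "real^'n^'n::finite"
  assumes "k \<le> CARD('n)"
  shows "Sij k A i j = - Re ((-1) ^ k * coeff (det (replace_row (cp_mat A) i (axis j 1))) (CARD('n) - k))"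
proof -
  have eq: "A + t *\<^sub>R axis i (axis j 1) = A + outer (t *\<^sub>R axis i 1) (axis j 1)" for t
    by (auto simp: outer_def vec_eq_iff axis_def)
  have ax: "(\<chi> l. [:complex_of_real (axis j 1 $ l):]) = axis j 1"
    by (auto simp: vec_eq_iff axis_def one_pCons)
  have cp: "charpoly (A + t *\<^sub>R axis i (axis j 1)) = charpoly A - smult (of_real t) (det (replace_row (cp_mat A) i (axis j 1)))" for t
  proof -
    have "(\<Sum>l\<in>UNIV. [:- complex_of_real ((t *\<^sub>R axis i 1 :: real^'n) $ l):] * det (replace_row (cp_mat A) l (axis j 1)))
       = (\<Sum>l\<in>UNIV. if l = i then - smult (of_real t) (det (replace_row (cp_mat A) i (axis j 1))) else 0)"
      by (intro sum.cong refl) (auto simp: axis_def)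
    then show ?thesis
      unfolding charpoly_eq eq cp_mat_add_outer det_add_outer ax by simp
  qed
  have "S k (A + t *\<^sub>R axis i (axis j 1)) = S k A + t * (- Re ((-1) ^ k * coeff (det (replace_row (cp_mat A) i (axis j 1))) (CARD('n) - k)))" for t
    unfolding S_charpoly[OF assms] cp by (simp add: right_diff_distrib)
  then show ?thesis
    unfolding Sij_def by (intro DERIV_imp_deriv) (auto intro!: derivative_eq_intros)
qed

text \<open>The determinant of a rank one perturbation is affine in the perturbation, so that the first
  order expansion of \<open>S\<^sub>k\<close> in the direction \<open>a a\<^sup>T\<close> is exact. This reduces the quadratic form to
  characteristic polynomials.\<close>

lemma Sij_quadratic_form:
  fixes A :: "real^'n^'n::finite"
  assumes "k \<le> CARD('n)"
  shows "(\<Sum>i\<in>UNIV. \<Sum>j\<in>UNIV. a $ i * a $ j * Sij k A i j) = S k (A + outer a a) - S k A"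
proof -
  let ?m = "CARD('n) - k" and ?d = "\<lambda>i j. det (replace_row (cp_mat A) i (axis j 1))"
  have "S k (A + outer a a) - S k A
     = Re ((-1) ^ k * coeff (\<Sum>i\<in>UNIV. [:- complex_of_real (a $ i):] * det (replace_row (cp_mat A) i (\<chi> j. [:complex_of_real (a $ j):]))) ?m)"
    unfolding S_charpoly[OF assms] charpoly_eq cp_mat_add_outer det_add_outer
    by (simp add: right_diff_distrib distrib_left)
  also have "\<dots> = Re ((-1) ^ k * coeff (\<Sum>i\<in>UNIV. \<Sum>j\<in>UNIV. smult (- complex_of_real (a $ i * a $ j)) (?d i j)) ?m)"
  proof -
    have "det (replace_row (cp_mat A) i (\<chi> j. [:complex_of_real (a $ j):])) = (\<Sum>j\<in>UNIV. [:complex_of_real (a $ j):] * ?d i j)" for i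
      using det_replace_row_sum[of "\<chi> j. [:complex_of_real (a $ j):]" "cp_mat A" i] by simp
    then show ?thesis by (simp add: sum_distrib_left sum_negf mult.commute smult_sum)
  qed
  also have "\<dots> = (\<Sum>i\<in>UNIV. \<Sum>j\<in>UNIV. a $ i * a $ j * Sij k A i j)"
    unfolding Sij_eq[OF assms] coeff_sum sum_distrib_left Re_sum
    by (intro sum.cong refl) (simp add: algebra_simps)
  finally show ?thesis by simp
qed

lemma poly_det:
  fixes M :: "'a::comm_ring_1 poly^'n^'n::finite"
  shows "poly (det M) x = det (\<chi> i j. poly (M $ i $ j) x)"
proof -
  have "poly (of_int m) x = of_int m" for m by (metis of_int_poly poly_const_conv)
  then show ?thesis by (simp add: det_def poly_sum poly_prod)
qed

lemma of_real_det:
  fixes M :: "real^'n^'n::finite"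
  shows "complex_of_real (det M) = det (\<chi> i j. complex_of_real (M $ i $ j))"
  by (simp add: det_def)

lemma poly_charpoly_real:
  fixes B :: "real^'n^'n::finite"
  shows "poly (charpoly B) (of_real x) = of_real (det (mat x - B))"
proof -
  have "(\<chi> i j. poly (cp_mat B $ i $ j) (of_real x)) = (\<chi> i j. complex_of_real ((mat x - B) $ i $ j))"
    by (auto simp: cp_mat_def mat_def vec_eq_iff)
  then show ?thesis by (simp add: charpoly_eq poly_det of_real_det)
qed

lemma complex_poly_eqI_reals:
  fixes p q :: "complex poly"
  assumes "finite N" "\<And>x. x \<notin> N \<Longrightarrow> poly p (of_real x) = poly q (of_real x)"
  shows "p = q"
proof (rule ccontr)
  assume "p \<noteq> q"
  then have "finite {z. poly (p - q) z = 0}" by (intro poly_roots_finite) simp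
  then have "finite (complex_of_real -` {z. poly (p - q) z = 0})"
    by (intro finite_vimageI) (auto simp: inj_on_def)
  moreover have "- N \<subseteq> complex_of_real -` {z. poly (p - q) z = 0}"
    using assms(2) by auto
  ultimately have "finite (- N)" using finite_subset by blast
  then have "finite (UNIV :: real set)" using assms(1) by (metis Compl_partition finite_Un)
  then show False using infinite_UNIV_char_0 by blast
qed

lemma det_mat_minus_outer:
  fixes a b :: "real^'n::finite"
  assumes "y \<noteq> 0"
  shows "det (mat y - outer a b) = y ^ (CARD('n) - 1) * (y - a \<bullet> b)"
proof -
  have "mat y - outer a b = (\<chi> i. y *s (mat 1 - outer ((1 / y) *\<^sub>R a) b) $ i)"
    using assms by (auto simp: vec_eq_iff mat_def outer_def algebra_simps)
  then have "det (mat y - outer a b) = y ^ CARD('n) * det (mat 1 - outer ((1 / y) *\<^sub>R a) b)"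
    using det_rows_mul[of "\<lambda>_. y" "\<lambda>i. (mat 1 - outer ((1 / y) *\<^sub>R a) b) $ i"]
    unfolding vec_lambda_eta by simp
  also have "det (mat 1 - outer ((1 / y) *\<^sub>R a) b) = 1 - (a \<bullet> b) / y"
    unfolding det_one_minus_outer by (simp add: inner_vec_def sum_divide_distrib)
  also have "y ^ CARD('n) = y ^ (CARD('n) - 1) * y"
    using power_minus_mult[of "CARD('n)" y] by simp
  finally have "det (mat y - outer a b) = y ^ (CARD('n) - 1) * (y * (1 - a \<bullet> b / y))"
    by (simp only: mult.assoc)
  also have "y * (1 - a \<bullet> b / y) = y - a \<bullet> b" using assms by (simp add: right_diff_distrib)
  finally show ?thesis .
qed

text \<open>The matrices \<open>l I + m e e\<^sup>T\<close> with a unit vector \<open>e\<close> are the Hessians of radial functions: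
  \<open>l\<close> is the tangential eigenvalue and \<open>l + m\<close> the radial one.\<close>

definition radial_matrix :: "real \<Rightarrow> real \<Rightarrow> real^'n \<Rightarrow> real^'n^'n::finite" where
  "radial_matrix l m e = mat l + m *\<^sub>R outer e e"

text \<open>The eigenvalues are \<open>l + m\<close> on the line spanned by \<open>e\<close> and \<open>l\<close> on its orthogonal complement.\<close>

lemma charpoly_radial_matrix:
  fixes e :: "real^'n::finite"
  assumes "e \<bullet> e = 1"
  shows "charpoly (radial_matrix l m e) = [:- of_real l, 1:] ^ (CARD('n) - 1) * [:- of_real (l + m), 1:]"
proof (rule complex_poly_eqI_reals[of "{l}"])
  fix x assume "x \<notin> {l}"
  then have "x - l \<noteq> 0" by simp
  have "mat x - radial_matrix l m e = mat (x - l) - outer (m *\<^sub>R e) e"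
    by (auto simp: radial_matrix_def outer_def mat_def vec_eq_iff)
  then have "det (mat x - radial_matrix l m e) = (x - l) ^ (CARD('n) - 1) * (x - l - m)"
    using det_mat_minus_outer[OF \<open>x - l \<noteq> 0\<close>, of "m *\<^sub>R e" e] assms by simp
  then show "poly (charpoly (radial_matrix l m e)) (of_real x)
      = poly ([:- of_real l, 1:] ^ (CARD('n) - 1) * [:- of_real (l + m), 1:]) (of_real x)"
    unfolding poly_charpoly_real by (simp flip: of_real_diff of_real_add of_real_mult of_real_power add: algebra_simps)
qed simp

lemma charpoly_radial_matrix_add_outer:
  fixes e a :: "real^'n::finite"
  assumes e: "e \<bullet> e = 1" and T: "T = a \<bullet> a - (e \<bullet> a)\<^sup>2" and n: "2 \<le> CARD('n) \<or> T = 0"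
  shows "charpoly (radial_matrix l m e + outer a a) = charpoly (radial_matrix l m e)
     - smult (of_real ((e \<bullet> a)\<^sup>2)) ([:- of_real l, 1:] ^ (CARD('n) - 1))
     - smult (of_real T) ([:- of_real l, 1:] ^ (CARD('n) - 2) * [:- of_real (l + m), 1:])"
proof (rule complex_poly_eqI_reals[of "{l, l + m}"])
  fix x assume "x \<notin> {l, l + m}"
  define y where "y = x - l"
  have y: "y \<noteq> 0" "y - m \<noteq> 0" using \<open>x \<notin> {l, l + m}\<close> by (auto simp: y_def)
  define M where "M = mat y - outer (m *\<^sub>R e) e"
  define w where "w = (1 / y) *\<^sub>R (a + (m * (e \<bullet> a) / (y - m)) *\<^sub>R e)"
  have detM: "det M = y ^ (CARD('n) - 1) * (y - m)"
    unfolding M_def using det_mat_minus_outer[OF y(1), of "m *\<^sub>R e" e] e by simp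
  have Mx: "mat x - radial_matrix l m e = M"
    by (auto simp: radial_matrix_def outer_def mat_def vec_eq_iff y_def M_def)
  have Mv: "M *v z = y *\<^sub>R z - (m * (e \<bullet> z)) *\<^sub>R e" for z
  proof -
    have "(\<Sum>j\<in>UNIV. (M $ i $ j) * z $ j) = (\<Sum>j\<in>UNIV. (if j = i then y * z $ i else 0) - m * e $ i * (e $ j * z $ j))" for i
      by (intro sum.cong refl) (auto simp: M_def mat_def outer_def algebra_simps)
    then show ?thesis
      by (simp add: vec_eq_iff matrix_vector_mult_def sum_subtractf inner_vec_def flip: sum_distrib_left)
  qed
  have "M *v w = a"
  proof -
    have ew: "e \<bullet> w = (e \<bullet> a) / (y - m)" 
    proof -
      have "e \<bullet> w = (1 / y) * ((e \<bullet> a) + m * (e \<bullet> a) / (y - m))"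
        unfolding w_def using e by (simp add: inner_add_right)
      also have "\<dots> = (e \<bullet> a) / (y - m)" using y by (simp add: divide_simps) (simp add: algebra_simps)
      finally show ?thesis .
    qed
    have "y *\<^sub>R w = a + (m * (e \<bullet> a) / (y - m)) *\<^sub>R e" unfolding w_def using y by simp
    then show ?thesis unfolding Mv ew by simp
  qed
  moreover have "M ** outer w a = outer (M *v w) a"
    by (simp add: matrix_matrix_mult_def matrix_vector_mult_def outer_def vec_eq_iff sum_distrib_right mult.assoc)
  moreover have "M ** (mat 1 - Z) = M ** mat 1 - M ** Z" for Z
    by (simp add: matrix_matrix_mult_def vec_eq_iff sum_subtractf right_diff_distrib)
  ultimately have "M - outer a a = M ** (mat 1 - outer w a)"
    by simp
  then have "det (M - outer a a) = det M * (1 - (\<Sum>i\<in>UNIV. w $ i * a $ i))"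
    by (simp add: det_mul det_one_minus_outer)
  also have "(\<Sum>i\<in>UNIV. w $ i * a $ i) = w \<bullet> a" by (simp add: inner_vec_def)
  also have "w \<bullet> a = (T + (e \<bullet> a)\<^sup>2 + m * (e \<bullet> a)\<^sup>2 / (y - m)) / y"
    unfolding w_def T by (simp add: inner_add_left power2_eq_square add_divide_distrib)
  also have "\<dots> = T / y + (e \<bullet> a)\<^sup>2 / (y - m)"
    using y by (simp add: divide_simps) (simp add: algebra_simps)
  finally have *: "det (M - outer a a) = det M - y ^ (CARD('n) - 1) * (e \<bullet> a)\<^sup>2 - T * (y ^ (CARD('n) - 1) / y) * (y - m)"
    unfolding detM using y by (simp add: divide_simps) (simp add: algebra_simps)
  have "T * (y ^ (CARD('n) - 1) / y) = T * y ^ (CARD('n) - 2)"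
  proof (cases "2 \<le> CARD('n)")
    case True
    then have "y ^ (CARD('n) - 1) = y ^ (CARD('n) - 2) * y"
      using power_minus_mult[of "CARD('n) - 1" y] by (simp add: numeral_2_eq_2)
    then show ?thesis using y by simp
  qed (use n in simp)
  then have "det (mat x - (radial_matrix l m e + outer a a))
      = det (mat x - radial_matrix l m e) - y ^ (CARD('n) - 1) * (e \<bullet> a)\<^sup>2 - T * y ^ (CARD('n) - 2) * (y - m)"
    using * by (simp add: Mx diff_diff_eq[symmetric])
  then show "poly (charpoly (radial_matrix l m e + outer a a)) (of_real x)
     = poly (charpoly (radial_matrix l m e)
     - smult (of_real ((e \<bullet> a)\<^sup>2)) ([:- of_real l, 1:] ^ (CARD('n) - 1))
     - smult (of_real T) ([:- of_real l, 1:] ^ (CARD('n) - 2) * [:- of_real (l + m), 1:])) (of_real x)"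
    by (simp flip: of_real_diff of_real_add of_real_mult of_real_power add: poly_charpoly_real y_def algebra_simps)
qed simp

lemma coeff_linear_power_signed:
  assumes "1 \<le> k" "k \<le> n"
  shows "(-1) ^ k * coeff ([:- complex_of_real l, 1:] ^ (n - 1)) (n - k)
    = - of_real (real ((n - 1) choose (k - 1)) * l ^ (k - 1))"
proof -
  have "n - 1 - (n - k) = k - 1" "(n - 1) choose (n - k) = (n - 1) choose (k - 1)"
    using assms binomial_symmetric[of "k - 1" "n - 1"] by auto
  moreover have "(-1 :: complex) ^ k * (- of_real l) ^ (k - 1) = - (of_real l ^ (k - 1))"
    using assms by (cases k) (auto simp flip: power_mult_distrib)
  ultimately show ?thesis
    using assms by (subst coeff_linear_poly_power) (auto simp: mult.left_commute[of "(-1) ^ k"])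
qed

lemma binomial_c_nk:
  assumes "1 \<le> k" "k \<le> n"
  shows "real ((n - 1) choose (k - 1)) = real k * c_nk n k"
    and "real ((n - 1) choose k) = real (n - k) * c_nk n k"
proof -
  obtain n' k' where nk: "n = Suc n'" "k = Suc k'" using assms by (metis Suc_le_D One_nat_def le_trans)
  have "Suc k' * (Suc n' choose Suc k') = Suc n' * (n' choose k')" by (rule Suc_times_binomial)
  then have *: "real k * real (n choose k) = real n * real ((n - 1) choose (k - 1))"
    unfolding nk by (metis diff_Suc_1 of_nat_mult)
  then show a: "real ((n - 1) choose (k - 1)) = real k * c_nk n k"
    using nk by (simp add: c_nk_def field_simps)
  have "n choose k = ((n - 1) choose (k - 1)) + ((n - 1) choose k)" unfolding nk by simp
  then have "real ((n - 1) choose k) = real n * c_nk n k - real k * c_nk n k"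
    using a nk by (simp add: c_nk_def)
  then show "real ((n - 1) choose k) = real (n - k) * c_nk n k"
    using assms by (simp add: of_nat_diff algebra_simps)
qed

lemma coeff_two_linear_powers:
  assumes "1 \<le> k" "k \<le> n"
  shows "(-1) ^ k * coeff ([:- complex_of_real l, 1:] ^ (n - 1) * [:- of_real m, 1:]) (n - k)
    = of_real (real ((n - 1) choose k) * l ^ k + m * (real ((n - 1) choose (k - 1)) * l ^ (k - 1)))"
proof -
  let ?p = "[:- complex_of_real l, 1:] ^ (n - 1)"
  have "?p * [:- of_real m, 1:] = pCons 0 ?p - smult (of_real m) ?p"
    by (simp add: mult.commute[of ?p])
  then have *: "coeff (?p * [:- of_real m, 1:]) (n - k) = coeff (pCons 0 ?p) (n - k) - of_real m * coeff ?p (n - k)"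
    by simp
  have "(-1) ^ k * coeff (pCons 0 ?p) (n - k) = of_real (real ((n - 1) choose k) * l ^ k)"
  proof (cases "k = n")
    case True
    then show ?thesis using assms by (simp add: binomial_eq_0)
  next
    case False
    then have "coeff (pCons 0 ?p) (n - k) = coeff ?p (n - Suc k)"
      using assms by (simp add: coeff_pCons Suc_diff_Suc[symmetric] split: nat.split)
    then show ?thesis
      using coeff_linear_power_signed[of "Suc k" n l] assms False by simp
  qed
  moreover have "(-1) ^ k * (of_real m * coeff ?p (n - k)) = - of_real (m * (real ((n - 1) choose (k - 1)) * l ^ (k - 1)))"
    using coeff_linear_power_signed[OF assms, of l] by (simp add: mult.left_commute[of "(-1) ^ k"])
  ultimately show ?thesis unfolding * right_diff_distrib by simp
qed

lemma S_radial_matrix: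
  fixes e :: "real^'n::finite"
  assumes "1 \<le> k" "k \<le> CARD('n)" "e \<bullet> e = 1"
  shows "S k (radial_matrix l m e) = c_nk CARD('n) k * (real CARD('n) * l ^ k + real k * l ^ (k - 1) * m)"
proof -
  have "S k (radial_matrix l m e)
      = real (CARD('n) - k) * c_nk CARD('n) k * l ^ k + (l + m) * (real k * c_nk CARD('n) k * l ^ (k - 1))"
    unfolding S_charpoly[OF assms(2)] charpoly_radial_matrix[OF assms(3)] coeff_two_linear_powers[OF assms(1,2)]
      binomial_c_nk[OF assms(1,2)] by simp
  also have "l ^ k = l * l ^ (k - 1)" using assms(1) by (cases k) auto
  finally show ?thesis using assms(1,2)
    by (simp add: \<open>l ^ k = _\<close> of_nat_diff algebra_simps)
qed

text \<open>The quadratic form of \<open>S\<^sub>k\<^sup>i\<^sup>j\<close> splits into a radial part, whose coefficient is the one in the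
  stability inequality, and a tangential part. Where \<open>S\<^sub>k\<close> is positive the tangential coefficient is
  nonnegative, because it is the sum of a nonnegative multiple of \<open>S\<^sub>k / l\<close> and of a nonnegative multiple
  of \<open>l\<^sup>k\<^sup>-\<^sup>1\<close>.\<close>

lemma Sij_radial_matrix:
  fixes e :: "real^'n::finite"
  assumes k: "1 \<le> k" "k \<le> CARD('n)" and e: "e \<bullet> e = 1" and l: "l > 0"
    and pos: "S k (radial_matrix l m e) > 0"
  obtains \<tau> where "\<tau> \<ge> 0"
    "\<And>a. (\<Sum>i\<in>UNIV. \<Sum>j\<in>UNIV. a $ i * a $ j * Sij k (radial_matrix l m e) i j)
      = real k * c_nk CARD('n) k * l ^ (k - 1) * (e \<bullet> a)\<^sup>2 + \<tau> * (a \<bullet> a - (e \<bullet> a)\<^sup>2)"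
proof -
  let ?n = "CARD('n)"
  let ?q = "[:- complex_of_real l, 1:] ^ (?n - 2) * [:- of_real (l + m), 1:]"
  define \<tau> where "\<tau> = (if ?n = 1 then 0 else - Re ((-1) ^ k * coeff ?q (?n - k)))"
  have form: "(\<Sum>i\<in>UNIV. \<Sum>j\<in>UNIV. a $ i * a $ j * Sij k (radial_matrix l m e) i j)
      = real k * c_nk ?n k * l ^ (k - 1) * (e \<bullet> a)\<^sup>2 + \<tau> * (a \<bullet> a - (e \<bullet> a)\<^sup>2)" for a
  proof -
    have T: "2 \<le> ?n \<or> a \<bullet> a - (e \<bullet> a)\<^sup>2 = 0"
    proof (cases "?n = 1")
      case True
      then obtain i :: 'n where i: "UNIV = {i}" by (metis card_1_singletonE)
      have "(e \<bullet> a)\<^sup>2 = (e $ i * e $ i) * (a $ i * a $ i)"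
        by (simp add: inner_vec_def i power2_eq_square)
      moreover have "e $ i * e $ i = 1" using e by (simp add: inner_vec_def i)
      moreover have "a \<bullet> a = a $ i * a $ i" by (simp add: inner_vec_def i)
      ultimately show ?thesis by simp
    next
      case False
      then show ?thesis using zero_less_card_finite[where 'a='n] by linarith
    qed
    let ?M = "radial_matrix l m e"
    have "S k (?M + outer a a) - S k ?M =
      - ((e \<bullet> a)\<^sup>2 * Re ((-1) ^ k * coeff ([:- complex_of_real l, 1:] ^ (?n - 1)) (?n - k)))
      - (a \<bullet> a - (e \<bullet> a)\<^sup>2) * Re ((-1) ^ k * coeff ?q (?n - k))"
    proof -
      have "(-1) ^ k * coeff (charpoly (?M + outer a a)) (?n - k)
        = (-1) ^ k * coeff (charpoly ?M) (?n - k)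
          - of_real ((e \<bullet> a)\<^sup>2) * ((-1) ^ k * coeff ([:- complex_of_real l, 1:] ^ (?n - 1)) (?n - k))
          - of_real (a \<bullet> a - (e \<bullet> a)\<^sup>2) * ((-1) ^ k * coeff ?q (?n - k))"
      proof -
        have "(-1) ^ k * coeff (P - smult \<alpha> Q - smult \<beta> R) j
          = (-1) ^ k * coeff P j - \<alpha> * ((-1) ^ k * coeff Q j) - \<beta> * ((-1) ^ k * coeff R j)"
          for P Q R :: "complex poly" and \<alpha> \<beta> j by (simp add: algebra_simps)
        then show ?thesis unfolding charpoly_radial_matrix_add_outer[OF e refl T] .
      qed
      then show ?thesis unfolding S_charpoly[OF k(2)] by (simp del: of_real_diff of_real_power)
    qed
    also have "(a \<bullet> a - (e \<bullet> a)\<^sup>2) * Re ((-1) ^ k * coeff ?q (?n - k)) = - \<tau> * (a \<bullet> a - (e \<bullet> a)\<^sup>2)"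
      using T by (auto simp: \<tau>_def)
    finally show ?thesis
      unfolding Sij_quadratic_form[OF k(2)] coeff_linear_power_signed[OF k] binomial_c_nk(1)[OF k]
      by (simp add: mult_ac)
  qed
  have "\<tau> \<ge> 0"
  proof (cases "?n = 1 \<or> k = 1")
    case True
    show ?thesis
    proof (cases "?n = 1")
      case False
      have "\<tau> = real ((?n - 2) choose (?n - 2))"
      proof -
        have "k = 1" using True False by simp
        have "?q = pCons 0 ([:- complex_of_real l, 1:] ^ (?n - 2)) - smult (of_real (l + m)) ([:- complex_of_real l, 1:] ^ (?n - 2))"
          by (simp add: mult.commute[of "_ ^ _"] smult_diff_left smult_add_left)
        moreover have "?n - 1 = Suc (?n - 2)" using False zero_less_card_finite[where 'a='n] by linarith
        moreover have "degree ([:- complex_of_real l, 1:] ^ (?n - 2)) = ?n - 2"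
          by (simp add: degree_linear_power)
        ultimately have "coeff ?q (?n - k) = 1"
          unfolding \<open>k = 1\<close> by (simp add: coeff_linear_power coeff_eq_0)
        then show ?thesis using False \<open>k = 1\<close> by (simp add: \<tau>_def)
      qed
      then show ?thesis by simp
    qed (simp add: \<tau>_def)
  next
    case False
    then have k2: "2 \<le> k" "2 \<le> ?n" using k zero_less_card_finite[where 'a='n] by linarith+
    let ?c = "c_nk (?n - 1) (k - 1)"
    have kn: "1 \<le> k - 1" "k - 1 \<le> ?n - 1" using k2 k by auto
    have eqs: "?n - 1 - 1 = ?n - 2" "?n - 1 - (k - 1) = ?n - k" using k2 k by auto
    have "(-1) ^ k * coeff ?q (?n - k) = - ((-1) ^ (k - 1) * coeff ?q (?n - k))"
      using k by (cases k) auto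
    also have "\<dots> = of_real (- (real (?n - k) * ?c * l ^ (k - 1) + (l + m) * (real (k - 1) * ?c * l ^ (k - 1 - 1))))"
      using coeff_two_linear_powers[OF kn, of l "l + m"] unfolding eqs binomial_c_nk[OF kn, unfolded eqs] by (simp only: of_real_minus)
    finally have q: "(-1) ^ k * coeff ?q (?n - k) = \<dots>" .
    have "\<tau> = - Re ((-1) ^ k * coeff ?q (?n - k))" unfolding \<tau>_def by (rule if_not_P) (use k2 in simp)
    also have "\<dots> = real (?n - k) * ?c * l ^ (k - 1) + (l + m) * (real (k - 1) * ?c * l ^ (k - 1 - 1))"
      unfolding q by (simp only: Re_complex_of_real minus_minus)
    also have "l ^ (k - 1) = l ^ (k - 1 - 1) * l" using power_minus_mult[of "k - 1" l] kn by simp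
    finally have \<tau>: "\<tau> = ?c * l ^ (k - 1 - 1) * (real (?n - k) * l + real (k - 1) * (l + m))"
      by (simp add: algebra_simps)
    have c: "0 \<le> ?c" "0 \<le> c_nk ?n k" by (simp_all add: c_nk_def)
    have "l ^ k = l ^ (k - 1) * l" using power_minus_mult[of k l] k by simp
    then have "0 < (c_nk ?n k * l ^ (k - 1)) * (real ?n * l + real k * m)"
      using pos unfolding S_radial_matrix[OF k e] by (simp add: algebra_simps)
    moreover have "0 \<le> c_nk ?n k * l ^ (k - 1)" using c l by simp
    ultimately have "0 < real ?n * l + real k * m" by (simp add: zero_less_mult_iff)
    then have "0 \<le> real (k - 1) * (real ?n * l + real k * m) + real (?n - k) * l" using l by simp
    also have "\<dots> = real k * (real (?n - k) * l + real (k - 1) * (l + m))"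
      using k by (simp add: of_nat_diff algebra_simps)
    finally have "0 \<le> real (?n - k) * l + real (k - 1) * (l + m)"
      using k by (simp add: zero_le_mult_iff)
    then show ?thesis unfolding \<tau> using c l by simp
  qed
  then show ?thesis using form that by blast
qed

section \<open>Polar coordinates\<close>

lemma nn_integral_lborel_scale:
  fixes F :: "'a::euclidean_space \<Rightarrow> ennreal"
  assumes [measurable]: "F \<in> borel_measurable borel" and "c > 0"
  shows "(\<integral>\<^sup>+x. F (c *\<^sub>R x) \<partial>lborel) = ennreal (1 / c ^ DIM('a)) * (\<integral>\<^sup>+x. F x \<partial>lborel)"
proof -
  have "(\<integral>\<^sup>+x. F x \<partial>lborel) = (\<integral>\<^sup>+x. F x \<partial>density (distr lborel borel (\<lambda>x. 0 + c *\<^sub>R x)) (\<lambda>_. \<bar>c\<bar> ^ DIM('a)))"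
    using lborel_affine[of c "0::'a"] assms(2) by simp
  also have "\<dots> = ennreal (c ^ DIM('a)) * (\<integral>\<^sup>+x. F (c *\<^sub>R x) \<partial>lborel)"
    using assms(2) by (subst nn_integral_density, simp, simp, subst nn_integral_distr) (simp_all add: nn_integral_cmult)
  finally have "ennreal (1 / c ^ DIM('a)) * (\<integral>\<^sup>+x. F x \<partial>lborel)
     = (ennreal (1 / c ^ DIM('a)) * ennreal (c ^ DIM('a))) * (\<integral>\<^sup>+x. F (c *\<^sub>R x) \<partial>lborel)"
    by (simp add: mult.assoc)
  also have "ennreal (1 / c ^ DIM('a)) * ennreal (c ^ DIM('a)) = 1"
    using assms(2) by (simp flip: ennreal_mult)
  finally show ?thesis by simp
qed

abbreviation annulus :: "'a::euclidean_space set" where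
  "annulus \<equiv> {y. 1 \<le> norm y \<and> norm y \<le> 2}"

definition ray_integral :: "('a::euclidean_space \<Rightarrow> ennreal) \<Rightarrow> 'a \<Rightarrow> ennreal" where
  "ray_integral F w = (\<integral>\<^sup>+r. indicator {0<..} r * F (r *\<^sub>R w) * ennreal (r ^ (DIM('a) - 1)) \<partial>lborel)"

lemma nn_integral_inverse_dyadic:
  assumes "R > 0"
  shows "(\<integral>\<^sup>+s. indicator {R / 2..R} s * ennreal (1 / s) \<partial>lborel) = ennreal (ln 2)"
proof -
  have "(\<integral>\<^sup>+s. ennreal (1 / s) * indicator {R / 2..R} s \<partial>lborel) = ennreal (ln R - ln (R / 2))"
    by (rule nn_integral_FTC_Icc) (use assms in \<open>auto intro!: derivative_eq_intros simp: field_simps\<close>)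
  then show ?thesis using assms by (simp add: mult.commute ln_div)
qed

text \<open>Averaging over dilations takes the place of the surface measure: for \<open>x \<noteq> 0\<close> the \<open>s > 0\<close> such that \<open>x/s\<close> lies in
  the annulus form the interval \<open>[|x|/2, |x|]\<close>, whose length with respect to \<open>ds/s\<close> is \<open>ln 2\<close>
  for every \<open>x\<close>.\<close>

lemma polar_annulus:
  fixes F :: "'a::euclidean_space \<Rightarrow> ennreal"
  assumes F[measurable]: "F \<in> borel_measurable borel"
  shows "ennreal (ln 2) * (\<integral>\<^sup>+x. F x \<partial>lborel) = (\<integral>\<^sup>+y. indicator annulus y * ray_integral F y \<partial>lborel)"
proof -
  let ?n = "DIM('a)"
  have [measurable]: "(annulus :: 'a set) \<in> sets borel" by measurable
  have "(\<integral>\<^sup>+y. indicator annulus y * ray_integral F y \<partial>lborel)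
     = (\<integral>\<^sup>+y. \<integral>\<^sup>+s. indicator annulus y * (indicator {0<..} s * F (s *\<^sub>R y) * ennreal (s ^ (?n - 1))) \<partial>lborel \<partial>lborel)"
    unfolding ray_integral_def by (subst nn_integral_cmult) auto
  also have "\<dots> = (\<integral>\<^sup>+s. \<integral>\<^sup>+y. indicator annulus y * (indicator {0<..} s * F (s *\<^sub>R y) * ennreal (s ^ (?n - 1))) \<partial>lborel \<partial>lborel)"
    by (rule lborel_pair.Fubini'[symmetric]) measurable
  also have "\<dots> = (\<integral>\<^sup>+s. \<integral>\<^sup>+x. F x * (indicator {norm x / 2..norm x} s * indicator {0<..} s * ennreal (1 / s)) \<partial>lborel \<partial>lborel)"
  proof (rule nn_integral_cong)
    fix s :: real
    show "(\<integral>\<^sup>+y. indicator annulus y * (indicator {0<..} s * F (s *\<^sub>R y) * ennreal (s ^ (?n - 1))) \<partial>lborel)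
      = (\<integral>\<^sup>+x. F x * (indicator {norm x / 2..norm x} s * indicator {0<..} s * ennreal (1 / s)) \<partial>lborel)"
    proof (cases "s > 0")
      case True
      have "(\<integral>\<^sup>+y. indicator annulus y * (indicator {0<..} s * F (s *\<^sub>R y) * ennreal (s ^ (?n - 1))) \<partial>lborel)
        = (\<integral>\<^sup>+y. (\<lambda>x. indicator annulus ((1 / s) *\<^sub>R x) * (F x * ennreal (s ^ (?n - 1)))) (s *\<^sub>R y) \<partial>lborel)"
        using True by simp
      also have "\<dots> = ennreal (1 / s ^ ?n) * (\<integral>\<^sup>+x. indicator annulus ((1 / s) *\<^sub>R x) * (F x * ennreal (s ^ (?n - 1))) \<partial>lborel)"
        by (rule nn_integral_lborel_scale[OF _ True]) measurable
      also have "\<dots> = (\<integral>\<^sup>+x. ennreal (1 / s ^ ?n) * (indicator annulus ((1 / s) *\<^sub>R x) * (F x * ennreal (s ^ (?n - 1)))) \<partial>lborel)"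
        by (subst nn_integral_cmult) auto
      also have "\<dots> = (\<integral>\<^sup>+x. F x * (indicator {norm x / 2..norm x} s * indicator {0<..} s * ennreal (1 / s)) \<partial>lborel)"
      proof (rule nn_integral_cong)
        fix x :: 'a
        have "ennreal (1 / s ^ ?n) * ennreal (s ^ (?n - 1)) = ennreal (1 / s)"
          using True power_minus_mult[of ?n s] by (simp flip: ennreal_mult add: field_simps)
        moreover have "(1 / s) *\<^sub>R x \<in> annulus \<longleftrightarrow> s \<in> {norm x / 2..norm x}"
          using True by (auto simp: field_simps)
        ultimately show "ennreal (1 / s ^ ?n) * (indicator annulus ((1 / s) *\<^sub>R x) * (F x * ennreal (s ^ (?n - 1))))
          = F x * (indicator {norm x / 2..norm x} s * indicator {0<..} s * ennreal (1 / s))"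
          using True by (simp add: indicator_def mult_ac)
      qed
      finally show ?thesis .
    qed simp
  qed
  also have "\<dots> = (\<integral>\<^sup>+x. \<integral>\<^sup>+s. F x * (indicator {norm x / 2..norm x} s * indicator {0<..} s * ennreal (1 / s)) \<partial>lborel \<partial>lborel)"
  proof (rule lborel_pair.Fubini')
    have "(\<lambda>p. indicator {p. norm (fst p) / 2 \<le> snd p \<and> snd p \<le> norm (fst p)} p :: ennreal) \<in> borel_measurable (lborel \<Otimes>\<^sub>M (lborel :: real measure))"
      by measurable
    then have [measurable]: "(\<lambda>(x :: 'a, s). indicator {norm x / 2..norm x} s :: ennreal) \<in> borel_measurable (lborel \<Otimes>\<^sub>M lborel)"
      by (simp add: indicator_def case_prod_unfold)
    show "(\<lambda>(x :: 'a, s). F x * (indicator {norm x / 2..norm x} s * indicator {0<..} s * ennreal (1 / s)))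
        \<in> borel_measurable (lborel \<Otimes>\<^sub>M lborel)"
      by measurable
  qed
  also have "\<dots> = (\<integral>\<^sup>+x. F x * ennreal (ln 2) \<partial>lborel)"
  proof (rule nn_integral_cong_AE)
    have "AE x in lborel. x \<noteq> (0::'a)" by (rule AE_lborel_singleton)
    then show "AE x in lborel. (\<integral>\<^sup>+s. F x * (indicator {norm x / 2..norm x} s * indicator {0<..} s * ennreal (1 / s)) \<partial>lborel) = F x * ennreal (ln 2)"
    proof eventually_elim
      fix x :: 'a assume x: "x \<noteq> 0"
      have "indicator {norm x / 2..norm x} s * indicator {0<..} s = (indicator {norm x / 2..norm x} s :: ennreal)" for s
      proof -
        have "s > 0" if "norm x / 2 \<le> s"
        proof -
          have "0 < norm x" using x by simp
          then show ?thesis using that by linarith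
        qed
        then show ?thesis by (auto simp: indicator_def)
      qed
      then show "(\<integral>\<^sup>+s. F x * (indicator {norm x / 2..norm x} s * indicator {0<..} s * ennreal (1 / s)) \<partial>lborel) = F x * ennreal (ln 2)"
        using nn_integral_inverse_dyadic[of "norm x"] x by (subst nn_integral_cmult) auto
    qed
  qed
  also have "\<dots> = ennreal (ln 2) * (\<integral>\<^sup>+x. F x \<partial>lborel)"
    by (subst nn_integral_multc) (auto simp: mult.commute)
  finally show ?thesis by simp
qed

lemma ray_integral_normalize:
  fixes F :: "'a::euclidean_space \<Rightarrow> ennreal"
  assumes F[measurable]: "F \<in> borel_measurable borel" and y: "y \<noteq> 0"
  shows "ray_integral F y = ennreal (1 / norm y ^ DIM('a)) * ray_integral F ((1 / norm y) *\<^sub>R y)"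
proof -
  let ?n = "DIM('a)" and ?N = "norm y"
  have N: "?N > 0" using y by simp
  have "ray_integral F y = (\<integral>\<^sup>+r. (\<lambda>r. indicator {0<..} r * F (r *\<^sub>R ((1 / ?N) *\<^sub>R y)) * ennreal ((r / ?N) ^ (?n - 1))) (?N *\<^sub>R r) \<partial>lborel)"
    unfolding ray_integral_def using N by (intro nn_integral_cong) (simp add: indicator_def zero_less_mult_iff)
  also have "\<dots> = ennreal (1 / ?N ^ DIM(real)) * (\<integral>\<^sup>+r. indicator {0<..} r * F (r *\<^sub>R ((1 / ?N) *\<^sub>R y)) * ennreal ((r / ?N) ^ (?n - 1)) \<partial>lborel)"
    by (rule nn_integral_lborel_scale[OF _ N]) measurable
  also have "\<dots> = (\<integral>\<^sup>+r. ennreal (1 / ?N) * (indicator {0<..} r * F (r *\<^sub>R ((1 / ?N) *\<^sub>R y)) * ennreal ((r / ?N) ^ (?n - 1))) \<partial>lborel)"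
    by (subst nn_integral_cmult) auto
  also have "\<dots> = (\<integral>\<^sup>+r. ennreal (1 / ?N ^ ?n) * (indicator {0<..} r * F (r *\<^sub>R ((1 / ?N) *\<^sub>R y)) * ennreal (r ^ (?n - 1))) \<partial>lborel)"
  proof (rule nn_integral_cong)
    fix r :: real
    show "ennreal (1 / ?N) * (indicator {0<..} r * F (r *\<^sub>R ((1 / ?N) *\<^sub>R y)) * ennreal ((r / ?N) ^ (?n - 1)))
       = ennreal (1 / ?N ^ ?n) * (indicator {0<..} r * F (r *\<^sub>R ((1 / ?N) *\<^sub>R y)) * ennreal (r ^ (?n - 1)))"
    proof (cases "r > 0")
      case True
      have "1 / ?N * (r / ?N) ^ (?n - 1) = 1 / ?N ^ ?n * r ^ (?n - 1)"
        using N power_minus_mult[of ?n ?N] by (simp add: field_simps power_divide)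
      then have "ennreal (1 / ?N) * ennreal ((r / ?N) ^ (?n - 1)) = ennreal (1 / ?N ^ ?n) * ennreal (r ^ (?n - 1))"
        using N True by (simp flip: ennreal_mult)
      then show ?thesis by (metis mult.left_commute)
    qed simp
  qed
  also have "\<dots> = ennreal (1 / norm y ^ ?n) * ray_integral F ((1 / ?N) *\<^sub>R y)"
    unfolding ray_integral_def by (subst nn_integral_cmult) auto
  finally show ?thesis .
qed

lemma nn_integral_le_if_rays_le:
  fixes F G :: "'a::euclidean_space \<Rightarrow> ennreal"
  assumes F: "F \<in> borel_measurable borel" and G: "G \<in> borel_measurable borel"
    and le: "\<And>w. norm w = 1 \<Longrightarrow> ray_integral F w \<le> ray_integral G w"
  shows "(\<integral>\<^sup>+x. F x \<partial>lborel) \<le> (\<integral>\<^sup>+x. G x \<partial>lborel)"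
proof -
  have "indicator annulus y * ray_integral F y \<le> indicator annulus y * ray_integral G y" for y
  proof (cases "y = 0")
    case False
    then have "ray_integral F ((1 / norm y) *\<^sub>R y) \<le> ray_integral G ((1 / norm y) *\<^sub>R y)" by (intro le) simp
    then show ?thesis
      using ray_integral_normalize[OF F False] ray_integral_normalize[OF G False] by (simp add: mult_left_mono)
  qed simp
  then have "ennreal (ln 2) * (\<integral>\<^sup>+x. F x \<partial>lborel) \<le> ennreal (ln 2) * (\<integral>\<^sup>+x. G x \<partial>lborel)"
    unfolding polar_annulus[OF F] polar_annulus[OF G] by (intro nn_integral_mono)
  then have "ennreal (1 / ln 2) * (ennreal (ln 2) * (\<integral>\<^sup>+x. F x \<partial>lborel)) \<le> ennreal (1 / ln 2) * (ennreal (ln 2) * (\<integral>\<^sup>+x. G x \<partial>lborel))"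
    by (rule mult_left_mono) simp
  moreover have "ennreal (1 / ln 2) * ennreal (ln 2) = 1" by (simp flip: ennreal_mult)
  ultimately show ?thesis by (simp flip: mult.assoc)
qed

lemma nn_integral_radial:
  obtains C :: real where "C > 0"
    "\<And>h. h \<in> borel_measurable borel \<Longrightarrow> (\<integral>\<^sup>+x. h (norm x) \<partial>(lborel :: 'a::euclidean_space measure))
       = ennreal C * (\<integral>\<^sup>+r. indicator {0<..} r * h r * ennreal (r ^ (DIM('a) - 1)) \<partial>lborel)"
proof -
  let ?n = "DIM('a)"
  define K where "K = (\<integral>\<^sup>+y. indicator (annulus :: 'a set) y * ennreal (1 / norm y ^ ?n) \<partial>lborel)"
  have [measurable]: "(annulus :: 'a set) \<in> sets borel" by measurable
  have fin: "emeasure lborel (annulus :: 'a set) < \<infinity>"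
    by (rule emeasure_bounded_finite) (auto simp: bounded_iff)
  have "K \<le> (\<integral>\<^sup>+y. indicator (annulus :: 'a set) y \<partial>lborel)"
    unfolding K_def by (intro nn_integral_mono) (auto simp: indicator_def divide_le_eq)
  also have "\<dots> < \<infinity>" using fin by simp
  finally have Kfin: "K < \<infinity>" .
  have Kpos: "K > 0"
  proof -
    obtain b :: 'a where b: "b \<in> Basis" using nonempty_Basis by blast
    have "ball ((3/2) *\<^sub>R b) (1/2) \<subseteq> annulus"
    proof
      fix y assume "y \<in> ball ((3/2) *\<^sub>R b) (1/2)"
      then have "norm ((3/2) *\<^sub>R b - y) < 1/2" by (simp add: dist_norm)
      moreover have "norm ((3/2) *\<^sub>R b) = 3/2" using b by simp
      moreover have "norm ((3/2) *\<^sub>R b) \<le> norm ((3/2) *\<^sub>R b - y) + norm y" "norm y \<le> norm ((3/2) *\<^sub>R b - y) + norm ((3/2) *\<^sub>R b)"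
        using norm_triangle_sub[of "(3/2) *\<^sub>R b" y] norm_triangle_sub[of y "(3/2) *\<^sub>R b"] by (auto simp: norm_minus_commute)
      ultimately show "y \<in> annulus" by simp
    qed
    then have "emeasure lborel (ball ((3/2) *\<^sub>R b) (1/2)) \<le> emeasure lborel (annulus :: 'a set)"
      by (intro emeasure_mono) auto
    moreover have "emeasure lborel (ball ((3/2) *\<^sub>R b) (1/2)) > 0"
      by (simp add: emeasure_ball)
    ultimately have "emeasure lborel (annulus :: 'a set) > 0" by (rule less_le_trans[rotated])
    moreover have "ennreal (1 / 2 ^ ?n) * emeasure lborel (annulus :: 'a set) \<le> K"
    proof -
      have "ennreal (1 / 2 ^ ?n) * emeasure lborel (annulus :: 'a set) = (\<integral>\<^sup>+y. ennreal (1 / 2 ^ ?n) * indicator (annulus :: 'a set) y \<partial>lborel)"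
        by (subst nn_integral_cmult) auto
      also have "\<dots> \<le> K"
        unfolding K_def
      proof (rule nn_integral_mono)
        fix y :: 'a
        show "ennreal (1 / 2 ^ ?n) * indicator annulus y \<le> indicator annulus y * ennreal (1 / norm y ^ ?n)"
        proof (cases "y \<in> annulus")
          case True
          then have "1 \<le> norm y" by simp
          then have "0 < norm y" by linarith
          then have "1 / 2 ^ ?n \<le> 1 / norm y ^ ?n" using True by (intro frac_le power_mono) auto
          then show ?thesis using True by (simp add: ennreal_leI)
        qed simp
      qed
      finally show ?thesis .
    qed
    ultimately show ?thesis
      by (meson ennreal_zero_less_mult_iff less_le_trans ennreal_less_zero_iff zero_less_divide_1_iff zero_less_numeral zero_less_power)
  qed
  have main: "ennreal (ln 2) * (\<integral>\<^sup>+x. h (norm x) \<partial>(lborel :: 'a measure))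
       = K * (\<integral>\<^sup>+r. indicator {0<..} r * h r * ennreal (r ^ (?n - 1)) \<partial>lborel)"
    if [measurable]: "h \<in> borel_measurable borel" for h
  proof -
    let ?I = "\<integral>\<^sup>+r. indicator {0<..} r * h r * ennreal (r ^ (?n - 1)) \<partial>lborel"
    have meas: "(\<lambda>x::'a. h (norm x)) \<in> borel_measurable borel" by measurable
    have "ray_integral (\<lambda>x. h (norm x)) w = ?I" if "norm w = 1" for w :: 'a
      unfolding ray_integral_def using that by (intro nn_integral_cong) (auto simp: indicator_def)
    then have "indicator annulus y * ray_integral (\<lambda>x. h (norm x)) y = indicator annulus y * ennreal (1 / norm y ^ ?n) * ?I" for y :: 'a
    proof (cases "y = 0")
      case False
      then show ?thesis using ray_integral_normalize[OF meas False] \<open>\<And>w. norm w = 1 \<Longrightarrow> _\<close>[of "(1 / norm y) *\<^sub>R y"]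
        by (simp add: mult.assoc)
    qed simp
    then show ?thesis unfolding polar_annulus[OF meas] K_def
      by (subst nn_integral_multc[symmetric]) auto
  qed
  obtain c where c: "K = ennreal c" "c > 0"
    using Kfin Kpos by (cases K) auto
  show ?thesis
  proof (rule that[of "c / ln 2"])
    fix h :: "real \<Rightarrow> ennreal" assume h: "h \<in> borel_measurable borel"
    have "ennreal (1 / ln 2) * ennreal (ln 2) = 1" by (simp flip: ennreal_mult)
    moreover have "ennreal (1 / ln 2) * ennreal c = ennreal (c / ln 2)" using c by (simp flip: ennreal_mult)
    ultimately show "(\<integral>\<^sup>+x. h (norm x) \<partial>(lborel :: 'a measure))
       = ennreal (c / ln 2) * (\<integral>\<^sup>+r. indicator {0<..} r * h r * ennreal (r ^ (?n - 1)) \<partial>lborel)"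
    proof -
      let ?L = "\<integral>\<^sup>+x. h (norm x) \<partial>(lborel :: 'a measure)"
      have "?L = ennreal (1 / ln 2) * (ennreal (ln 2) * ?L)"
        unfolding mult.assoc[symmetric] \<open>ennreal (1 / ln 2) * ennreal (ln 2) = 1\<close> by simp
      then show ?thesis
        unfolding main[OF h] c(1) mult.assoc[symmetric] \<open>ennreal (1 / ln 2) * ennreal c = _\<close> .
    qed
  qed (use c in simp)
qed

section \<open>Mollification\<close>

text \<open>The simplest function of class \<open>C\<^sup>1\<close> that vanishes on a half line; bumps and cut-offs are built
  from it.\<close>

definition pos_sq :: "real \<Rightarrow> real" where
  "pos_sq t = (max 0 t)\<^sup>2"

lemma pos_sq_nonneg [simp]: "0 \<le> pos_sq t"
  by (simp add: pos_sq_def)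

lemma pos_sq_eq_0: "t \<le> 0 \<Longrightarrow> pos_sq t = 0"
  by (simp add: pos_sq_def max_def)

lemma pos_sq_taylor: "\<bar>pos_sq b - pos_sq a - 2 * max 0 a * (b - a)\<bar> \<le> (b - a)\<^sup>2"
proof (cases "a \<ge> 0")
  case a: True
  show ?thesis
  proof (cases "b \<ge> 0")
    case True
    then have "pos_sq b - pos_sq a - 2 * max 0 a * (b - a) = (b - a)\<^sup>2"
      using a by (simp add: pos_sq_def max_def power2_eq_square algebra_simps)
    then show ?thesis by simp
  next
    case False
    then have "pos_sq b - pos_sq a - 2 * max 0 a * (b - a) = (b - a)\<^sup>2 - b\<^sup>2"
      using a by (simp add: pos_sq_def max_def power2_eq_square algebra_simps)
    moreover have "b\<^sup>2 \<le> (b - a)\<^sup>2" using a False by (intro abs_le_square_iff[THEN iffD1]) auto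
    ultimately show ?thesis by simp
  qed
next
  case a: False
  then have "pos_sq b - pos_sq a - 2 * max 0 a * (b - a) = pos_sq b"
    by (simp add: pos_sq_def max_def)
  moreover have "max 0 b \<le> \<bar>b - a\<bar>" using a by auto
  then have "pos_sq b \<le> (b - a)\<^sup>2"
    unfolding pos_sq_def by (intro abs_le_square_iff[THEN iffD1]) auto
  ultimately show ?thesis by (simp only: abs_of_nonneg pos_sq_nonneg)
qed

lemma pos_sq_has_derivative:
  "(pos_sq has_real_derivative 2 * max 0 t) (at t)"
proof -
  have "((\<lambda>h. (pos_sq (t + h) - pos_sq t) / h - 2 * max 0 t) \<longlongrightarrow> 0) (at 0)"
  proof (rule tendsto_rabs_zero_cancel, rule tendsto_sandwich[of "\<lambda>_. 0" _ _ "\<lambda>h. \<bar>h\<bar>"])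
    show "\<forall>\<^sub>F h in at 0. \<bar>(pos_sq (t + h) - pos_sq t) / h - 2 * max 0 t\<bar> \<le> \<bar>h\<bar>"
      unfolding eventually_at_filter
    proof (rule always_eventually, intro allI impI)
      fix h :: real assume h: "h \<noteq> 0"
      have "(pos_sq (t + h) - pos_sq t) / h - 2 * max 0 t = (pos_sq (t + h) - pos_sq t - 2 * max 0 t * h) / h"
        using h by (simp add: field_simps)
      moreover have "\<bar>pos_sq (t + h) - pos_sq t - 2 * max 0 t * h\<bar> \<le> \<bar>h\<bar> * \<bar>h\<bar>"
        using pos_sq_taylor[of "t + h" t] by (simp add: power2_eq_square)
      ultimately show "\<bar>(pos_sq (t + h) - pos_sq t) / h - 2 * max 0 t\<bar> \<le> \<bar>h\<bar>"
        using h by (simp add: abs_divide divide_le_eq)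
    qed
  qed (auto intro!: tendsto_eq_intros)
  then show ?thesis unfolding DERIV_def by (simp add: LIM_zero_cancel)
qed

lemma pos_sq_derivative_intro [derivative_intros]:
  "(f has_real_derivative f') (at x) \<Longrightarrow> ((\<lambda>x. pos_sq (f x)) has_real_derivative 2 * max 0 (f x) * f') (at x)"
  using DERIV_chain2[OF pos_sq_has_derivative] .

lemma continuous_pos_sq [continuous_intros]:
  "continuous_on A f \<Longrightarrow> continuous_on A (\<lambda>x. pos_sq (f x))"
  unfolding pos_sq_def by (intro continuous_intros)

lemma integrable_continuous_bounded_support:
  fixes f :: "'a::euclidean_space \<Rightarrow> real"
  assumes "continuous_on UNIV f" "bounded B" "\<And>x. x \<notin> B \<Longrightarrow> f x = 0"
  shows "integrable lborel f"
proof -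
  have c: "compact (closure B)" using assms(2) by (simp add: compact_closure)
  have "integrable lborel (\<lambda>x. indicator (closure B) x *\<^sub>R f x)"
    by (rule borel_integrable_compact[OF c]) (use assms(1) continuous_on_subset in blast)
  moreover have "(\<lambda>x. indicator (closure B) x *\<^sub>R f x) = f"
    using assms(3) closure_subset[of B] by (force simp: indicator_def)
  ultimately show ?thesis by simp
qed

definition bump :: "real \<Rightarrow> 'a::euclidean_space \<Rightarrow> real" where
  "bump \<epsilon> z = pos_sq (\<epsilon>\<^sup>2 - z \<bullet> z)"

definition mollifier :: "real \<Rightarrow> 'a::euclidean_space \<Rightarrow> real" where
  "mollifier \<epsilon> z = bump \<epsilon> z / (\<integral>y. bump \<epsilon> (y::'a) \<partial>lborel)"

lemma bump_eq_0: "\<epsilon> \<ge> 0 \<Longrightarrow> norm z \<ge> \<epsilon> \<Longrightarrow> bump \<epsilon> z = 0"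
  unfolding bump_def by (intro pos_sq_eq_0) (simp add: dot_square_norm)

lemma continuous_bump: "continuous_on UNIV (bump \<epsilon>)"
  unfolding bump_def by (intro continuous_intros)

lemma integrable_bump: "\<epsilon> > 0 \<Longrightarrow> integrable lborel (bump \<epsilon> :: 'a::euclidean_space \<Rightarrow> real)"
  by (rule integrable_continuous_bounded_support[OF continuous_bump, of "ball 0 \<epsilon>"]) (auto intro!: bump_eq_0)

lemma bump_integral_pos:
  assumes "\<epsilon> > 0"
  shows "(\<integral>y. bump \<epsilon> (y::'a::euclidean_space) \<partial>lborel) > 0"
proof -
  have nn: "AE y in lborel. 0 \<le> bump \<epsilon> (y::'a)" by (simp add: bump_def)
  have "(\<integral>y. bump \<epsilon> (y::'a) \<partial>lborel) \<noteq> 0"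
  proof
    assume "(\<integral>y. bump \<epsilon> (y::'a) \<partial>lborel) = 0"
    then have "AE y in lborel. bump \<epsilon> (y::'a) = 0"
      using integral_nonneg_eq_0_iff_AE[OF integrable_bump[OF assms] nn] by simp
    moreover have "bump \<epsilon> y \<noteq> 0" if "y \<in> ball 0 \<epsilon>" for y :: 'a
    proof -
      have "(norm y)\<^sup>2 < \<epsilon>\<^sup>2" using that by (intro power_strict_mono) auto
      then show ?thesis by (simp add: bump_def pos_sq_def max_def dot_square_norm)
    qed
    ultimately have "AE y in lborel. (y::'a) \<notin> ball 0 \<epsilon>" by (auto elim!: eventually_mono)
    then have "emeasure lborel (ball (0::'a) \<epsilon>) = 0" using AE_iff_null_sets[of "ball (0::'a) \<epsilon>" lborel] by (auto simp: null_sets_def)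
    then show False using assms unit_ball_vol_pos[of "real DIM('a)"] by (simp add: emeasure_ball)
  qed
  moreover have "0 \<le> (\<integral>y. bump \<epsilon> (y::'a) \<partial>lborel)"
    by (intro integral_nonneg_AE nn)
  ultimately show ?thesis by simp
qed

lemma mollifier_nonneg: "0 \<le> mollifier \<epsilon> z"
  unfolding mollifier_def by (intro divide_nonneg_nonneg integral_nonneg_AE) (simp_all add: bump_def)

lemma mollifier_eq_0: "\<epsilon> \<ge> 0 \<Longrightarrow> norm z \<ge> \<epsilon> \<Longrightarrow> mollifier \<epsilon> z = 0"
  by (simp add: mollifier_def bump_eq_0)

lemma continuous_mollifier: "continuous_on UNIV (mollifier \<epsilon> :: 'a::euclidean_space \<Rightarrow> real)"
  unfolding mollifier_def divide_inverse using continuous_bump by (intro continuous_intros)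

lemma continuous_mollifier_intro [continuous_intros]:
  "continuous_on A f \<Longrightarrow> continuous_on A (\<lambda>x. mollifier \<epsilon> (f x))"
  using continuous_on_compose2[OF continuous_mollifier] by blast

lemma measurable_mollifier [measurable]: "mollifier \<epsilon> \<in> borel_measurable borel"
  by (rule borel_measurable_continuous_onI[OF continuous_mollifier])

lemma integrable_mollifier: "\<epsilon> > 0 \<Longrightarrow> integrable lborel (mollifier \<epsilon> :: 'a::euclidean_space \<Rightarrow> real)"
  unfolding mollifier_def by (intro integrable_divide_zero integrable_bump)

lemma integral_mollifier: "\<epsilon> > 0 \<Longrightarrow> (\<integral>z. mollifier \<epsilon> (z::'a::euclidean_space) \<partial>lborel) = 1"
  unfolding mollifier_def using bump_integral_pos[of \<epsilon>, where 'a='a] by simp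

lemma lborel_shift_reflect:
  fixes k :: "'a::euclidean_space \<Rightarrow> real"
  shows "integrable lborel k \<Longrightarrow> integrable lborel (\<lambda>y. k (x - y))"
    and "(\<integral>y. k (x - y) \<partial>lborel) = (\<integral>y. k y \<partial>lborel)"
proof -
  have d: "distr lborel borel (\<lambda>y. x - y) = (lborel :: 'a measure)"
    using lborel_affine[of "-1" x] by (simp add: density_1)
  show "integrable lborel k \<Longrightarrow> integrable lborel (\<lambda>y. k (x - y))"
    using integrable_distr_eq[of "\<lambda>y. x - y" lborel borel k] unfolding d by auto
  show "(\<integral>y. k (x - y) \<partial>lborel) = (\<integral>y. k y \<partial>lborel)"
  proof (cases "k \<in> borel_measurable borel")
    case True
    then show ?thesis using integral_distr[of "\<lambda>y. x - y" lborel borel k] unfolding d by auto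
  next
    case False
    then have "\<not> integrable lborel k" by auto
    moreover have "\<not> integrable lborel (\<lambda>y. k (x - y))"
    proof
      assume "integrable lborel (\<lambda>y. k (x - y))"
      then have "(\<lambda>y. k (x - y)) \<in> borel_measurable borel" by auto
      then have "(\<lambda>z. (\<lambda>y. k (x - y)) (x - z)) \<in> borel_measurable borel"
        by (rule measurable_compose[rotated]) simp
      then show False using False by simp
    qed
    ultimately show ?thesis by (simp add: not_integrable_integral_eq)
  qed
qed

definition conv :: "('a::euclidean_space \<Rightarrow> real) \<Rightarrow> ('a \<Rightarrow> real) \<Rightarrow> 'a \<Rightarrow> real" where
  "conv f k x = (\<integral>y. f y * k (x - y) \<partial>lborel)"

lemma integrable_mult_bounded_continuous:
  fixes f k :: "'a::euclidean_space \<Rightarrow> real"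
  assumes "integrable lborel f" "continuous_on UNIV k" "bounded B" "\<And>z. z \<notin> B \<Longrightarrow> k z = 0"
  shows "integrable lborel (\<lambda>y. f y * k (x - y))"
proof -
  have "bounded (k ` closure B)"
    using assms by (intro compact_imp_bounded compact_continuous_image) (auto simp: compact_closure intro: continuous_on_subset)
  then obtain M where M: "\<And>z. z \<in> closure B \<Longrightarrow> \<bar>k z\<bar> \<le> M" by (auto simp: bounded_iff)
  have "\<bar>k z\<bar> \<le> \<bar>M\<bar>" for z
    using M[of z] assms(4)[of z] closure_subset[of B] by (cases "z \<in> B") auto
  moreover have [measurable]: "k \<in> borel_measurable borel" by (rule borel_measurable_continuous_onI[OF assms(2)])
  moreover have [measurable]: "f \<in> borel_measurable borel" using assms(1) by auto
  ultimately show ?thesis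
    by (intro Bochner_Integration.integrable_bound[OF integrable_mult_right[OF assms(1), of "\<bar>M\<bar>"]])
      (auto simp: abs_mult mult.commute[of "\<bar>f _\<bar>"] intro!: mult_right_mono)
qed

lemma integrable_mult_mollifier:
  "\<epsilon> > 0 \<Longrightarrow> integrable lborel f \<Longrightarrow> integrable lborel (\<lambda>y. f y * mollifier \<epsilon> (x - y))"
  by (rule integrable_mult_bounded_continuous[OF _ continuous_mollifier, of _ "ball 0 \<epsilon>"])
    (auto intro!: mollifier_eq_0)

lemma jensen_power:
  fixes f \<kappa> :: "'a \<Rightarrow> real"
  assumes p: "p = 1 \<or> p = (2::nat)" and [measurable]: "f \<in> borel_measurable M"
    and \<kappa>: "integrable M \<kappa>" "\<And>y. 0 \<le> \<kappa> y" "(\<integral>y. \<kappa> y \<partial>M) = 1"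
  shows "ennreal (\<bar>\<integral>y. f y * \<kappa> y \<partial>M\<bar> ^ p) \<le> (\<integral>\<^sup>+y. ennreal (\<bar>f y\<bar> ^ p * \<kappa> y) \<partial>M)"
proof (cases "p = 1")
  case True
  have "norm (\<integral>y. f y * \<kappa> y \<partial>M) \<le> (\<integral>\<^sup>+y. norm (f y * \<kappa> y) \<partial>M)"
  proof (cases "integrable M (\<lambda>y. f y * \<kappa> y)")
    case True
    then show ?thesis by (rule integral_norm_bound_ennreal)
  qed (simp add: not_integrable_integral_eq)
  then show ?thesis using True \<kappa>(2) by (simp add: abs_mult)
next
  case False
  then have p: "p = 2" using p by simp
  have [measurable]: "\<kappa> \<in> borel_measurable M" using \<kappa>(1) by auto
  show ?thesis
  proof (cases "(\<integral>\<^sup>+y. ennreal (\<bar>f y\<bar> ^ 2 * \<kappa> y) \<partial>M) = \<infinity>")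
    case False
    then have i2: "integrable M (\<lambda>y. (f y)\<^sup>2 * \<kappa> y)"
      using \<kappa>(2) by (intro integrableI_bounded) (auto simp: abs_mult less_top)
    have i1: "integrable M (\<lambda>y. f y * \<kappa> y)"
    proof (rule Bochner_Integration.integrable_bound)
      show "integrable M (\<lambda>y. \<kappa> y + (f y)\<^sup>2 * \<kappa> y)" using i2 \<kappa>(1) by simp
      have "\<bar>f y\<bar> \<le> 1 + (f y)\<^sup>2" for y
        using zero_le_power2[of "\<bar>f y\<bar> - 1"] zero_le_power2[of "f y"] by (simp add: power2_eq_square algebra_simps)
      then have "\<bar>f y\<bar> * \<kappa> y \<le> (1 + (f y)\<^sup>2) * \<kappa> y" for y by (intro mult_right_mono \<kappa>(2))
      then show "AE y in M. norm (f y * \<kappa> y) \<le> norm (\<kappa> y + (f y)\<^sup>2 * \<kappa> y)"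
        using \<kappa>(2) by (simp add: abs_mult algebra_simps)
    qed measurable
    define m where "m = (\<integral>y. f y * \<kappa> y \<partial>M)"
    have "0 \<le> (\<integral>y. (f y - m)\<^sup>2 * \<kappa> y \<partial>M)" using \<kappa>(2) by (intro integral_nonneg_AE) simp
    also have "\<dots> = (\<integral>y. (f y)\<^sup>2 * \<kappa> y - 2 * m * (f y * \<kappa> y) + m\<^sup>2 * \<kappa> y \<partial>M)"
      by (intro Bochner_Integration.integral_cong) (simp_all add: power2_eq_square algebra_simps)
    also have "\<dots> = (\<integral>y. (f y)\<^sup>2 * \<kappa> y \<partial>M) - m\<^sup>2"
      using i1 i2 \<kappa> by (simp add: m_def[symmetric] power2_eq_square)
    finally have "ennreal (m\<^sup>2) \<le> ennreal (\<integral>y. (f y)\<^sup>2 * \<kappa> y \<partial>M)" by (intro ennreal_leI) simp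
    also have "\<dots> = (\<integral>\<^sup>+y. ennreal ((f y)\<^sup>2 * \<kappa> y) \<partial>M)"
      using i2 \<kappa>(2) by (subst nn_integral_eq_integral) auto
    finally show ?thesis by (simp add: p m_def)
  qed (simp add: p)
qed

lemma measurable_conv [measurable]:
  assumes [measurable]: "f \<in> borel_measurable borel" "k \<in> borel_measurable borel"
  shows "conv f k \<in> borel_measurable borel"
  unfolding conv_def by measurable

lemma young_power:
  fixes f :: "'a::euclidean_space \<Rightarrow> real"
  assumes p: "p = 1 \<or> p = (2::nat)" and \<epsilon>: "\<epsilon> > 0" and [measurable]: "f \<in> borel_measurable borel"
  shows "(\<integral>\<^sup>+x. ennreal (\<bar>conv f (mollifier \<epsilon>) x\<bar> ^ p) \<partial>lborel) \<le> (\<integral>\<^sup>+x. ennreal (\<bar>f x\<bar> ^ p) \<partial>lborel)"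
proof -
  let ?k = "mollifier \<epsilon> :: 'a \<Rightarrow> real"
  have k: "integrable lborel (\<lambda>y. ?k (x - y))" "(\<integral>y. ?k (x - y) \<partial>lborel) = 1" for x
    using lborel_shift_reflect[of ?k x] integrable_mollifier[OF \<epsilon>] integral_mollifier[OF \<epsilon>, where 'a='a] by auto
  have k': "(\<integral>\<^sup>+x. ennreal (?k (x - y)) \<partial>lborel) = 1" for y
  proof -
    have sym: "?k (x - y) = ?k (y - x)" for x by (simp add: mollifier_def bump_def inner_diff_left inner_diff_right inner_commute algebra_simps)
    show ?thesis unfolding sym using k[of y] by (subst nn_integral_eq_integral) (auto simp: mollifier_nonneg)
  qed
  have "(\<integral>\<^sup>+x. ennreal (\<bar>conv f ?k x\<bar> ^ p) \<partial>lborel) \<le> (\<integral>\<^sup>+x. \<integral>\<^sup>+y. ennreal (\<bar>f y\<bar> ^ p * ?k (x - y)) \<partial>lborel \<partial>lborel)"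
    unfolding conv_def using k by (intro nn_integral_mono jensen_power p) (auto simp: mollifier_nonneg)
  also have "\<dots> = (\<integral>\<^sup>+y. \<integral>\<^sup>+x. ennreal (\<bar>f y\<bar> ^ p * ?k (x - y)) \<partial>lborel \<partial>lborel)"
    by (rule lborel_pair.Fubini') measurable
  also have "\<dots> = (\<integral>\<^sup>+y. ennreal (\<bar>f y\<bar> ^ p) \<partial>lborel)"
    using k' by (simp add: ennreal_mult' nn_integral_cmult)
  finally show ?thesis .
qed

lemma AE_limit_continuous:
  fixes f :: "'a::euclidean_space \<Rightarrow> real"
  assumes "f \<in> borel_measurable borel"
  obtains g :: "nat \<Rightarrow> 'a \<Rightarrow> real" where "\<And>n. continuous_on UNIV (g n)"
    "AE x in lborel. (\<lambda>n. g n x) \<longlonglongrightarrow> f x"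
proof -
  have "f \<in> borel_measurable lebesgue" using assms by (intro measurable_completion) simp
  then have "f measurable_on UNIV" by (rule lebesgue_measurable_imp_measurable_on) simp
  then obtain N g where N: "negligible N" and g: "\<And>n. continuous_on UNIV (g n)"
     "\<And>x. x \<notin> N \<Longrightarrow> (\<lambda>n. g n x) \<longlonglongrightarrow> f x"
    unfolding measurable_on_def by auto
  have "AE x in lebesgue. x \<notin> N" using N by (simp add: negligible_iff_null_sets AE_not_in)
  then have "AE x in lebesgue. (\<lambda>n. g n x) \<longlonglongrightarrow> f x" using g(2) by (auto elim: eventually_mono)
  then have "AE x in lborel. (\<lambda>n. g n x) \<longlonglongrightarrow> f x" by (simp add: AE_completion_iff)
  then show ?thesis using that g(1) by blast
qed

definition clamp_real :: "real \<Rightarrow> real \<Rightarrow> real" where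
  "clamp_real N t = max (- N) (min N t)"

lemma power_p_sum3:
  fixes a b c :: real
  assumes "p = 1 \<or> p = (2::nat)"
  shows "\<bar>a + b + c\<bar> ^ p \<le> 3 * (\<bar>a\<bar> ^ p + \<bar>b\<bar> ^ p + \<bar>c\<bar> ^ p)"
proof (cases "p = 1")
  case False
  have "0 \<le> (a - b)\<^sup>2 + (b - c)\<^sup>2 + (a - c)\<^sup>2" by simp
  then have "(a + b + c)\<^sup>2 \<le> 3 * (a\<^sup>2 + b\<^sup>2 + c\<^sup>2)" by (simp add: power2_eq_square algebra_simps)
  then show ?thesis using assms False by simp
qed simp

text \<open>Truncation in the values makes both exponents accessible to dominated convergence at once.\<close>

lemma continuous_dense_power:
  fixes f :: "'a::euclidean_space \<Rightarrow> real"
  assumes p: "p = 1 \<or> p = (2::nat)" and f[measurable]: "f \<in> borel_measurable borel"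
    and int: "integrable lborel (\<lambda>x. \<bar>f x\<bar> ^ p)" and supp: "\<And>x. norm x > R \<Longrightarrow> f x = 0" and e: "e > 0"
  obtains g where "continuous_on UNIV g" "\<And>x. norm x > R + 1 \<Longrightarrow> g x = 0"
    "(\<integral>\<^sup>+x. ennreal (\<bar>f x - g x\<bar> ^ p) \<partial>lborel) < ennreal e"
proof -
  have p0: "p > 0" using p by auto
  define fN where "fN N x = clamp_real (real N) (f x)" for N x
  have [measurable]: "fN N \<in> borel_measurable borel" for N unfolding fN_def clamp_real_def by measurable
  have "(\<lambda>N. \<integral>x. \<bar>f x - fN N x\<bar> ^ p \<partial>lborel) \<longlonglongrightarrow> (\<integral>x. 0 \<partial>(lborel :: 'a measure))"
  proof (rule integral_dominated_convergence[where w="\<lambda>x. \<bar>f x\<bar> ^ p"])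
    show "AE x in lborel. (\<lambda>N. \<bar>f x - fN N x\<bar> ^ p) \<longlonglongrightarrow> 0"
    proof (rule AE_I2)
      fix x
      obtain N0 :: nat where N0: "\<bar>f x\<bar> \<le> real N0" using real_arch_simple by blast
      have "\<forall>\<^sub>F N in sequentially. \<bar>f x - fN N x\<bar> ^ p = 0"
        using eventually_ge_at_top[of N0]
      proof eventually_elim
        case (elim N)
        then have "\<bar>f x\<bar> \<le> real N" using N0 by linarith
        then show ?case using p0 by (auto simp: fN_def clamp_real_def min_def max_def abs_le_iff)
      qed
      then show "(\<lambda>N. \<bar>f x - fN N x\<bar> ^ p) \<longlonglongrightarrow> 0" by (rule tendsto_eventually)
    qed
    show "AE x in lborel. norm (\<bar>f x - fN N x\<bar> ^ p) \<le> \<bar>f x\<bar> ^ p" for N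
    proof (rule AE_I2)
      fix x
      have "\<bar>f x - fN N x\<bar> \<le> \<bar>f x\<bar>" by (simp add: fN_def clamp_real_def min_def max_def)
      then show "norm (\<bar>f x - fN N x\<bar> ^ p) \<le> \<bar>f x\<bar> ^ p" by (simp add: power_abs power_mono)
    qed
  qed (use int in auto)
  then have "\<forall>\<^sub>F N in sequentially. (\<integral>x. \<bar>f x - fN N x\<bar> ^ p \<partial>lborel) < e / 7"
    using e by (intro order_tendstoD(2)[where y=0]) auto
  then obtain N where N: "(\<integral>x. \<bar>f x - fN N x\<bar> ^ p \<partial>lborel) < e / 7" by (auto simp: eventually_sequentially)
  have iN: "integrable lborel (\<lambda>x. \<bar>f x - fN N x\<bar> ^ p)"
  proof (rule Bochner_Integration.integrable_bound[OF int])
    have "\<bar>f x - fN N x\<bar> \<le> \<bar>f x\<bar>" for x by (simp add: fN_def clamp_real_def min_def max_def)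
    then show "AE x in lborel. norm (\<bar>f x - fN N x\<bar> ^ p) \<le> norm (\<bar>f x\<bar> ^ p)"
      by (simp add: power_abs power_mono)
  qed measurable
  obtain h where h: "\<And>n. continuous_on UNIV (h n)" "AE x in lborel. (\<lambda>n. h n x) \<longlonglongrightarrow> fN N x"
    using AE_limit_continuous[of "fN N"] by auto
  define cut where "cut x = max 0 (min 1 (R + 1 - norm x))" for x :: 'a
  have cut01: "0 \<le> cut x" "cut x \<le> 1" for x by (auto simp: cut_def)
  have cutf: "cut x * fN N x = fN N x" for x
  proof (cases "norm x > R")
    case True
    then show ?thesis using supp[OF True] by (simp add: fN_def clamp_real_def)
  qed (simp add: cut_def)
  define g where "g n x = cut x * clamp_real (real N) (h n x)" for n x
  have gc: "continuous_on UNIV (g n)" for n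
    unfolding g_def cut_def clamp_real_def by (intro continuous_intros h(1))
  then have [measurable]: "g n \<in> borel_measurable borel" for n by (rule borel_measurable_continuous_onI)
  have g0: "g n x = 0" if "norm x > R + 1" for n x using that by (simp add: g_def cut_def)
  let ?w = "\<lambda>x::'a. indicator (cball 0 (R + 1)) x * (2 * real N) ^ p :: real"
  have le: "\<bar>fN N x - g n x\<bar> ^ p \<le> ?w x" for n x
  proof (cases "norm x > R + 1")
    case True
    then have "fN N x = 0" using cutf[of x] by (simp add: cut_def)
    then show ?thesis using True g0[OF True] p0 by (simp add: indicator_def zero_power)
  next
    case False
    have *: "\<bar>clamp_real (real N) t\<bar> \<le> real N" for t by (auto simp: clamp_real_def min_def max_def abs_le_iff)
    then have "\<bar>g n x\<bar> \<le> 1 * real N" unfolding g_def abs_mult using cut01 by (intro mult_mono) auto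
    then have "\<bar>fN N x - g n x\<bar> \<le> 2 * real N" using *[of "f x"] by (simp add: fN_def)
    from power_mono[OF this, of p] show ?thesis using False by simp
  qed
  have wi: "integrable lborel ?w"
    by (intro integrable_mult_left integrable_real_indicator) (use emeasure_lborel_cball_finite[where 'a='a] in \<open>auto simp: top_unique infinity_ennreal_def\<close>)
  have "(\<lambda>n. \<integral>x. \<bar>fN N x - g n x\<bar> ^ p \<partial>lborel) \<longlonglongrightarrow> (\<integral>x. 0 \<partial>(lborel :: 'a measure))"
  proof (rule integral_dominated_convergence[where w="?w", OF _ _ wi])
    show "AE x in lborel. (\<lambda>n. \<bar>fN N x - g n x\<bar> ^ p) \<longlonglongrightarrow> 0"
      using h(2)
    proof eventually_elim
      case (elim x)
      have "(\<lambda>n. g n x) \<longlonglongrightarrow> cut x * clamp_real (real N) (fN N x)"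
        unfolding g_def clamp_real_def by (intro tendsto_intros elim)
      also have "clamp_real (real N) (fN N x) = fN N x" by (simp add: fN_def clamp_real_def)
      finally have "(\<lambda>n. \<bar>fN N x - g n x\<bar> ^ p) \<longlonglongrightarrow> \<bar>fN N x - fN N x\<bar> ^ p"
        unfolding cutf by (intro tendsto_intros)
      then show ?case using p0 by (simp only: diff_self abs_zero zero_power)
    qed
    show "AE x in lborel. norm (\<bar>fN N x - g n x\<bar> ^ p) \<le> ?w x" for n
      using le[of _ n] by (simp add: power_abs)
  qed measurable
  then have "\<forall>\<^sub>F n in sequentially. (\<integral>x. \<bar>fN N x - g n x\<bar> ^ p \<partial>lborel) < e / 7"
    using e by (intro order_tendstoD(2)[where y=0]) auto
  then obtain n where n: "(\<integral>x. \<bar>fN N x - g n x\<bar> ^ p \<partial>lborel) < e / 7" by (auto simp: eventually_sequentially)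
  have ig: "integrable lborel (\<lambda>x. \<bar>fN N x - g n x\<bar> ^ p)"
    by (rule Bochner_Integration.integrable_bound[OF wi]) (use le[of _ n] in \<open>auto simp: power_abs intro: order_trans[OF _ abs_ge_self]\<close>)
  have "(\<integral>\<^sup>+x. ennreal (\<bar>f x - g n x\<bar> ^ p) \<partial>lborel)
      \<le> (\<integral>\<^sup>+x. ennreal (3 * (\<bar>f x - fN N x\<bar> ^ p + \<bar>fN N x - g n x\<bar> ^ p)) \<partial>lborel)"
  proof (intro nn_integral_mono ennreal_leI)
    fix x
    show "\<bar>f x - g n x\<bar> ^ p \<le> 3 * (\<bar>f x - fN N x\<bar> ^ p + \<bar>fN N x - g n x\<bar> ^ p)"
      using power_p_sum3[OF p, of "f x - fN N x" "fN N x - g n x" 0] p0 by (simp add: zero_power)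
  qed
  also have "\<dots> = ennreal (\<integral>x. 3 * (\<bar>f x - fN N x\<bar> ^ p + \<bar>fN N x - g n x\<bar> ^ p) \<partial>lborel)"
    using iN ig by (intro nn_integral_eq_integral) auto
  also have "\<dots> < ennreal e"
    using iN ig N n e by (intro ennreal_lessI) auto
  finally show ?thesis using that[OF gc[of n] g0] by simp
qed

lemma conv_mollifier_eq_0:
  assumes "\<epsilon> \<ge> 0" "\<And>y. norm (x - y) < \<epsilon> \<Longrightarrow> f y = 0"
  shows "conv f (mollifier \<epsilon>) x = 0"
proof -
  have "f y * mollifier \<epsilon> (x - y) = 0" for y
    using assms(2)[of y] mollifier_eq_0[OF assms(1), of "x - y"] by (cases "norm (x - y) < \<epsilon>") auto
  then have "(\<lambda>y. f y * mollifier \<epsilon> (x - y)) = (\<lambda>_. 0)" by blast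
  then show ?thesis by (simp add: conv_def)
qed

lemma conv_continuous_close:
  fixes g :: "'a::euclidean_space \<Rightarrow> real"
  assumes "\<epsilon> > 0" and g: "integrable lborel g" and close: "\<And>y. norm (x - y) < \<epsilon> \<Longrightarrow> \<bar>g y - g x\<bar> \<le> d"
  shows "\<bar>conv g (mollifier \<epsilon>) x - g x\<bar> \<le> d"
proof -
  let ?k = "\<lambda>y. mollifier \<epsilon> (x - y)"
  have k: "integrable lborel ?k" "(\<integral>y. ?k y \<partial>lborel) = 1"
    using lborel_shift_reflect[of "mollifier \<epsilon>" x] integrable_mollifier[OF assms(1)] integral_mollifier[OF assms(1), where 'a='a] by auto
  have gk: "integrable lborel (\<lambda>y. g y * ?k y)" by (rule integrable_mult_mollifier[OF assms(1) g])
  have "conv g (mollifier \<epsilon>) x - g x = (\<integral>y. (g y - g x) * ?k y \<partial>lborel)"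
    unfolding conv_def using gk k by (simp add: left_diff_distrib)
  also have "\<bar>\<dots>\<bar> \<le> (\<integral>y. \<bar>(g y - g x) * ?k y\<bar> \<partial>lborel)" by (rule integral_abs_bound)
  also have "\<dots> \<le> (\<integral>y. d * ?k y \<partial>lborel)"
  proof (rule integral_mono)
    show "integrable lborel (\<lambda>y. \<bar>(g y - g x) * ?k y\<bar>)" using gk k by (simp add: left_diff_distrib)
    show "\<bar>(g y - g x) * ?k y\<bar> \<le> d * ?k y" for y
      using close[of y] mollifier_eq_0[of \<epsilon> "x - y"] mollifier_nonneg[of \<epsilon> "x - y"] assms(1)
      by (cases "norm (x - y) < \<epsilon>") (auto simp: abs_mult intro!: mult_right_mono)
  qed (use k in simp)
  also have "\<dots> = d" using k by simp
  finally show ?thesis .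
qed

text \<open>By Young's inequality mollification is a contraction in \<open>L\<^sup>p\<close>, so it suffices to treat the dense set of
  continuous functions with compact support, on which the convergence is uniform.\<close>

lemma conv_mollifier_converges:
  fixes f :: "'a::euclidean_space \<Rightarrow> real"
  assumes p: "p = 1 \<or> p = (2::nat)" and f[measurable]: "f \<in> borel_measurable borel"
    and int: "integrable lborel (\<lambda>x. \<bar>f x\<bar> ^ p)" and supp: "\<And>x. norm x > R \<Longrightarrow> f x = 0"
    and \<epsilon>: "\<And>m. \<epsilon> m > 0" "\<epsilon> \<longlonglongrightarrow> (0::real)"
  shows "(\<lambda>m. \<integral>\<^sup>+x. ennreal (\<bar>conv f (mollifier (\<epsilon> m)) x - f x\<bar> ^ p) \<partial>lborel) \<longlonglongrightarrow> 0"
proof -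
  have p0: "p > 0" using p by auto
  have fi: "integrable lborel f"
  proof (rule Bochner_Integration.integrable_bound)
    show "integrable lborel (\<lambda>x. indicator (cball 0 R) x + \<bar>f x\<bar> ^ p)"
      by (intro Bochner_Integration.integrable_add int integrable_real_indicator) (use emeasure_lborel_cball_finite[where 'a='a] in \<open>auto simp: top_unique infinity_ennreal_def\<close>)
    have "\<bar>f x\<bar> \<le> indicator (cball 0 R) x + \<bar>f x\<bar> ^ p" for x
    proof (cases "norm x > R")
      case False
      have "0 \<le> (\<bar>f x\<bar> - 1)\<^sup>2 + \<bar>f x\<bar>\<^sup>2" by simp
      then show ?thesis using p False by (auto simp: power2_eq_square algebra_simps)
    qed (simp add: supp)
    then show "AE x in lborel. norm (f x) \<le> norm (indicator (cball 0 R) x + \<bar>f x\<bar> ^ p)"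
      by (auto intro: order_trans[OF _ abs_ge_self])
  qed measurable
  define V where "V = measure lborel (cball (0::'a) (R + 3))"
  show ?thesis
  proof (rule order_tendstoI)
    fix e :: ennreal assume "0 < e"
    obtain e' :: real where e': "e' > 0" "ennreal e' \<le> e"
    proof (cases "e = \<infinity>")
      case True
      then show ?thesis using that[of 1] by simp
    next
      case False
      then show ?thesis using that[of "enn2real e"] \<open>0 < e\<close> by (cases e) auto
    qed
    obtain g where g: "continuous_on UNIV g" "\<And>x. norm x > R + 1 \<Longrightarrow> g x = 0"
      "(\<integral>\<^sup>+x. ennreal (\<bar>f x - g x\<bar> ^ p) \<partial>lborel) < ennreal (e' / 12)"
      using continuous_dense_power[OF p f int supp, where e="e' / 12"] e' by auto
    have [measurable]: "g \<in> borel_measurable borel" by (rule borel_measurable_continuous_onI[OF g(1)])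
    have gi: "integrable lborel g"
      by (rule integrable_continuous_bounded_support[OF g(1), of "cball 0 (R + 1)"]) (use g(2) in auto)
    define d where "d = min 1 (e' / (12 * (1 + V)))"
    have V0: "V \<ge> 0" by (simp add: V_def)
    have d: "d > 0" "d \<le> 1" "d * V \<le> e' / 12"
    proof -
      show "d > 0" "d \<le> 1" using e' V0 by (auto simp: d_def)
      have "1 + V > 0" using V0 by simp
      have "d * V \<le> e' / (12 * (1 + V)) * (1 + V)" using V0 e' by (intro mult_mono) (auto simp: d_def)
      also have "\<dots> = e' / 12" using \<open>1 + V > 0\<close> by (simp add: field_simps)
      finally show "d * V \<le> e' / 12" .
    qed
    have "uniformly_continuous_on (cball 0 (R + 3)) g"
      by (intro compact_uniformly_continuous continuous_on_subset[OF g(1)]) auto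
    then obtain \<delta> where \<delta>: "\<delta> > 0" "\<And>x y. norm x \<le> R + 3 \<Longrightarrow> norm y \<le> R + 3 \<Longrightarrow> norm (y - x) < \<delta> \<Longrightarrow> \<bar>g y - g x\<bar> < d"
      unfolding uniformly_continuous_on_def using d(1) by (auto simp: dist_norm)
    have main: "(\<integral>\<^sup>+x. ennreal (\<bar>conv f (mollifier t) x - f x\<bar> ^ p) \<partial>lborel) < e" if t: "0 < t" "t < \<delta>" "t < 1" for t
    proof -
      have lin: "conv f (mollifier t) x - f x = conv (\<lambda>y. f y - g y) (mollifier t) x + (conv g (mollifier t) x - g x) + (g x - f x)" for x
      proof -
        have "conv (\<lambda>y. f y - g y) (mollifier t) x = conv f (mollifier t) x - conv g (mollifier t) x"
          unfolding conv_def left_diff_distrib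
          using integrable_mult_mollifier[OF t(1) fi] integrable_mult_mollifier[OF t(1) gi] by simp
        then show ?thesis by simp
      qed
      have mid: "\<bar>conv g (mollifier t) x - g x\<bar> ^ p \<le> d * indicator (cball 0 (R + 3)) x" for x
      proof (cases "norm x > R + 2")
        case True
        have "g y = 0" if "norm (x - y) < t" for y
          using True that t(3) norm_triangle_ineq2[of x y] by (intro g(2)) (simp add: abs_le_iff) 
        then have "conv g (mollifier t) x = 0" using t by (intro conv_mollifier_eq_0) auto
        moreover have "g x = 0" using True by (intro g(2)) simp
        ultimately show ?thesis using p0 d by (simp add: zero_power)
      next
        case False
        have "\<bar>conv g (mollifier t) x - g x\<bar> \<le> d"
        proof (rule conv_continuous_close[OF t(1) gi])
          fix y assume y: "norm (x - y) < t"
          have "norm y \<le> R + 3" using False y t(3) norm_triangle_ineq2[of y x] by (simp add: norm_minus_commute)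
          then have "\<bar>g y - g x\<bar> < d" using \<delta>(2)[of x y] False y t(2) by (simp add: norm_minus_commute)
          then show "\<bar>g y - g x\<bar> \<le> d" by simp
        qed
        then have "\<bar>conv g (mollifier t) x - g x\<bar> ^ p \<le> d ^ p" by (intro power_mono) auto
        also have "\<dots> \<le> d ^ 1" using d p0 by (intro power_decreasing) auto
        finally show ?thesis using False by simp
      qed
      have [measurable]: "cball (0::'a) (R + 3) \<in> sets borel" by simp
      let ?fg = "\<integral>\<^sup>+x. ennreal (\<bar>f x - g x\<bar> ^ p) \<partial>lborel"
      have "(\<integral>\<^sup>+x. ennreal (\<bar>conv f (mollifier t) x - f x\<bar> ^ p) \<partial>lborel)
         \<le> (\<integral>\<^sup>+x. 3 * (ennreal (\<bar>conv (\<lambda>y. f y - g y) (mollifier t) x\<bar> ^ p) + ennreal (d * indicator (cball 0 (R + 3)) x) + ennreal (\<bar>f x - g x\<bar> ^ p)) \<partial>lborel)"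
      proof (rule nn_integral_mono)
        fix x
        let ?A = "\<bar>conv (\<lambda>y. f y - g y) (mollifier t) x\<bar> ^ p"
        have "\<bar>conv f (mollifier t) x - f x\<bar> ^ p \<le> 3 * (?A + \<bar>conv g (mollifier t) x - g x\<bar> ^ p + \<bar>g x - f x\<bar> ^ p)"
          unfolding lin by (rule power_p_sum3[OF p])
        also have "\<dots> \<le> 3 * (?A + d * indicator (cball 0 (R + 3)) x + \<bar>f x - g x\<bar> ^ p)"
          using mid[of x] by (simp add: abs_minus_commute)
        finally have "ennreal (\<bar>conv f (mollifier t) x - f x\<bar> ^ p) \<le> ennreal (3 * (?A + d * indicator (cball 0 (R + 3)) x + \<bar>f x - g x\<bar> ^ p))"
          by (rule ennreal_leI)
        also have "\<dots> = 3 * (ennreal ?A + ennreal (d * indicator (cball 0 (R + 3)) x) + ennreal (\<bar>f x - g x\<bar> ^ p))"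
          using d by (simp add: ennreal_mult ennreal_plus)
        finally show "ennreal (\<bar>conv f (mollifier t) x - f x\<bar> ^ p) \<le> \<dots>" .
      qed
      also have "\<dots> = 3 * ((\<integral>\<^sup>+x. ennreal (\<bar>conv (\<lambda>y. f y - g y) (mollifier t) x\<bar> ^ p) \<partial>lborel)
           + (\<integral>\<^sup>+x. ennreal (d * indicator (cball (0::'a) (R + 3)) x) \<partial>lborel) + ?fg)"
        by (subst nn_integral_cmult, measurable, subst nn_integral_add, measurable, subst nn_integral_add) measurable
      also have "\<dots> \<le> 3 * (?fg + ennreal (e' / 12) + ?fg)"
      proof (intro mult_left_mono add_mono order_refl)
        show "(\<integral>\<^sup>+x. ennreal (\<bar>conv (\<lambda>y. f y - g y) (mollifier t) x\<bar> ^ p) \<partial>lborel) \<le> ?fg"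
          by (rule young_power[OF p t(1)]) measurable
        have "(\<integral>\<^sup>+x. ennreal (d * indicator (cball (0::'a) (R + 3)) x) \<partial>lborel) = ennreal d * emeasure lborel (cball (0::'a) (R + 3))"
          using d by (simp add: ennreal_mult nn_integral_cmult ennreal_indicator)
        also have "\<dots> = ennreal (d * V)"
          using d emeasure_eq_ennreal_measure[of lborel "cball (0::'a) (R + 3)"] emeasure_lborel_cball_finite[of "0::'a" "R + 3"]
          by (simp add: V_def ennreal_mult)
        also have "\<dots> \<le> ennreal (e' / 12)" by (intro ennreal_leI d)
        finally show "(\<integral>\<^sup>+x. ennreal (d * indicator (cball (0::'a) (R + 3)) x) \<partial>lborel) \<le> ennreal (e' / 12)" .
      qed simp
      also have "\<dots> \<le> 3 * (ennreal (e' / 12) + ennreal (e' / 12) + ennreal (e' / 12))"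
        using g(3) by (intro mult_left_mono add_mono) auto
      also have "\<dots> = ennreal (3 * (e' / 12 + e' / 12 + e' / 12))"
      proof -
        have "3 * ennreal x = ennreal (3 * x)" if "x \<ge> 0" for x using that by (simp add: ennreal_mult)
        then show ?thesis using e' by (simp flip: ennreal_plus)
      qed
      also have "\<dots> < ennreal e'" using e' by (intro ennreal_lessI) auto
      finally show ?thesis using e'(2) by (rule less_le_trans)
    qed
    have "\<forall>\<^sub>F m in sequentially. \<epsilon> m < min \<delta> 1" using \<epsilon>(2) \<delta>(1) by (intro order_tendstoD(2)) auto
    then show "\<forall>\<^sub>F m in sequentially. (\<integral>\<^sup>+x. ennreal (\<bar>conv f (mollifier (\<epsilon> m)) x - f x\<bar> ^ p) \<partial>lborel) < e"
      by eventually_elim (rule main, use \<epsilon>(1) in auto)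
  qed simp
qed

section \<open>The fundamental lemma of the calculus of variations\<close>

lemma AE_lebesgue_on_open_local:
  fixes W :: "'a::euclidean_space set"
  assumes "\<And>z. z \<in> W \<Longrightarrow> \<exists>r>0. AE x in lebesgue. x \<in> ball z r \<longrightarrow> P x"
  shows "AE x in lebesgue. x \<in> W \<longrightarrow> P x"
proof -
  obtain r where r: "\<And>z. z \<in> W \<Longrightarrow> r z > 0 \<and> (AE x in lebesgue. x \<in> ball z (r z) \<longrightarrow> P x)"
    using assms by metis
  define \<F> where "\<F> = (\<lambda>z. ball z (r z)) ` W"
  obtain \<F>' where F': "\<F>' \<subseteq> \<F>" "countable \<F>'" "\<Union>\<F>' = \<Union>\<F>"
    using Lindelof[of \<F>] by (auto simp: \<F>_def)
  have "AE x in lebesgue. \<forall>B\<in>\<F>'. x \<in> B \<longrightarrow> P x"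
    using F'(1) r by (intro AE_ball_countable[OF F'(2), THEN iffD2]) (auto simp: \<F>_def)
  moreover have "W \<subseteq> \<Union>\<F>'" unfolding F'(3) \<F>_def using r by (force intro: centre_in_ball[THEN iffD2])
  ultimately show ?thesis by (auto elim!: eventually_mono)
qed

lemma borel_representative:
  fixes f :: "'a::euclidean_space \<Rightarrow> real"
  assumes "f \<in> borel_measurable lebesgue"
  obtains f' where "f' \<in> borel_measurable borel" "AE x in lebesgue. f x = f' x"
proof -
  obtain f' where f': "f' \<in> borel_measurable lborel" "AE x in lborel. f x = f' x"
    using completion_ex_borel_measurable_real[OF assms] by blast
  then have "AE x in lebesgue. f x = f' x" by (intro AE_completion)
  then show ?thesis using that[of f'] f'(1) by simp
qed

text \<open>Near a point of \<open>W\<close> the function agrees with an integrable one whose mollifications vanish by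
  hypothesis; but they converge to it in \<open>L\<^sup>1\<close>.\<close>

lemma fundamental_lemma:
  fixes f :: "'a::euclidean_space \<Rightarrow> real"
  assumes W: "open W" and loc: "\<And>K. compact K \<Longrightarrow> K \<subseteq> W \<Longrightarrow> set_integrable lebesgue K f"
    and zero: "\<And>x \<epsilon>. \<epsilon> > 0 \<Longrightarrow> cball x \<epsilon> \<subseteq> W \<Longrightarrow> (LINT y|lebesgue_on W. f y * mollifier \<epsilon> (x - y)) = 0"
  shows "AE x in lebesgue. x \<in> W \<longrightarrow> f x = 0"
proof (rule AE_lebesgue_on_open_local)
  fix z assume "z \<in> W"
  then obtain r0 where r0: "r0 > 0" "cball z r0 \<subseteq> W" using W open_contains_cball by blast
  define r where "r = r0 / 2"
  have r: "r > 0" "cball z (2 * r) \<subseteq> W" using r0 by (auto simp: r_def)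
  let ?B = "cball z (2 * r)"
  have f1i: "integrable lebesgue (\<lambda>x. indicator ?B x * f x)"
    using loc[of ?B] r by (simp add: set_integrable_def)
  obtain f1 where f1: "f1 \<in> borel_measurable borel" "AE x in lebesgue. indicator ?B x * f x = f1 x"
    using borel_representative[of "\<lambda>x. indicator ?B x * f x"] f1i by (auto dest: borel_measurable_integrable)
  define f2 where "f2 x = indicator ?B x * f1 x" for x
  have f2m[measurable]: "f2 \<in> borel_measurable borel" 
  proof -
    have [measurable]: "?B \<in> sets borel" "f1 \<in> borel_measurable borel" using f1(1) by auto
    show ?thesis unfolding f2_def by measurable
  qed
  have f2AE: "AE x in lebesgue. indicator ?B x * f x = f2 x"
    using f1(2) by eventually_elim (auto simp: f2_def indicator_def split: if_splits)
  have "integrable lebesgue f2"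
    by (rule integrable_cong_AE_imp[OF f1i]) (use f2AE f2m in \<open>auto intro: measurable_completion elim: eventually_mono\<close>)
  then have f2i: "integrable lborel f2" by (simp add: integrable_completion)
  have supp: "f2 x = 0" if "norm x > norm z + 2 * r" for x
    using that norm_triangle_ineq2[of x z] by (auto simp: f2_def indicator_def dist_norm norm_minus_commute)
  define \<epsilon> where "\<epsilon> m = r / real (Suc m)" for m
  have \<epsilon>: "\<epsilon> m > 0" "\<epsilon> m \<le> r" for m using r by (auto simp: \<epsilon>_def divide_le_eq)
  have \<epsilon>0: "\<epsilon> \<longlonglongrightarrow> 0" unfolding \<epsilon>_def by real_asymp
  have conv0: "conv f2 (mollifier (\<epsilon> m)) x = 0" if x: "x \<in> ball z r" for x m
  proof -
    have sub: "cball x (\<epsilon> m) \<subseteq> ?B"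
      using x \<epsilon>(2)[of m] by (auto simp: dist_norm) (smt (verit) norm_triangle_ineq diff_add_cancel norm_minus_commute add_diff_eq)
    have "conv f2 (mollifier (\<epsilon> m)) x = (LINT y|lebesgue. f2 y * mollifier (\<epsilon> m) (x - y))"
      unfolding conv_def by (rule integral_completion[symmetric]) measurable
    also have "\<dots> = (LINT y|lebesgue. indicator W y *\<^sub>R (f y * mollifier (\<epsilon> m) (x - y)))"
    proof (rule integral_cong_AE)
      have "(\<lambda>y. (indicator ?B y * f y) * mollifier (\<epsilon> m) (x - y)) \<in> borel_measurable lebesgue"
        by (intro borel_measurable_times borel_measurable_integrable[OF f1i] measurable_completion) measurable
      moreover have eq: "(indicator ?B y * f y) * mollifier (\<epsilon> m) (x - y) = indicator W y *\<^sub>R (f y * mollifier (\<epsilon> m) (x - y))" for y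
      proof (cases "y \<in> ?B")
        case True
        then show ?thesis using r by (auto simp: indicator_def)
      next
        case False
        then have "norm (x - y) \<ge> \<epsilon> m" using sub by (force simp: dist_norm)
        then show ?thesis using mollifier_eq_0[of "\<epsilon> m" "x - y"] \<epsilon>(1)[of m] by simp
      qed
      ultimately show "(\<lambda>y. indicator W y *\<^sub>R (f y * mollifier (\<epsilon> m) (x - y))) \<in> borel_measurable lebesgue"
        by (simp only:)
      show "AE y in lebesgue. f2 y * mollifier (\<epsilon> m) (x - y) = indicator W y *\<^sub>R (f y * mollifier (\<epsilon> m) (x - y))"
        using f2AE
      proof eventually_elim
        case (elim y)
        show ?case unfolding elim[symmetric] by (rule eq)
      qed
    qed (intro measurable_completion, measurable)
    also have "\<dots> = (LINT y|lebesgue_on W. f y * mollifier (\<epsilon> m) (x - y))"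
      using W by (subst integral_restrict_space) auto
    also have "\<dots> = 0" using sub r(2) by (intro zero \<epsilon>) auto
    finally show ?thesis .
  qed
  have lim: "(\<lambda>m. \<integral>\<^sup>+x. ennreal (\<bar>conv f2 (mollifier (\<epsilon> m)) x - f2 x\<bar> ^ 1) \<partial>lborel) \<longlonglongrightarrow> 0"
    by (rule conv_mollifier_converges[OF _ f2m _ supp \<epsilon>(1) \<epsilon>0]) (use f2i in auto)
  let ?I = "\<integral>\<^sup>+x. ennreal \<bar>f2 x\<bar> * indicator (ball z r) x \<partial>lborel"
  have "?I \<le> 0"
  proof (rule LIMSEQ_le_const[OF lim], intro exI allI impI)
    fix m
    show "?I \<le> (\<integral>\<^sup>+x. ennreal (\<bar>conv f2 (mollifier (\<epsilon> m)) x - f2 x\<bar> ^ 1) \<partial>lborel)"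
      by (intro nn_integral_mono) (auto simp: indicator_def conv0)
  qed
  then have "?I = 0" by simp
  then have "AE x in lborel. ennreal \<bar>f2 x\<bar> * indicator (ball z r) x = 0"
  proof -
    have [measurable]: "ball z r \<in> sets borel" by simp
    have "(\<lambda>x. ennreal \<bar>f2 x\<bar> * indicator (ball z r) x) \<in> borel_measurable lborel" by measurable
    from nn_integral_0_iff_AE[OF this] \<open>?I = 0\<close> show ?thesis by simp
  qed
  then have "AE x in lebesgue. x \<in> ball z r \<longrightarrow> f2 x = 0"
    by (intro AE_completion) (auto elim!: eventually_mono simp: indicator_def)
  then have "AE x in lebesgue. x \<in> ball z r \<longrightarrow> f x = 0"
    using f2AE
  proof eventually_elim
    case (elim x)
    show ?case
    proof
      assume x: "x \<in> ball z r"
      then have "x \<in> ?B" using r by auto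
      then show "f x = 0" using elim x by auto
    qed
  qed
  then show "\<exists>r>0. AE x in lebesgue. x \<in> ball z r \<longrightarrow> f x = 0" using r by blast
qed

section \<open>Mollified functions are continuously differentiable\<close>

definition mollifier_deriv :: "real \<Rightarrow> 'a::euclidean_space \<Rightarrow> 'a \<Rightarrow> real" where
  "mollifier_deriv \<epsilon> h z = - 4 * max 0 (\<epsilon>\<^sup>2 - z \<bullet> z) * (z \<bullet> h) / (\<integral>y. bump \<epsilon> (y::'a) \<partial>lborel)"

lemma continuous_mollifier_deriv: "continuous_on UNIV (mollifier_deriv \<epsilon> h)"
  unfolding mollifier_deriv_def divide_inverse by (intro continuous_intros)

lemma mollifier_deriv_eq_0: "\<epsilon> \<ge> 0 \<Longrightarrow> norm z \<ge> \<epsilon> \<Longrightarrow> mollifier_deriv \<epsilon> h z = 0"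
  by (simp add: mollifier_deriv_def max_def dot_square_norm)

lemma mollifier_taylor:
  fixes z :: "'a::euclidean_space"
  assumes "\<epsilon> > 0"
  obtains C where "\<And>z h :: 'a. norm h \<le> 1 \<Longrightarrow>
     \<bar>mollifier \<epsilon> (z + h) - mollifier \<epsilon> z - mollifier_deriv \<epsilon> h z\<bar> \<le> C * (norm h)\<^sup>2"
proof -
  define c where "c = (\<integral>y. bump \<epsilon> (y::'a) \<partial>lborel)"
  have c: "c > 0" unfolding c_def by (rule bump_integral_pos[OF assms])
  define K where "K = (2 * (\<epsilon> + 1) + 1)\<^sup>2 + 2 * \<epsilon>\<^sup>2"
  have "\<bar>mollifier \<epsilon> (z + h) - mollifier \<epsilon> z - mollifier_deriv \<epsilon> h z\<bar> \<le> K / c * (norm h)\<^sup>2" if h: "norm h \<le> 1" for z h :: 'a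
  proof (cases "norm z \<ge> \<epsilon> + 1")
    case True
    then have "norm (z + h) \<ge> \<epsilon>" using h norm_triangle_ineq2[of z "- h"] by simp
    then show ?thesis using True assms c
      by (simp add: mollifier_eq_0 mollifier_deriv_eq_0 K_def)
  next
    case False
    define a b where "a = \<epsilon>\<^sup>2 - z \<bullet> z" and "b = \<epsilon>\<^sup>2 - (z + h) \<bullet> (z + h)"
    have ba: "b - a = - 2 * (z \<bullet> h) - h \<bullet> h" by (simp add: a_def b_def inner_add_left inner_add_right inner_commute)
    have "\<bar>b - a\<bar> \<le> (2 * (\<epsilon> + 1) + 1) * norm h"
    proof -
      have "\<bar>b - a\<bar> \<le> 2 * \<bar>z \<bullet> h\<bar> + \<bar>h \<bullet> h\<bar>" unfolding ba by linarith
      also have "\<dots> \<le> 2 * (norm z * norm h) + norm h * norm h"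
        using Cauchy_Schwarz_ineq2[of z h] Cauchy_Schwarz_ineq2[of h h] by linarith
      also have "\<dots> \<le> 2 * ((\<epsilon> + 1) * norm h) + 1 * norm h"
        using False h assms by (intro add_mono mult_mono) auto
      finally show ?thesis by (simp add: algebra_simps)
    qed
    then have sq: "(b - a)\<^sup>2 \<le> (2 * (\<epsilon> + 1) + 1)\<^sup>2 * (norm h)\<^sup>2"
      using assms by (metis abs_ge_zero power2_abs power_mono power_mult_distrib)
    have ma: "0 \<le> max 0 a" "max 0 a \<le> \<epsilon>\<^sup>2" by (auto simp: a_def)
    have eq: "mollifier \<epsilon> (z + h) - mollifier \<epsilon> z - mollifier_deriv \<epsilon> h z
      = ((pos_sq b - pos_sq a - 2 * max 0 a * (b - a)) - 2 * max 0 a * (h \<bullet> h)) / c"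
      unfolding mollifier_def bump_def mollifier_deriv_def c_def[symmetric] a_def[symmetric] b_def[symmetric] ba
      by (simp add: diff_divide_distrib add_divide_distrib algebra_simps)
    have "\<bar>(pos_sq b - pos_sq a - 2 * max 0 a * (b - a)) - 2 * max 0 a * (h \<bullet> h)\<bar> \<le> (b - a)\<^sup>2 + 2 * max 0 a * (h \<bullet> h)"
      using pos_sq_taylor[of b a] ma by (smt (verit) inner_ge_zero mult_nonneg_nonneg)
    also have "\<dots> \<le> (2 * (\<epsilon> + 1) + 1)\<^sup>2 * (norm h)\<^sup>2 + 2 * \<epsilon>\<^sup>2 * (norm h)\<^sup>2"
      using sq ma by (intro add_mono mult_mono) (auto simp: dot_square_norm)
    also have "\<dots> = K * (norm h)\<^sup>2" by (simp add: K_def algebra_simps)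
    finally show ?thesis unfolding eq using c by (simp add: abs_divide divide_right_mono)
  qed
  then show ?thesis using that by blast
qed

lemma conv_mollifier_has_derivative:
  fixes f :: "'a::euclidean_space \<Rightarrow> real"
  assumes \<epsilon>: "\<epsilon> > 0" and f: "integrable lborel f"
  shows "(conv f (mollifier \<epsilon>) has_derivative (\<lambda>h. conv f (mollifier_deriv \<epsilon> h) x)) (at x)"
proof -
  obtain C where C: "\<And>z h :: 'a. norm h \<le> 1 \<Longrightarrow>
     \<bar>mollifier \<epsilon> (z + h) - mollifier \<epsilon> z - mollifier_deriv \<epsilon> h z\<bar> \<le> C * (norm h)\<^sup>2"
    using mollifier_taylor[OF \<epsilon>, where 'a='a] by blast
  have id: "integrable lborel (\<lambda>y. f y * mollifier_deriv \<epsilon> h (x - y))" for h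
    by (rule integrable_mult_bounded_continuous[OF f continuous_mollifier_deriv, of "ball 0 \<epsilon>"])
      (use \<epsilon> in \<open>auto intro!: mollifier_deriv_eq_0\<close>)
  define F where "F = (\<integral>y. \<bar>f y\<bar> \<partial>lborel)"
  have bl: "bounded_linear (\<lambda>h. conv f (mollifier_deriv \<epsilon> h) x)"
  proof (rule linear_conv_bounded_linear[THEN iffD1], rule linearI)
    fix a b
    have "mollifier_deriv \<epsilon> (a + b) z = mollifier_deriv \<epsilon> a z + mollifier_deriv \<epsilon> b z" for z :: 'a
      by (simp add: mollifier_deriv_def inner_add_right distrib_left diff_divide_distrib)
    then show "conv f (mollifier_deriv \<epsilon> (a + b)) x = conv f (mollifier_deriv \<epsilon> a) x + conv f (mollifier_deriv \<epsilon> b) x"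
      unfolding conv_def using id by (simp add: distrib_left)
  next
    fix t :: real and a
    have *: "f y * mollifier_deriv \<epsilon> (t *\<^sub>R a) (x - y) = t * (f y * mollifier_deriv \<epsilon> a (x - y))" for y
      by (simp add: mollifier_deriv_def)
    show "conv f (mollifier_deriv \<epsilon> (t *\<^sub>R a)) x = t *\<^sub>R conv f (mollifier_deriv \<epsilon> a) x"
      unfolding conv_def * by simp
  qed
  show ?thesis
  proof (rule has_derivative_at[THEN iffD2], intro conjI bl)
    have bound: "\<bar>conv f (mollifier \<epsilon>) (x + h) - conv f (mollifier \<epsilon>) x - conv f (mollifier_deriv \<epsilon> h) x\<bar> \<le> C * F * (norm h)\<^sup>2"
      if h: "norm h \<le> 1" for h
    proof -
      have "conv f (mollifier \<epsilon>) (x + h) - conv f (mollifier \<epsilon>) x - conv f (mollifier_deriv \<epsilon> h) x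
        = (\<integral>y. f y * (mollifier \<epsilon> (x - y + h) - mollifier \<epsilon> (x - y) - mollifier_deriv \<epsilon> h (x - y)) \<partial>lborel)"
        unfolding conv_def right_diff_distrib
        using id[of h] integrable_mult_mollifier[OF \<epsilon> f, of x] integrable_mult_mollifier[OF \<epsilon> f, of "x + h"]
        by (simp add: algebra_simps)
      also have "\<bar>\<dots>\<bar> \<le> (\<integral>y. \<bar>f y * (mollifier \<epsilon> (x - y + h) - mollifier \<epsilon> (x - y) - mollifier_deriv \<epsilon> h (x - y))\<bar> \<partial>lborel)"
        by (rule integral_abs_bound)
      also have "\<dots> \<le> (\<integral>y. \<bar>f y\<bar> * (C * (norm h)\<^sup>2) \<partial>lborel)"
      proof (rule integral_mono)
        show "integrable lborel (\<lambda>y. \<bar>f y * (mollifier \<epsilon> (x - y + h) - mollifier \<epsilon> (x - y) - mollifier_deriv \<epsilon> h (x - y))\<bar>)"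
          unfolding right_diff_distrib
          using id[of h] integrable_mult_mollifier[OF \<epsilon> f, of x] integrable_mult_mollifier[OF \<epsilon> f, of "x + h"]
          by (intro integrable_abs Bochner_Integration.integrable_diff) (simp_all add: algebra_simps)
        show "\<bar>f y * (mollifier \<epsilon> (x - y + h) - mollifier \<epsilon> (x - y) - mollifier_deriv \<epsilon> h (x - y))\<bar> \<le> \<bar>f y\<bar> * (C * (norm h)\<^sup>2)" for y
          unfolding abs_mult by (intro mult_left_mono C h) simp
      qed (use f in simp)
      also have "\<dots> = C * F * (norm h)\<^sup>2" by (simp add: F_def)
      finally show ?thesis .
    qed
    show "(\<lambda>h. norm (conv f (mollifier \<epsilon>) (x + h) - conv f (mollifier \<epsilon>) x - conv f (mollifier_deriv \<epsilon> h) x) / norm h) \<midarrow>0\<rightarrow> 0"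
    proof (rule tendsto_sandwich[of "\<lambda>_. 0" _ _ "\<lambda>h. C * F * norm h"])
      have "\<forall>\<^sub>F h in at (0::'a). norm h < 1" using eventually_at_ball[of 1 "0::'a" UNIV] by (simp add: dist_norm)
      then show "\<forall>\<^sub>F h in at 0. norm (conv f (mollifier \<epsilon>) (x + h) - conv f (mollifier \<epsilon>) x - conv f (mollifier_deriv \<epsilon> h) x) / norm h \<le> C * F * norm h"
      proof eventually_elim
        case (elim h)
        show ?case
          using bound[of h] elim by (cases "h = 0") (auto simp: divide_le_eq power2_eq_square mult.assoc)
      qed
    qed (auto intro!: tendsto_eq_intros)
  qed
qed

lemma continuous_conv:
  fixes f :: "'a::euclidean_space \<Rightarrow> real"
  assumes f: "integrable lborel f" and k: "continuous_on UNIV k" "bounded B" "\<And>z. z \<notin> B \<Longrightarrow> k z = 0"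
  shows "continuous_on UNIV (conv f k)"
proof (rule continuous_at_imp_continuous_on, rule ballI)
  fix x0 :: 'a
  have "bounded (k ` closure B)"
    using k by (intro compact_imp_bounded compact_continuous_image) (auto simp: compact_closure intro: continuous_on_subset)
  then obtain M where M: "\<And>z. z \<in> closure B \<Longrightarrow> \<bar>k z\<bar> \<le> M" by (auto simp: bounded_iff)
  have kb: "\<bar>k z\<bar> \<le> \<bar>M\<bar>" for z
    using M[of z] k(3)[of z] closure_subset[of B] by (cases "z \<in> B") auto
  have [measurable]: "k \<in> borel_measurable borel" "f \<in> borel_measurable borel"
    using f borel_measurable_continuous_onI[OF k(1)] by auto
  have "(\<lambda>n. conv f k (X n)) \<longlonglongrightarrow> conv f k x0" if X: "X \<longlonglongrightarrow> x0" for X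
    unfolding conv_def
  proof (rule integral_dominated_convergence[where w="\<lambda>y. \<bar>f y\<bar> * \<bar>M\<bar>"])
    show "AE y in lborel. (\<lambda>n. f y * k (X n - y)) \<longlonglongrightarrow> f y * k (x0 - y)"
    proof (rule AE_I2)
      fix y
      have "isCont k (x0 - y)" using k(1) by (simp add: continuous_on_eq_continuous_at)
      then have "(\<lambda>n. k (X n - y)) \<longlonglongrightarrow> k (x0 - y)" by (rule isCont_tendsto_compose) (intro tendsto_intros X)
      then show "(\<lambda>n. f y * k (X n - y)) \<longlonglongrightarrow> f y * k (x0 - y)" by (intro tendsto_intros)
    qed
    show "AE y in lborel. norm (f y * k (X n - y)) \<le> \<bar>f y\<bar> * \<bar>M\<bar>" for n
      using kb by (simp add: abs_mult mult_left_mono)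
  qed (use f in auto)
  then show "isCont (conv f k) x0" by (simp add: continuous_at_sequentially o_def)
qed

section \<open>Continuously differentiable functions\<close>

definition C1_with :: "(real^'n::finite \<Rightarrow> real) \<Rightarrow> (real^'n \<Rightarrow> real^'n) \<Rightarrow> bool" where
  "C1_with f G \<longleftrightarrow> (\<forall>x. (f has_derivative (\<lambda>h. G x \<bullet> h)) (at x)) \<and> continuous_on UNIV G"

lemma partial_eqI:
  "(f has_derivative (\<lambda>h. g \<bullet> h)) (at x) \<Longrightarrow> partial i f x = g $ i"
  unfolding partial_def by (simp add: frechet_derivative_at[symmetric] inner_axis)

lemma grad_eqI:
  "(f has_derivative (\<lambda>h. g \<bullet> h)) (at x) \<Longrightarrow> grad f x = g"
  by (simp add: grad_def partial_eqI vec_eq_iff)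

lemma has_derivative_grad:
  assumes "f differentiable (at x)"
  shows "(f has_derivative (\<lambda>h. grad f x \<bullet> h)) (at x)"
proof -
  let ?D = "frechet_derivative f (at x)"
  have D: "(f has_derivative ?D) (at x)" using assms by (simp add: frechet_derivative_works)
  then have lin: "linear ?D" by (rule has_derivative_linear)
  have "?D h = grad f x \<bullet> h" for h
  proof -
    have "h = (\<Sum>i\<in>UNIV. h $ i *\<^sub>R axis i 1)" by (simp add: vec_eq_iff axis_def if_distrib cong: if_cong)
    then have "?D h = (\<Sum>i\<in>UNIV. h $ i * ?D (axis i 1))"
      using linear_sum[OF lin, of "\<lambda>i. h $ i *\<^sub>R axis i 1" UNIV] linear_cmul[OF lin] by simp
    then show ?thesis by (simp add: grad_def partial_def inner_vec_def mult.commute)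
  qed
  then show ?thesis using D by (metis (no_types, lifting) ext)
qed

lemma C1_on_UNIV_iff: "C1_on UNIV f \<longleftrightarrow> C1_with f (grad f)"
proof
  assume "C1_on UNIV f"
  then have "\<And>x. f differentiable (at x)" "\<And>i. continuous_on UNIV (partial i f)"
    unfolding C1_on_def by auto
  then show "C1_with f (grad f)"
    unfolding C1_with_def by (intro conjI allI has_derivative_grad) (auto intro!: continuous_on_vec_lambda simp: grad_def[abs_def])
next
  assume *: "C1_with f (grad f)"
  have "continuous_on UNIV (\<lambda>x. grad f x $ i)" for i
    using * unfolding C1_with_def by (intro continuous_intros) auto
  then show "C1_on UNIV f"
    using * unfolding C1_on_def C1_with_def by (auto simp: differentiable_def grad_def)
qed

lemma C1_with_grad: "C1_with f G \<Longrightarrow> grad f = G"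
  by (auto simp: C1_with_def grad_eqI)

lemma C1_with_partial: "C1_with f G \<Longrightarrow> partial i f = (\<lambda>x. G x $ i)"
  by (auto simp: C1_with_def partial_eqI)

lemma C1_with_continuous: "C1_with f G \<Longrightarrow> continuous_on UNIV f"
  unfolding C1_with_def by (meson continuous_at_imp_continuous_on has_derivative_continuous)

lemma C1_with_zero:
  assumes "C1_with f G" "closed K" "\<And>x. x \<notin> K \<Longrightarrow> f x = 0" "x \<notin> K"
  shows "G x = 0"
proof -
  have "((\<lambda>x. 0 :: real) has_derivative (\<lambda>h. G x \<bullet> h)) (at x)"
    by (rule has_derivative_transform_within_open[of f _ x UNIV "- K"])
      (use assms in \<open>auto simp: C1_with_def\<close>)
  then have "(\<lambda>h. G x \<bullet> h) = (\<lambda>h. 0)" by (rule has_derivative_unique) (rule has_derivative_const)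
  then have "G x \<bullet> G x = 0" by meson
  then show ?thesis by simp
qed

lemma C1_c_iff:
  "C1_c W f \<longleftrightarrow> C1_with f (grad f) \<and> (\<exists>K. compact K \<and> K \<subseteq> W \<and> (\<forall>x. x \<notin> K \<longrightarrow> f x = 0))"
proof
  assume "C1_c W f"
  then show "C1_with f (grad f) \<and> (\<exists>K. compact K \<and> K \<subseteq> W \<and> (\<forall>x. x \<notin> K \<longrightarrow> f x = 0))"
    using closure_subset[of "{x. f x \<noteq> 0}"] unfolding C1_c_def C1_on_UNIV_iff
    by (auto intro!: exI[of _ "closure {x. f x \<noteq> 0}"])
next
  assume *: "C1_with f (grad f) \<and> (\<exists>K. compact K \<and> K \<subseteq> W \<and> (\<forall>x. x \<notin> K \<longrightarrow> f x = 0))"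
  then obtain K where K: "compact K" "K \<subseteq> W" "\<And>x. x \<notin> K \<Longrightarrow> f x = 0" by auto
  then have "closure {x. f x \<noteq> 0} \<subseteq> K" by (intro closure_minimal) (auto intro: compact_imp_closed)
  then show "C1_c W f" using * K unfolding C1_c_def C1_on_UNIV_iff
    by (auto simp: compact_closure intro: bounded_subset[OF compact_imp_bounded])
qed

lemma C1_cI:
  assumes "C1_with f G" "compact K" "K \<subseteq> W" "\<And>x. x \<notin> K \<Longrightarrow> f x = 0"
  shows "C1_c W f"
  using assms C1_with_grad[OF assms(1)] unfolding C1_c_iff by auto

lemma C1_cE:
  assumes "C1_c W f"
  obtains K where "C1_with f (grad f)" "compact K" "K \<subseteq> W" "\<And>x. x \<notin> K \<Longrightarrow> f x = 0" "\<And>x. x \<notin> K \<Longrightarrow> grad f x = 0"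
proof -
  obtain K where K: "C1_with f (grad f)" "compact K" "K \<subseteq> W" "\<And>x. x \<notin> K \<Longrightarrow> f x = 0"
    using assms unfolding C1_c_iff by auto
  then have "\<And>x. x \<notin> K \<Longrightarrow> grad f x = 0" using C1_with_zero[OF K(1) compact_imp_closed[OF K(2)]] by blast
  then show ?thesis using that K by blast
qed

lemma C1_with_mult:
  assumes "C1_with f F" "C1_with g G"
  shows "C1_with (\<lambda>x. f x * g x) (\<lambda>x. g x *\<^sub>R F x + f x *\<^sub>R G x)"
proof -
  have "((\<lambda>x. f x * g x) has_derivative (\<lambda>h. (g x *\<^sub>R F x + f x *\<^sub>R G x) \<bullet> h)) (at x)" for x
  proof -
    have "((\<lambda>x. f x * g x) has_derivative (\<lambda>h. f x * (G x \<bullet> h) + (F x \<bullet> h) * g x)) (at x)"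
      using assms unfolding C1_with_def by (intro has_derivative_mult) auto
    then show ?thesis by (simp add: inner_add_left mult.commute add.commute)
  qed
  moreover have "continuous_on UNIV (\<lambda>x. g x *\<^sub>R F x + f x *\<^sub>R G x)"
    using C1_with_continuous[OF assms(1)] C1_with_continuous[OF assms(2)] assms unfolding C1_with_def
    by (intro continuous_intros) auto
  ultimately show ?thesis unfolding C1_with_def by blast
qed

lemma C1_with_compose:
  assumes f: "C1_with f F" and g: "\<And>t. (g has_real_derivative g' t) (at t)" "continuous_on UNIV g'"
  shows "C1_with (\<lambda>x. g (f x)) (\<lambda>x. g' (f x) *\<^sub>R F x)"
proof -
  have "((\<lambda>x. g (f x)) has_derivative (\<lambda>h. (g' (f x) *\<^sub>R F x) \<bullet> h)) (at x)" for x
  proof -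
    have "(f has_derivative (\<lambda>h. F x \<bullet> h)) (at x)" using f unfolding C1_with_def by blast
    moreover have "(g has_derivative (\<lambda>h. g' (f x) * h)) (at (f x))"
      using g(1)[of "f x"] by (simp add: has_field_derivative_def)
    ultimately have "((\<lambda>x. g (f x)) has_derivative (\<lambda>h. g' (f x) * (F x \<bullet> h))) (at x)"
      by (rule has_derivative_compose)
    then show ?thesis by simp
  qed
  moreover have "continuous_on UNIV (\<lambda>x. g' (f x) *\<^sub>R F x)"
    using C1_with_continuous[OF f] f continuous_on_compose2[OF g(2)] unfolding C1_with_def
    by (intro continuous_intros) auto
  ultimately show ?thesis unfolding C1_with_def by blast
qed

lemma C1_with_norm_sq:
  "C1_with (\<lambda>x :: real^'n::finite. x \<bullet> x) (\<lambda>x. 2 *\<^sub>R x)"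
proof -
  have "((\<lambda>x. x \<bullet> x) has_derivative (\<lambda>h. (2 *\<^sub>R x) \<bullet> h)) (at x)" for x :: "real^'n"
  proof -
    have "((\<lambda>x. x \<bullet> x) has_derivative (\<lambda>h. x \<bullet> h + h \<bullet> x)) (at x)"
      by (intro has_derivative_inner has_derivative_ident)
    then show ?thesis by (simp add: inner_commute algebra_simps)
  qed
  moreover have "continuous_on UNIV (\<lambda>x :: real^'n. 2 *\<^sub>R x)" by (intro continuous_intros)
  ultimately show ?thesis unfolding C1_with_def by blast
qed

lemma C1_with_integrable:
  assumes "C1_with f F" "C1_c W \<psi>"
  shows "integrable lborel (\<lambda>x. f x * partial i \<psi> x)" "integrable lborel (\<lambda>x. F x $ i * \<psi> x)"
proof -
  obtain K where K: "C1_with \<psi> (grad \<psi>)" "compact K" "\<And>x. x \<notin> K \<Longrightarrow> \<psi> x = 0" "\<And>x. x \<notin> K \<Longrightarrow> grad \<psi> x = 0"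
    using C1_cE[OF assms(2)] by metis
  have c: "continuous_on UNIV (\<lambda>x. grad \<psi> x $ i)" "continuous_on UNIV (\<lambda>x. F x $ i)"
    using K(1) assms(1) unfolding C1_with_def by (auto intro!: continuous_intros)
  show "integrable lborel (\<lambda>x. f x * partial i \<psi> x)" unfolding C1_with_partial[OF K(1)]
    by (rule integrable_continuous_bounded_support[of _ K])
      (use K c C1_with_continuous[OF assms(1)] in \<open>auto intro!: continuous_intros compact_imp_bounded\<close>)
  show "integrable lborel (\<lambda>x. F x $ i * \<psi> x)"
    by (rule integrable_continuous_bounded_support[of _ K])
      (use K c C1_with_continuous[OF K(1)] in \<open>auto intro!: continuous_intros compact_imp_bounded\<close>)
qed

text \<open>The integral of a difference quotient vanishes by translation invariance.\<close>

lemma integral_partial_eq_0: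
  fixes \<phi> :: "real^'n::finite \<Rightarrow> real"
  assumes "C1_c W \<phi>"
  shows "(\<integral>x. partial i \<phi> x \<partial>lborel) = 0"
proof -
  obtain K where K: "C1_with \<phi> (grad \<phi>)" "compact K" "\<And>x. x \<notin> K \<Longrightarrow> \<phi> x = 0" "\<And>x. x \<notin> K \<Longrightarrow> grad \<phi> x = 0"
    using C1_cE[OF assms] by metis
  define e :: "real^'n" where "e = axis i 1"
  have ne: "norm e = 1" by (simp add: e_def)
  let ?g = "\<lambda>x. grad \<phi> x $ i"
  have c: "continuous_on UNIV ?g" using K(1) unfolding C1_with_def by (intro continuous_intros) auto
  have \<phi>c: "continuous_on UNIV \<phi>" by (rule C1_with_continuous[OF K(1)])
  have [measurable]: "\<phi> \<in> borel_measurable borel" "?g \<in> borel_measurable borel"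
    using c \<phi>c by (auto intro: borel_measurable_continuous_onI)
  have "bounded (?g ` K)"
    by (intro compact_imp_bounded compact_continuous_image K continuous_on_subset[OF c]) auto
  then obtain M where "\<And>x. x \<in> K \<Longrightarrow> \<bar>?g x\<bar> \<le> M" by (auto simp: bounded_iff)
  then have M: "\<bar>?g x\<bar> \<le> \<bar>M\<bar>" for x using K(4)[of x] by (cases "x \<in> K") (auto intro: order_trans[OF _ abs_ge_self])
  obtain R where R: "\<And>x. x \<in> K \<Longrightarrow> norm x \<le> R" using compact_imp_bounded[OF K(2)] by (auto simp: bounded_iff)
  have d: "((\<lambda>t. \<phi> (x + t *\<^sub>R e)) has_real_derivative ?g (x + s *\<^sub>R e)) (at s)" for x s
  proof -
    have "((\<lambda>t. x + t *\<^sub>R e) has_derivative (\<lambda>t. t *\<^sub>R e)) (at s)" by (auto intro!: derivative_eq_intros)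
    moreover have "(\<phi> has_derivative (\<lambda>h. grad \<phi> (x + s *\<^sub>R e) \<bullet> h)) (at (x + s *\<^sub>R e))"
      using K(1) unfolding C1_with_def by blast
    ultimately have "((\<lambda>t. \<phi> (x + t *\<^sub>R e)) has_derivative (\<lambda>t. grad \<phi> (x + s *\<^sub>R e) \<bullet> (t *\<^sub>R e))) (at s)"
      by (rule has_derivative_compose)
    moreover have "(\<lambda>t. grad \<phi> (x + s *\<^sub>R e) \<bullet> (t *\<^sub>R e)) = (*) (?g (x + s *\<^sub>R e))"
      by (auto simp: e_def inner_axis)
    ultimately show ?thesis unfolding has_field_derivative_def by simp
  qed
  define t where "t m = 1 / real (Suc m)" for m
  have t: "0 < t m" "t m \<le> 1" for m by (auto simp: t_def)
  define q where "q m x = (\<phi> (x + t m *\<^sub>R e) - \<phi> x) / t m" for m x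
  have \<phi>i: "integrable lborel \<phi>"
    by (rule integrable_continuous_bounded_support[OF \<phi>c compact_imp_bounded[OF K(2)]]) (use K in auto)
  have shift: "integrable lborel (\<lambda>x. \<phi> (x + a))" "(\<integral>x. \<phi> (x + a) \<partial>lborel) = (\<integral>x. \<phi> x \<partial>lborel)" for a
  proof -
    have d: "distr lborel borel (\<lambda>x. x + a) = (lborel :: (real^'n) measure)"
    proof -
      have "(\<lambda>x. x + a) = (+) a" by (auto simp: add.commute)
      then show ?thesis using lborel_distr_plus[of a] by simp
    qed
    show "integrable lborel (\<lambda>x. \<phi> (x + a))"
      using integrable_distr_eq[of "\<lambda>x. x + a" lborel borel \<phi>] \<phi>i unfolding d by auto
    show "(\<integral>x. \<phi> (x + a) \<partial>lborel) = (\<integral>x. \<phi> x \<partial>lborel)"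
      using integral_distr[of "\<lambda>x. x + a" lborel borel \<phi>] unfolding d by auto
  qed
  have q0: "(\<integral>x. q m x \<partial>lborel) = 0" for m
    unfolding q_def using shift \<phi>i by simp
  have "(\<lambda>m. \<integral>x. q m x \<partial>lborel) \<longlonglongrightarrow> (\<integral>x. ?g x \<partial>lborel)"
  proof (rule integral_dominated_convergence[where w="\<lambda>x. \<bar>M\<bar> * indicator (cball 0 (R + 1)) x"])
    show "AE x in lborel. (\<lambda>m. q m x) \<longlonglongrightarrow> ?g x"
    proof (rule AE_I2)
      fix x
      have "((\<lambda>h. (\<phi> (x + h *\<^sub>R e) - \<phi> x) / h) \<longlongrightarrow> ?g x) (at 0)"
        using d[of x 0] unfolding DERIV_def by simp
      moreover have "filterlim t (at 0) sequentially"
      proof -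
        have "t \<longlonglongrightarrow> 0" unfolding t_def by real_asymp
        moreover have "t m \<noteq> 0" for m by (simp add: t_def)
        ultimately show ?thesis by (auto simp: filterlim_at intro!: always_eventually)
      qed
      ultimately show "(\<lambda>m. q m x) \<longlonglongrightarrow> ?g x" unfolding q_def by (rule filterlim_compose)
    qed
    show "AE x in lborel. norm (q m x) \<le> \<bar>M\<bar> * indicator (cball 0 (R + 1)) x" for m
    proof (rule AE_I2)
      fix x
      show "norm (q m x) \<le> \<bar>M\<bar> * indicator (cball 0 (R + 1)) x"
      proof (cases "norm x \<le> R + 1")
        case True
        obtain s where "\<phi> (x + t m *\<^sub>R e) - \<phi> (x + 0 *\<^sub>R e) = (t m - 0) * ?g (x + s *\<^sub>R e)"
          using MVT2[of 0 "t m" "\<lambda>s. \<phi> (x + s *\<^sub>R e)" "\<lambda>s. ?g (x + s *\<^sub>R e)"] t(1)[of m] d by blast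
        then have "q m x = ?g (x + s *\<^sub>R e)" using t(1)[of m] by (simp add: q_def field_simps)
        then show ?thesis using True M[of "x + s *\<^sub>R e"] by simp
      next
        case False
        have "norm (x + t m *\<^sub>R e) \<ge> norm x - 1"
          using norm_triangle_ineq2[of x "- (t m *\<^sub>R e)"] t[of m] ne by simp
        then have "x + t m *\<^sub>R e \<notin> K" "x \<notin> K" using False R[of x] R[of "x + t m *\<^sub>R e"] by auto
        then show ?thesis using K(3) False by (simp add: q_def)
      qed
    qed
    show "integrable lborel (\<lambda>x. \<bar>M\<bar> * indicator (cball (0::real^'n) (R + 1)) x)"
      by (intro integrable_mult_right integrable_real_indicator)
        (use emeasure_lborel_cball_finite[of "0::real^'n" "R + 1"] in auto)
  qed (unfold q_def, measurable)
  then have "(\<lambda>m. 0) \<longlonglongrightarrow> (\<integral>x. ?g x \<partial>lborel)" unfolding q0 .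
  from LIMSEQ_unique[OF this tendsto_const] show ?thesis unfolding C1_with_partial[OF K(1)] .
qed

lemma integral_by_parts_C1:
  assumes f: "C1_with f F" and \<psi>: "C1_c W \<psi>"
  shows "(\<integral>x. f x * partial i \<psi> x \<partial>lborel) = - (\<integral>x. F x $ i * \<psi> x \<partial>lborel)"
proof -
  obtain K where K: "C1_with \<psi> (grad \<psi>)" "compact K" "K \<subseteq> W" "\<And>x. x \<notin> K \<Longrightarrow> \<psi> x = 0"
    using C1_cE[OF \<psi>] by metis
  note m = C1_with_mult[OF f K(1)]
  have "C1_c W (\<lambda>x. f x * \<psi> x)" by (rule C1_cI[OF m K(2,3)]) (use K in auto)
  then have "0 = (\<integral>x. \<psi> x * F x $ i + f x * grad \<psi> x $ i \<partial>lborel)"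
    using integral_partial_eq_0[of W "\<lambda>x. f x * \<psi> x" i] unfolding C1_with_partial[OF m] by simp
  also have "\<dots> = (\<integral>x. F x $ i * \<psi> x \<partial>lborel) + (\<integral>x. f x * partial i \<psi> x \<partial>lborel)"
    using C1_with_integrable[OF f \<psi>, of i] unfolding C1_with_partial[OF K(1)] by (simp add: mult.commute)
  finally show ?thesis by simp
qed

lemma C1_with_mollifier:
  obtains G where "C1_with (mollifier \<epsilon>) G" "\<And>z h. G z \<bullet> h = mollifier_deriv \<epsilon> h (z :: real^'n::finite)"
proof -
  define c where "c = (\<integral>y. bump \<epsilon> (y::real^'n) \<partial>lborel)"
  have "C1_with (\<lambda>z. pos_sq (\<epsilon>\<^sup>2 - z \<bullet> z) / c) (\<lambda>z. (2 * max 0 (\<epsilon>\<^sup>2 - z \<bullet> z) * (- 1) / c) *\<^sub>R (2 *\<^sub>R (z :: real^'n)))"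
    by (rule C1_with_compose[OF C1_with_norm_sq, where g="\<lambda>t. pos_sq (\<epsilon>\<^sup>2 - t) / c" and g'="\<lambda>t. 2 * max 0 (\<epsilon>\<^sup>2 - t) * (- 1) / c"])
      (auto intro!: derivative_eq_intros continuous_intros simp: divide_inverse)
  then show ?thesis
    by (intro that[of "\<lambda>z. (2 * max 0 (\<epsilon>\<^sup>2 - z \<bullet> z) * (- 1) / c) *\<^sub>R (2 *\<^sub>R z)"])
      (simp_all add: mollifier_def[abs_def] bump_def[abs_def] c_def mollifier_deriv_def)
qed

lemma C1_with_mollifier_reflected:
  obtains G where "C1_with (\<lambda>y. mollifier \<epsilon> (x - y)) G" "\<And>y i. G y $ i = - mollifier_deriv \<epsilon> (axis i 1) (x - y :: real^'n::finite)"
proof -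
  obtain G where G: "C1_with (mollifier \<epsilon>) G" "\<And>z h. G z \<bullet> h = mollifier_deriv \<epsilon> h (z :: real^'n)"
    using C1_with_mollifier by blast
  have "((\<lambda>y. mollifier \<epsilon> (x - y)) has_derivative (\<lambda>h. (- G (x - y)) \<bullet> h)) (at y)" for y
  proof -
    have "((\<lambda>y. x - y) has_derivative (\<lambda>h. - h)) (at y)" by (auto intro!: derivative_eq_intros)
    moreover have "(mollifier \<epsilon> has_derivative (\<lambda>h. G (x - y) \<bullet> h)) (at (x - y))"
      using G(1) unfolding C1_with_def by blast
    ultimately have "((\<lambda>y. mollifier \<epsilon> (x - y)) has_derivative (\<lambda>h. G (x - y) \<bullet> (- h))) (at y)"
      by (rule has_derivative_compose)
    then show ?thesis by simp
  qed
  moreover have "continuous_on UNIV (\<lambda>y. - G (x - y))"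
  proof -
    have "continuous_on UNIV G" using G(1) unfolding C1_with_def by blast
    then have "continuous_on UNIV (\<lambda>y. G (x - y))"
      by (rule continuous_on_compose2[of UNIV G UNIV "\<lambda>y. x - y"]) (auto intro!: continuous_intros)
    then show ?thesis by (rule continuous_on_minus)
  qed
  ultimately have "C1_with (\<lambda>y. mollifier \<epsilon> (x - y)) (\<lambda>y. - G (x - y))" unfolding C1_with_def by blast
  moreover have "(- G (x - y)) $ i = - mollifier_deriv \<epsilon> (axis i 1) (x - y)" for y i
    using G(2)[of "x - y" "axis i 1"] by (simp add: inner_axis)
  ultimately show ?thesis using that by blast
qed

section \<open>Weak gradients\<close>

text \<open>The function spaces involve functions on the ball up to null sets, whereas Fubini's theorem and
  polar coordinates are applied to Borel functions on the whole space. This lemma translates.\<close>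

lemma lebesgue_on_transfer:
  fixes h h0 :: "'a::euclidean_space \<Rightarrow> real"
  assumes W[measurable]: "W \<in> sets lebesgue" and h0: "h0 \<in> borel_measurable borel" "\<And>x. x \<notin> W \<Longrightarrow> h0 x = 0"
    and ae: "AE x in lebesgue. x \<in> W \<longrightarrow> h x = h0 x"
  shows "h \<in> borel_measurable (lebesgue_on W)"
    and "integral\<^sup>L (lebesgue_on W) h = integral\<^sup>L lborel h0"
    and "integrable (lebesgue_on W) h \<longleftrightarrow> integrable lborel h0"
    and "(\<integral>\<^sup>+x. ennreal (h x) \<partial>lebesgue_on W) = (\<integral>\<^sup>+x. ennreal (h0 x) \<partial>lborel)"
proof -
  have h0m: "h0 \<in> borel_measurable lebesgue" using h0(1) by (intro measurable_completion) simp
  have ae': "AE x in lebesgue. h0 x = indicator W x *\<^sub>R h x"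
    using ae by eventually_elim (use h0(2) in \<open>auto simp: indicator_def\<close>)
  have m: "(\<lambda>x. indicator W x *\<^sub>R h x) \<in> borel_measurable lebesgue"
    by (rule borel_measurable_AE[OF h0m ae'])
  show "h \<in> borel_measurable (lebesgue_on W)"
    using m by (subst borel_measurable_restrict_space_iff) auto
  have "integral\<^sup>L (lebesgue_on W) h = integral\<^sup>L lebesgue (\<lambda>x. indicator W x *\<^sub>R h x)"
    by (rule integral_restrict_space) simp
  also have "\<dots> = integral\<^sup>L lebesgue h0" by (rule integral_cong_AE) (use m h0m ae' in \<open>auto elim: eventually_mono\<close>)
  also have "\<dots> = integral\<^sup>L lborel h0" using h0(1) by (intro integral_completion) simp
  finally show "integral\<^sup>L (lebesgue_on W) h = integral\<^sup>L lborel h0" .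
  have "integrable (lebesgue_on W) h \<longleftrightarrow> integrable lebesgue (\<lambda>x. indicator W x *\<^sub>R h x)"
    by (rule integrable_restrict_space) simp
  also have "\<dots> \<longleftrightarrow> integrable lebesgue h0" by (rule integrable_cong_AE) (use m h0m ae' in \<open>auto elim: eventually_mono\<close>)
  also have "\<dots> \<longleftrightarrow> integrable lborel h0" using h0(1) by (intro integrable_completion) simp
  finally show "integrable (lebesgue_on W) h \<longleftrightarrow> integrable lborel h0" .
  have "(\<integral>\<^sup>+x. ennreal (h x) \<partial>lebesgue_on W) = (\<integral>\<^sup>+x. ennreal (h x) * indicator W x \<partial>lebesgue)"
    by (rule nn_integral_restrict_space) simp
  also have "\<dots> = (\<integral>\<^sup>+x. ennreal (h0 x) \<partial>lebesgue)"
    by (rule nn_integral_cong_AE) (use ae' in \<open>auto elim!: eventually_mono simp: indicator_def\<close>)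
  also have "\<dots> = (\<integral>\<^sup>+x. ennreal (h0 x) \<partial>lborel)" by (rule nn_integral_completion)
  finally show "(\<integral>\<^sup>+x. ennreal (h x) \<partial>lebesgue_on W) = (\<integral>\<^sup>+x. ennreal (h0 x) \<partial>lborel)" .
qed

lemma weak_zero_imp_AE_zero:
  fixes g :: "real^'n::finite \<Rightarrow> real"
  assumes W: "open W" and g: "L1_loc W g" and z: "\<And>\<psi>. C1_c W \<psi> \<Longrightarrow> (LINT x|lebesgue_on W. g x * \<psi> x) = 0"
  shows "AE x in lebesgue. x \<in> W \<longrightarrow> g x = 0"
proof (rule fundamental_lemma[OF W])
  fix x :: "real^'n" and \<epsilon> :: real assume e: "\<epsilon> > 0" "cball x \<epsilon> \<subseteq> W"
  obtain G where "C1_with (\<lambda>y. mollifier \<epsilon> (x - y)) G" using C1_with_mollifier_reflected by blast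
  then have "C1_c W (\<lambda>y. mollifier \<epsilon> (x - y))"
    by (rule C1_cI[OF _ compact_cball e(2)]) (use e in \<open>auto intro!: mollifier_eq_0 simp: dist_norm\<close>)
  then show "(LINT y|lebesgue_on W. g y * mollifier \<epsilon> (x - y)) = 0" by (rule z)
next
  fix K assume "compact K" "K \<subseteq> W"
  then show "set_integrable lebesgue K g" using g unfolding L1_loc_def by blast
qed

lemma L1_loc_component:
  fixes G :: "real^'n::finite \<Rightarrow> real^'m::finite"
  assumes "L1_loc W G"
  shows "L1_loc W (\<lambda>x. G x $ i)"
  unfolding L1_loc_def set_integrable_def
proof (intro allI impI)
  fix K assume "compact K \<and> K \<subseteq> W"
  then have "integrable lebesgue (\<lambda>x. indicator K x *\<^sub>R G x)"
    using assms unfolding L1_loc_def set_integrable_def by blast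
  from integrable_bounded_linear[OF bounded_linear_vec_nth this, of i]
  show "integrable lebesgue (\<lambda>x. indicator K x *\<^sub>R (G x $ i))" by simp
qed

lemma L1_loc_vecI:
  fixes G :: "real^'n::finite \<Rightarrow> real^'m::finite"
  assumes "\<And>i. L1_loc W (\<lambda>x. G x $ i)"
  shows "L1_loc W G"
  unfolding L1_loc_def set_integrable_def
proof (intro allI impI)
  fix K assume K: "compact K \<and> K \<subseteq> W"
  have "indicator K x *\<^sub>R G x = (\<Sum>i\<in>UNIV. (indicator K x *\<^sub>R (G x $ i)) *\<^sub>R axis i 1)" for x
    by (simp add: vec_eq_iff axis_def if_distrib cong: if_cong)
  moreover have "integrable lebesgue (\<lambda>x. \<Sum>i\<in>UNIV. (indicator K x *\<^sub>R (G x $ i)) *\<^sub>R (axis i 1 :: real^'m))"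
    using assms K unfolding L1_loc_def set_integrable_def
    by (intro Bochner_Integration.integrable_sum integrable_scaleR_left) auto
  ultimately show "integrable lebesgue (\<lambda>x. indicator K x *\<^sub>R G x)" by simp
qed

lemma L1_loc_mult_continuous:
  fixes f k :: "real^'n::finite \<Rightarrow> real"
  assumes "L1_loc W f" "continuous_on UNIV k"
  shows "L1_loc W (\<lambda>x. f x * k x)"
  unfolding L1_loc_def set_integrable_def
proof (intro allI impI)
  fix K assume K: "compact K \<and> K \<subseteq> W"
  have "bounded (k ` K)"
    using K by (intro compact_imp_bounded compact_continuous_image continuous_on_subset[OF assms(2)]) auto
  then obtain M where M: "\<And>x. x \<in> K \<Longrightarrow> \<bar>k x\<bar> \<le> M" by (auto simp: bounded_iff)
  have i: "integrable lebesgue (\<lambda>x. indicator K x *\<^sub>R f x)"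
    using assms(1) K unfolding L1_loc_def set_integrable_def by blast
  have km: "k \<in> borel_measurable lebesgue"
    using borel_measurable_continuous_onI[OF assms(2)] by (intro measurable_completion) simp
  have "(\<lambda>x. (indicator K x *\<^sub>R f x) * k x) \<in> borel_measurable lebesgue"
    using borel_measurable_integrable[OF i] km by (rule borel_measurable_times)
  then have "integrable lebesgue (\<lambda>x. (indicator K x *\<^sub>R f x) * k x)"
  proof (rule Bochner_Integration.integrable_bound[OF integrable_mult_right[OF i, of M]], intro AE_I2)
    fix x
    show "norm ((indicator K x *\<^sub>R f x) * k x) \<le> norm (M * (indicator K x *\<^sub>R f x))"
    proof (cases "x \<in> K")
      case True
      then have "\<bar>k x\<bar> \<le> \<bar>M\<bar>" using M[OF True] by linarith
      then show ?thesis using True by (simp add: abs_mult mult.commute[of "\<bar>f x\<bar>"] mult_right_mono)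
    qed simp
  qed
  then show "integrable lebesgue (\<lambda>x. indicator K x *\<^sub>R (f x * k x))" by (simp add: mult.assoc)
qed

lemma L1_loc_add:
  fixes f g :: "real^'n::finite \<Rightarrow> real"
  assumes "L1_loc W f" "L1_loc W g"
  shows "L1_loc W (\<lambda>x. f x + g x)"
  using assms unfolding L1_loc_def set_integrable_def by (auto simp: distrib_left)

lemma L1_loc_subset: "L1_loc W f \<Longrightarrow> V \<subseteq> W \<Longrightarrow> L1_loc V f"
  unfolding L1_loc_def by blast

lemma L1_loc_integrable_test:
  fixes f :: "real^'n::finite \<Rightarrow> real"
  assumes W: "open W" and f: "L1_loc W f" and k: "continuous_on UNIV k" "compact K" "K \<subseteq> W" "\<And>x. x \<notin> K \<Longrightarrow> k x = 0"
  shows "integrable (lebesgue_on W) (\<lambda>x. f x * k x)"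
    and "(LINT x|lebesgue_on W. f x * k x) = (LINT x|lebesgue. indicator K x *\<^sub>R (f x * k x))"
proof -
  have i: "integrable lebesgue (\<lambda>x. indicator K x *\<^sub>R (f x * k x))"
    using L1_loc_mult_continuous[OF f k(1)] k unfolding L1_loc_def set_integrable_def by blast
  have eq: "indicator K x *\<^sub>R (f x * k x) = indicator W x *\<^sub>R (f x * k x)" for x
    using k(3) k(4)[of x] by (auto simp: indicator_def)
  show "integrable (lebesgue_on W) (\<lambda>x. f x * k x)"
    using i W unfolding eq by (subst integrable_restrict_space) auto
  show "(LINT x|lebesgue_on W. f x * k x) = (LINT x|lebesgue. indicator K x *\<^sub>R (f x * k x))"
    using W unfolding eq by (subst integral_restrict_space) auto
qed

lemma weak_grad_AE_unique:
  fixes G G' :: "real^'n::finite \<Rightarrow> real^'n"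
  assumes W: "open W" and "has_weak_grad W f G" "has_weak_grad W f G'"
  shows "AE x in lebesgue. x \<in> W \<longrightarrow> G x = G' x"
proof -
  have L: "L1_loc W G" "L1_loc W G'" using assms by (auto simp: has_weak_grad_def)
  have "AE x in lebesgue. x \<in> W \<longrightarrow> G x $ i + G' x $ i * (- 1) = 0" for i
  proof (rule weak_zero_imp_AE_zero[OF W])
    show "L1_loc W (\<lambda>x. G x $ i + G' x $ i * (- 1))"
      using L by (intro L1_loc_add L1_loc_mult_continuous L1_loc_component continuous_intros)
    fix \<psi> assume \<psi>: "C1_c W \<psi>"
    obtain K where K: "C1_with \<psi> (grad \<psi>)" "compact K" "K \<subseteq> W" "\<And>x. x \<notin> K \<Longrightarrow> \<psi> x = 0"
      using C1_cE[OF \<psi>] by metis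
    have "integrable (lebesgue_on W) (\<lambda>x. G x $ i * \<psi> x)" "integrable (lebesgue_on W) (\<lambda>x. G' x $ i * \<psi> x)"
      using L1_loc_integrable_test(1)[OF W L1_loc_component C1_with_continuous[OF K(1)] K(2-4)] L by auto
    moreover have "(LINT x|lebesgue_on W. G x $ i * \<psi> x) = (LINT x|lebesgue_on W. G' x $ i * \<psi> x)"
    proof -
      have "(LINT x|lebesgue_on W. f x * partial i \<psi> x) = - (LINT x|lebesgue_on W. G x $ i * \<psi> x)"
        "(LINT x|lebesgue_on W. f x * partial i \<psi> x) = - (LINT x|lebesgue_on W. G' x $ i * \<psi> x)"
        using assms \<psi> unfolding has_weak_grad_def by blast+
      then show ?thesis by simp
    qed
    ultimately show "(LINT x|lebesgue_on W. (G x $ i + G' x $ i * (- 1)) * \<psi> x) = 0"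
      by (simp add: algebra_simps)
  qed
  then have "AE x in lebesgue. \<forall>i\<in>UNIV. x \<in> W \<longrightarrow> G x $ i + G' x $ i * (- 1) = 0"
    by (intro AE_finite_allI) auto
  then show ?thesis by (auto elim!: eventually_mono simp: vec_eq_iff)
qed

lemma weak_grad_AE_eq:
  assumes "open W" "has_weak_grad W f G"
  shows "AE x in lebesgue. x \<in> W \<longrightarrow> weak_grad W f x = G x"
proof -
  have "has_weak_grad W f (weak_grad W f)" unfolding weak_grad_def using assms(2) by (rule someI[of "\<lambda>G. has_weak_grad W f G"])
  then show ?thesis using weak_grad_AE_unique[OF assms(1) _ assms(2)] by blast
qed

lemma weak_grad_zero_off_support:
  fixes f :: "real^'n::finite \<Rightarrow> real"
  assumes W: "open W" and fG: "has_weak_grad W f G" and K: "compact K"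
    and f0: "AE x in lebesgue. x \<in> W \<longrightarrow> x \<notin> K \<longrightarrow> f x = 0"
  shows "AE x in lebesgue. x \<in> W \<longrightarrow> x \<notin> K \<longrightarrow> G x = 0"
proof -
  let ?V = "W - K"
  have V: "open ?V" using W K by (intro open_Diff) (auto intro: compact_imp_closed)
  have L: "L1_loc W G" "L1_loc W f" using fG by (auto simp: has_weak_grad_def)
  have "AE x in lebesgue. x \<in> ?V \<longrightarrow> G x $ i = 0" for i
  proof (rule weak_zero_imp_AE_zero[OF V])
    show "L1_loc ?V (\<lambda>x. G x $ i)" by (rule L1_loc_subset[OF L1_loc_component[OF L(1)]]) auto
    fix \<psi> assume \<psi>: "C1_c ?V \<psi>"
    obtain C where C: "C1_with \<psi> (grad \<psi>)" "compact C" "C \<subseteq> ?V" "\<And>x. x \<notin> C \<Longrightarrow> \<psi> x = 0" "\<And>x. x \<notin> C \<Longrightarrow> grad \<psi> x = 0"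
      using C1_cE[OF \<psi>] by metis
    have CW: "C \<subseteq> W" using C(3) by auto
    have \<psi>W: "C1_c W \<psi>" by (rule C1_cI[OF C(1,2)]) (use C in auto)
    note t = L1_loc_integrable_test(2)[OF _ _ C1_with_continuous[OF C(1)] C(2) _ C(4)]
    have "(LINT x|lebesgue_on ?V. G x $ i * \<psi> x) = (LINT x|lebesgue_on W. G x $ i * \<psi> x)"
      using t[OF V L1_loc_subset[OF L1_loc_component[OF L(1)]] C(3)] t[OF W L1_loc_component[OF L(1)] CW] by simp
    also have "\<dots> = - (LINT x|lebesgue_on W. f x * partial i \<psi> x)"
      using fG \<psi>W unfolding has_weak_grad_def by simp
    also have "(LINT x|lebesgue_on W. f x * partial i \<psi> x) = (LINT x|(lborel :: (real^'n) measure). (0::real))"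
    proof (rule lebesgue_on_transfer(2))
      show "AE x in lebesgue. x \<in> W \<longrightarrow> f x * partial i \<psi> x = 0"
        using f0
      proof eventually_elim
        case (elim x)
        show ?case using elim C(3) C(5)[of x] by (cases "x \<in> C") (auto simp: C1_with_partial[OF C(1)])
      qed
    qed (use W in auto)
    finally show "(LINT x|lebesgue_on ?V. G x $ i * \<psi> x) = 0" by simp
  qed
  then have "AE x in lebesgue. \<forall>i\<in>UNIV. x \<in> ?V \<longrightarrow> G x $ i = 0"
    by (intro AE_finite_allI) auto
  then show ?thesis by (auto elim!: eventually_mono simp: vec_eq_iff)
qed

lemma L2_Cauchy_Schwarz:
  fixes f g :: "'a \<Rightarrow> real"
  assumes [measurable]: "f \<in> borel_measurable M" "g \<in> borel_measurable M"
    and f: "integrable M (\<lambda>x. (f x)\<^sup>2)" and g: "integrable M (\<lambda>x. (g x)\<^sup>2)"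
  shows "integrable M (\<lambda>x. f x * g x)"
    and "(\<integral>x. \<bar>f x * g x\<bar> \<partial>M) \<le> sqrt (\<integral>x. (f x)\<^sup>2 \<partial>M) * sqrt (\<integral>x. (g x)\<^sup>2 \<partial>M)"
proof -
  show i: "integrable M (\<lambda>x. f x * g x)"
  proof (rule Bochner_Integration.integrable_bound[OF Bochner_Integration.integrable_add[OF f g]])
    show "AE x in M. norm (f x * g x) \<le> norm ((f x)\<^sup>2 + (g x)\<^sup>2)"
    proof (rule AE_I2)
      fix x
      have "2 * (\<bar>f x\<bar> * \<bar>g x\<bar>) \<le> (f x)\<^sup>2 + (g x)\<^sup>2"
        using sum_squares_bound[of "\<bar>f x\<bar>" "\<bar>g x\<bar>"] by (simp add: mult.assoc)
      moreover have "0 \<le> \<bar>f x\<bar> * \<bar>g x\<bar>" by simp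
      ultimately have "\<bar>f x\<bar> * \<bar>g x\<bar> \<le> (f x)\<^sup>2 + (g x)\<^sup>2" by linarith
      then show "norm (f x * g x) \<le> norm ((f x)\<^sup>2 + (g x)\<^sup>2)" by (simp add: abs_mult)
    qed
  qed measurable
  define a b c where "a = (\<integral>x. (f x)\<^sup>2 \<partial>M)" and "b = (\<integral>x. (g x)\<^sup>2 \<partial>M)" and "c = (\<integral>x. \<bar>f x * g x\<bar> \<partial>M)"
  have nn: "0 \<le> a" "0 \<le> b" "0 \<le> c" by (auto simp: a_def b_def c_def intro!: integral_nonneg_AE)
  have "(\<integral>\<^sup>+x. ennreal \<bar>f x\<bar> * ennreal \<bar>g x\<bar> \<partial>M)\<^sup>2 \<le> (\<integral>\<^sup>+x. (ennreal \<bar>f x\<bar>)\<^sup>2 \<partial>M) * (\<integral>\<^sup>+x. (ennreal \<bar>g x\<bar>)\<^sup>2 \<partial>M)"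
    by (rule Cauchy_Schwarz_nn_integral) measurable
  moreover have "(\<integral>\<^sup>+x. ennreal \<bar>f x\<bar> * ennreal \<bar>g x\<bar> \<partial>M) = ennreal c"
    using integrable_abs[OF i] unfolding c_def by (subst nn_integral_eq_integral[symmetric]) (auto simp: abs_mult ennreal_mult)
  moreover have "(\<integral>\<^sup>+x. (ennreal \<bar>f x\<bar>)\<^sup>2 \<partial>M) = ennreal a"
    using f unfolding a_def by (subst nn_integral_eq_integral[symmetric]) (auto simp: ennreal_power)
  moreover have "(\<integral>\<^sup>+x. (ennreal \<bar>g x\<bar>)\<^sup>2 \<partial>M) = ennreal b"
    using g unfolding b_def by (subst nn_integral_eq_integral[symmetric]) (auto simp: ennreal_power)
  ultimately have "ennreal (c\<^sup>2) \<le> ennreal (a * b)" using nn by (simp add: ennreal_power ennreal_mult)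
  then have "c\<^sup>2 \<le> a * b" using nn by (simp add: ennreal_le_iff)
  then have "c \<le> sqrt (a * b)" using nn by (simp add: real_le_rsqrt)
  then show "(\<integral>x. \<bar>f x * g x\<bar> \<partial>M) \<le> sqrt (\<integral>x. (f x)\<^sup>2 \<partial>M) * sqrt (\<integral>x. (g x)\<^sup>2 \<partial>M)"
    by (simp add: a_def b_def c_def real_sqrt_mult)
qed

definition L2_lim :: "'a measure \<Rightarrow> (nat \<Rightarrow> 'a \<Rightarrow> real) \<Rightarrow> ('a \<Rightarrow> real) \<Rightarrow> bool" where
  "L2_lim M F f \<longleftrightarrow> f \<in> borel_measurable M \<and> integrable M (\<lambda>x. (f x)\<^sup>2) \<and>
     (\<forall>m. F m \<in> borel_measurable M \<and> integrable M (\<lambda>x. (F m x - f x)\<^sup>2)) \<and>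
     (\<lambda>m. \<integral>x. (F m x - f x)\<^sup>2 \<partial>M) \<longlonglongrightarrow> 0"

lemma L2_lim_product:
  fixes \<phi> :: "'a \<Rightarrow> real"
  assumes F: "L2_lim M F f" and G: "L2_lim M G g" and [measurable]: "\<phi> \<in> borel_measurable M"
    and \<phi>: "\<And>x. \<bar>\<phi> x\<bar> \<le> C"
  shows "integrable M (\<lambda>x. f x * g x * \<phi> x)" "\<And>m. integrable M (\<lambda>x. F m x * G m x * \<phi> x)"
    and "(\<lambda>m. \<integral>x. F m x * G m x * \<phi> x \<partial>M) \<longlonglongrightarrow> (\<integral>x. f x * g x * \<phi> x \<partial>M)"
proof -
  have [measurable]: "f \<in> borel_measurable M" "g \<in> borel_measurable M"
    "F m \<in> borel_measurable M" "G m \<in> borel_measurable M" for m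
    using F G by (auto simp: L2_lim_def)
  have f2: "integrable M (\<lambda>x. (f x)\<^sup>2)" "integrable M (\<lambda>x. (g x)\<^sup>2)"
    "integrable M (\<lambda>x. (F m x - f x)\<^sup>2)" "integrable M (\<lambda>x. (G m x - g x)\<^sup>2)" for m
    using F G by (auto simp: L2_lim_def)
  define A B where "A m = sqrt (\<integral>x. (F m x - f x)\<^sup>2 \<partial>M)" and "B m = sqrt (\<integral>x. (G m x - g x)\<^sup>2 \<partial>M)" for m
  have AB: "A \<longlonglongrightarrow> 0" "B \<longlonglongrightarrow> 0"
    using F G tendsto_real_sqrt[of _ 0 sequentially] by (auto simp: L2_lim_def A_def[abs_def] B_def[abs_def])
  define p where "p = sqrt (\<integral>x. (f x)\<^sup>2 \<partial>M)"
  define q where "q = sqrt (\<integral>x. (g x)\<^sup>2 \<partial>M)"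
  have C: "0 \<le> C" using \<phi>[of undefined] by linarith
  have bd: "integrable M (\<lambda>x. h x * \<phi> x)" if "integrable M h" for h :: "'a \<Rightarrow> real"
  proof (rule Bochner_Integration.integrable_bound[OF integrable_mult_right[OF that, of C]])
    have [measurable]: "h \<in> borel_measurable M" using that by auto
    show "(\<lambda>x. h x * \<phi> x) \<in> borel_measurable M" by measurable
    show "AE x in M. norm (h x * \<phi> x) \<le> norm (C * h x)"
      using \<phi> C by (auto simp: abs_mult mult.commute[of "\<bar>h _\<bar>"] intro!: mult_right_mono)
  qed
  have fg: "integrable M (\<lambda>x. f x * g x)" "integrable M (\<lambda>x. (F m x - f x) * (G m x - g x))"
     "integrable M (\<lambda>x. f x * (G m x - g x))" "integrable M (\<lambda>x. (F m x - f x) * g x)" for m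
    by (intro L2_Cauchy_Schwarz(1) f2; measurable)+
  have dec: "F m x * G m x = f x * g x + ((F m x - f x) * (G m x - g x) + f x * (G m x - g x) + (F m x - f x) * g x)" for m x
    by (simp add: algebra_simps)
  have FG: "integrable M (\<lambda>x. F m x * G m x)" for m
    unfolding dec by (intro Bochner_Integration.integrable_add fg)
  show i1: "integrable M (\<lambda>x. f x * g x * \<phi> x)" by (intro bd fg)
  show i2: "\<And>m. integrable M (\<lambda>x. F m x * G m x * \<phi> x)" by (intro bd FG)
  have bound: "\<bar>(\<integral>x. F m x * G m x * \<phi> x \<partial>M) - (\<integral>x. f x * g x * \<phi> x \<partial>M)\<bar> \<le> C * (A m * B m + p * B m + A m * q)" for m
  proof -
    have "(\<integral>x. F m x * G m x * \<phi> x \<partial>M) - (\<integral>x. f x * g x * \<phi> x \<partial>M) = (\<integral>x. F m x * G m x * \<phi> x - f x * g x * \<phi> x \<partial>M)"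
      using i1 i2 by simp
    also have "\<bar>\<dots>\<bar> \<le> (\<integral>x. \<bar>F m x * G m x * \<phi> x - f x * g x * \<phi> x\<bar> \<partial>M)" by (rule integral_abs_bound)
    also have "\<dots> \<le> (\<integral>x. C * (\<bar>(F m x - f x) * (G m x - g x)\<bar> + \<bar>f x * (G m x - g x)\<bar> + \<bar>(F m x - f x) * g x\<bar>) \<partial>M)"
    proof (rule integral_mono)
      show "integrable M (\<lambda>x. \<bar>F m x * G m x * \<phi> x - f x * g x * \<phi> x\<bar>)" using i1 i2 by simp
      show "integrable M (\<lambda>x. C * (\<bar>(F m x - f x) * (G m x - g x)\<bar> + \<bar>f x * (G m x - g x)\<bar> + \<bar>(F m x - f x) * g x\<bar>))"
        by (intro integrable_mult_right Bochner_Integration.integrable_add integrable_abs fg)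
      fix x
      have "F m x * G m x * \<phi> x - f x * g x * \<phi> x = \<phi> x * ((F m x - f x) * (G m x - g x) + f x * (G m x - g x) + (F m x - f x) * g x)"
        by (simp add: algebra_simps)
      also have "\<bar>\<dots>\<bar> \<le> C * (\<bar>(F m x - f x) * (G m x - g x)\<bar> + \<bar>f x * (G m x - g x)\<bar> + \<bar>(F m x - f x) * g x\<bar>)"
        unfolding abs_mult[of "\<phi> x"] by (intro mult_mono \<phi> C) auto
      finally show "\<bar>F m x * G m x * \<phi> x - f x * g x * \<phi> x\<bar> \<le> \<dots>" .
    qed
    also have "\<dots> = C * ((\<integral>x. \<bar>(F m x - f x) * (G m x - g x)\<bar> \<partial>M) + (\<integral>x. \<bar>f x * (G m x - g x)\<bar> \<partial>M) + (\<integral>x. \<bar>(F m x - f x) * g x\<bar> \<partial>M))"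
      using fg by (simp del: abs_mult)
    also have "\<dots> \<le> C * (A m * B m + p * B m + A m * q)"
      unfolding A_def B_def p_def q_def by (intro mult_left_mono add_mono L2_Cauchy_Schwarz(2) f2 C; measurable)
    finally show ?thesis .
  qed
  have "(\<lambda>m. C * (A m * B m + p * B m + A m * q)) \<longlonglongrightarrow> C * (0 * 0 + p * 0 + 0 * q)"
    by (intro tendsto_intros AB)
  then have "(\<lambda>m. C * (A m * B m + p * B m + A m * q)) \<longlonglongrightarrow> 0" by simp
  moreover have "\<forall>\<^sub>F m in sequentially. norm ((\<integral>x. F m x * G m x * \<phi> x \<partial>M) - (\<integral>x. f x * g x * \<phi> x \<partial>M)) \<le> C * (A m * B m + p * B m + A m * q)"
    using bound by (intro always_eventually allI) (simp only: real_norm_def)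
  ultimately have "(\<lambda>m. (\<integral>x. F m x * G m x * \<phi> x \<partial>M) - (\<integral>x. f x * g x * \<phi> x \<partial>M)) \<longlonglongrightarrow> 0"
    by (rule Lim_null_comparison[rotated])
  then show "(\<lambda>m. \<integral>x. F m x * G m x * \<phi> x \<partial>M) \<longlonglongrightarrow> (\<integral>x. f x * g x * \<phi> x \<partial>M)"
    by (rule LIM_zero_cancel)
qed

lemma unit_ball_cutoff:
  fixes K :: "(real^'n::finite) set"
  assumes "compact K" "K \<subseteq> ball 0 1"
  obtains \<theta> where "C1_with \<theta> (grad \<theta>)" "C1_c (ball 0 1) \<theta>" "\<And>x. x \<in> K \<Longrightarrow> \<theta> x = 1" "\<And>x. x \<in> K \<Longrightarrow> grad \<theta> x = 0"
proof -
  obtain R where R: "0 < R" "R < 1" "K \<subseteq> cball 0 R"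
  proof (cases "K = {}")
    case True
    then show ?thesis using that[of "1/2"] by auto
  next
    case False
    obtain z where z: "z \<in> K" "\<And>x. x \<in> K \<Longrightarrow> norm x \<le> norm z"
      using continuous_attains_sup[OF assms(1) False, of norm] by (auto intro: continuous_intros)
    have "norm z < 1" using z(1) assms(2) by auto
    then show ?thesis using z by (intro that[of "max (norm z) (1/2)"]) (auto simp: le_max_iff_disj)
  qed
  define S where "S = (1 + R) / 2"
  have S: "R < S" "S < 1" using R by (auto simp: S_def)
  have SR: "R\<^sup>2 < S\<^sup>2" using R S by (intro power_strict_mono) auto
  define M where "M = 1 / (S\<^sup>2 - R\<^sup>2)\<^sup>2"
  have M: "M > 0" using SR by (simp add: M_def)
  define \<rho> where "\<rho> t = pos_sq (1 - M * pos_sq (t - R\<^sup>2))" for t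
  define \<rho>' where "\<rho>' t = 2 * max 0 (1 - M * pos_sq (t - R\<^sup>2)) * (- M * (2 * max 0 (t - R\<^sup>2)))" for t
  define \<theta> where "\<theta> x = \<rho> (x \<bullet> x)" for x :: "real^'n"
  have d: "C1_with \<theta> (\<lambda>x. \<rho>' (x \<bullet> x) *\<^sub>R (2 *\<^sub>R x))"
    unfolding \<theta>_def
  proof (rule C1_with_compose[OF C1_with_norm_sq])
    show "(\<rho> has_real_derivative \<rho>' t) (at t)" for t
      unfolding \<rho>_def \<rho>'_def by (auto intro!: derivative_eq_intros)
    show "continuous_on UNIV \<rho>'" unfolding \<rho>'_def by (intro continuous_intros)
  qed
  have zero: "\<theta> x = 0" if "x \<notin> cball 0 S" for x
  proof -
    have "S\<^sup>2 \<le> x \<bullet> x" using that R S unfolding dot_square_norm by (intro power_mono) auto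
    then have "(S\<^sup>2 - R\<^sup>2)\<^sup>2 \<le> pos_sq (x \<bullet> x - R\<^sup>2)" using SR unfolding pos_sq_def by (intro power_mono) auto
    then have "1 \<le> M * pos_sq (x \<bullet> x - R\<^sup>2)" using SR by (simp add: M_def field_simps)
    then show ?thesis unfolding \<theta>_def \<rho>_def by (intro pos_sq_eq_0) simp
  qed
  have inK: "\<theta> x = 1" "\<rho>' (x \<bullet> x) = 0" if "x \<in> K" for x
  proof -
    have "x \<bullet> x \<le> R\<^sup>2" using that R unfolding dot_square_norm by (intro power_mono) auto
    then show "\<theta> x = 1" "\<rho>' (x \<bullet> x) = 0" by (auto simp: \<theta>_def \<rho>_def \<rho>'_def pos_sq_eq_0) (simp add: pos_sq_def)
  qed
  show ?thesis
  proof (rule that[of \<theta>])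
    show "C1_with \<theta> (grad \<theta>)" using d C1_with_grad[OF d] by simp
    show "C1_c (ball 0 1) \<theta>" by (rule C1_cI[OF d, of "cball 0 S"]) (use zero S in auto)
  qed (use inK C1_with_grad[OF d] in auto)
qed

lemma integrable_on_imp_L1_loc:
  fixes f :: "real^'n::finite \<Rightarrow> real"
  assumes W: "open W" and f: "integrable (lebesgue_on W) f"
  shows "L1_loc W f"
  unfolding L1_loc_def set_integrable_def
proof (intro allI impI)
  fix K assume K: "compact K \<and> K \<subseteq> W"
  have "integrable lebesgue (\<lambda>x. indicator W x *\<^sub>R f x)" using f W by (subst (asm) integrable_restrict_space) auto
  moreover have "K \<in> sets lebesgue" using K by (simp add: borel_compact)
  ultimately have "integrable lebesgue (\<lambda>x. indicator K x *\<^sub>R (indicator W x *\<^sub>R f x))"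
    using integrable_mult_indicator[of K lebesgue "\<lambda>x. indicator W x *\<^sub>R f x"] by blast
  moreover have "(\<lambda>x. indicator K x *\<^sub>R (indicator W x *\<^sub>R f x)) = (\<lambda>x. indicator K x *\<^sub>R f x)"
  proof
    fix x
    show "indicator K x *\<^sub>R (indicator W x *\<^sub>R f x) = indicator K x *\<^sub>R f x"
      using K by (cases "x \<in> K") (auto simp: indicator_def)
  qed
  ultimately show "integrable lebesgue (\<lambda>x. indicator K x *\<^sub>R f x)" by simp
qed

lemma borel_representative_compact:
  fixes h :: "real^'n::finite \<Rightarrow> real"
  assumes h: "L1_loc W h" and K: "compact K" "K \<subseteq> W" and ae: "AE x in lebesgue. x \<in> W \<longrightarrow> x \<notin> K \<longrightarrow> h x = 0"
  obtains h0 where "h0 \<in> borel_measurable borel" "\<And>x. x \<notin> K \<Longrightarrow> h0 x = 0" "AE x in lebesgue. x \<in> W \<longrightarrow> h x = h0 x"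
proof -
  have "integrable lebesgue (\<lambda>x. indicator K x *\<^sub>R h x)" using h K unfolding L1_loc_def set_integrable_def by blast
  then have m: "(\<lambda>x. indicator K x *\<^sub>R h x) \<in> borel_measurable lebesgue" by (rule borel_measurable_integrable)
  obtain h' where h': "h' \<in> borel_measurable borel" "AE x in lebesgue. indicator K x *\<^sub>R h x = h' x"
    using borel_representative[OF m] by blast
  have [measurable]: "K \<in> sets borel" using K(1) by (rule borel_compact)
  have [measurable]: "h' \<in> borel_measurable borel" by (rule h'(1))
  show ?thesis
  proof (rule that[of "\<lambda>x. indicator K x * h' x"])
    show "AE x in lebesgue. x \<in> W \<longrightarrow> h x = indicator K x * h' x"
      using ae h'(2) by eventually_elim (auto simp: indicator_def split: if_splits)
    show "(\<lambda>x. indicator K x * h' x) \<in> borel_measurable borel" by measurable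
  qed simp
qed

lemma integrable_of_L2_bounded_support:
  fixes f :: "'a::euclidean_space \<Rightarrow> real"
  assumes [measurable]: "f \<in> borel_measurable borel" and "integrable lborel (\<lambda>x. (f x)\<^sup>2)" and K: "compact K" "\<And>x. x \<notin> K \<Longrightarrow> f x = 0"
  shows "integrable lborel f"
proof (rule Bochner_Integration.integrable_bound)
  have [measurable]: "K \<in> sets borel" using K by (simp add: borel_compact)
  show "integrable lborel (\<lambda>x. indicator K x + (f x)\<^sup>2)"
    by (intro Bochner_Integration.integrable_add assms(2) integrable_real_indicator)
      (use emeasure_compact_finite[OF K(1)] in auto)
  have "\<bar>f x\<bar> \<le> indicator K x + (f x)\<^sup>2" for x
  proof (cases "x \<in> K")
    case True
    have "0 \<le> (\<bar>f x\<bar> - 1)\<^sup>2 + \<bar>f x\<bar>\<^sup>2" by simp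
    then show ?thesis using True by (simp add: power2_eq_square algebra_simps)
  qed (simp add: K)
  then show "AE x in lborel. norm (f x) \<le> norm (indicator K x + (f x)\<^sup>2)"
    by (auto intro: order_trans[OF _ abs_ge_self])
qed measurable

lemma L2_limI:
  fixes f :: "'a::euclidean_space \<Rightarrow> real"
  assumes f[measurable]: "f \<in> borel_measurable borel" and f2: "integrable lborel (\<lambda>x. (f x)\<^sup>2)"
    and F: "\<And>m. continuous_on UNIV (F m)" "bounded C" "\<And>m x. x \<notin> C \<Longrightarrow> F m x = 0"
    and lim: "(\<lambda>m. \<integral>\<^sup>+x. ennreal (\<bar>F m x - f x\<bar>\<^sup>2) \<partial>lborel) \<longlonglongrightarrow> 0"
  shows "L2_lim lborel F f"
proof -
  have [measurable]: "F m \<in> borel_measurable borel" for m by (rule borel_measurable_continuous_onI[OF F(1)])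
  have "integrable lborel (\<lambda>x. (F m x)\<^sup>2)" for m
    by (rule integrable_continuous_bounded_support[of _ C]) (use F in \<open>auto intro!: continuous_intros\<close>)
  then have i: "integrable lborel (\<lambda>x. 2 * (F m x)\<^sup>2 + 2 * (f x)\<^sup>2)" for m using f2 by simp
  have d: "integrable lborel (\<lambda>x. (F m x - f x)\<^sup>2)" for m
  proof (rule Bochner_Integration.integrable_bound[OF i[of m]])
    have "(F m x - f x)\<^sup>2 \<le> 2 * (F m x)\<^sup>2 + 2 * (f x)\<^sup>2" for x
      using zero_le_power2[of "F m x + f x"] by (simp add: power2_eq_square algebra_simps)
    then show "AE x in lborel. norm ((F m x - f x)\<^sup>2) \<le> norm (2 * (F m x)\<^sup>2 + 2 * (f x)\<^sup>2)" by auto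
  qed measurable
  have "(\<lambda>m. ennreal (\<integral>x. (F m x - f x)\<^sup>2 \<partial>lborel)) \<longlonglongrightarrow> ennreal 0"
    using lim d by (subst (asm) nn_integral_eq_integral) auto
  then have "(\<lambda>m. \<integral>x. (F m x - f x)\<^sup>2 \<partial>lborel) \<longlonglongrightarrow> 0"
    by (rule tendsto_ennrealD) (auto intro!: always_eventually integral_nonneg_AE)
  then show ?thesis using f2 d unfolding L2_lim_def by auto
qed

text \<open>\<open>f0\<close> and \<open>G0\<close> are Borel representatives of \<open>f\<close> and its weak gradient \<open>G\<close> that vanish outside
  \<open>K\<close>; the functions \<open>F m\<close> approximate them in \<open>L\<^sup>2\<close> and have a common compact support \<open>C\<close>.\<close>

definition H1_approximates ::
    "(real^'n::finite) set \<Rightarrow> (real^'n) set \<Rightarrow> (real^'n \<Rightarrow> real) \<Rightarrow> (real^'n \<Rightarrow> real^'n) \<Rightarrow>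
     (real^'n \<Rightarrow> real) \<Rightarrow> (real^'n \<Rightarrow> real^'n) \<Rightarrow> (nat \<Rightarrow> real^'n \<Rightarrow> real) \<Rightarrow> (real^'n) set \<Rightarrow> bool" where
  "H1_approximates U K f G f0 G0 F C \<longleftrightarrow>
     f0 \<in> borel_measurable borel \<and> (\<forall>i. (\<lambda>x. G0 x $ i) \<in> borel_measurable borel) \<and>
     (AE x in lebesgue. x \<in> ball 0 1 \<longrightarrow> f x = f0 x) \<and> (AE x in lebesgue. x \<in> ball 0 1 \<longrightarrow> G x = G0 x) \<and>
     (\<forall>x. x \<notin> K \<longrightarrow> f0 x = 0) \<and> (\<forall>x. x \<notin> K \<longrightarrow> G0 x = 0) \<and>
     L2_lim lborel F f0 \<and> (\<forall>i. L2_lim lborel (\<lambda>m. partial i (F m)) (\<lambda>x. G0 x $ i)) \<and>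
     (\<forall>m. C1_c U (F m)) \<and> compact C \<and> C \<subseteq> U \<and> (\<forall>m x. x \<notin> C \<longrightarrow> F m x = 0)"

text \<open>The approximations are mollifications. Their partial derivatives are the mollifications of the weak gradient, and
  for small parameters the supports stay in the given neighbourhood of \<open>K\<close>.\<close>

lemma H1_approximation:
  fixes f :: "real^'n::finite \<Rightarrow> real"
  assumes fG: "has_weak_grad (ball 0 1) f G"
    and f2: "integrable (lebesgue_on (ball 0 1)) (\<lambda>x. (f x)\<^sup>2)"
    and G2: "integrable (lebesgue_on (ball 0 1)) (\<lambda>x. (norm (G x))\<^sup>2)"
    and K: "compact K" "K \<subseteq> U" and U: "open U" "U \<subseteq> ball 0 1"
    and supp: "AE x in lebesgue. x \<in> ball 0 1 \<longrightarrow> x \<notin> K \<longrightarrow> f x = 0"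
  obtains f0 G0 F C where "H1_approximates U K f G f0 G0 F C"
proof -
  let ?B = "ball 0 1 :: (real^'n) set"
  have KB: "K \<subseteq> ?B" using K U by auto
  have L: "L1_loc ?B f" "L1_loc ?B G" using fG by (auto simp: has_weak_grad_def)
  obtain f0 where f0[measurable]: "f0 \<in> borel_measurable borel" and f00: "\<And>x. x \<notin> K \<Longrightarrow> f0 x = 0"
    and f0ae: "AE x in lebesgue. x \<in> ?B \<longrightarrow> f x = f0 x"
    using borel_representative_compact[OF L(1) K(1) KB supp] by blast
  have Gz: "AE x in lebesgue. x \<in> ?B \<longrightarrow> x \<notin> K \<longrightarrow> G x = 0"
    by (rule weak_grad_zero_off_support[OF open_ball fG K(1) supp])
  have "\<exists>h0. h0 \<in> borel_measurable borel \<and> (\<forall>x. x \<notin> K \<longrightarrow> h0 x = 0) \<and> (AE x in lebesgue. x \<in> ?B \<longrightarrow> G x $ i = h0 x)" for i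
  proof -
    have "AE x in lebesgue. x \<in> ?B \<longrightarrow> x \<notin> K \<longrightarrow> G x $ i = 0" using Gz by (auto elim: eventually_mono)
    then obtain h0 where "h0 \<in> borel_measurable borel" "\<And>x. x \<notin> K \<Longrightarrow> h0 x = 0" "AE x in lebesgue. x \<in> ?B \<longrightarrow> G x $ i = h0 x"
      using borel_representative_compact[OF L1_loc_component[OF L(2)] K(1) KB] by blast
    then show ?thesis by blast
  qed
  then have "\<forall>i. \<exists>h0. h0 \<in> borel_measurable borel \<and> (\<forall>x. x \<notin> K \<longrightarrow> h0 x = 0) \<and> (AE x in lebesgue. x \<in> ?B \<longrightarrow> G x $ i = h0 x)"
    by blast
  from choice[OF this] obtain g0 where g0: "\<And>i. g0 i \<in> borel_measurable borel" "\<And>i x. x \<notin> K \<Longrightarrow> g0 i x = 0"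
    "\<And>i. AE x in lebesgue. x \<in> ?B \<longrightarrow> G x $ i = g0 i x" by blast
  define G0 where "G0 x = (\<chi> i. g0 i x)" for x
  have [measurable]: "(\<lambda>x. G0 x $ i) \<in> borel_measurable borel" for i using g0(1)[of i] by (simp add: G0_def)
  have G00: "G0 x = 0" if "x \<notin> K" for x using g0(2)[OF that] by (simp add: G0_def vec_eq_iff)
  have "AE x in lebesgue. \<forall>i\<in>UNIV. x \<in> ?B \<longrightarrow> G x $ i = g0 i x" using g0(3) by (intro AE_finite_allI) auto
  then have G0ae: "AE x in lebesgue. x \<in> ?B \<longrightarrow> G x = G0 x"
    by (auto elim!: eventually_mono simp: G0_def vec_eq_iff)
  have offB: "f0 x = 0" "G0 x = 0" if "x \<notin> ?B" for x using that f00 G00 KB by blast+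
  have f02: "integrable lborel (\<lambda>x. (f0 x)\<^sup>2)"
  proof (rule lebesgue_on_transfer(3)[THEN iffD1, OF _ _ _ _ f2])
    show "AE x in lebesgue. x \<in> ?B \<longrightarrow> (f x)\<^sup>2 = (f0 x)\<^sup>2" using f0ae by (auto elim: eventually_mono)
  qed (use offB in auto)
  have G02: "integrable lborel (\<lambda>x. (G0 x $ i)\<^sup>2)" for i
  proof -
    have nG0: "integrable lborel (\<lambda>x. (\<Sum>j\<in>UNIV. (G0 x $ j)\<^sup>2))"
    proof (rule lebesgue_on_transfer(3)[THEN iffD1, OF _ _ _ _ G2])
      show "AE x in lebesgue. x \<in> ?B \<longrightarrow> (norm (G x))\<^sup>2 = (\<Sum>j\<in>UNIV. (G0 x $ j)\<^sup>2)"
        using G0ae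
      proof eventually_elim
        case (elim x)
        have "(norm y)\<^sup>2 = (\<Sum>j\<in>UNIV. (y $ j)\<^sup>2)" for y :: "real^'n"
          unfolding power2_norm_eq_inner inner_vec_def by (simp add: power2_eq_square)
        then show ?case using elim by simp
      qed
    qed (use offB in auto)
    have le: "(G0 x $ i)\<^sup>2 \<le> (\<Sum>j\<in>UNIV. (G0 x $ j)\<^sup>2)" for x
      by (rule member_le_sum) auto
    show ?thesis
      by (rule Bochner_Integration.integrable_bound[OF nG0])
        (use le in \<open>simp_all add: sum_nonneg\<close>)
  qed
  have f0i: "integrable lborel f0" by (rule integrable_of_L2_bounded_support[OF f0 f02 K(1) f00])
  have G0i: "integrable lborel (\<lambda>x. G0 x $ i)" for i
    by (rule integrable_of_L2_bounded_support[OF _ G02 K(1)]) (use G00 in auto)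
  obtain \<theta> where \<theta>: "C1_with \<theta> (grad \<theta>)" "C1_c ?B \<theta>" "\<And>x. x \<in> K \<Longrightarrow> \<theta> x = 1" "\<And>x. x \<in> K \<Longrightarrow> grad \<theta> x = 0"
    using unit_ball_cutoff[OF K(1) KB] by blast
  have weak: "(\<integral>x. f0 x * \<Psi> x $ i \<partial>lborel) = - (\<integral>x. G0 x $ i * \<psi> x \<partial>lborel)" if \<psi>: "C1_with \<psi> \<Psi>" for \<psi> \<Psi> i
  proof -
    note m = C1_with_mult[OF \<theta>(1) \<psi>]
    obtain C where C: "compact C" "C \<subseteq> ?B" "\<And>x. x \<notin> C \<Longrightarrow> \<theta> x = 0" using C1_cE[OF \<theta>(2)] by metis
    have c: "C1_c ?B (\<lambda>x. \<theta> x * \<psi> x)" by (rule C1_cI[OF m C(1,2)]) (use C in auto)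
    have [measurable]: "\<psi> \<in> borel_measurable borel" "(\<lambda>x. \<Psi> x $ i) \<in> borel_measurable borel"
      using C1_with_continuous[OF \<psi>] \<psi> unfolding C1_with_def
      by (auto intro!: borel_measurable_continuous_onI continuous_intros)
    have "(\<integral>x. f0 x * \<Psi> x $ i \<partial>lborel) = (LINT x|lebesgue_on ?B. f x * partial i (\<lambda>x. \<theta> x * \<psi> x) x)"
    proof (rule lebesgue_on_transfer(2)[symmetric])
      show "AE x in lebesgue. x \<in> ?B \<longrightarrow> f x * partial i (\<lambda>x. \<theta> x * \<psi> x) x = f0 x * \<Psi> x $ i"
        using f0ae
      proof eventually_elim
        case (elim x)
        show ?case using elim \<theta>(3,4)[of x] f00[of x] by (cases "x \<in> K") (auto simp: C1_with_partial[OF m])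
      qed
    qed (use offB in auto)
    also have "\<dots> = - (LINT x|lebesgue_on ?B. G x $ i * (\<theta> x * \<psi> x))"
      using fG c unfolding has_weak_grad_def by blast
    also have "(LINT x|lebesgue_on ?B. G x $ i * (\<theta> x * \<psi> x)) = (\<integral>x. G0 x $ i * \<psi> x \<partial>lborel)"
    proof (rule lebesgue_on_transfer(2))
      show "AE x in lebesgue. x \<in> ?B \<longrightarrow> G x $ i * (\<theta> x * \<psi> x) = G0 x $ i * \<psi> x"
        using G0ae
      proof eventually_elim
        case (elim x)
        show ?case using elim \<theta>(3)[of x] G00[of x] by (cases "x \<in> K") auto
      qed
    qed (use offB in auto)
    finally show ?thesis .
  qed
  obtain \<rho> where \<rho>: "\<rho> > 0" "\<And>x y. x \<in> K \<Longrightarrow> norm y \<le> \<rho> \<Longrightarrow> x + y \<in> U"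
  proof -
    obtain e where e: "e > 0" "(\<Union>x\<in>K. ball x e) \<subseteq> U"
      using compact_subset_open_imp_ball_epsilon_subset[OF K(1) U(1) K(2)] by blast
    show ?thesis
    proof (rule that[of "e / 2"])
      fix x y :: "real^'n" assume "x \<in> K" "norm y \<le> e / 2"
      then have "x + y \<in> ball x e" using e by (simp add: dist_norm)
      then show "x + y \<in> U" using e \<open>x \<in> K\<close> by blast
    qed (use e in simp)
  qed
  define C where "C = {x + y | x y. x \<in> K \<and> y \<in> cball 0 \<rho>}"
  have C: "compact C" "C \<subseteq> U"
    unfolding C_def by (rule compact_sums[OF K(1) compact_cball]) (use \<rho>(2) in auto)
  define \<epsilon> where "\<epsilon> m = \<rho> / real (Suc m)" for m
  have \<epsilon>: "\<epsilon> m > 0" "\<epsilon> m \<le> \<rho>" for m using \<rho>(1) by (auto simp: \<epsilon>_def divide_le_eq)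
  have \<epsilon>0: "\<epsilon> \<longlonglongrightarrow> 0" unfolding \<epsilon>_def by real_asymp
  define F where "F m = conv f0 (mollifier (\<epsilon> m))" for m
  have off: "conv h (mollifier (\<epsilon> m)) x = 0" if x: "x \<notin> C" and h: "\<And>y. y \<notin> K \<Longrightarrow> h y = 0" for h m x
  proof (rule conv_mollifier_eq_0)
    fix y assume y: "norm (x - y) < \<epsilon> m"
    have "y \<notin> K"
    proof
      assume "y \<in> K"
      then have "y + (x - y) \<in> C" unfolding C_def using y \<epsilon>(2)[of m] by (intro CollectI exI[of _ y] exI[of _ "x - y"]) auto
      then show False using x by simp
    qed
    then show "h y = 0" by (rule h)
  qed (use \<epsilon> in \<open>simp add: less_imp_le\<close>)
  have partialF: "partial i (F m) = conv (\<lambda>x. G0 x $ i) (mollifier (\<epsilon> m))" for i m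
  proof
    fix x
    have "partial i (F m) x = conv f0 (mollifier_deriv (\<epsilon> m) (axis i 1)) x"
      unfolding partial_def F_def frechet_derivative_at[OF conv_mollifier_has_derivative[OF \<epsilon>(1) f0i], symmetric] ..
    obtain \<Psi> where \<Psi>: "C1_with (\<lambda>y. mollifier (\<epsilon> m) (x - y)) \<Psi>" "\<And>y i. \<Psi> y $ i = - mollifier_deriv (\<epsilon> m) (axis i 1) (x - y)"
      using C1_with_mollifier_reflected by blast
    have "conv f0 (mollifier_deriv (\<epsilon> m) (axis i 1)) x = - (\<integral>y. f0 y * \<Psi> y $ i \<partial>lborel)"
      unfolding conv_def \<Psi>(2) by simp
    also have "\<dots> = conv (\<lambda>x. G0 x $ i) (mollifier (\<epsilon> m)) x"
      unfolding weak[OF \<Psi>(1)] conv_def by simp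
    finally show "partial i (F m) x = conv (\<lambda>x. G0 x $ i) (mollifier (\<epsilon> m)) x"
      using \<open>partial i (F m) x = _\<close> by simp
  qed
  have cc: "continuous_on UNIV (conv h (mollifier (\<epsilon> m)))" if "integrable lborel h" for h :: "real^'n \<Rightarrow> real" and m
    by (rule continuous_conv[OF that continuous_mollifier, of "ball 0 (\<epsilon> m)"])
      (use \<epsilon>(1)[of m] in \<open>auto intro!: mollifier_eq_0\<close>)
  have "C1_on UNIV (F m)" for m
    unfolding C1_on_def
  proof (intro conjI ballI allI)
    show "F m differentiable at x" for x
      unfolding F_def differentiable_def using conv_mollifier_has_derivative[OF \<epsilon>(1) f0i] by blast
    show "continuous_on UNIV (partial i (F m))" for i
      unfolding partialF by (rule cc[OF G0i])
  qed
  then have C1F: "C1_with (F m) (grad (F m))" for m by (simp add: C1_on_UNIV_iff)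
  have offF: "F m x = 0" if "x \<notin> C" for m x unfolding F_def by (rule off[OF that f00])
  obtain R where R: "\<And>x. x \<in> K \<Longrightarrow> norm x \<le> R" using compact_imp_bounded[OF K(1)] by (auto simp: bounded_iff)
  have lim1: "L2_lim lborel F f0"
    proof (rule L2_limI[OF f0 f02 _ compact_imp_bounded[OF C(1)] offF])
      show "continuous_on UNIV (F m)" for m unfolding F_def by (rule cc[OF f0i])
      show "(\<lambda>m. \<integral>\<^sup>+x. ennreal (\<bar>F m x - f0 x\<bar>\<^sup>2) \<partial>lborel) \<longlonglongrightarrow> 0"
        unfolding F_def by (rule conv_mollifier_converges[OF _ f0 _ _ \<epsilon>(1) \<epsilon>0, of 2 R]) (use f02 f00 R in \<open>auto simp: not_le[symmetric]\<close>)
    qed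
  have lim2: "L2_lim lborel (\<lambda>m. partial i (F m)) (\<lambda>x. G0 x $ i)" for i
      unfolding partialF
    proof (rule L2_limI[OF _ G02 _ compact_imp_bounded[OF C(1)]])
      show "continuous_on UNIV (conv (\<lambda>x. G0 x $ i) (mollifier (\<epsilon> m)))" for m by (rule cc[OF G0i])
      show "x \<notin> C \<Longrightarrow> conv (\<lambda>x. G0 x $ i) (mollifier (\<epsilon> m)) x = 0" for m x by (rule off) (use G00 in auto)
      show "(\<lambda>m. \<integral>\<^sup>+x. ennreal (\<bar>conv (\<lambda>x. G0 x $ i) (mollifier (\<epsilon> m)) x - G0 x $ i\<bar>\<^sup>2) \<partial>lborel) \<longlonglongrightarrow> 0"
      proof (rule conv_mollifier_converges[OF _ _ _ _ \<epsilon>(1) \<epsilon>0, of 2 _ R])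
        fix x :: "real^'n" assume "R < norm x"
        then have "x \<notin> K" using R[of x] by auto
        then show "G0 x $ i = 0" using G00 by simp
      qed (use G02 in auto)
    qed measurable
  have F1: "C1_c U (F m)" for m by (rule C1_cI[OF C1F C offF])
  have meas: "(\<lambda>x. G0 x $ i) \<in> borel_measurable borel" for i by measurable
  have "H1_approximates U K f G f0 G0 F C"
    unfolding H1_approximates_def
    by (intro conjI allI impI f0 meas f0ae G0ae lim1 lim2 F1 C; (erule f00 | erule G00 | erule offF))
  then show ?thesis by (rule that)
qed

lemma C1_c_bounded:
  assumes "C1_c W \<psi>"
  obtains M where "\<And>x. \<bar>\<psi> x\<bar> \<le> M" "\<And>x i. \<bar>partial i \<psi> x\<bar> \<le> M"
proof -
  obtain K where K: "C1_with \<psi> (grad \<psi>)" "compact K" "K \<subseteq> W" "\<And>x. x \<notin> K \<Longrightarrow> \<psi> x = 0" "\<And>x. x \<notin> K \<Longrightarrow> grad \<psi> x = 0"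
    using C1_cE[OF assms] by metis
  have "continuous_on UNIV (grad \<psi>)" using K(1) unfolding C1_with_def by blast
  then have "bounded (\<psi> ` K)" "bounded (grad \<psi> ` K)"
    using C1_with_continuous[OF K(1)]
    by (auto intro!: compact_imp_bounded compact_continuous_image K intro: continuous_on_subset)
  then obtain a b where ab: "\<And>x. x \<in> K \<Longrightarrow> \<bar>\<psi> x\<bar> \<le> a" "\<And>x. x \<in> K \<Longrightarrow> norm (grad \<psi> x) \<le> b"
    by (auto simp: bounded_iff)
  show ?thesis
  proof (rule that[of "\<bar>a\<bar> + \<bar>b\<bar>"])
    show "\<bar>\<psi> x\<bar> \<le> \<bar>a\<bar> + \<bar>b\<bar>" for x using ab(1)[of x] K(4)[of x] by (cases "x \<in> K") auto
    show "\<bar>partial i \<psi> x\<bar> \<le> \<bar>a\<bar> + \<bar>b\<bar>" for x i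
    proof (cases "x \<in> K")
      case True
      then show ?thesis using ab(2)[of x] component_le_norm_cart[of "grad \<psi> x" i] by (simp add: grad_def)
    next
      case False
      then show ?thesis using K(5)[of x] by (simp add: grad_def vec_eq_iff)
    qed
  qed
qed

text \<open>The chain rule holds for the approximating functions, and both sides of it are products of two
  sequences converging in \<open>L\<^sup>2\<close>.\<close>

lemma has_weak_grad_square:
  fixes f :: "real^'n::finite \<Rightarrow> real"
  assumes fG: "has_weak_grad (ball 0 1) f G"
    and f2: "integrable (lebesgue_on (ball 0 1)) (\<lambda>x. (f x)\<^sup>2)"
    and G2: "integrable (lebesgue_on (ball 0 1)) (\<lambda>x. (norm (G x))\<^sup>2)"
    and K: "compact K" "K \<subseteq> ball 0 1"
    and supp: "AE x in lebesgue. x \<in> ball 0 1 \<longrightarrow> x \<notin> K \<longrightarrow> f x = 0"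
  shows "has_weak_grad (ball 0 1) (\<lambda>x. (f x)\<^sup>2) (\<lambda>x. (2 * f x) *\<^sub>R G x)"
proof -
  let ?B = "ball 0 1 :: (real^'n) set"
  obtain f0 G0 F C where A: "H1_approximates ?B K f G f0 G0 F C"
    by (rule H1_approximation[OF fG f2 G2 K open_ball order_refl supp])
  have [measurable]: "f0 \<in> borel_measurable borel" "(\<lambda>x. G0 x $ i) \<in> borel_measurable borel" for i
    using A unfolding H1_approximates_def by blast+
  have ae: "AE x in lebesgue. x \<in> ?B \<longrightarrow> f x = f0 x" "AE x in lebesgue. x \<in> ?B \<longrightarrow> G x = G0 x"
    using A unfolding H1_approximates_def by blast+
  have z: "x \<notin> K \<Longrightarrow> f0 x = 0" "x \<notin> K \<Longrightarrow> G0 x = 0" for x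
    using A unfolding H1_approximates_def by blast+
  have lim: "L2_lim lborel F f0" "L2_lim lborel (\<lambda>m. partial i (F m)) (\<lambda>x. G0 x $ i)" for i
    using A unfolding H1_approximates_def by blast+
  have F: "C1_c ?B (F m)" for m using A unfolding H1_approximates_def by blast
  have offB: "f0 x = 0" "G0 x = 0" if "x \<notin> ?B" for x using that z K by blast+
  have i0: "integrable lborel (\<lambda>x. f0 x * G0 x $ i)" for i
    using lim by (intro L2_Cauchy_Schwarz(1)) (auto simp: L2_lim_def)
  have i1: "integrable (lebesgue_on ?B) (\<lambda>x. ((2 * f x) *\<^sub>R G x) $ i)" for i
  proof (rule lebesgue_on_transfer(3)[THEN iffD2])
    show "AE x in lebesgue. x \<in> ?B \<longrightarrow> ((2 * f x) *\<^sub>R G x) $ i = 2 * (f0 x * G0 x $ i)"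
      using ae by eventually_elim auto
    show "integrable lborel (\<lambda>x. 2 * (f0 x * G0 x $ i))" using i0 by simp
  qed (use offB in auto)
  show ?thesis
    unfolding has_weak_grad_def
  proof (intro conjI allI impI)
    show "L1_loc ?B (\<lambda>x. (f x)\<^sup>2)" by (rule integrable_on_imp_L1_loc[OF open_ball f2])
    show "L1_loc ?B (\<lambda>x. (2 * f x) *\<^sub>R G x)" by (intro L1_loc_vecI integrable_on_imp_L1_loc[OF open_ball] i1)
    fix \<psi> i assume \<psi>: "C1_c ?B \<psi>"
    obtain M where M: "\<And>x. \<bar>\<psi> x\<bar> \<le> M" "\<And>x i. \<bar>partial i \<psi> x\<bar> \<le> M" using C1_c_bounded[OF \<psi>] by blast
    obtain C' where C': "C1_with \<psi> (grad \<psi>)" "\<And>x. x \<notin> C' \<Longrightarrow> \<psi> x = 0" "C' \<subseteq> ?B" using C1_cE[OF \<psi>] by metis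
    have [measurable]: "\<psi> \<in> borel_measurable borel" "partial i \<psi> \<in> borel_measurable borel"
      using C1_with_continuous[OF C'(1)] C'(1) unfolding C1_with_def C1_with_partial[OF C'(1)]
      by (auto intro!: borel_measurable_continuous_onI continuous_intros)
    have Fi: "(\<integral>x. F m x * F m x * partial i \<psi> x \<partial>lborel) = - 2 * (\<integral>x. F m x * partial i (F m) x * \<psi> x \<partial>lborel)" for m
    proof -
      obtain Cm where Cm: "C1_with (F m) (grad (F m))" using C1_cE[OF F] by metis
      have "(\<integral>x. F m x * F m x * partial i \<psi> x \<partial>lborel) = - (\<integral>x. (F m x *\<^sub>R grad (F m) x + F m x *\<^sub>R grad (F m) x) $ i * \<psi> x \<partial>lborel)"
        by (rule integral_by_parts_C1[OF C1_with_mult[OF Cm Cm] \<psi>])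
      also have "(\<lambda>x. (F m x *\<^sub>R grad (F m) x + F m x *\<^sub>R grad (F m) x) $ i * \<psi> x) = (\<lambda>x. 2 * (F m x * partial i (F m) x * \<psi> x))"
        by (auto simp: C1_with_partial[OF Cm] algebra_simps)
      finally show ?thesis by simp
    qed
    have "(\<lambda>m. \<integral>x. F m x * F m x * partial i \<psi> x \<partial>lborel) \<longlonglongrightarrow> (\<integral>x. f0 x * f0 x * partial i \<psi> x \<partial>lborel)"
      by (rule L2_lim_product(3)[OF lim(1) lim(1) _ M(2)]) measurable
    moreover have "(\<lambda>m. - 2 * (\<integral>x. F m x * partial i (F m) x * \<psi> x \<partial>lborel)) \<longlonglongrightarrow> - 2 * (\<integral>x. f0 x * G0 x $ i * \<psi> x \<partial>lborel)"
      by (intro tendsto_intros L2_lim_product(3)[OF lim(1) lim(2) _ M(1)]) measurable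
    ultimately have eq: "(\<integral>x. f0 x * f0 x * partial i \<psi> x \<partial>lborel) = - 2 * (\<integral>x. f0 x * G0 x $ i * \<psi> x \<partial>lborel)"
      unfolding Fi by (rule LIMSEQ_unique)
    have "(LINT x|lebesgue_on ?B. (f x)\<^sup>2 * partial i \<psi> x) = (\<integral>x. f0 x * f0 x * partial i \<psi> x \<partial>lborel)"
    proof (rule lebesgue_on_transfer(2))
      show "AE x in lebesgue. x \<in> ?B \<longrightarrow> (f x)\<^sup>2 * partial i \<psi> x = f0 x * f0 x * partial i \<psi> x"
        using ae(1) by eventually_elim (auto simp: power2_eq_square)
    qed (use offB in auto)
    also have "\<dots> = - (\<integral>x. 2 * (f0 x * G0 x $ i * \<psi> x) \<partial>lborel)" unfolding eq by simp
    also have "(\<integral>x. 2 * (f0 x * G0 x $ i * \<psi> x) \<partial>lborel) = (LINT x|lebesgue_on ?B. ((2 * f x) *\<^sub>R G x) $ i * \<psi> x)"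
    proof (rule lebesgue_on_transfer(2)[symmetric])
      show "AE x in lebesgue. x \<in> ?B \<longrightarrow> ((2 * f x) *\<^sub>R G x) $ i * \<psi> x = 2 * (f0 x * G0 x $ i * \<psi> x)"
        using ae by eventually_elim auto
    qed (use offB in auto)
    finally show "(LINT x|lebesgue_on ?B. (f x)\<^sup>2 * partial i \<psi> x) = - (LINT x|lebesgue_on ?B. ((2 * f x) *\<^sub>R G x) $ i * \<psi> x)" .
  qed
qed

lemma has_weak_grad_mult_C1:
  fixes f :: "real^'n::finite \<Rightarrow> real"
  assumes W: "open W" and fG: "has_weak_grad W f G" and \<theta>: "C1_with \<theta> T"
  shows "has_weak_grad W (\<lambda>x. f x * \<theta> x) (\<lambda>x. \<theta> x *\<^sub>R G x + f x *\<^sub>R T x)"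
proof -
  have L: "L1_loc W f" "L1_loc W G" using fG by (auto simp: has_weak_grad_def)
  have c: "continuous_on UNIV \<theta>" "continuous_on UNIV (\<lambda>x. T x $ i)" for i
    using C1_with_continuous[OF \<theta>] \<theta> unfolding C1_with_def by (auto intro!: continuous_intros)
  have L1: "L1_loc W (\<lambda>x. f x * \<theta> x)" "L1_loc W (\<lambda>x. f x * T x $ i)" "L1_loc W (\<lambda>x. G x $ i * \<theta> x)" for i
    by (rule L1_loc_mult_continuous[OF L(1) c(1)], rule L1_loc_mult_continuous[OF L(1) c(2)],
        rule L1_loc_mult_continuous[OF L1_loc_component[OF L(2)] c(1)])
  show ?thesis
    unfolding has_weak_grad_def
  proof (intro conjI allI impI)
    show "L1_loc W (\<lambda>x. f x * \<theta> x)" by (rule L1)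
    show "L1_loc W (\<lambda>x. \<theta> x *\<^sub>R G x + f x *\<^sub>R T x)"
    proof (rule L1_loc_vecI)
      fix i
      show "L1_loc W (\<lambda>x. (\<theta> x *\<^sub>R G x + f x *\<^sub>R T x) $ i)"
        using L1_loc_add[OF L1(3)[of i] L1(2)[of i]] by (simp add: mult.commute)
    qed
    fix \<psi> i assume \<psi>: "C1_c W \<psi>"
    obtain C where C: "C1_with \<psi> (grad \<psi>)" "compact C" "C \<subseteq> W" "\<And>x. x \<notin> C \<Longrightarrow> \<psi> x = 0" "\<And>x. x \<notin> C \<Longrightarrow> grad \<psi> x = 0"
      using C1_cE[OF \<psi>] by metis
    note m = C1_with_mult[OF \<theta> C(1)]
    have "C1_c W (\<lambda>x. \<theta> x * \<psi> x)" by (rule C1_cI[OF m C(2,3)]) (use C in auto)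
    then have eq: "(LINT x|lebesgue_on W. f x * partial i (\<lambda>x. \<theta> x * \<psi> x) x) = - (LINT x|lebesgue_on W. G x $ i * (\<theta> x * \<psi> x))"
      using fG unfolding has_weak_grad_def by blast
    note t = L1_loc_integrable_test(1)[OF W _ _ C(2,3)]
    have c2: "continuous_on UNIV (\<lambda>x. grad \<psi> x $ i)" using C(1) unfolding C1_with_def by (intro continuous_intros) auto
    have i: "integrable (lebesgue_on W) (\<lambda>x. f x * \<theta> x * grad \<psi> x $ i)" "integrable (lebesgue_on W) (\<lambda>x. f x * T x $ i * \<psi> x)"
       "integrable (lebesgue_on W) (\<lambda>x. G x $ i * \<theta> x * \<psi> x)"
      using t[OF L1(1) c2] t[OF L1(2) C1_with_continuous[OF C(1)]] t[OF L1(3) C1_with_continuous[OF C(1)]] C(4,5) by auto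
    have "(LINT x|lebesgue_on W. f x * \<theta> x * grad \<psi> x $ i) + (LINT x|lebesgue_on W. f x * T x $ i * \<psi> x) = - (LINT x|lebesgue_on W. G x $ i * \<theta> x * \<psi> x)"
      using eq i unfolding C1_with_partial[OF m] by (simp add: algebra_simps)
    then show "(LINT x|lebesgue_on W. f x * \<theta> x * partial i \<psi> x) = - (LINT x|lebesgue_on W. (\<theta> x *\<^sub>R G x + f x *\<^sub>R T x) $ i * \<psi> x)"
      using i unfolding C1_with_partial[OF C(1)] by (simp add: algebra_simps)
  qed
qed

lemma has_weak_grad_C1:
  fixes f :: "real^'n::finite \<Rightarrow> real"
  assumes W: "open W" and f: "C1_with f F"
  shows "has_weak_grad W f F"
proof -
  have one: "L1_loc W (\<lambda>x. 1)"
    unfolding L1_loc_def set_integrable_def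
  proof (intro allI impI)
    fix K assume "compact K \<and> K \<subseteq> W"
    then have "K \<in> lmeasurable" by (simp add: lmeasurable_compact)
    then have "integrable lebesgue (indicat_real K)" by (intro integrable_real_indicator) (auto simp: fmeasurable_def)
    then show "integrable lebesgue (\<lambda>x. indicat_real K x *\<^sub>R 1)" by simp
  qed
  have c: "continuous_on UNIV f" "continuous_on UNIV (\<lambda>x. F x $ i)" for i
    using C1_with_continuous[OF f] f unfolding C1_with_def by (auto intro!: continuous_intros)
  show ?thesis
    unfolding has_weak_grad_def
  proof (intro conjI allI impI L1_loc_vecI)
    show "L1_loc W f" using L1_loc_mult_continuous[OF one c(1)] by simp
    show "L1_loc W (\<lambda>x. F x $ i)" for i using L1_loc_mult_continuous[OF one c(2)] by simp
    fix \<psi> i assume \<psi>: "C1_c W \<psi>"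
    obtain C where C: "C1_with \<psi> (grad \<psi>)" "C \<subseteq> W" "\<And>x. x \<notin> C \<Longrightarrow> \<psi> x = 0" "\<And>x. x \<notin> C \<Longrightarrow> grad \<psi> x = 0"
      using C1_cE[OF \<psi>] by metis
    have off: "\<psi> x = 0" "grad \<psi> x = 0" if "x \<notin> W" for x using that C by blast+
    have "(LINT x|lebesgue_on W. f x * partial i \<psi> x) = (\<integral>x. f x * partial i \<psi> x \<partial>lborel)"
      by (rule lebesgue_on_transfer(2)) (use W off C1_with_integrable(1)[OF f \<psi>] in \<open>auto simp: C1_with_partial[OF C(1)] dest!: borel_measurable_integrable\<close>)
    moreover have "(LINT x|lebesgue_on W. F x $ i * \<psi> x) = (\<integral>x. F x $ i * \<psi> x \<partial>lborel)"
      by (rule lebesgue_on_transfer(2)) (use W off C1_with_integrable(2)[OF f \<psi>] in \<open>auto dest!: borel_measurable_integrable\<close>)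
    ultimately show "(LINT x|lebesgue_on W. f x * partial i \<psi> x) = - (LINT x|lebesgue_on W. F x $ i * \<psi> x)"
      using integral_by_parts_C1[OF f \<psi>] by simp
  qed
qed

lemma C1_c_in_H1_c:
  fixes f :: "real^'n::finite \<Rightarrow> real"
  assumes f: "C1_c (ball 0 1) f"
  shows "f \<in> H1_c (ball 0 1)" "f \<in> Linf_loc (ball 0 1)"
proof -
  let ?B = "ball 0 1 :: (real^'n) set"
  obtain K where K: "C1_with f (grad f)" "compact K" "K \<subseteq> ?B" "\<And>x. x \<notin> K \<Longrightarrow> f x = 0" "\<And>x. x \<notin> K \<Longrightarrow> grad f x = 0"
    using C1_cE[OF f] by metis
  have offB: "f x = 0" "grad f x = 0" if "x \<notin> ?B" for x using that K by blast+
  have cf: "continuous_on UNIV f" by (rule C1_with_continuous[OF K(1)])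
  have cg: "continuous_on UNIV (grad f)" using K(1) unfolding C1_with_def by blast
  have m: "f \<in> borel_measurable (lebesgue_on ?B)"
    by (rule lebesgue_on_transfer(1)[of _ f]) (use offB in \<open>auto intro!: borel_measurable_continuous_onI[OF cf]\<close>)
  have i1: "integrable (lebesgue_on ?B) (\<lambda>x. (f x)\<^sup>2)"
  proof (rule lebesgue_on_transfer(3)[THEN iffD2])
    show "integrable lborel (\<lambda>x. (f x)\<^sup>2)"
      by (rule integrable_continuous_bounded_support[OF _ compact_imp_bounded[OF K(2)]]) (use K cf in \<open>auto intro!: continuous_intros\<close>)
    then show "(\<lambda>x. (f x)\<^sup>2) \<in> borel_measurable borel" by auto
  qed (use offB in auto)
  have i2: "integrable (lebesgue_on ?B) (\<lambda>x. (norm (grad f x))\<^sup>2)"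
  proof (rule lebesgue_on_transfer(3)[THEN iffD2])
    show "integrable lborel (\<lambda>x. (norm (grad f x))\<^sup>2)"
      by (rule integrable_continuous_bounded_support[OF _ compact_imp_bounded[OF K(2)]]) (use K cg in \<open>auto intro!: continuous_intros\<close>)
    then show "(\<lambda>x. (norm (grad f x))\<^sup>2) \<in> borel_measurable borel" by auto
  qed (use offB in auto)
  show "f \<in> H1_c ?B"
    unfolding H1_c_def H1_def using m i1 i2 has_weak_grad_C1[OF open_ball K(1)] K(2,3,4) by auto
  obtain M where "\<And>x. \<bar>f x\<bar> \<le> M" "\<And>x i. \<bar>partial i f x\<bar> \<le> M" using C1_c_bounded[OF f] by metis
  then have "\<exists>M. AE x in lebesgue_on A. \<bar>f x\<bar> \<le> M" for A by (intro exI[of _ M] AE_I2)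
  then show "f \<in> Linf_loc ?B" unfolding Linf_loc_def using m by simp
qed

section \<open>Radial functions\<close>

lemma partial_cong_open:
  assumes "open A" "x \<in> A" "\<And>y. y \<in> A \<Longrightarrow> f y = f' y" "(f' has_derivative (\<lambda>h. G \<bullet> h)) (at x)"
  shows "partial i f x = G $ i"
proof (rule partial_eqI)
  show "(f has_derivative (\<lambda>h. G \<bullet> h)) (at x)"
    by (rule has_derivative_transform_within_open[OF assms(4,1,2)]) (use assms(3) in auto)
qed

lemma has_derivative_radial:
  fixes x :: "real^'n::finite"
  assumes "x \<noteq> 0" "(f has_real_derivative f') (at (norm x))"
  shows "((\<lambda>y. f (norm y)) has_derivative (\<lambda>h. ((f' / norm x) *\<^sub>R x) \<bullet> h)) (at x)"
proof -
  have "(norm has_derivative (\<lambda>h. h \<bullet> sgn x)) (at x)"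
    by (rule has_derivative_norm[OF assms(1)])
  moreover have "(f has_derivative (\<lambda>h. f' * h)) (at (norm x))"
    using assms(2) by (simp add: has_field_derivative_def)
  ultimately have "((\<lambda>y. f (norm y)) has_derivative (\<lambda>h. f' * (h \<bullet> sgn x))) (at x)"
    by (rule has_derivative_compose)
  moreover have "(\<lambda>h. f' * (h \<bullet> sgn x)) = (\<lambda>h. ((f' / norm x) *\<^sub>R x) \<bullet> h)"
    by (auto simp: sgn_div_norm inner_commute divide_inverse)
  ultimately show ?thesis by simp
qed

lemma hessian_radial:
  fixes u :: "real^'n::finite \<Rightarrow> real"
  assumes u: "\<And>x. x \<in> B1 \<Longrightarrow> u x = v (norm x)"
    and v: "\<And>r. 0 < r \<Longrightarrow> r < 1 \<Longrightarrow> (v has_real_derivative r * q r) (at r)"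
    and q: "\<And>r. 0 < r \<Longrightarrow> r < 1 \<Longrightarrow> (q has_real_derivative q' r) (at r)"
    and x: "x \<in> B1" "x \<noteq> 0"
  shows "hessian u x = radial_matrix (q (norm x)) (norm x * q' (norm x)) ((1 / norm x) *\<^sub>R x)"
proof -
  let ?A = "B1 - {0} :: (real^'n) set"
  have A: "open ?A" by (simp add: open_delete)
  have p1: "partial i u y = q (norm y) * y $ i" if "y \<in> ?A" for y i
  proof -
    have "partial i u y = ((norm y * q (norm y) / norm y) *\<^sub>R y) $ i"
    proof (rule partial_cong_open[OF A that])
      show "((\<lambda>y. v (norm y)) has_derivative (\<lambda>h. ((norm y * q (norm y) / norm y) *\<^sub>R y) \<bullet> h)) (at y)"
        using that by (intro has_derivative_radial v) auto
    qed (use u in auto)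
    then show ?thesis using that by simp
  qed
  have p2: "partial j (partial i u) x = (if i = j then q (norm x) else 0) + q' (norm x) / norm x * x $ i * x $ j" for i j
  proof -
    have "((\<lambda>y. q (norm y) * y $ i) has_derivative (\<lambda>h. q (norm x) * h $ i + (((q' (norm x) / norm x) *\<^sub>R x) \<bullet> h) * x $ i)) (at x)"
      using x by (intro has_derivative_mult has_derivative_radial q bounded_linear_imp_has_derivative bounded_linear_vec_nth) auto
    moreover have "(\<lambda>h. q (norm x) * h $ i + (((q' (norm x) / norm x) *\<^sub>R x) \<bullet> h) * x $ i)
       = (\<lambda>h. (q (norm x) *\<^sub>R axis i 1 + (x $ i * q' (norm x) / norm x) *\<^sub>R x) \<bullet> h)"
      by (auto simp: inner_add_left inner_axis' algebra_simps)
    ultimately have d: "((\<lambda>y. q (norm y) * y $ i) has_derivative (\<lambda>h. (q (norm x) *\<^sub>R axis i 1 + (x $ i * q' (norm x) / norm x) *\<^sub>R x) \<bullet> h)) (at x)"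
      by simp
    have "partial j (partial i u) x = (q (norm x) *\<^sub>R axis i 1 + (x $ i * q' (norm x) / norm x) *\<^sub>R x) $ j"
      by (rule partial_cong_open[OF A _ p1 d]) (use x in auto)
    then show ?thesis by (auto simp: axis_def algebra_simps)
  qed
  show ?thesis
    using x by (auto simp: hessian_def radial_matrix_def outer_def mat_def vec_eq_iff p2 field_simps power2_eq_square)
qed

lemma continuous_on_mult_compact_support:
  fixes f :: "'a::topological_space \<Rightarrow> real"
  assumes U: "open U" and K: "closed K" "K \<subseteq> U" and W: "continuous_on U W" and f: "continuous_on UNIV f" "\<And>x. x \<notin> K \<Longrightarrow> f x = 0"
  shows "continuous_on UNIV (\<lambda>x. W x * f x)"
proof -
  have "continuous_on U (\<lambda>x. W x * f x)" by (intro continuous_intros W continuous_on_subset[OF f(1)]) auto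
  moreover have "continuous_on (- K) (\<lambda>x. W x * f x)"
    by (rule continuous_on_eq[of _ "\<lambda>_. 0"]) (use f(2) in auto)
  moreover have "U \<union> - K = UNIV" using K by auto
  ultimately show ?thesis using continuous_on_open_Un[OF U, of "- K"] K(1) by (metis open_Compl)
qed

lemma nn_integral_neg_le_iff:
  fixes f :: "'a \<Rightarrow> real"
  assumes "integrable M f"
  shows "(\<integral>\<^sup>+x. ennreal (- f x) \<partial>M) \<le> (\<integral>\<^sup>+x. ennreal (f x) \<partial>M) \<longleftrightarrow> 0 \<le> integral\<^sup>L M f"
    and "(\<integral>\<^sup>+x. ennreal (- f x) \<partial>M) < \<infinity>"
proof -
  have i: "integrable M (\<lambda>x. max 0 (f x))" "integrable M (\<lambda>x. max 0 (- f x))" using assms by auto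
  have p: "(\<integral>\<^sup>+x. ennreal (f x) \<partial>M) = ennreal (\<integral>x. max 0 (f x) \<partial>M)"
    using i(1) by (subst nn_integral_eq_integral[symmetric]) (auto simp: max_def ennreal_neg intro!: nn_integral_cong)
  have m: "(\<integral>\<^sup>+x. ennreal (- f x) \<partial>M) = ennreal (\<integral>x. max 0 (- f x) \<partial>M)"
    using i(2) by (subst nn_integral_eq_integral[symmetric]) (auto simp: max_def ennreal_neg intro!: nn_integral_cong)
  have "integral\<^sup>L M f = (\<integral>x. max 0 (f x) - max 0 (- f x) \<partial>M)"
    by (intro Bochner_Integration.integral_cong) (auto simp: max_def)
  also have "\<dots> = (\<integral>x. max 0 (f x) \<partial>M) - (\<integral>x. max 0 (- f x) \<partial>M)" using i by simp
  finally show "(\<integral>\<^sup>+x. ennreal (- f x) \<partial>M) \<le> (\<integral>\<^sup>+x. ennreal (f x) \<partial>M) \<longleftrightarrow> 0 \<le> integral\<^sup>L M f"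
    unfolding p m by (subst ennreal_le_iff) (auto intro!: integral_nonneg_AE)
  show "(\<integral>\<^sup>+x. ennreal (- f x) \<partial>M) < \<infinity>" unfolding m by simp
qed

text \<open>Nonnegativity of an integral compares the integrals of the negative and the positive part, and
  this comparison may be made on each ray separately.\<close>

lemma integral_nonneg_if_rays_nonneg:
  fixes F :: "'a::euclidean_space \<Rightarrow> real"
  assumes F: "integrable lborel F"
    and f: "\<And>w. norm w = 1 \<Longrightarrow> integrable lborel (\<lambda>r. indicator {0<..} r * (F (r *\<^sub>R w) * r ^ (DIM('a) - 1)))"
    and nn: "\<And>w. norm w = 1 \<Longrightarrow> 0 \<le> (\<integral>r. indicator {0<..} r * (F (r *\<^sub>R w) * r ^ (DIM('a) - 1)) \<partial>lborel)"
  shows "0 \<le> (\<integral>x. F x \<partial>lborel)"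
proof -
  have [measurable]: "F \<in> borel_measurable borel" using F by auto
  have eq: "ray_integral (\<lambda>x. ennreal (s * F x)) w = (\<integral>\<^sup>+r. ennreal (s * (indicator {0<..} r * (F (r *\<^sub>R w) * r ^ (DIM('a) - 1)))) \<partial>lborel)" for w and s :: real
    unfolding ray_integral_def
  proof (rule nn_integral_cong)
    fix r :: real
    show "indicator {0<..} r * ennreal (s * F (r *\<^sub>R w)) * ennreal (r ^ (DIM('a) - 1)) = ennreal (s * (indicator {0<..} r * (F (r *\<^sub>R w) * r ^ (DIM('a) - 1))))"
      by (cases "r > 0") (auto simp: ennreal_mult''[symmetric] mult.assoc)
  qed
  have "(\<integral>\<^sup>+x. ennreal (- 1 * F x) \<partial>lborel) \<le> (\<integral>\<^sup>+x. ennreal (1 * F x) \<partial>lborel)"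
  proof (rule nn_integral_le_if_rays_le)
    fix w :: 'a assume w: "norm w = 1"
    show "ray_integral (\<lambda>x. ennreal (- 1 * F x)) w \<le> ray_integral (\<lambda>x. ennreal (1 * F x)) w"
      unfolding eq using nn_integral_neg_le_iff(1)[OF f[OF w]] nn[OF w] by simp
  qed measurable
  then show ?thesis using nn_integral_neg_le_iff(1)[OF F] by simp
qed

lemma integral_radial_nonneg:
  fixes f :: "real \<Rightarrow> real"
  assumes [measurable]: "f \<in> borel_measurable borel"
    and F: "integrable lborel (\<lambda>x :: 'a::euclidean_space. f (norm x))" and nn: "0 \<le> (\<integral>x. f (norm (x :: 'a)) \<partial>lborel)"
    and i: "integrable lborel (\<lambda>r. indicator {0<..} r * (f r * r ^ (DIM('a) - 1)))"
  shows "0 \<le> (\<integral>r. indicator {0<..} r * (f r * r ^ (DIM('a) - 1)) \<partial>lborel)"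
proof -
  obtain C :: real where C: "C > 0"
    "\<And>h. h \<in> borel_measurable borel \<Longrightarrow> (\<integral>\<^sup>+x. h (norm x) \<partial>(lborel :: 'a measure))
       = ennreal C * (\<integral>\<^sup>+r. indicator {0<..} r * h r * ennreal (r ^ (DIM('a) - 1)) \<partial>lborel)"
    using nn_integral_radial by blast
  have eq: "(\<integral>\<^sup>+x. ennreal (s * f (norm x)) \<partial>(lborel :: 'a measure))
       = ennreal C * (\<integral>\<^sup>+r. ennreal (s * (indicator {0<..} r * (f r * r ^ (DIM('a) - 1)))) \<partial>lborel)" for s
  proof -
    have "indicator {0<..} r * ennreal (s * f r) * ennreal (r ^ (DIM('a) - 1)) = ennreal (s * (indicator {0<..} r * (f r * r ^ (DIM('a) - 1))))" for r
      by (cases "r > 0") (auto simp: ennreal_mult''[symmetric] mult.assoc)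
    then show ?thesis using C(2)[of "\<lambda>r. ennreal (s * f r)"] by simp
  qed
  have "ennreal C * (\<integral>\<^sup>+r. ennreal (- 1 * (indicator {0<..} r * (f r * r ^ (DIM('a) - 1)))) \<partial>lborel)
     \<le> ennreal C * (\<integral>\<^sup>+r. ennreal (1 * (indicator {0<..} r * (f r * r ^ (DIM('a) - 1)))) \<partial>lborel)"
    unfolding eq[symmetric] using nn_integral_neg_le_iff(1)[OF F] nn by simp
  then have "(\<integral>\<^sup>+r. ennreal (- 1 * (indicator {0<..} r * (f r * r ^ (DIM('a) - 1)))) \<partial>lborel)
     \<le> (\<integral>\<^sup>+r. ennreal (1 * (indicator {0<..} r * (f r * r ^ (DIM('a) - 1)))) \<partial>lborel)"
    using C(1) by (subst (asm) ennreal_mult_le_mult_iff) auto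
  then show ?thesis using nn_integral_neg_le_iff(1)[OF i] by simp
qed

section \<open>Test functions on the interval\<close>

text \<open>Functions of class \<open>C\<^sup>1\<close> with compact support in the open unit interval, together with their
  derivative.\<close>

definition test1 :: "(real \<Rightarrow> real) \<Rightarrow> (real \<Rightarrow> real) \<Rightarrow> bool" where
  "test1 h h' \<longleftrightarrow> (\<forall>r. (h has_real_derivative h' r) (at r)) \<and> continuous_on UNIV h' \<and>
     (\<exists>a b. 0 < a \<and> a < b \<and> b < 1 \<and> (\<forall>r. r \<notin> {a..b} \<longrightarrow> h r = 0 \<and> h' r = 0))"

lemma test1E:
  assumes "test1 h h'"
  obtains a b where "0 < a" "a < b" "b < 1" "\<And>r. r \<notin> {a..b} \<Longrightarrow> h r = 0" "\<And>r. r \<notin> {a..b} \<Longrightarrow> h' r = 0"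
    "\<And>r. (h has_real_derivative h' r) (at r)" "continuous_on UNIV h" "continuous_on UNIV h'"
proof -
  obtain a b where *: "0 < a" "a < b" "b < 1" "\<And>r. r \<notin> {a..b} \<Longrightarrow> h r = 0 \<and> h' r = 0"
    using assms unfolding test1_def by blast
  have d: "\<And>r. (h has_real_derivative h' r) (at r)" "continuous_on UNIV h'" using assms unfolding test1_def by blast+
  have "continuous_on UNIV h" using d(1) by (meson DERIV_continuous_on DERIV_subset subset_UNIV)
  then show ?thesis using that[OF *(1-3)] * d by blast
qed

text \<open>A function that is continuously differentiable on the open interval and vanishes outside a compact
  part of it extends by zero.\<close>

lemma test1I:
  assumes ab: "0 < a" "a < b" "b < 1"
    and d: "\<And>r. 0 < r \<Longrightarrow> r < 1 \<Longrightarrow> (h has_real_derivative h' r) (at r)"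
    and c: "continuous_on {0<..<1} h'"
    and z: "\<And>r. r \<notin> {a..b} \<Longrightarrow> h r = 0" "\<And>r. r \<notin> {a..b} \<Longrightarrow> h' r = 0"
  shows "test1 h h'"
  unfolding test1_def
proof (intro conjI allI)
  show "(h has_real_derivative h' r) (at r)" for r
  proof (cases "r \<in> {a..b}")
    case True
    then show ?thesis using ab by (intro d) auto
  next
    case False
    have "((\<lambda>_. 0 :: real) has_real_derivative 0) (at r)" by simp
    then have "(h has_real_derivative 0) (at r)"
      by (rule has_field_derivative_transform_within_open[of _ _ _ "- {a..b}"]) (use z(1) False in auto)
    then show ?thesis using z(2)[OF False] by simp
  qed
  have "continuous_on (- {a..b}) h'" by (rule continuous_on_eq[of _ "\<lambda>_. 0"]) (use z(2) in auto)
  moreover have "{0<..<1} \<union> - {a..b} = UNIV" using ab by auto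
  ultimately show "continuous_on UNIV h'"
    using continuous_on_open_Un[of "{0<..<1}" "- {a..b}" h'] c open_Compl[OF closed_atLeastAtMost[of a b]] by simp
  show "\<exists>a b. 0 < a \<and> a < b \<and> b < 1 \<and> (\<forall>r. r \<notin> {a..b} \<longrightarrow> h r = 0 \<and> h' r = 0)"
    using ab z by blast
qed

lemma punctured_ball_compact:
  fixes K :: "(real^'n::finite) set"
  assumes "compact K" "K \<subseteq> B1 - {0}"
  obtains a b where "0 < a" "a < b" "b < 1" "\<And>x. x \<in> K \<Longrightarrow> a \<le> norm x \<and> norm x \<le> b"
proof (cases "K = {}")
  case True
  then show ?thesis using that[of "1/3" "2/3"] by auto
next
  case False
  have c: "continuous_on K norm" by (intro continuous_intros)
  obtain y where y: "y \<in> K" "\<And>x. x \<in> K \<Longrightarrow> norm x \<le> norm y"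
    using continuous_attains_sup[OF assms(1) False c] by auto
  obtain z where z: "z \<in> K" "\<And>x. x \<in> K \<Longrightarrow> norm z \<le> norm x"
    using continuous_attains_inf[OF assms(1) False c] by auto
  have "0 < norm z" "norm y < 1" using y(1) z(1) assms(2) by auto
  moreover have "norm z \<le> norm y" by (rule z(2)[OF y(1)])
  ultimately have *: "0 < norm z / 2" "norm z / 2 < norm y" "norm y < 1" by linarith+
  have "norm z / 2 \<le> norm x \<and> norm x \<le> norm y" if "x \<in> K" for x
    using y(2)[OF that] z(2)[OF that] *(1) by linarith
  then show ?thesis using that[OF *] by blast
qed

lemma test1_ray:
  fixes \<phi> :: "real^'n::finite \<Rightarrow> real"
  assumes \<phi>: "C1_c (B1 - {0}) \<phi>" and w: "norm w = 1"
  shows "test1 (\<lambda>r. indicator {0<..} r * \<phi> (r *\<^sub>R w)) (\<lambda>r. indicator {0<..} r * (w \<bullet> grad \<phi> (r *\<^sub>R w)))"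
proof -
  obtain K where K: "C1_with \<phi> (grad \<phi>)" "compact K" "K \<subseteq> B1 - {0}" "\<And>x. x \<notin> K \<Longrightarrow> \<phi> x = 0" "\<And>x. x \<notin> K \<Longrightarrow> grad \<phi> x = 0"
    using C1_cE[OF \<phi>] by metis
  obtain a b where ab: "0 < a" "a < b" "b < 1" "\<And>x. x \<in> K \<Longrightarrow> a \<le> norm x \<and> norm x \<le> b"
    using punctured_ball_compact[OF K(2,3)] by blast
  have off: "r *\<^sub>R w \<notin> K" if "r > 0" "r \<notin> {a..b}" for r using ab(4)[of "r *\<^sub>R w"] that w by auto
  show ?thesis
  proof (rule test1I[OF ab(1-3)])
    fix r :: real assume r: "0 < r" "r < 1"
    have "((\<lambda>t. t *\<^sub>R w) has_derivative (\<lambda>t. t *\<^sub>R w)) (at r)" by (auto intro!: derivative_eq_intros)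
    moreover have "(\<phi> has_derivative (\<lambda>h. grad \<phi> (r *\<^sub>R w) \<bullet> h)) (at (r *\<^sub>R w))" using K(1) unfolding C1_with_def by blast
    ultimately have "((\<lambda>t. \<phi> (t *\<^sub>R w)) has_derivative (\<lambda>t. grad \<phi> (r *\<^sub>R w) \<bullet> (t *\<^sub>R w))) (at r)"
      by (rule has_derivative_compose)
    moreover have "(\<lambda>t. grad \<phi> (r *\<^sub>R w) \<bullet> (t *\<^sub>R w)) = (*) (w \<bullet> grad \<phi> (r *\<^sub>R w))" by (auto simp: inner_commute)
    ultimately have "((\<lambda>t. \<phi> (t *\<^sub>R w)) has_real_derivative w \<bullet> grad \<phi> (r *\<^sub>R w)) (at r)"
      unfolding has_field_derivative_def by simp
    then have "((\<lambda>t. indicator {0<..} t * \<phi> (t *\<^sub>R w)) has_real_derivative w \<bullet> grad \<phi> (r *\<^sub>R w)) (at r)"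
      by (rule has_field_derivative_transform_within_open[of _ _ _ "{0<..}"]) (use r in auto)
    then show "((\<lambda>t. indicator {0<..} t * \<phi> (t *\<^sub>R w)) has_real_derivative indicator {0<..} r * (w \<bullet> grad \<phi> (r *\<^sub>R w))) (at r)"
      using r by simp
  next
    have "continuous_on UNIV (grad \<phi>)" using K(1) unfolding C1_with_def by blast
    then have "continuous_on {0<..<1} (\<lambda>r. grad \<phi> (r *\<^sub>R w))"
      by (rule continuous_on_compose2) (auto intro!: continuous_intros)
    then have "continuous_on {0<..<1} (\<lambda>r. w \<bullet> grad \<phi> (r *\<^sub>R w))" by (intro continuous_intros)
    then show "continuous_on {0<..<1} (\<lambda>r. indicator {0<..} r * (w \<bullet> grad \<phi> (r *\<^sub>R w)))"
      by (rule continuous_on_eq) auto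
  next
    fix r assume r: "r \<notin> {a..b}"
    show "indicator {0<..} r * \<phi> (r *\<^sub>R w) = 0" using off[OF _ r] K(4) by (cases "r > 0") auto
    show "indicator {0<..} r * (w \<bullet> grad \<phi> (r *\<^sub>R w)) = 0" using off[OF _ r] K(5) by (cases "r > 0") auto
  qed
qed

lemma C1_c_radial:
  assumes h: "test1 h h'"
  shows "C1_c (B1 - {0}) (\<lambda>x :: real^'n::finite. h (norm x))"
    and "grad (\<lambda>x :: real^'n::finite. h (norm x)) x = (h' (norm x) / norm x) *\<^sub>R x"
proof -
  obtain a b where ab: "0 < a" "a < b" "b < 1" "\<And>r. r \<notin> {a..b} \<Longrightarrow> h r = 0" "\<And>r. r \<notin> {a..b} \<Longrightarrow> h' r = 0"
    "\<And>r. (h has_real_derivative h' r) (at r)" "continuous_on UNIV h'" using test1E[OF h] by metis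
  let ?K = "{x :: real^'n. a \<le> norm x \<and> norm x \<le> b}"
  have K: "closed ?K" by (intro closed_Collect_conj closed_Collect_le continuous_intros)
  have "((\<lambda>x. h (norm x)) has_derivative (\<lambda>d. ((h' (norm x) / norm x) *\<^sub>R x) \<bullet> d)) (at x)" for x :: "real^'n"
  proof (cases "x = 0")
    case False
    then show ?thesis by (intro has_derivative_radial ab)
  next
    case True
    have "((\<lambda>x. 0 :: real) has_derivative (\<lambda>d. 0)) (at x)" by simp
    then have "((\<lambda>x. h (norm x)) has_derivative (\<lambda>d. 0)) (at x)"
      by (rule has_derivative_transform_within_open[of _ _ _ UNIV "- ?K"]) (use True ab K in auto)
    then show ?thesis using True by simp
  qed
  moreover have "continuous_on UNIV (\<lambda>x :: real^'n. (h' (norm x) / norm x) *\<^sub>R x)"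
  proof -
    have "continuous_on UNIV (\<lambda>x :: real^'n. h' (norm x))"
      by (rule continuous_on_compose2[OF ab(7)]) (auto intro!: continuous_intros)
    then have "continuous_on UNIV (\<lambda>x :: real^'n. (1 / norm x) * h' (norm x))"
      by (intro continuous_on_mult_compact_support[of "- {0}" ?K]) (use ab K in \<open>auto intro!: continuous_intros\<close>)
    then have "continuous_on UNIV (\<lambda>x :: real^'n. ((1 / norm x) * h' (norm x)) *\<^sub>R x)" by (rule continuous_on_scaleR) (rule continuous_on_id)
    then show ?thesis by simp
  qed
  ultimately have C: "C1_with (\<lambda>x :: real^'n. h (norm x)) (\<lambda>x. (h' (norm x) / norm x) *\<^sub>R x)"
    unfolding C1_with_def by blast
  show "grad (\<lambda>x :: real^'n. h (norm x)) x = (h' (norm x) / norm x) *\<^sub>R x" using C1_with_grad[OF C] by simp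
  have "bounded ?K" by (auto simp: bounded_iff)
  then have "compact ?K" using K by (simp add: compact_eq_bounded_closed)
  then show "C1_c (B1 - {0}) (\<lambda>x :: real^'n. h (norm x))"
    by (rule C1_cI[OF C]) (use ab in auto)
qed

section \<open>The one-dimensional quadratic forms\<close>

text \<open>Here \<open>q = u'/r\<close>, and \<open>ode\<close> is the equation in radial form. The condition on the flux
  \<open>r\<^sup>n q\<^sup>k\<close> says that \<open>u\<close> solves the equation across the origin, and not only in the punctured ball; \<open>energy\<close> is the
  integrability required of weak solutions, near the origin.\<close>

locale radial_core =
  fixes u :: "real^'n::finite \<Rightarrow> real" and v g g' q q' :: "real \<Rightarrow> real" and n k :: nat
  assumes n_def: "n = CARD('n)" and k: "1 \<le> k" "k \<le> n"
    and u: "\<And>x. x \<in> B1 \<Longrightarrow> u x = v (norm x)"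
    and v': "\<And>r. 0 < r \<Longrightarrow> r < 1 \<Longrightarrow> (v has_real_derivative r * q r) (at r)"
    and q': "\<And>r. 0 < r \<Longrightarrow> r < 1 \<Longrightarrow> (q has_real_derivative q' r) (at r)"
    and q_pos: "\<And>r. 0 < r \<Longrightarrow> r < 1 \<Longrightarrow> q r > 0"
    and g': "\<And>t. (g has_real_derivative g' t) (at t)" "continuous_on UNIV g'"
    and g_pos: "\<And>t. g t > 0"
    and ode: "\<And>r. 0 < r \<Longrightarrow> r < 1 \<Longrightarrow> c_nk n k * (real n * q r ^ k + real k * q r ^ (k - 1) * (r * q' r)) = g (v r)"
    and flux_lim: "((\<lambda>r. r ^ n * q r ^ k) \<longlongrightarrow> 0) (at_right 0)"
    and energy: "(\<integral>\<^sup>+r. indicator {0<..<1/2} r * ennreal (r ^ (n + 1) * q r ^ (k + 1)) \<partial>lborel) < \<infinity>"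
begin

abbreviation "c \<equiv> c_nk n k"

definition "\<beta> = (real k - 1) / (real k + 1)"
definition "\<gamma> = (2 * real n - real k - 1) / (real k + 1)"

definition Q_form :: "(real \<Rightarrow> real) \<Rightarrow> (real \<Rightarrow> real) \<Rightarrow> real \<Rightarrow> real" where
  "Q_form h h' r = real k * c * q r ^ (k - 1) * (h' r)\<^sup>2 + g' (v r) * (h r)\<^sup>2"

definition J_form :: "(real \<Rightarrow> real) \<Rightarrow> (real \<Rightarrow> real) \<Rightarrow> real \<Rightarrow> real" where
  "J_form h h' r = q r ^ (k + 1) * ((r * h' r)\<^sup>2 + 2 * \<beta> * h r * (r * h' r) - \<gamma> * (h r)\<^sup>2)"

lemma n_pos: "n \<ge> 1" using k by simp

lemma c_pos: "c > 0"
  using k by (simp add: c_nk_def zero_less_binomial)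

lemma \<beta>_bounds: "0 \<le> \<beta>" "\<beta> \<le> 1" using k by (auto simp: \<beta>_def)

lemma \<gamma>_nonneg: "0 \<le> \<gamma>" using k by (auto simp: \<gamma>_def)

lemma continuous_v: "continuous_on {0<..<1} v"
  by (rule DERIV_continuous_on[where D="\<lambda>r. r * q r"]) (auto intro: DERIV_subset v')

lemma continuous_q: "continuous_on {0<..<1} q"
  by (rule DERIV_continuous_on[where D=q']) (auto intro: DERIV_subset q')

lemma continuous_g: "continuous_on A g"
  by (rule DERIV_continuous_on[where D=g']) (auto intro: DERIV_subset g')

lemma continuous_q': "continuous_on {0<..<1} q'"
proof (rule continuous_on_eq)
  show "continuous_on {0<..<1} (\<lambda>r. (g (v r) / c - real n * q r ^ k) / (real k * q r ^ (k - 1) * r))"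
    using q_pos[THEN less_imp_neq] k c_pos
    by (intro continuous_intros continuous_q continuous_on_compose2[OF continuous_g continuous_v, of UNIV]) auto
  fix r :: real assume "r \<in> {0<..<1}"
  then have r: "0 < r" "r < 1" by auto
  show "(g (v r) / c - real n * q r ^ k) / (real k * q r ^ (k - 1) * r) = q' r"
    using ode[OF r] q_pos[OF r] k c_pos r by (simp add: field_simps)
qed

lemma continuous_g'v: "continuous_on {0<..<1} (\<lambda>r. g' (v r))"
  by (rule continuous_on_compose2[OF g'(2) continuous_v]) auto

lemma forms_compact_support:
  assumes "test1 h h'"
  shows "continuous_on UNIV (Q_form h h')" "continuous_on UNIV (J_form h h')"
    "\<exists>a b. 0 < a \<and> a < b \<and> b < 1 \<and> (\<forall>r. r \<notin> {a..b} \<longrightarrow> Q_form h h' r = 0 \<and> J_form h h' r = 0)"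
proof -
  obtain a b where ab: "0 < a" "a < b" "b < 1" "\<And>r. r \<notin> {a..b} \<Longrightarrow> h r = 0" "\<And>r. r \<notin> {a..b} \<Longrightarrow> h' r = 0"
    and h: "continuous_on UNIV h" "continuous_on UNIV h'"
    using test1E[OF assms] by metis
  show "\<exists>a b. 0 < a \<and> a < b \<and> b < 1 \<and> (\<forall>r. r \<notin> {a..b} \<longrightarrow> Q_form h h' r = 0 \<and> J_form h h' r = 0)"
    using ab by (intro exI[of _ a] exI[of _ b]) (simp add: Q_form_def J_form_def)
  have sub: "{a..b} \<subseteq> {0<..<1}" using ab by auto
  have "continuous_on UNIV (\<lambda>r. (real k * c * q r ^ (k - 1)) * (h' r)\<^sup>2)" "continuous_on UNIV (\<lambda>r. g' (v r) * (h r)\<^sup>2)"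
    by (rule continuous_on_mult_compact_support[OF open_greaterThanLessThan _ sub];
        use ab in \<open>auto intro!: continuous_intros continuous_q continuous_g'v h\<close>)+
  then show "continuous_on UNIV (Q_form h h')" unfolding Q_form_def by (rule continuous_on_add)
  show "continuous_on UNIV (J_form h h')"
    unfolding J_form_def
    by (rule continuous_on_mult_compact_support[OF open_greaterThanLessThan _ sub])
      (use ab in \<open>auto intro!: continuous_intros continuous_q h\<close>)
qed

text \<open>The substitution \<open>h = u'\<eta>\<close>, with \<open>u' = r q\<close>, turns the stability form into the weighted form: the
  differentiated equation shows that the integrands differ by the derivative of
  \<open>\<eta>\<^sup>2 r\<^sup>n q (g(v) - c (n - 2k/(k+1)) q\<^sup>k)\<close>. The first summand removes \<open>g'\<close>, the second one
  the terms in which \<open>q'\<close> is multiplied with \<open>\<eta>\<^sup>2\<close>.\<close>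

lemma Q_minus_J_derivative:
  assumes r: "0 < r" "r < 1" and \<eta>: "(\<eta> has_real_derivative \<eta>' r) (at r)"
    and h: "h r = r * q r * \<eta> r" and h': "h' r = (q r + r * q' r) * \<eta> r + r * q r * \<eta>' r"
  shows "((\<lambda>r. (\<eta> r)\<^sup>2 * r ^ n * q r * (g (v r) - c * (real n - 2 * real k / (real k + 1)) * q r ^ k))
     has_real_derivative (Q_form h h' r * r ^ (n - 1) - real k * c * (J_form \<eta> \<eta>' r * r ^ (n - 1)))) (at r)"
proof -
  define A where "A = real n - 2 * real k / (real k + 1)"
  define R K where "R = r ^ (n - 1)" and "K = q r ^ (k - 1)"
  have Rn: "r ^ n = r * R" "q r ^ k = q r * K" "q r ^ (k + 1) = q r * q r * K"
    using n_pos k by (auto simp: R_def K_def power_eq_if)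
  have gv: "((\<lambda>r. g (v r)) has_real_derivative g' (v r) * (r * q r)) (at r)"
    by (rule DERIV_chain2[OF g'(1) v'[OF r]])
  have G: "g (v r) = c * (real n * (q r * K) + real k * K * (r * q' r))"
    using ode[OF r] Rn by (simp add: K_def)
  define N kk where "N = real n" and "kk = real k"
  have kk: "kk + 1 \<noteq> 0" by (simp add: kk_def)
  have "((\<lambda>r. (\<eta> r)\<^sup>2 * r ^ n * q r * (g (v r) - c * A * q r ^ k)) has_real_derivative
     (2 * \<eta> r * \<eta>' r * (r * R) * q r + (\<eta> r)\<^sup>2 * (N * R) * q r + (\<eta> r)\<^sup>2 * (r * R) * q' r) * (g (v r) - c * A * (q r * K))
      + (\<eta> r)\<^sup>2 * (r * R) * q r * (g' (v r) * (r * q r) - c * A * (kk * K * q' r))) (at r)"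
    by (rule derivative_eq_intros \<eta> q'[OF r] gv refl)+
      (simp add: Rn flip: R_def K_def N_def kk_def, simp add: N_def kk_def R_def K_def algebra_simps power2_eq_square)
  moreover have "(2 * \<eta> r * \<eta>' r * (r * R) * q r + (\<eta> r)\<^sup>2 * (N * R) * q r + (\<eta> r)\<^sup>2 * (r * R) * q' r) * (g (v r) - c * A * (q r * K))
      + (\<eta> r)\<^sup>2 * (r * R) * q r * (g' (v r) * (r * q r) - c * A * (kk * K * q' r))
     = Q_form h h' r * R - kk * c * (J_form \<eta> \<eta>' r * R)"
  proof -
    have A: "(kk + 1) * A = N * (kk + 1) - 2 * kk" using kk by (simp add: A_def N_def kk_def field_simps)
    have B: "(kk + 1) * \<beta> = kk - 1" "(kk + 1) * \<gamma> = 2 * N - kk - 1"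
      using kk by (simp_all add: \<beta>_def \<gamma>_def N_def kk_def)
    have Qf: "Q_form h h' r = kk * c * K * ((q r + r * q' r) * \<eta> r + r * q r * \<eta>' r)\<^sup>2 + g' (v r) * (r * q r * \<eta> r)\<^sup>2"
      by (simp add: Q_form_def h h' K_def kk_def)
    have Jf: "J_form \<eta> \<eta>' r = q r * q r * K * ((r * \<eta>' r)\<^sup>2 + 2 * \<beta> * \<eta> r * (r * \<eta>' r) - \<gamma> * (\<eta> r)\<^sup>2)"
      unfolding J_form_def Rn(3) ..
    have G': "g (v r) = c * (N * (q r * K) + kk * K * (r * q' r))" using G by (simp add: N_def kk_def)
    have "(kk + 1) * ((2 * \<eta> r * \<eta>' r * (r * R) * q r + (\<eta> r)\<^sup>2 * (N * R) * q r + (\<eta> r)\<^sup>2 * (r * R) * q' r) * (g (v r) - c * A * (q r * K))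
      + (\<eta> r)\<^sup>2 * (r * R) * q r * (g' (v r) * (r * q r) - c * A * (kk * K * q' r))
      - (Q_form h h' r * R - kk * c * (J_form \<eta> \<eta>' r * R))) = 0"
      unfolding Qf Jf G' using A B by algebra
    then show ?thesis using kk by simp
  qed
  ultimately show ?thesis by (simp add: A_def R_def kk_def)
qed

lemma forms_integrable:
  assumes "test1 h h'"
  shows "integrable lborel (\<lambda>r. indicator {0<..} r * (Q_form h h' r * r ^ m))"
    and "integrable lborel (\<lambda>r. indicator {0<..} r * (J_form h h' r * r ^ m))"
proof -
  obtain a b where ab: "0 < a" "a < b" "b < 1" "\<And>r. r \<notin> {a..b} \<Longrightarrow> Q_form h h' r = 0 \<and> J_form h h' r = 0"
    using forms_compact_support(3)[OF assms] by blast
  have eq: "indicator {0<..} r * (Q_form h h' r * r ^ m) = Q_form h h' r * r ^ m"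
     "indicator {0<..} r * (J_form h h' r * r ^ m) = J_form h h' r * r ^ m" for r
    using ab(4)[of r] ab(1) by (auto simp: indicator_def)
  have c: "continuous_on UNIV (\<lambda>r. Q_form h h' r * r ^ m)" "continuous_on UNIV (\<lambda>r. J_form h h' r * r ^ m)"
    by (intro continuous_on_mult continuous_on_power continuous_on_id forms_compact_support assms)+
  show "integrable lborel (\<lambda>r. indicator {0<..} r * (Q_form h h' r * r ^ m))"
    unfolding eq by (rule integrable_continuous_bounded_support[OF c(1), of "{a..b}"]) (use ab in auto)
  show "integrable lborel (\<lambda>r. indicator {0<..} r * (J_form h h' r * r ^ m))"
    unfolding eq by (rule integrable_continuous_bounded_support[OF c(2), of "{a..b}"]) (use ab in auto)
qed

lemma integral_Q_eq_J:
  assumes \<eta>: "test1 \<eta> \<eta>'" and hh: "test1 h h'"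
    and h: "\<And>r. 0 < r \<Longrightarrow> r < 1 \<Longrightarrow> h r = r * q r * \<eta> r"
    and h': "\<And>r. 0 < r \<Longrightarrow> r < 1 \<Longrightarrow> h' r = (q r + r * q' r) * \<eta> r + r * q r * \<eta>' r"
  shows "(\<integral>r. indicator {0<..} r * (Q_form h h' r * r ^ (n - 1)) \<partial>lborel)
       = real k * c * (\<integral>r. indicator {0<..} r * (J_form \<eta> \<eta>' r * r ^ (n - 1)) \<partial>lborel)"
proof -
  obtain a b where ab: "0 < a" "a < b" "b < 1" "\<And>r. r \<notin> {a..b} \<Longrightarrow> Q_form h h' r = 0"
    using forms_compact_support(3)[OF hh] by blast
  obtain a' b' where ab': "0 < a'" "a' < b'" "b' < 1" "\<And>r. r \<notin> {a'..b'} \<Longrightarrow> J_form \<eta> \<eta>' r = 0"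
    using forms_compact_support(3)[OF \<eta>] by blast
  obtain a2 b2 where ab2: "0 < a2" "a2 < b2" "b2 < 1" "\<And>r. r \<notin> {a2..b2} \<Longrightarrow> \<eta> r = 0"
    "\<And>r. (\<eta> has_real_derivative \<eta>' r) (at r)"
    using test1E[OF \<eta>] by metis
  define l where "l = min a (min a' a2) / 2"
  define m where "m = (1 + max b (max b' b2)) / 2"
  have lm: "0 < l" "l < a" "l < a'" "l < a2" "b < m" "b' < m" "b2 < m" "m < 1" "l \<le> m"
    using ab ab' ab2 by (auto simp: l_def m_def)
  have eq: "indicator {0<..} r * (Q_form h h' r * r ^ (n - 1)) = Q_form h h' r * r ^ (n - 1)"
     "indicator {0<..} r * (J_form \<eta> \<eta>' r * r ^ (n - 1)) = J_form \<eta> \<eta>' r * r ^ (n - 1)" for r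
    using ab(4)[of r] ab'(4)[of r] ab(1) ab'(1) by (auto simp: indicator_def)
  have cQ: "continuous_on UNIV (\<lambda>r. Q_form h h' r * r ^ (n - 1))" "continuous_on UNIV (\<lambda>r. J_form \<eta> \<eta>' r * r ^ (n - 1))"
    by (intro continuous_on_mult continuous_on_power continuous_on_id forms_compact_support hh \<eta>)+
  have iQ: "integrable lborel (\<lambda>r. Q_form h h' r * r ^ (n - 1))" "integrable lborel (\<lambda>r. J_form \<eta> \<eta>' r * r ^ (n - 1))"
    using forms_integrable(1)[OF hh, of "n - 1"] forms_integrable(2)[OF \<eta>, of "n - 1"] unfolding eq .
  define B where "B r = (\<eta> r)\<^sup>2 * r ^ n * q r * (g (v r) - c * (real n - 2 * real k / (real k + 1)) * q r ^ k)" for r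
  define D where "D r = Q_form h h' r * r ^ (n - 1) - real k * c * (J_form \<eta> \<eta>' r * r ^ (n - 1))" for r
  have "(\<integral>r. D r * indicator {l..m} r \<partial>lborel) = B m - B l"
  proof (rule integral_FTC_Icc_real[OF lm(9)])
    fix r assume "l \<le> r" "r \<le> m"
    then have r: "0 < r" "r < 1" using lm by auto
    show "(B has_real_derivative D r) (at r)"
      unfolding B_def D_def
      by (rule Q_minus_J_derivative[where r=r and \<eta>=\<eta> and \<eta>'=\<eta>' and h=h and h'=h', OF r ab2(5) h[OF r] h'[OF r]])
    have "continuous_on UNIV D" unfolding D_def by (intro continuous_intros cQ)
    then show "isCont D r" by (simp add: continuous_on_eq_continuous_at)
  qed
  also have "B m - B l = 0" using ab2(4)[of m] ab2(4)[of l] lm by (simp add: B_def)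
  also have "(\<lambda>r. D r * indicator {l..m} r) = D"
  proof
    fix r
    show "D r * indicator {l..m} r = D r"
    proof (cases "r \<in> {l..m}")
      case False
      then have "r \<notin> {a..b}" "r \<notin> {a'..b'}" using lm by auto
      then show ?thesis using ab(4) ab'(4) by (simp add: D_def)
    qed simp
  qed
  finally have "(\<integral>r. D r \<partial>lborel) = 0" .
  then show "(\<integral>r. indicator {0<..} r * (Q_form h h' r * r ^ (n - 1)) \<partial>lborel)
       = real k * c * (\<integral>r. indicator {0<..} r * (J_form \<eta> \<eta>' r * r ^ (n - 1)) \<partial>lborel)"
    unfolding eq D_def using iQ by simp
qed

definition Q_nonneg :: bool where
  "Q_nonneg \<longleftrightarrow> (\<forall>h h'. test1 h h' \<longrightarrow> 0 \<le> (\<integral>r. indicator {0<..} r * (Q_form h h' r * r ^ (n - 1)) \<partial>lborel))"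

definition J_nonneg :: bool where
  "J_nonneg \<longleftrightarrow> (\<forall>h h'. test1 h h' \<longrightarrow> 0 \<le> (\<integral>r. indicator {0<..} r * (J_form h h' r * r ^ (n - 1)) \<partial>lborel))"

text \<open>As \<open>u' = r q\<close> is positive and of class \<open>C\<^sup>1\<close>, multiplication by it is a bijection of the test functions.\<close>

lemma Q_nonneg_iff_J_nonneg: "Q_nonneg \<longleftrightarrow> J_nonneg"
proof
  assume Q: Q_nonneg
  show J_nonneg
    unfolding J_nonneg_def
  proof (intro allI impI)
    fix \<eta> \<eta>' assume \<eta>: "test1 \<eta> \<eta>'"
    obtain a b where ab: "0 < a" "a < b" "b < 1" "\<And>r. r \<notin> {a..b} \<Longrightarrow> \<eta> r = 0" "\<And>r. r \<notin> {a..b} \<Longrightarrow> \<eta>' r = 0"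
      "\<And>r. (\<eta> has_real_derivative \<eta>' r) (at r)" "continuous_on UNIV \<eta>" "continuous_on UNIV \<eta>'"
      using test1E[OF \<eta>] by metis
    let ?h = "\<lambda>r. r * q r * \<eta> r" and ?h' = "\<lambda>r. (q r + r * q' r) * \<eta> r + r * q r * \<eta>' r"
    have h: "test1 ?h ?h'"
    proof (rule test1I[OF ab(1-3)])
      fix r :: real assume r: "0 < r" "r < 1"
      show "(?h has_real_derivative ?h' r) (at r)"
        by (rule derivative_eq_intros q'[OF r] ab(6) refl)+ (simp add: algebra_simps)
    next
      show "continuous_on {0<..<1} ?h'"
        using ab(7,8) by (intro continuous_intros continuous_q continuous_q') (auto intro: continuous_on_subset)
    qed (use ab in auto)
    have "0 \<le> real k * c * (\<integral>r. indicator {0<..} r * (J_form \<eta> \<eta>' r * r ^ (n - 1)) \<partial>lborel)"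
    proof -
      have "0 \<le> (\<integral>r. indicator {0<..} r * (Q_form ?h ?h' r * r ^ (n - 1)) \<partial>lborel)"
        using Q h unfolding Q_nonneg_def by blast
      then show ?thesis unfolding integral_Q_eq_J[OF \<eta> h refl refl] .
    qed
    moreover have "0 < real k * c" using k c_pos by simp
    ultimately show "0 \<le> (\<integral>r. indicator {0<..} r * (J_form \<eta> \<eta>' r * r ^ (n - 1)) \<partial>lborel)"
      using mult_pos_neg linorder_not_less by metis
  qed
next
  assume J: J_nonneg
  show Q_nonneg
    unfolding Q_nonneg_def
  proof (intro allI impI)
    fix h h' assume hh: "test1 h h'"
    obtain a b where ab: "0 < a" "a < b" "b < 1" "\<And>r. r \<notin> {a..b} \<Longrightarrow> h r = 0" "\<And>r. r \<notin> {a..b} \<Longrightarrow> h' r = 0"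
      "\<And>r. (h has_real_derivative h' r) (at r)" "continuous_on UNIV h" "continuous_on UNIV h'"
      using test1E[OF hh] by metis
    let ?\<eta> = "\<lambda>r. h r / (r * q r)" and ?\<eta>' = "\<lambda>r. (h' r * (r * q r) - h r * (q r + r * q' r)) / (r * q r)\<^sup>2"
    have \<eta>: "test1 ?\<eta> ?\<eta>'"
    proof (rule test1I[OF ab(1-3)])
      fix r :: real assume r: "0 < r" "r < 1"
      then show "(?\<eta> has_real_derivative ?\<eta>' r) (at r)"
        using q_pos[OF r] by (auto intro!: derivative_eq_intros q' ab simp: power2_eq_square algebra_simps)
    next
      show "continuous_on {0<..<1} ?\<eta>'"
        using ab(7,8) q_pos by (intro continuous_intros continuous_q continuous_q') (auto intro: continuous_on_subset simp: less_imp_neq[symmetric])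
    qed (use ab in auto)
    have "(\<integral>r. indicator {0<..} r * (Q_form h h' r * r ^ (n - 1)) \<partial>lborel) = real k * c * (\<integral>r. indicator {0<..} r * (J_form ?\<eta> ?\<eta>' r * r ^ (n - 1)) \<partial>lborel)"
    proof (rule integral_Q_eq_J[OF \<eta> hh])
      fix r :: real assume r: "0 < r" "r < 1"
      then have z: "r * q r \<noteq> 0" using q_pos[OF r] by simp
      then show "h r = r * q r * ?\<eta> r" by simp
      show "h' r = (q r + r * q' r) * ?\<eta> r + r * q r * ?\<eta>' r"
        using z unfolding power2_eq_square by (simp add: divide_simps)
    qed
    then show "0 \<le> (\<integral>r. indicator {0<..} r * (Q_form h h' r * r ^ (n - 1)) \<partial>lborel)"
      using J \<eta> k c_pos unfolding J_nonneg_def by simp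
  qed
qed

end

section \<open>Reduction to rays\<close>

context radial_core
begin

definition Qn :: "(real^'n \<Rightarrow> real) \<Rightarrow> real^'n \<Rightarrow> real" where
  "Qn \<phi> x = real k * c * q (norm x) ^ (k - 1) * (((1 / norm x) *\<^sub>R x) \<bullet> grad \<phi> x)\<^sup>2 + g' (v (norm x)) * (\<phi> x)\<^sup>2"

definition Jn :: "(real^'n \<Rightarrow> real) \<Rightarrow> real^'n \<Rightarrow> real" where
  "Jn \<phi> x = q (norm x) ^ (k + 1) * ((x \<bullet> grad \<phi> x)\<^sup>2 + 2 * \<beta> * \<phi> x * (x \<bullet> grad \<phi> x) - \<gamma> * (\<phi> x)\<^sup>2)"

lemma continuous_on_norm_compose:
  assumes "continuous_on {0<..<1} f"
  shows "continuous_on (B1 - {0} :: (real^'n) set) (\<lambda>x. f (norm x))"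
  by (rule continuous_on_compose2[OF assms]) (auto intro!: continuous_intros)

lemma open_punctured_ball: "open (B1 - {0} :: (real^'n) set)"
  by (simp add: open_delete)

lemma Qn_Jn_integrable:
  assumes \<phi>: "C1_c (B1 - {0}) \<phi>"
  shows "integrable lborel (Qn \<phi>)" "integrable lborel (Jn \<phi>)"
    "\<And>x. x \<notin> B1 \<Longrightarrow> Qn \<phi> x = 0" "\<And>x. x \<notin> B1 \<Longrightarrow> Jn \<phi> x = 0"
proof -
  obtain K where K: "C1_with \<phi> (grad \<phi>)" "compact K" "K \<subseteq> B1 - {0}" "\<And>x. x \<notin> K \<Longrightarrow> \<phi> x = 0" "\<And>x. x \<notin> K \<Longrightarrow> grad \<phi> x = 0"
    using C1_cE[OF \<phi>] by metis
  have c: "continuous_on UNIV \<phi>" "continuous_on UNIV (grad \<phi>)"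
    using C1_with_continuous[OF K(1)] K(1) unfolding C1_with_def by auto
  note prodc = continuous_on_mult_compact_support[OF open_punctured_ball compact_imp_closed[OF K(2)] K(3)]
  have "continuous_on UNIV (\<lambda>x. (real k * c * q (norm x) ^ (k - 1) * (1 / norm x)\<^sup>2) * (x \<bullet> grad \<phi> x)\<^sup>2)"
    by (rule prodc) (use K(5) in \<open>auto intro!: continuous_intros continuous_on_norm_compose[OF continuous_q] c\<close>)
  moreover have "continuous_on UNIV (\<lambda>x. g' (v (norm x)) * (\<phi> x)\<^sup>2)"
    by (rule prodc) (use K(4) in \<open>auto intro!: continuous_intros continuous_on_norm_compose[OF continuous_g'v] c\<close>)
  ultimately have "continuous_on UNIV (\<lambda>x. (real k * c * q (norm x) ^ (k - 1) * (1 / norm x)\<^sup>2) * (x \<bullet> grad \<phi> x)\<^sup>2 + g' (v (norm x)) * (\<phi> x)\<^sup>2)"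
    by (rule continuous_on_add)
  moreover have "Qn \<phi> = (\<lambda>x. (real k * c * q (norm x) ^ (k - 1) * (1 / norm x)\<^sup>2) * (x \<bullet> grad \<phi> x)\<^sup>2 + g' (v (norm x)) * (\<phi> x)\<^sup>2)"
    by (rule ext) (simp add: Qn_def power_mult_distrib power_divide)
  ultimately have cQ: "continuous_on UNIV (Qn \<phi>)" by simp
  have cJ: "continuous_on UNIV (Jn \<phi>)"
    unfolding Jn_def by (rule prodc) (use K(4,5) in \<open>auto intro!: continuous_intros continuous_on_norm_compose[OF continuous_q] c\<close>)
  have z: "Qn \<phi> x = 0" "Jn \<phi> x = 0" if "x \<notin> K" for x using K(4,5)[OF that] by (simp_all add: Qn_def Jn_def)
  show "integrable lborel (Qn \<phi>)" "integrable lborel (Jn \<phi>)"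
    using integrable_continuous_bounded_support[OF cQ compact_imp_bounded[OF K(2)] z(1)]
      integrable_continuous_bounded_support[OF cJ compact_imp_bounded[OF K(2)] z(2)] by auto
  show "\<And>x. x \<notin> B1 \<Longrightarrow> Qn \<phi> x = 0" "\<And>x. x \<notin> B1 \<Longrightarrow> Jn \<phi> x = 0" using z K(3) by blast+
qed

lemma Qn_Jn_ray:
  assumes "norm w = 1"
  shows "indicator {0<..} r * (Qn \<phi> (r *\<^sub>R w) * r ^ m) = indicator {0<..} r *
      (Q_form (\<lambda>r. indicator {0<..} r * \<phi> (r *\<^sub>R w)) (\<lambda>r. indicator {0<..} r * (w \<bullet> grad \<phi> (r *\<^sub>R w))) r * r ^ m)"
    and "indicator {0<..} r * (Jn \<phi> (r *\<^sub>R w) * r ^ m) = indicator {0<..} r *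
      (J_form (\<lambda>r. indicator {0<..} r * \<phi> (r *\<^sub>R w)) (\<lambda>r. indicator {0<..} r * (w \<bullet> grad \<phi> (r *\<^sub>R w))) r * r ^ m)"
  using assms by (auto simp: indicator_def Qn_def Jn_def Q_form_def J_form_def)

lemma rays_nonneg:
  assumes \<phi>: "C1_c (B1 - {0}) \<phi>"
  shows "Q_nonneg \<Longrightarrow> 0 \<le> (\<integral>x. Qn \<phi> x \<partial>lborel)" "J_nonneg \<Longrightarrow> 0 \<le> (\<integral>x. Jn \<phi> x \<partial>lborel)"
proof -
  have d: "DIM(real^'n) - 1 = n - 1" by (simp add: n_def)
  assume Q: Q_nonneg
  show "0 \<le> (\<integral>x. Qn \<phi> x \<partial>lborel)"
  proof (rule integral_nonneg_if_rays_nonneg[OF Qn_Jn_integrable(1)[OF \<phi>]], unfold d)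
    fix w :: "real^'n" assume w: "norm w = 1"
    show "integrable lborel (\<lambda>r. indicator {0<..} r * (Qn \<phi> (r *\<^sub>R w) * r ^ (n - 1)))"
      "0 \<le> (\<integral>r. indicator {0<..} r * (Qn \<phi> (r *\<^sub>R w) * r ^ (n - 1)) \<partial>lborel)"
      unfolding Qn_Jn_ray[OF w] using forms_integrable(1)[OF test1_ray[OF \<phi> w]] Q test1_ray[OF \<phi> w] unfolding Q_nonneg_def by blast+
  qed
next
  have d: "DIM(real^'n) - 1 = n - 1" by (simp add: n_def)
  assume J: J_nonneg
  show "0 \<le> (\<integral>x. Jn \<phi> x \<partial>lborel)"
  proof (rule integral_nonneg_if_rays_nonneg[OF Qn_Jn_integrable(2)[OF \<phi>]], unfold d)
    fix w :: "real^'n" assume w: "norm w = 1"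
    show "integrable lborel (\<lambda>r. indicator {0<..} r * (Jn \<phi> (r *\<^sub>R w) * r ^ (n - 1)))"
      "0 \<le> (\<integral>r. indicator {0<..} r * (Jn \<phi> (r *\<^sub>R w) * r ^ (n - 1)) \<partial>lborel)"
      unfolding Qn_Jn_ray[OF w] using forms_integrable(2)[OF test1_ray[OF \<phi> w]] J test1_ray[OF \<phi> w] unfolding J_nonneg_def by blast+
  qed
qed

lemma Qn_Jn_radial:
  assumes h: "test1 h h'"
  shows "Qn (\<lambda>x. h (norm x)) x = Q_form h h' (norm x)" "Jn (\<lambda>x. h (norm x)) x = J_form h h' (norm x)"
proof -
  obtain a b where ab: "0 < a" "\<And>r. r \<notin> {a..b} \<Longrightarrow> h r = 0" "\<And>r. r \<notin> {a..b} \<Longrightarrow> h' r = 0"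
    using test1E[OF h] by metis
  have G: "x \<bullet> grad (\<lambda>x. h (norm x)) x = norm x * h' (norm x)" for x :: "real^'n"
    unfolding C1_c_radial(2)[OF h] by (simp add: dot_square_norm power2_eq_square)
  show "Jn (\<lambda>x. h (norm x)) x = J_form h h' (norm x)" unfolding Jn_def G J_form_def ..
  show "Qn (\<lambda>x. h (norm x)) x = Q_form h h' (norm x)"
    using ab(3)[of 0] ab(1) by (cases "x = 0") (auto simp: Qn_def Q_form_def inner_scaleR_left G)
qed

lemma radial_nonneg_imp:
  assumes h: "test1 h h'"
  shows "0 \<le> (\<integral>x. Qn (\<lambda>x. h (norm x)) x \<partial>lborel) \<Longrightarrow> 0 \<le> (\<integral>r. indicator {0<..} r * (Q_form h h' r * r ^ (n - 1)) \<partial>lborel)"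
    and "0 \<le> (\<integral>x. Jn (\<lambda>x. h (norm x)) x \<partial>lborel) \<Longrightarrow> 0 \<le> (\<integral>r. indicator {0<..} r * (J_form h h' r * r ^ (n - 1)) \<partial>lborel)"
proof -
  have d: "DIM(real^'n) - 1 = n - 1" by (simp add: n_def)
  note i = Qn_Jn_integrable[OF C1_c_radial(1)[OF h]]
  note m = borel_measurable_continuous_onI[OF forms_compact_support(1)[OF h]] borel_measurable_continuous_onI[OF forms_compact_support(2)[OF h]]
  show "0 \<le> (\<integral>x. Qn (\<lambda>x. h (norm x)) x \<partial>lborel) \<Longrightarrow> 0 \<le> (\<integral>r. indicator {0<..} r * (Q_form h h' r * r ^ (n - 1)) \<partial>lborel)"
    using integral_radial_nonneg[where 'a="real^'n", OF m(1)] i(1) forms_integrable(1)[OF h]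
    unfolding d Qn_Jn_radial[OF h, abs_def] by blast
  show "0 \<le> (\<integral>x. Jn (\<lambda>x. h (norm x)) x \<partial>lborel) \<Longrightarrow> 0 \<le> (\<integral>r. indicator {0<..} r * (J_form h h' r * r ^ (n - 1)) \<partial>lborel)"
    using integral_radial_nonneg[where 'a="real^'n", OF m(2)] i(2) forms_integrable(2)[OF h]
    unfolding d Qn_Jn_radial[OF h, abs_def] by blast
qed

section \<open>Semistability\<close>

lemma stability_quadratic_form:
  assumes x: "x \<in> B1" "x \<noteq> 0"
  obtains \<tau> where "\<tau> \<ge> 0" "\<And>a. (\<Sum>i\<in>UNIV. \<Sum>j\<in>UNIV. a $ i * a $ j * Sij k (hessian u x) i j)
      = real k * c * q (norm x) ^ (k - 1) * (((1 / norm x) *\<^sub>R x) \<bullet> a)\<^sup>2 + \<tau> * (a \<bullet> a - (((1 / norm x) *\<^sub>R x) \<bullet> a)\<^sup>2)"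
proof -
  let ?e = "(1 / norm x) *\<^sub>R x"
  have r: "0 < norm x" "norm x < 1" using x by auto
  have H: "hessian u x = radial_matrix (q (norm x)) (norm x * q' (norm x)) ?e"
    by (rule hessian_radial[OF u v' q' x])
  have e: "?e \<bullet> ?e = 1" using x by (simp add: dot_square_norm power2_eq_square)
  have k': "k \<le> CARD('n)" using k n_def by simp
  have pos: "S k (radial_matrix (q (norm x)) (norm x * q' (norm x)) ?e) > 0"
    unfolding S_radial_matrix[OF k(1) k' e] using ode[OF r] g_pos[of "v (norm x)"] by (simp add: n_def)
  obtain \<tau> where "\<tau> \<ge> 0" "\<And>a. (\<Sum>i\<in>UNIV. \<Sum>j\<in>UNIV. a $ i * a $ j * Sij k (hessian u x) i j)
      = real k * c_nk CARD('n) k * q (norm x) ^ (k - 1) * (?e \<bullet> a)\<^sup>2 + \<tau> * (a \<bullet> a - (?e \<bullet> a)\<^sup>2)"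
    using Sij_radial_matrix[OF k(1) k' e q_pos[OF r] pos] unfolding H by blast
  then show ?thesis using that by (simp add: n_def)
qed

text \<open>Dropping the tangential part of the form does not increase it, and does not change it on radial test
  functions. What remains is an inequality along each ray.\<close>

lemma semistable_iff_Q_nonneg: "semistable k g u \<longleftrightarrow> Q_nonneg"
proof
  have dg: "deriv g = g'" using g'(1) DERIV_imp_deriv by blast
  {
    assume st: "semistable k g u"
    show Q_nonneg
      unfolding Q_nonneg_def
    proof (intro allI impI)
      fix h h' assume h: "test1 h h'"
      let ?\<phi> = "\<lambda>x :: real^'n. h (norm x)"
      note C = C1_c_radial(1)[OF h, where 'n='n]
      obtain a b where ab: "0 < a" "\<And>r. r \<notin> {a..b} \<Longrightarrow> h r = 0" "\<And>r. r \<notin> {a..b} \<Longrightarrow> h' r = 0"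
        using test1E[OF h] by metis
      have "0 \<le> (LINT x|lebesgue_on B1. (\<Sum>i\<in>UNIV. \<Sum>j\<in>UNIV. partial i ?\<phi> x * partial j ?\<phi> x * Sij k (hessian u x) i j) + deriv g (u x) * (?\<phi> x)\<^sup>2)"
        using st C unfolding semistable_def by blast
      also have "\<dots> = (\<integral>x. Qn ?\<phi> x \<partial>lborel)"
      proof (rule lebesgue_on_transfer(2))
        show "AE x in lebesgue. x \<in> B1 \<longrightarrow> (\<Sum>i\<in>UNIV. \<Sum>j\<in>UNIV. partial i ?\<phi> x * partial j ?\<phi> x * Sij k (hessian u x) i j) + deriv g (u x) * (?\<phi> x)\<^sup>2 = Qn ?\<phi> x"
        proof (rule AE_I2, rule impI)
          fix x :: "real^'n" assume x: "x \<in> B1"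
          have p: "partial i ?\<phi> x = grad ?\<phi> x $ i" for i by (simp add: grad_def)
          show "(\<Sum>i\<in>UNIV. \<Sum>j\<in>UNIV. partial i ?\<phi> x * partial j ?\<phi> x * Sij k (hessian u x) i j) + deriv g (u x) * (?\<phi> x)\<^sup>2 = Qn ?\<phi> x"
          proof (cases "x = 0")
            case True
            then show ?thesis using ab(2)[of 0] ab(1) unfolding p C1_c_radial(2)[OF h] Qn_def by simp
          next
            case False
            obtain \<tau> where \<tau>: "\<And>a. (\<Sum>i\<in>UNIV. \<Sum>j\<in>UNIV. a $ i * a $ j * Sij k (hessian u x) i j)
              = real k * c * q (norm x) ^ (k - 1) * (((1 / norm x) *\<^sub>R x) \<bullet> a)\<^sup>2 + \<tau> * (a \<bullet> a - (((1 / norm x) *\<^sub>R x) \<bullet> a)\<^sup>2)"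
              using stability_quadratic_form[OF x False] by blast
            have "grad ?\<phi> x \<bullet> grad ?\<phi> x = (((1 / norm x) *\<^sub>R x) \<bullet> grad ?\<phi> x)\<^sup>2"
              unfolding C1_c_radial(2)[OF h] using False by (simp add: dot_square_norm power2_eq_square)
            then show ?thesis unfolding p \<tau> Qn_def dg u[OF x] by simp
          qed
        qed
        show "Qn ?\<phi> \<in> borel_measurable borel" using Qn_Jn_integrable(1)[OF C] by auto
      qed (use Qn_Jn_integrable(3)[OF C] in auto)
      finally show "0 \<le> (\<integral>r. indicator {0<..} r * (Q_form h h' r * r ^ (n - 1)) \<partial>lborel)"
        by (rule radial_nonneg_imp(1)[OF h])
    qed
  }
  assume Q: Q_nonneg
  show "semistable k g u"
    unfolding semistable_def
  proof (intro allI impI)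
    fix \<phi> :: "real^'n \<Rightarrow> real" assume \<phi>: "C1_c (B1 - {0}) \<phi>"
    obtain K where K: "K \<subseteq> B1 - {0}" "\<And>x. x \<notin> K \<Longrightarrow> \<phi> x = 0" "\<And>x. x \<notin> K \<Longrightarrow> grad \<phi> x = 0"
      using C1_cE[OF \<phi>] by metis
    let ?F = "\<lambda>x. (\<Sum>i\<in>UNIV. \<Sum>j\<in>UNIV. partial i \<phi> x * partial j \<phi> x * Sij k (hessian u x) i j) + deriv g (u x) * (\<phi> x)\<^sup>2"
    have p: "partial i \<phi> x = grad \<phi> x $ i" for i x by (simp add: grad_def)
    have le: "Qn \<phi> x \<le> ?F x" if x: "x \<in> B1" for x
    proof (cases "x = 0")
      case True
      then have "x \<notin> K" using K(1) by auto
      then show ?thesis using K(2,3) by (simp add: p Qn_def)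
    next
      case False
      let ?e = "(1 / norm x) *\<^sub>R x"
      obtain \<tau> where \<tau>: "\<tau> \<ge> 0" "\<And>a. (\<Sum>i\<in>UNIV. \<Sum>j\<in>UNIV. a $ i * a $ j * Sij k (hessian u x) i j)
          = real k * c * q (norm x) ^ (k - 1) * (?e \<bullet> a)\<^sup>2 + \<tau> * (a \<bullet> a - (?e \<bullet> a)\<^sup>2)"
        using stability_quadratic_form[OF x False] by blast
      have "\<bar>?e \<bullet> grad \<phi> x\<bar> \<le> norm ?e * norm (grad \<phi> x)" by (rule Cauchy_Schwarz_ineq2)
      then have "(?e \<bullet> grad \<phi> x)\<^sup>2 \<le> (norm (grad \<phi> x))\<^sup>2" using False by (simp add: abs_le_square_iff[symmetric])
      then have "0 \<le> \<tau> * (grad \<phi> x \<bullet> grad \<phi> x - (?e \<bullet> grad \<phi> x)\<^sup>2)" using \<tau>(1) by (simp add: dot_square_norm)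
      then show ?thesis unfolding p \<tau>(2) Qn_def dg u[OF x] by simp
    qed
    have m: "Qn \<phi> \<in> borel_measurable borel" using Qn_Jn_integrable(1)[OF \<phi>] by auto
    note tr = lebesgue_on_transfer(2,3)[of "B1 :: (real^'n) set" "Qn \<phi>" "Qn \<phi>", OF _ m Qn_Jn_integrable(3)[OF \<phi>]]
    show "0 \<le> (LINT x|lebesgue_on B1. ?F x)"
    proof (cases "integrable (lebesgue_on B1) ?F")
      case True
      have "0 \<le> (LINT x|lebesgue_on B1. Qn \<phi> x)" using tr rays_nonneg(1)[OF \<phi> Q] by simp
      also have "\<dots> \<le> (LINT x|lebesgue_on B1. ?F x)"
        by (rule integral_mono[OF _ True]) (use tr Qn_Jn_integrable(1)[OF \<phi>] le in auto)
      finally show ?thesis .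
    qed (simp add: not_integrable_integral_eq)
  qed
qed

end

section \<open>Integrability of the weight at the origin\<close>

text \<open>An inner cut-off with \<open>0 \<le> r d/dr \<le> 1\<close> uniformly in \<open>\<delta>\<close>.\<close>

definition cutoff_in :: "real \<Rightarrow> real \<Rightarrow> real" where
  "cutoff_in \<delta> r = pos_sq (1 - \<delta> / r)"

text \<open>The logarithmic derivative \<open>r d/dr\<close> of \<^term>\<open>cutoff_in\<close>.\<close>

definition cutoff_in_deriv :: "real \<Rightarrow> real \<Rightarrow> real" where
  "cutoff_in_deriv \<delta> r = 2 * max 0 (1 - \<delta> / r) * (\<delta> / r)"

lemma cutoff_in_has_derivative:
  "r > 0 \<Longrightarrow> (cutoff_in \<delta> has_real_derivative cutoff_in_deriv \<delta> r / r) (at r)"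
  unfolding cutoff_in_def cutoff_in_deriv_def
  by (auto intro!: derivative_eq_intros simp: power2_eq_square field_simps)

lemma cutoff_in_bounds:
  assumes "r > 0" "\<delta> > 0"
  shows "0 \<le> cutoff_in \<delta> r" "cutoff_in \<delta> r \<le> 1" "0 \<le> cutoff_in_deriv \<delta> r" "cutoff_in_deriv \<delta> r \<le> 1"
proof -
  define t where "t = \<delta> / r"
  have t: "t > 0" using assms by (simp add: t_def)
  then have m: "0 \<le> max 0 (1 - t)" "max 0 (1 - t) \<le> 1" by auto
  show "0 \<le> cutoff_in \<delta> r" by (simp add: cutoff_in_def)
  show "cutoff_in \<delta> r \<le> 1" unfolding cutoff_in_def pos_sq_def t_def[symmetric] using m by (simp add: power_le_one)
  show "0 \<le> cutoff_in_deriv \<delta> r" unfolding cutoff_in_deriv_def t_def[symmetric] using t by simp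
  show "cutoff_in_deriv \<delta> r \<le> 1"
  proof (cases "t \<le> 1")
    case True
    have "0 \<le> (2 * t - 1)\<^sup>2" by simp
    then have "2 * (1 - t) * t \<le> 1" by (simp add: power2_eq_square algebra_simps)
    then show ?thesis unfolding cutoff_in_deriv_def t_def[symmetric] using True by (simp add: max_def)
  next
    case False
    then show ?thesis unfolding cutoff_in_deriv_def t_def[symmetric] by (simp add: max_def)
  qed
qed

lemma cutoff_in_eq_0: "0 < r \<Longrightarrow> r \<le> \<delta> \<Longrightarrow> cutoff_in \<delta> r = 0 \<and> cutoff_in_deriv \<delta> r = 0"
  by (simp add: cutoff_in_def cutoff_in_deriv_def pos_sq_eq_0 field_simps max_def)

definition cutoff_out :: "real \<Rightarrow> real" where
  "cutoff_out r = pos_sq (1 - 16 * pos_sq (r - 1/2))"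

definition cutoff_out_deriv :: "real \<Rightarrow> real" where
  "cutoff_out_deriv r = 2 * max 0 (1 - 16 * pos_sq (r - 1/2)) * (- (32 * max 0 (r - 1/2)))"

lemma cutoff_out_has_derivative: "(cutoff_out has_real_derivative cutoff_out_deriv r) (at r)"
  unfolding cutoff_out_def cutoff_out_deriv_def by (auto intro!: derivative_eq_intros)

lemma cutoff_out_eq:
  "r \<le> 1/2 \<Longrightarrow> cutoff_out r = 1 \<and> cutoff_out_deriv r = 0"
  "3/4 \<le> r \<Longrightarrow> cutoff_out r = 0 \<and> cutoff_out_deriv r = 0"
proof -
  show "r \<le> 1/2 \<Longrightarrow> cutoff_out r = 1 \<and> cutoff_out_deriv r = 0"
    by (simp add: cutoff_out_def cutoff_out_deriv_def pos_sq_eq_0) (simp add: pos_sq_def)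
  assume "3/4 \<le> r"
  then have "(1/4)\<^sup>2 \<le> pos_sq (r - 1/2)" unfolding pos_sq_def by (intro power_mono) auto
  then have "1 - 16 * pos_sq (r - 1/2) \<le> 0" by (simp add: power2_eq_square)
  then show "cutoff_out r = 0 \<and> cutoff_out_deriv r = 0"
    by (simp add: cutoff_out_def cutoff_out_deriv_def pos_sq_eq_0 max_def)
qed

lemma cutoff_out_bounds:
  "0 \<le> cutoff_out r" "cutoff_out r \<le> 1" "r \<le> 1 \<Longrightarrow> \<bar>cutoff_out_deriv r\<bar> \<le> 32"
proof -
  have p: "0 \<le> pos_sq (r - 1/2)" by simp
  have m: "0 \<le> max 0 (1 - 16 * pos_sq (r - 1/2))" "max 0 (1 - 16 * pos_sq (r - 1/2)) \<le> 1" using p by auto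
  show "0 \<le> cutoff_out r" by (simp add: cutoff_out_def)
  show "cutoff_out r \<le> 1" unfolding cutoff_out_def pos_sq_def[of "1 - _"] using m by (simp add: power_le_one)
  assume r: "r \<le> 1"
  have "\<bar>cutoff_out_deriv r\<bar> = 2 * max 0 (1 - 16 * pos_sq (r - 1/2)) * (32 * max 0 (r - 1/2))"
    unfolding cutoff_out_deriv_def abs_mult abs_minus_cancel using m by simp
  also have "\<dots> \<le> 2 * 1 * (32 * (1/2))" using m r by (intro mult_mono) (auto simp: max_def)
  finally show "\<bar>cutoff_out_deriv r\<bar> \<le> 32" by simp
qed

lemma flux_has_derivative:
  assumes nk: "1 \<le> n" "1 \<le> k" and c: "c \<noteq> 0" and q: "(q has_real_derivative q') (at r)"
    and ode: "c * (real n * q r ^ k + real k * q r ^ (k - 1) * (r * q')) = G"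
  shows "((\<lambda>r. r ^ n * q r ^ k) has_real_derivative r ^ (n - 1) * G / c) (at r)"
proof -
  have p: "r ^ n = r * r ^ (n - 1)" "q r ^ k = q r * q r ^ (k - 1)" using nk by (auto simp: power_eq_if)
  have "((\<lambda>r. r ^ n * q r ^ k) has_real_derivative (real n * r ^ (n - 1) * q r ^ k + r ^ n * (real k * q r ^ (k - 1) * q'))) (at r)"
    by (rule derivative_eq_intros q refl)+ (simp add: algebra_simps)
  moreover have "real n * r ^ (n - 1) * q r ^ k + r ^ n * (real k * q r ^ (k - 1) * q') = r ^ (n - 1) * G / c"
    using ode[symmetric] c by (simp add: p(1) field_simps)
  ultimately show ?thesis by simp
qed

context radial_core
begin

definition flux :: "real \<Rightarrow> real" where
  "flux r = r ^ n * q r ^ k"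

lemma flux_derivative:
  assumes r: "0 < r" "r < 1"
  shows "(flux has_real_derivative r ^ (n - 1) * g (v r) / c) (at r)"
  unfolding flux_def by (rule flux_has_derivative[OF n_pos k(1) _ q'[OF r] ode[OF r]]) (use c_pos in simp)

lemma v_mono:
  assumes "0 < r" "r \<le> s" "s < 1"
  shows "v r \<le> v s"
proof (rule DERIV_nonneg_imp_nondecreasing[OF assms(2)])
  fix x assume "r \<le> x" "x \<le> s"
  then show "\<exists>y. (v has_real_derivative y) (at x) \<and> 0 \<le> y"
    using assms v'[of x] q_pos[of x] by (intro exI[of _ "x * q x"]) auto
qed

text \<open>Below the borderline dimension \<open>n = 2k\<close> the monotone flux \<open>r\<^sup>n q\<^sup>k\<close> makes \<open>u\<close> bounded at the
  origin; as the flux vanishes at the origin it is then of order \<open>r\<^sup>n\<close>, so that \<open>q\<close> is bounded.\<close>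

lemma q_bounded_low_dimension:
  assumes nk: "n < 2 * k"
  obtains M where "\<And>r. 0 < r \<Longrightarrow> r \<le> 1/2 \<Longrightarrow> q r \<le> M"
proof -
  define D where "D = flux (1/2)"
  have flux_le: "flux r \<le> D" if r: "0 < r" "r \<le> 1/2" for r
    unfolding D_def
  proof (rule DERIV_nonneg_imp_nondecreasing[OF r(2)])
    fix x :: real assume "r \<le> x" "x \<le> 1/2"
    then show "\<exists>y. (flux has_real_derivative y) (at x) \<and> 0 \<le> y"
      using r flux_derivative[of x] g_pos[of "v x"] c_pos by (intro exI[of _ "x ^ (n - 1) * g (v x) / c"]) auto
  qed
  have D: "D > 0" using q_pos[of "1/2"] by (simp add: D_def flux_def)
  define s where "s = 1 - real n / real k"
  have s: "s + 1 > 0" using nk k by (simp add: s_def field_simps)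
  define E where "E = D powr (1 / real k)"
  have E: "E > 0" using D by (simp add: E_def)
  have q_le: "r * q r \<le> E * r powr s" if r: "0 < r" "r \<le> 1/2" for r
  proof -
    have qr: "q r > 0" using q_pos r by auto
    have "q r = (q r ^ k) powr (1 / real k)" using qr k by (simp add: powr_powr flip: powr_realpow)
    also have "\<dots> \<le> (D * r powr (- real n)) powr (1 / real k)"
    proof (rule powr_mono2)
      have "r ^ n > 0" using r by simp
      then have "q r ^ k \<le> D / r ^ n" using flux_le[OF r] by (simp add: flux_def field_simps)
      also have "\<dots> = D * r powr (- real n)"
        unfolding powr_minus powr_realpow[OF r(1)] divide_inverse ..
      finally show "q r ^ k \<le> D * r powr (- real n)" .
    qed (use qr in auto)
    also have "\<dots> = E * r powr (- real n / real k)" using D r by (simp add: E_def powr_mult powr_powr)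
    finally have "r * q r \<le> r * (E * r powr (- real n / real k))" using r by (intro mult_left_mono) auto
    also have "\<dots> = E * (r powr 1 * r powr (- real n / real k))" using r by simp
    also have "r powr 1 * r powr (- real n / real k) = r powr s" unfolding powr_add[symmetric] by (simp add: s_def)
    finally show ?thesis .
  qed
  define vm where "vm = v (1/2) - E / (s + 1) * (1/2) powr (s + 1)"
  have v_ge: "vm \<le> v r" if r: "0 < r" "r \<le> 1/2" for r
  proof -
    have "v (1/2) - E / (s + 1) * (1/2) powr (s + 1) \<le> v r - E / (s + 1) * r powr (s + 1)"
    proof (rule DERIV_nonpos_imp_nonincreasing[OF r(2)])
      fix x :: real assume x: "r \<le> x" "x \<le> 1/2"
      then have x0: "0 < x" "x < 1" using r by auto
      have "((\<lambda>x. v x - E / (s + 1) * x powr (s + 1)) has_real_derivative x * q x - E / (s + 1) * ((s + 1) * x powr (s + 1 - 1))) (at x)"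
        using x0 by (auto intro!: derivative_eq_intros v')
      moreover have "x * q x - E / (s + 1) * ((s + 1) * x powr (s + 1 - 1)) \<le> 0"
        using q_le[of x] x r s by simp
      ultimately show "\<exists>y. ((\<lambda>x. v x - E / (s + 1) * x powr (s + 1)) has_real_derivative y) (at x) \<and> y \<le> 0" by blast
    qed
    moreover have "0 \<le> E / (s + 1) * r powr (s + 1)" using E s by simp
    ultimately show ?thesis unfolding vm_def by linarith
  qed
  have "bounded (g ` {vm..v (1/2)})" by (intro compact_imp_bounded compact_continuous_image continuous_g compact_Icc)
  then obtain G where G0: "\<forall>y\<in>g ` {vm..v (1/2)}. norm y \<le> G" unfolding bounded_iff by blast
  have G: "g t \<le> G" if "vm \<le> t" "t \<le> v (1/2)" for t
  proof -
    have "norm (g t) \<le> G" using G0 that by auto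
    then show ?thesis by simp
  qed
  define Y where "Y = G / (real n * c)"
  have flux_le2: "flux r \<le> Y * r ^ n" if r: "0 < r" "r \<le> 1/2" for r
  proof -
    have dec: "flux r - Y * r ^ n \<le> flux t - Y * t ^ n" if t: "0 < t" "t \<le> r" for t
    proof (rule DERIV_nonpos_imp_nonincreasing[OF t(2)])
      fix x :: real assume x: "t \<le> x" "x \<le> r"
      then have x0: "0 < x" "x < 1" "x \<le> 1/2" using r t by auto
      have "((\<lambda>x. flux x - Y * x ^ n) has_real_derivative x ^ (n - 1) * g (v x) / c - Y * (real n * x ^ (n - 1))) (at x)"
        using x0 by (auto intro!: derivative_eq_intros flux_derivative)
      moreover have "x ^ (n - 1) * g (v x) / c \<le> x ^ (n - 1) * G / c"
        using G[OF v_ge[of x] v_mono[of x "1/2"]] x0 c_pos by (intro divide_right_mono mult_left_mono) auto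
      moreover have "x ^ (n - 1) * G / c = Y * (real n * x ^ (n - 1))" using n_pos c_pos by (simp add: Y_def)
      ultimately show "\<exists>y. ((\<lambda>x. flux x - Y * x ^ n) has_real_derivative y) (at x) \<and> y \<le> 0" by fastforce
    qed
    have "((\<lambda>t. flux t - Y * t ^ n) \<longlongrightarrow> 0 - Y * 0 ^ n) (at_right 0)"
      using flux_lim unfolding flux_def by (intro tendsto_intros)
    then have "((\<lambda>t. flux t - Y * t ^ n) \<longlongrightarrow> 0) (at_right 0)" using n_pos by (simp add: power_0_left)
    moreover have "\<forall>\<^sub>F t in at_right 0. flux r - Y * r ^ n \<le> flux t - Y * t ^ n"
      using r by (intro eventually_at_rightI[of 0 r]) (auto intro: dec)
    ultimately have "flux r - Y * r ^ n \<le> 0" by (rule tendsto_lowerbound) simp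
    then show ?thesis by simp
  qed
  have "q r \<le> 1 + \<bar>Y\<bar>" if r: "0 < r" "r \<le> 1/2" for r
  proof (cases "q r \<le> 1")
    case False
    have "r ^ n > 0" using r by simp
    then have "q r ^ k \<le> Y" using flux_le2[OF r] by (simp add: flux_def mult.commute[of "r ^ n"])
    moreover have "q r ^ 1 \<le> q r ^ k" using False k by (intro power_increasing) auto
    ultimately show ?thesis by simp
  qed simp
  then show ?thesis using that by blast
qed

text \<open>From the borderline dimension on, the test functions \<open>\<eta> = r/(r + \<epsilon>)\<close>, cut off at the origin and
  near the boundary, satisfy \<open>0 \<le> r\<eta>' \<le> \<eta>\<close>, and the form is pointwise nonpositive near the origin because
  \<open>1 + 2\<beta> \<le> \<gamma>\<close>. Its nonnegativity bounds the weighted mass away from the origin uniformly in \<open>\<epsilon>\<close>.\<close>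

lemma mass_bound_high_dimension:
  assumes J: J_nonneg and nk: "2 * k \<le> n"
  obtains M where "M \<ge> 0" "\<And>\<epsilon>. 0 < \<epsilon> \<Longrightarrow> \<epsilon> < 1/4 \<Longrightarrow>
    (\<integral>\<^sup>+r. indicator {\<epsilon>..<1/2} r * ennreal (q r ^ (k + 1) * r ^ (n - 1)) \<partial>lborel) \<le> ennreal M"
proof -
  have \<gamma>: "1 + 2 * \<beta> \<le> \<gamma>"
  proof -
    have "\<gamma> - (1 + 2 * \<beta>) = (2 * real n - 4 * real k) / (real k + 1)"
    proof -
      have "(2 * real n - real k - 1) / K - (1 + 2 * ((real k - 1) / K)) = ((2 * real n - real k - 1) - (K + 2 * (real k - 1))) / K"
        if "K \<noteq> 0" for K :: real
        using that by (simp add: diff_divide_distrib add_divide_distrib)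
      from this[of "real k + 1"] show ?thesis by (simp add: \<beta>_def \<gamma>_def)
    qed
    moreover have "2 * real k \<le> real n" using nk by (metis of_nat_le_iff of_nat_mult of_nat_numeral)
    then have "0 \<le> (2 * real n - 4 * real k) / (real k + 1)" by (intro divide_nonneg_nonneg) auto
    ultimately show ?thesis by linarith
  qed
  have "compact (q ` {1/2..3/4})"
    by (intro compact_continuous_image continuous_on_subset[OF continuous_q]) auto
  then have "bounded (q ` {1/2..3/4})" by (rule compact_imp_bounded)
  then obtain Mq where Mq0: "\<forall>y\<in>q ` {1/2..3/4}. norm y \<le> Mq" unfolding bounded_iff by blast
  have Mq: "q r ^ (k + 1) \<le> \<bar>Mq\<bar> ^ (k + 1)" if "1/2 \<le> r" "r \<le> 3/4" for r
  proof (rule power_mono)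
    have "norm (q r) \<le> Mq" using Mq0 that by auto
    then show "q r \<le> \<bar>Mq\<bar>" by simp
    show "0 \<le> q r" using q_pos[of r] that by simp
  qed
  define C0 where "C0 = 2000 * \<bar>Mq\<bar> ^ (k + 1)"
  have C0: "C0 \<ge> 0" by (simp add: C0_def)
  define W where "W r = q r ^ (k + 1) * r ^ (n - 1)" for r
  have W0: "W r \<ge> 0" if "0 < r" "r < 1" for r using q_pos[OF that] that by (simp add: W_def)
  have cW: "continuous_on {0<..<1} W" unfolding W_def by (intro continuous_intros continuous_q)
  show ?thesis
  proof (rule that[of "128 * C0"])
    show "128 * C0 \<ge> 0" using C0 by simp
    fix \<epsilon> :: real assume \<epsilon>: "0 < \<epsilon>" "\<epsilon> < 1/4"
    let ?I = "{\<epsilon>..<1/2}"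
    have iW: "integrable lborel (\<lambda>r. indicator ?I r * W r)"
    proof -
      have "integrable lborel (\<lambda>r. indicator {\<epsilon>..1/2} r *\<^sub>R W r)"
        by (rule borel_integrable_compact) (use \<epsilon> cW in \<open>auto intro: continuous_on_subset\<close>)
      from integrable_mult_indicator[OF _ this, of ?I] show ?thesis
        by (rule Bochner_Integration.integrable_cong[THEN iffD1, rotated 2]) (auto simp: indicator_def)
    qed
    define E where "E r = indicator {0<..<1/2} r * (r ^ 2 * W r)" for r
    have Em: "E \<in> borel_measurable borel"
    proof -
      have "(\<lambda>r. indicator {0<..<1/2} r *\<^sub>R (r ^ 2 * W r)) \<in> borel_measurable borel"
        by (rule borel_measurable_continuous_on_indicator)
          (use cW in \<open>auto intro!: continuous_intros intro: continuous_on_subset\<close>)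
      then show ?thesis by (simp add: E_def[abs_def])
    qed
    have E0: "E r \<ge> 0" for r using W0[of r] by (auto simp: E_def indicator_def)
    have Ei: "integrable lborel E"
    proof (rule integrableI_nonneg)
      have "(\<integral>\<^sup>+r. ennreal (E r) \<partial>lborel) = (\<integral>\<^sup>+r. indicator {0<..<1/2} r * ennreal (r ^ (n + 1) * q r ^ (k + 1)) \<partial>lborel)"
      proof (rule nn_integral_cong)
        fix r :: real
        have "r ^ (n + 1) = r ^ 2 * r ^ (n - 1)" using n_pos by (simp flip: power_add)
        then show "ennreal (E r) = indicator {0<..<1/2} r * ennreal (r ^ (n + 1) * q r ^ (k + 1))"
          by (auto simp: E_def W_def indicator_def algebra_simps)
      qed
      then show "(\<integral>\<^sup>+r. ennreal (E r) \<partial>lborel) < \<infinity>" using energy by simp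
    qed (use Em E0 in auto)
    define \<delta> where "\<delta> m = \<epsilon> / (real m + 2)" for m :: nat
    have \<delta>: "0 < \<delta> m" "2 * \<delta> m \<le> \<epsilon>" for m using \<epsilon> by (auto simp: \<delta>_def field_simps)
    have \<delta>0: "\<delta> \<longlonglongrightarrow> 0" unfolding \<delta>_def by real_asymp
    have main: "(\<integral>r. indicator ?I r * W r \<partial>lborel) \<le> 128 * (C0 * (1/4) + 5 / \<epsilon>\<^sup>2 * (\<integral>r. cutoff_in_deriv (\<delta> m) r * E r \<partial>lborel))" for m
    proof -
      define X where "X = cutoff_in_deriv (\<delta> m)"
      \<comment> \<open>\<open>t\<close> is the logarithmic derivative \<open>r \<rho>' / \<rho>\<close>\<close>
      define t where "t r = \<epsilon> / (r + \<epsilon>)" for r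
      define \<rho> where "\<rho> r = r / (r + \<epsilon>)" for r
      define \<eta> where "\<eta> r = indicator {0<..} r * (cutoff_in (\<delta> m) r * \<rho> r * cutoff_out r)" for r
      define P where "P r = X r * \<rho> r * cutoff_out r + cutoff_in (\<delta> m) r * (t r * \<rho> r) * cutoff_out r
          + cutoff_in (\<delta> m) r * \<rho> r * (r * cutoff_out_deriv r)" for r
      define \<eta>' where "\<eta>' r = indicator {0<..} r * (P r / r)" for r
      have small: "\<eta> r = 0" "\<eta>' r = 0" if "r \<notin> {\<delta> m..3/4}" for r
      proof -
        have "\<eta> r = 0 \<and> \<eta>' r = 0"
        proof (cases "r > 0")
          case True
          consider "r \<le> \<delta> m" | "3/4 \<le> r" using \<open>r \<notin> {\<delta> m..3/4}\<close> by force
          then show ?thesis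
            by cases (use cutoff_in_eq_0[OF True] cutoff_out_eq(2) in \<open>auto simp: \<eta>_def \<eta>'_def P_def X_def\<close>)
        qed (simp add: \<eta>_def \<eta>'_def)
        then show "\<eta> r = 0" "\<eta>' r = 0" by auto
      qed
      have T: "test1 \<eta> \<eta>'"
      proof (rule test1I[of "\<delta> m" "3/4"])
        fix r :: real assume r: "0 < r" "r < 1"
        have \<rho>d: "(\<rho> has_real_derivative t r * \<rho> r / r) (at r)"
          unfolding \<rho>_def[abs_def] using r \<epsilon>
          by (auto intro!: derivative_eq_intros simp: t_def \<rho>_def divide_simps power2_eq_square)
        have "((\<lambda>r. cutoff_in (\<delta> m) r * \<rho> r * cutoff_out r) has_real_derivative P r / r) (at r)"
          by (rule derivative_eq_intros cutoff_in_has_derivative[OF r(1)] \<rho>d cutoff_out_has_derivative refl)+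
            (use r in \<open>simp add: P_def X_def field_simps\<close>)
        then have "(\<eta> has_real_derivative P r / r) (at r)"
          by (rule has_field_derivative_transform_within_open[of _ _ _ "{0<..}"]) (use r in \<open>auto simp: \<eta>_def\<close>)
        then show "(\<eta> has_real_derivative \<eta>' r) (at r)" using r by (simp add: \<eta>'_def)
      next
        have "continuous_on {0<..<1} (\<lambda>r. P r / r)"
          unfolding P_def X_def cutoff_in_def cutoff_in_deriv_def t_def \<rho>_def cutoff_out_def cutoff_out_deriv_def
          using \<epsilon> by (intro continuous_intros) auto
        then show "continuous_on {0<..<1} \<eta>'" by (rule continuous_on_eq) (auto simp: \<eta>'_def)
      qed (use small \<delta>[of m] \<epsilon> in auto)
      \<comment> \<open>On \<open>[\<epsilon>, 1/2)\<close> the inner cut-off is at least \<open>1/4\<close> and \<open>\<rho> \<ge> 1/2\<close>, so that the form is below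
        a fixed negative multiple of the weight. The outer cut-off contributes on \<open>[1/2, 3/4]\<close> only; the term with \<open>X\<close>,
        from the inner one, is absorbed by the energy because \<open>\<rho> \<le> r/\<epsilon>\<close>.\<close>
      have key: "(1/128) * (indicator ?I r * W r) + indicator {0<..} r * (J_form \<eta> \<eta>' r * r ^ (n - 1))
          \<le> C0 * indicator {1/2..3/4} r + 5 / \<epsilon>\<^sup>2 * (X r * E r)" for r
      proof (cases "r \<in> {\<delta> m..3/4}")
        case False
        have "0 \<le> X r * E r"
        proof (cases "r > 0")
          case True
          then show ?thesis using cutoff_in_bounds(3)[OF True \<delta>(1)[of m]] E0[of r] by (simp add: X_def)
        qed (simp add: E_def)
        then have "0 \<le> 5 / \<epsilon>\<^sup>2 * (X r * E r)" by simp
        moreover have "indicator ?I r = (0 :: real)" using False \<delta>[of m] \<epsilon> by (auto simp: indicator_def)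
        moreover have "0 \<le> C0 * indicator {1/2..3/4} r" using C0 by (simp add: indicator_def)
        ultimately show ?thesis using small[OF False] by (simp add: J_form_def)
      next
        case rin: True
        then have r: "0 < r" "r < 1" "r \<le> 3/4" "\<delta> m \<le> r" using \<delta>(1)[of m] by auto
        define \<theta> where "\<theta> = cutoff_in (\<delta> m) r"
        have b: "0 \<le> \<theta>" "\<theta> \<le> 1" "0 \<le> X r" "X r \<le> 1"
          using cutoff_in_bounds[OF r(1) \<delta>(1)[of m]] by (auto simp: \<theta>_def X_def)
        have t: "0 \<le> t r" "t r \<le> 1" "0 \<le> \<rho> r" "\<rho> r \<le> 1" using r \<epsilon> by (auto simp: t_def \<rho>_def divide_le_eq)
        have Jr: "indicator {0<..} r * (J_form \<eta> \<eta>' r * r ^ (n - 1)) = W r * ((P r)\<^sup>2 + 2 * \<beta> * \<eta> r * P r - \<gamma> * (\<eta> r)\<^sup>2)"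
          using r by (simp add: J_form_def \<eta>'_def W_def)
        have \<eta>r: "\<eta> r = \<theta> * \<rho> r * cutoff_out r" using r by (simp add: \<eta>_def \<theta>_def)
        have Wr: "0 \<le> W r" using W0 r by blast
        show ?thesis
        proof (cases "r < 1/2")
          case True
          then have out: "cutoff_out r = 1" "cutoff_out_deriv r = 0" using cutoff_out_eq(1)[of r] by auto
          have P: "P r = \<rho> r * (X r + \<theta> * t r)" by (simp add: P_def out \<theta>_def algebra_simps)
          have a1: "(X r)\<^sup>2 \<le> X r" using b by (simp add: power2_eq_square mult_left_le_one_le)
          have a2: "X r * (\<theta> * t r) \<le> X r * 1" using b t by (intro mult_left_mono mult_le_one) auto
          have a3: "\<beta> * \<theta> * X r \<le> 1 * 1 * X r" using b \<beta>_bounds by (intro mult_right_mono mult_mono) auto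
          have e1: "(X r + \<theta> * t r)\<^sup>2 + 2 * \<beta> * \<theta> * (X r + \<theta> * t r) - \<gamma> * \<theta>\<^sup>2
              \<le> 5 * X r + \<theta>\<^sup>2 * ((t r)\<^sup>2 + 2 * \<beta> * t r - \<gamma>)"
            using a1 a2 a3 by (simp add: power2_eq_square algebra_simps)
          have e2: "\<theta>\<^sup>2 * (\<rho> r)\<^sup>2 * ((t r)\<^sup>2 + 2 * \<beta> * t r - \<gamma>) \<le> - (1/128) * indicator ?I r"
          proof (cases "\<epsilon> \<le> r")
            case eps: True
            have t2: "t r \<le> 1/2" "1/2 \<le> \<rho> r" using eps \<epsilon> r by (auto simp: t_def \<rho>_def field_simps)
            have "\<beta> * t r \<le> \<beta> * (1/2)" using t2 \<beta>_bounds by (intro mult_left_mono) auto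
            moreover have "(t r)\<^sup>2 \<le> (1/2)\<^sup>2" using t t2 by (intro power_mono) auto
            ultimately have s1: "(t r)\<^sup>2 + 2 * \<beta> * t r - \<gamma> \<le> - (3/4)" using \<gamma> \<beta>_bounds by (simp add: power2_eq_square)
            have "1/2 \<le> 1 - \<delta> m / r" using \<delta>[of m] eps r by (simp add: field_simps)
            then have "1/2 \<le> max 0 (1 - \<delta> m / r)" by (simp add: le_max_iff_disj)
            then have "(1/2)\<^sup>2 \<le> \<theta>" unfolding \<theta>_def cutoff_in_def pos_sq_def by (rule power_mono) simp
            then have "((1/2)\<^sup>2)\<^sup>2 \<le> \<theta>\<^sup>2" by (rule power_mono) simp
            moreover have "(1/2)\<^sup>2 \<le> (\<rho> r)\<^sup>2" using t2 by (intro power_mono) auto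
            ultimately have "((1/2)\<^sup>2)\<^sup>2 * (1/2)\<^sup>2 \<le> \<theta>\<^sup>2 * (\<rho> r)\<^sup>2" by (intro mult_mono) auto
            then have s2: "1/64 \<le> \<theta>\<^sup>2 * (\<rho> r)\<^sup>2" by (simp add: power2_eq_square)
            have "\<theta>\<^sup>2 * (\<rho> r)\<^sup>2 * ((t r)\<^sup>2 + 2 * \<beta> * t r - \<gamma>) \<le> \<theta>\<^sup>2 * (\<rho> r)\<^sup>2 * (- (3/4))"
              by (intro mult_left_mono s1) simp
            also have "\<dots> \<le> - (1/128)" using s2 by simp
            finally show ?thesis using eps True by simp
          next
            case False
            have "(t r)\<^sup>2 \<le> 1" using t by (simp add: power_le_one)
            moreover have "\<beta> * t r \<le> \<beta> * 1" using t \<beta>_bounds by (intro mult_left_mono) auto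
            ultimately have "(t r)\<^sup>2 + 2 * \<beta> * t r - \<gamma> \<le> 0" using \<gamma> by simp
            then have "\<theta>\<^sup>2 * (\<rho> r)\<^sup>2 * ((t r)\<^sup>2 + 2 * \<beta> * t r - \<gamma>) \<le> 0" by (intro mult_nonneg_nonpos) auto
            then show ?thesis using False by simp
          qed
          have "\<rho> r \<le> r / \<epsilon>" using r \<epsilon> by (simp add: \<rho>_def frac_le)
          then have e3: "(\<rho> r)\<^sup>2 \<le> r\<^sup>2 / \<epsilon>\<^sup>2" using t by (metis power_divide power_mono)
          have "(P r)\<^sup>2 + 2 * \<beta> * \<eta> r * P r - \<gamma> * (\<eta> r)\<^sup>2
             = (\<rho> r)\<^sup>2 * ((X r + \<theta> * t r)\<^sup>2 + 2 * \<beta> * \<theta> * (X r + \<theta> * t r) - \<gamma> * \<theta>\<^sup>2)"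
            unfolding P \<eta>r out by (simp add: power2_eq_square algebra_simps)
          also have "\<dots> \<le> (\<rho> r)\<^sup>2 * (5 * X r + \<theta>\<^sup>2 * ((t r)\<^sup>2 + 2 * \<beta> * t r - \<gamma>))"
            by (intro mult_left_mono e1) simp
          also have "\<dots> = (\<rho> r)\<^sup>2 * (5 * X r) + \<theta>\<^sup>2 * (\<rho> r)\<^sup>2 * ((t r)\<^sup>2 + 2 * \<beta> * t r - \<gamma>)"
            by (simp add: algebra_simps)
          also have "\<dots> \<le> r\<^sup>2 / \<epsilon>\<^sup>2 * (5 * X r) + - (1/128) * indicator ?I r"
            using b by (intro add_mono e2 mult_right_mono e3) auto
          finally have "W r * ((P r)\<^sup>2 + 2 * \<beta> * \<eta> r * P r - \<gamma> * (\<eta> r)\<^sup>2)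
              \<le> W r * (r\<^sup>2 / \<epsilon>\<^sup>2 * (5 * X r) + - (1/128) * indicator ?I r)"
            by (rule mult_left_mono[OF _ Wr])
          moreover have "E r = r\<^sup>2 * W r" using True r by (simp add: E_def)
          ultimately show ?thesis unfolding Jr using True by (simp add: algebra_simps)
        next
          case False
          then have ind: "indicator ?I r = (0 :: real)" "indicator {1/2..3/4} r = (1 :: real)" "E r = 0"
            using r by (auto simp: E_def)
          have Z: "0 \<le> cutoff_out r" "cutoff_out r \<le> 1" "\<bar>cutoff_out_deriv r\<bar> \<le> 32"
            using cutoff_out_bounds[of r] r by auto
          have h: "\<bar>\<eta> r\<bar> \<le> 1" unfolding \<eta>r abs_mult using b t Z by (intro mult_le_one) auto
          have p1: "\<bar>X r * \<rho> r * cutoff_out r\<bar> \<le> 1" unfolding abs_mult using b t Z by (intro mult_le_one) auto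
          have p2: "\<bar>\<theta> * (t r * \<rho> r) * cutoff_out r\<bar> \<le> 1" unfolding abs_mult using b t Z by (intro mult_le_one) auto
          have "\<bar>\<theta> * \<rho> r * (r * cutoff_out_deriv r)\<bar> \<le> 1 * (1 * 32)"
            unfolding abs_mult using b t Z r by (intro mult_mono mult_le_one) auto
          then have Pb: "\<bar>P r\<bar> \<le> 34" unfolding P_def \<theta>_def[symmetric] using p1 p2 by linarith
          have "(P r)\<^sup>2 \<le> 34\<^sup>2" using Pb abs_le_square_iff[of "P r" 34] by simp
          moreover have "\<bar>\<beta> * \<eta> r * P r\<bar> \<le> 1 * 1 * 34" unfolding abs_mult using \<beta>_bounds h Pb by (intro mult_mono) auto
          moreover have "0 \<le> \<gamma> * (\<eta> r)\<^sup>2" using \<gamma>_nonneg by simp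
          ultimately have "(P r)\<^sup>2 + 2 * \<beta> * \<eta> r * P r - \<gamma> * (\<eta> r)\<^sup>2 \<le> 2000" by (simp add: abs_le_iff)
          then have "W r * ((P r)\<^sup>2 + 2 * \<beta> * \<eta> r * P r - \<gamma> * (\<eta> r)\<^sup>2) \<le> W r * 2000" by (rule mult_left_mono[OF _ Wr])
          moreover have "W r \<le> \<bar>Mq\<bar> ^ (k + 1) * 1"
            unfolding W_def using Mq[of r] r False by (intro mult_mono power_le_one) auto
          ultimately show ?thesis unfolding Jr ind C0_def by simp
        qed
      qed
      have iX: "integrable lborel (\<lambda>r. X r * E r)"
      proof (rule Bochner_Integration.integrable_bound[OF Ei])
        have [measurable]: "E \<in> borel_measurable borel" by (rule Em)
        show "(\<lambda>r. X r * E r) \<in> borel_measurable lborel" unfolding X_def cutoff_in_deriv_def by measurable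
        show "AE r in lborel. norm (X r * E r) \<le> norm (E r)"
        proof (rule AE_I2)
          fix r :: real
          show "norm (X r * E r) \<le> norm (E r)"
          proof (cases "r > 0")
            case True
            then show ?thesis using cutoff_in_bounds(3,4)[OF True \<delta>(1)[of m]] E0[of r]
              by (simp add: abs_mult mult_left_le_one_le X_def)
          qed (simp add: E_def)
        qed
      qed
      have iJ: "integrable lborel (\<lambda>r. indicator {0<..} r * (J_form \<eta> \<eta>' r * r ^ (n - 1)))" by (rule forms_integrable(2)[OF T])
      have iC: "integrable lborel (\<lambda>r. indicator {1/2..3/4::real} r :: real)" by (intro integrable_real_indicator) auto
      have "(1/128) * (\<integral>r. indicator ?I r * W r \<partial>lborel) + (\<integral>r. indicator {0<..} r * (J_form \<eta> \<eta>' r * r ^ (n - 1)) \<partial>lborel)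
        = (\<integral>r. (1/128) * (indicator ?I r * W r) + indicator {0<..} r * (J_form \<eta> \<eta>' r * r ^ (n - 1)) \<partial>lborel)"
        using iW iJ by simp
      also have "\<dots> \<le> (\<integral>r. C0 * indicator {1/2..3/4} r + 5 / \<epsilon>\<^sup>2 * (X r * E r) \<partial>lborel)"
        by (rule integral_mono[OF _ _ key]) (use iW iJ iX iC in auto)
      also have "\<dots> = C0 * (1/4) + 5 / \<epsilon>\<^sup>2 * (\<integral>r. X r * E r \<partial>lborel)"
        using iX iC by (simp add: measure_def)
      finally have "(1/128) * (\<integral>r. indicator ?I r * W r \<partial>lborel) + (\<integral>r. indicator {0<..} r * (J_form \<eta> \<eta>' r * r ^ (n - 1)) \<partial>lborel)
         \<le> C0 * (1/4) + 5 / \<epsilon>\<^sup>2 * (\<integral>r. X r * E r \<partial>lborel)" .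
      moreover have "0 \<le> (\<integral>r. indicator {0<..} r * (J_form \<eta> \<eta>' r * r ^ (n - 1)) \<partial>lborel)"
        using J T unfolding J_nonneg_def by blast
      moreover have "A \<le> 128 * Z" if "(1/128) * A + B \<le> Z" "0 \<le> B" for A B Z :: real
        using that by linarith
      ultimately show ?thesis unfolding X_def by blast
    qed
    have "(\<lambda>m. \<integral>r. cutoff_in_deriv (\<delta> m) r * E r \<partial>lborel) \<longlonglongrightarrow> (\<integral>r. 0 \<partial>(lborel :: real measure))"
    proof (rule integral_dominated_convergence[OF _ _ Ei])
      have [measurable]: "E \<in> borel_measurable borel" by (rule Em)
      show "(\<lambda>r. cutoff_in_deriv (\<delta> m) r * E r) \<in> borel_measurable lborel" for m
        unfolding cutoff_in_deriv_def by measurable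
      show "AE r in lborel. (\<lambda>m. cutoff_in_deriv (\<delta> m) r * E r) \<longlonglongrightarrow> 0"
      proof (rule AE_I2)
        fix r :: real
        have "(\<lambda>m. \<delta> m / r) \<longlonglongrightarrow> 0"
          using tendsto_mult_left_zero[OF \<delta>0, of "inverse r"] by (simp add: divide_inverse)
        then have "(\<lambda>m. 2 * max 0 (1 - \<delta> m / r) * (\<delta> m / r) * E r) \<longlonglongrightarrow> 2 * max 0 (1 - 0) * 0 * E r"
          by (intro tendsto_intros)
        then show "(\<lambda>m. cutoff_in_deriv (\<delta> m) r * E r) \<longlonglongrightarrow> 0" by (simp add: cutoff_in_deriv_def)
      qed
      show "AE r in lborel. norm (cutoff_in_deriv (\<delta> m) r * E r) \<le> E r" for m
      proof (rule AE_I2)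
        fix r :: real
        show "norm (cutoff_in_deriv (\<delta> m) r * E r) \<le> E r"
        proof (cases "r > 0")
          case True
          then show ?thesis using cutoff_in_bounds(3,4)[OF True \<delta>(1)[of m]] E0[of r]
            by (simp add: abs_mult mult_left_le_one_le)
        qed (simp add: E_def)
      qed
    qed simp
    then have "(\<lambda>m. 128 * (C0 * (1/4) + 5 / \<epsilon>\<^sup>2 * (\<integral>r. cutoff_in_deriv (\<delta> m) r * E r \<partial>lborel))) \<longlonglongrightarrow> 128 * (C0 * (1/4) + 5 / \<epsilon>\<^sup>2 * 0)"
      by (intro tendsto_intros) simp
    then have "(\<integral>r. indicator ?I r * W r \<partial>lborel) \<le> 128 * (C0 * (1/4) + 5 / \<epsilon>\<^sup>2 * 0)"
      by (rule LIMSEQ_le_const) (use main in blast)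
    also have "\<dots> \<le> 128 * C0" using C0 by simp
    finally have "ennreal (\<integral>r. indicator ?I r * W r \<partial>lborel) \<le> ennreal (128 * C0)" by (rule ennreal_leI)
    moreover have "(\<integral>\<^sup>+r. indicator ?I r * ennreal (q r ^ (k + 1) * r ^ (n - 1)) \<partial>lborel) = (\<integral>\<^sup>+r. ennreal (indicator ?I r * W r) \<partial>lborel)"
      by (intro nn_integral_cong) (auto simp: W_def indicator_def)
    moreover have "\<dots> = ennreal (\<integral>r. indicator ?I r * W r \<partial>lborel)"
      by (rule nn_integral_eq_integral[OF iW]) (use W0 \<epsilon> in \<open>auto simp: indicator_def\<close>)
    ultimately show "(\<integral>\<^sup>+r. indicator ?I r * ennreal (q r ^ (k + 1) * r ^ (n - 1)) \<partial>lborel) \<le> ennreal (128 * C0)" by simp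
  qed
qed

text \<open>In either case the bound is uniform down to the origin: pointwise in low dimensions, and by
  monotone convergence in high dimensions.\<close>

lemma weight_integrable_origin:
  assumes J: J_nonneg
  shows "(\<integral>\<^sup>+r. indicator {0<..<1/2} r * ennreal (q r ^ (k + 1) * r ^ (n - 1)) \<partial>lborel) < \<infinity>"
proof (cases "n < 2 * k")
  case True
  obtain M where M: "\<And>r. 0 < r \<Longrightarrow> r \<le> 1/2 \<Longrightarrow> q r \<le> M" by (rule q_bounded_low_dimension[OF True]) (rule that)
  have "(\<integral>\<^sup>+r. indicator {0<..<1/2} r * ennreal (q r ^ (k + 1) * r ^ (n - 1)) \<partial>lborel)
     \<le> (\<integral>\<^sup>+r. ennreal (\<bar>M\<bar> ^ (k + 1)) * indicator {0<..<1/2::real} r \<partial>lborel)"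
  proof (rule nn_integral_mono)
    fix r :: real
    show "indicator {0<..<1/2} r * ennreal (q r ^ (k + 1) * r ^ (n - 1)) \<le> ennreal (\<bar>M\<bar> ^ (k + 1)) * indicator {0<..<1/2} r"
    proof (cases "r \<in> {0<..<1/2}")
      case True
      have "q r ^ (k + 1) * r ^ (n - 1) \<le> \<bar>M\<bar> ^ (k + 1) * 1"
        using True M[of r] q_pos[of r] by (intro mult_mono power_mono power_le_one) auto
      then show ?thesis using True by (simp add: ennreal_leI)
    qed simp
  qed
  also have "\<dots> = ennreal (\<bar>M\<bar> ^ (k + 1)) * emeasure lborel {0<..<1/2::real}" by (rule nn_integral_cmult_indicator) simp
  also have "\<dots> < \<infinity>"
    using emeasure_bounded_finite[of "{0<..<1/2::real}"] by (simp only: ennreal_mult_less_top infinity_ennreal_def) simp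
  finally show ?thesis .
next
  case False
  then have nk: "2 * k \<le> n" by simp
  obtain M where M: "M \<ge> 0" "\<And>\<epsilon>. 0 < \<epsilon> \<Longrightarrow> \<epsilon> < 1/4 \<Longrightarrow>
    (\<integral>\<^sup>+r. indicator {\<epsilon>..<1/2} r * ennreal (q r ^ (k + 1) * r ^ (n - 1)) \<partial>lborel) \<le> ennreal M"
    by (rule mass_bound_high_dimension[OF J nk]) (rule that)
  define e where "e m = 1 / (real m + 5)" for m :: nat
  define f where "f m r = indicator {e m..<1/2} r * ennreal (q r ^ (k + 1) * r ^ (n - 1))" for m r
  have e: "0 < e m" "e m < 1/4" for m by (auto simp: e_def field_simps)
  have edec: "e (Suc m) \<le> e m" for m by (simp add: e_def field_simps)
  have meas: "f m \<in> borel_measurable lborel" for m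
  proof -
    have "(\<lambda>r. indicator {e m..<1/2} r *\<^sub>R (q r ^ (k + 1) * r ^ (n - 1))) \<in> borel_measurable borel"
      by (rule borel_measurable_continuous_on_indicator)
        (use e[of m] in \<open>auto intro!: continuous_intros continuous_on_subset[OF continuous_q]\<close>)
    then have "(\<lambda>r. ennreal (indicator {e m..<1/2} r *\<^sub>R (q r ^ (k + 1) * r ^ (n - 1)))) \<in> borel_measurable borel" by measurable
    moreover have "(\<lambda>r. ennreal (indicator {e m..<1/2} r *\<^sub>R (q r ^ (k + 1) * r ^ (n - 1)))) = f m"
      by (auto simp: f_def indicator_def)
    ultimately show ?thesis by simp
  qed
  have sup: "(SUP m. f m r) = indicator {0<..<1/2} r * ennreal (q r ^ (k + 1) * r ^ (n - 1))" for r
  proof (cases "r \<in> {0<..<1/2}")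
    case True
    have "e \<longlonglongrightarrow> 0" unfolding e_def by real_asymp
    then have "\<forall>\<^sub>F m in sequentially. e m < r" using True by (intro order_tendstoD(2)) auto
    then obtain m where m: "e m < r" by (auto simp: eventually_sequentially)
    show ?thesis
    proof (rule antisym)
      show "(SUP m. f m r) \<le> indicator {0<..<1/2} r * ennreal (q r ^ (k + 1) * r ^ (n - 1))"
        using True by (intro SUP_least) (auto simp: f_def indicator_def)
      have "indicator {0<..<1/2} r * ennreal (q r ^ (k + 1) * r ^ (n - 1)) = f m r" using True m by (simp add: f_def)
      then show "indicator {0<..<1/2} r * ennreal (q r ^ (k + 1) * r ^ (n - 1)) \<le> (SUP m. f m r)"
        by (metis SUP_upper UNIV_I)
    qed
  next
    case False
    then have "f m r = 0" for m using e(1)[of m] by (auto simp: f_def indicator_def)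
    then show ?thesis using False by simp
  qed
  have "incseq f"
  proof (rule incseq_SucI, rule le_funI)
    fix m r
    show "f m r \<le> f (Suc m) r" using edec[of m] by (auto simp: f_def indicator_def)
  qed
  then have "(\<integral>\<^sup>+r. (SUP m. f m r) \<partial>lborel) = (SUP m. \<integral>\<^sup>+r. f m r \<partial>lborel)"
    by (intro nn_integral_monotone_convergence_SUP meas)
  also have "\<dots> \<le> ennreal M" unfolding f_def by (intro SUP_least M(2) e)
  also have "\<dots> < \<infinity>" by simp
  finally show ?thesis unfolding sup .
qed

end

section \<open>Passage to bounded functions of class \<open>H\<^sup>1\<close>\<close>

lemma pos_sq_cutoff_C1:
  assumes \<delta>: "\<delta> > 0"
  shows "C1_with (\<lambda>x :: real^'n::finite. indicator {0<..} (norm x) * cutoff_in \<delta> (norm x)) (\<lambda>x. (cutoff_in_deriv \<delta> (norm x) / (norm x)\<^sup>2) *\<^sub>R x)"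
    (is "C1_with ?\<theta> ?T")
proof -
  have z: "?\<theta> x = 0" "?T x = 0" if "x \<in> ball 0 \<delta>" for x :: "real^'n"
    using cutoff_in_eq_0[of "norm x" \<delta>] that by (cases "x = 0"; simp)+
  have "(?\<theta> has_derivative (\<lambda>h. ?T x \<bullet> h)) (at x)" for x :: "real^'n"
  proof (cases "x = 0")
    case False
    then have r: "norm x > 0" by simp
    have "((\<lambda>r. indicator {0<..} r * cutoff_in \<delta> r) has_real_derivative cutoff_in_deriv \<delta> (norm x) / norm x) (at (norm x))"
      by (rule has_field_derivative_transform_within_open[OF cutoff_in_has_derivative[OF r], of "{0<..}"]) (use r in auto)
    from has_derivative_radial[OF False this] show ?thesis by (simp add: power2_eq_square)
  next
    case True
    have "((\<lambda>x. 0 :: real) has_derivative (\<lambda>h. 0)) (at x)" by simp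
    then have "(?\<theta> has_derivative (\<lambda>h. 0)) (at x)"
      by (rule has_derivative_transform_within_open[of _ _ _ UNIV "ball 0 \<delta>"]) (use True \<delta> z(1) in auto)
    then show ?thesis using True by simp
  qed
  moreover have "continuous_on UNIV ?T"
  proof -
    have "continuous_on (- {0}) ?T" unfolding cutoff_in_deriv_def by (intro continuous_intros) auto
    moreover have "continuous_on (ball 0 \<delta>) ?T" by (rule continuous_on_eq[of _ "\<lambda>_. 0"]) (use z(2) in auto)
    moreover have "- {0} \<union> ball 0 \<delta> = (UNIV :: (real^'n) set)" using \<delta> by auto
    ultimately show ?thesis using continuous_on_open_Un[of "- {0}" "ball 0 \<delta>" ?T] by (simp add: open_Compl)
  qed
  ultimately show ?thesis unfolding C1_with_def by blast
qed

context radial_core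
begin

lemma continuous_weight: "continuous_on {0<..<1} (\<lambda>r. q r ^ m)"
  by (intro continuous_intros continuous_q)

lemma measurable_weight:
  assumes "A \<in> sets borel" "A \<subseteq> {0<..<1}"
  shows "(\<lambda>r. indicator A r * q r ^ m) \<in> borel_measurable borel"
proof -
  have "(\<lambda>r. indicator A r *\<^sub>R q r ^ m) \<in> borel_measurable borel"
    by (rule borel_measurable_continuous_on_indicator[OF assms(1) continuous_on_subset[OF continuous_weight assms(2)]])
  then show ?thesis by simp
qed

lemma weight_integrable:
  assumes J: J_nonneg and R: "0 < R" "R < 1"
  shows "integrable lborel (\<lambda>x :: real^'n. indicator {0<..R} (norm x) * q (norm x) ^ (k + 1))"
proof (rule integrableI_nonneg)
  let ?w = "\<lambda>r. indicator {0<..R} r * q r ^ (k + 1)"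
  have wm[measurable]: "?w \<in> borel_measurable borel" by (rule measurable_weight) (use R in auto)
  have wme: "(\<lambda>r. ennreal (?w r)) \<in> borel_measurable borel" by measurable
  show "(\<lambda>x :: real^'n. ?w (norm x)) \<in> borel_measurable lborel" by measurable
  show "AE x :: real^'n in lborel. 0 \<le> ?w (norm x)"
    using R by (intro AE_I2) (auto simp: indicator_def less_imp_le[OF q_pos])
  obtain C :: real where C: "C > 0"
    "\<And>h. h \<in> borel_measurable borel \<Longrightarrow> (\<integral>\<^sup>+x. h (norm x) \<partial>(lborel :: (real^'n) measure))
       = ennreal C * (\<integral>\<^sup>+r. indicator {0<..} r * h r * ennreal (r ^ (DIM(real^'n) - 1)) \<partial>lborel)"
    using nn_integral_radial by blast
  have "bounded (q ` {1/2..max (1/2) R})"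
    by (intro compact_imp_bounded compact_continuous_image continuous_on_subset[OF continuous_q]) (use R in auto)
  then obtain M where M: "\<forall>y\<in>q ` {1/2..max (1/2) R}. norm y \<le> M" unfolding bounded_iff by blast
  have "(\<integral>\<^sup>+x. ennreal (?w (norm x)) \<partial>(lborel :: (real^'n) measure))
      = ennreal C * (\<integral>\<^sup>+r. indicator {0<..} r * ennreal (?w r) * ennreal (r ^ (n - 1)) \<partial>lborel)"
    unfolding C(2)[OF wme] by (simp add: n_def)
  also have "\<dots> \<le> ennreal C * (\<integral>\<^sup>+r. indicator {0<..<1/2} r * ennreal (q r ^ (k + 1) * r ^ (n - 1)) + ennreal (\<bar>M\<bar> ^ (k + 1)) * indicator {1/2..1::real} r \<partial>lborel)"
  proof (intro mult_left_mono nn_integral_mono)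
    fix r :: real
    show "indicator {0<..} r * ennreal (?w r) * ennreal (r ^ (n - 1)) \<le> indicator {0<..<1/2} r * ennreal (q r ^ (k + 1) * r ^ (n - 1)) + ennreal (\<bar>M\<bar> ^ (k + 1)) * indicator {1/2..1} r"
    proof (cases "r \<in> {0<..R}")
      case True
      then have qr: "0 < q r" using q_pos[of r] R by auto
      have eq: "ennreal (?w r) * ennreal (r ^ (n - 1)) = ennreal (q r ^ (k + 1) * r ^ (n - 1))"
        using True qr by (simp add: ennreal_mult)
      show ?thesis
      proof (cases "r < 1/2")
        case True
        then show ?thesis using \<open>r \<in> {0<..R}\<close> eq by simp
      next
        case False
        have "norm (q r) \<le> M" using M False \<open>r \<in> {0<..R}\<close> by auto
        then have "q r ^ (k + 1) * r ^ (n - 1) \<le> \<bar>M\<bar> ^ (k + 1) * 1"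
          using True qr R by (intro mult_mono power_mono power_le_one) auto
        then show ?thesis using False \<open>r \<in> {0<..R}\<close> eq R by (simp add: ennreal_leI)
      qed
    qed simp
  qed simp
  also have "(\<integral>\<^sup>+r. indicator {0<..<1/2} r * ennreal (q r ^ (k + 1) * r ^ (n - 1)) + ennreal (\<bar>M\<bar> ^ (k + 1)) * indicator {1/2..1::real} r \<partial>lborel)
    = (\<integral>\<^sup>+r. indicator {0<..<1/2} r * ennreal (q r ^ (k + 1) * r ^ (n - 1)) \<partial>lborel) + (\<integral>\<^sup>+r. ennreal (\<bar>M\<bar> ^ (k + 1)) * indicator {1/2..1::real} r \<partial>lborel)"
  proof (rule nn_integral_add)
    have "(\<lambda>r. indicator {0<..<1/2} r * q r ^ (k + 1)) \<in> borel_measurable borel" by (rule measurable_weight) auto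
    then have [measurable]: "(\<lambda>r. ennreal (indicator {0<..<1/2} r * q r ^ (k + 1) * r ^ (n - 1))) \<in> borel_measurable borel" by measurable
    moreover have "ennreal (indicator {0<..<1/2} r * q r ^ (k + 1) * r ^ (n - 1)) = indicator {0<..<1/2} r * ennreal (q r ^ (k + 1) * r ^ (n - 1))" for r
      by (simp add: indicator_def)
    ultimately show "(\<lambda>r. indicator {0<..<1/2} r * ennreal (q r ^ (k + 1) * r ^ (n - 1))) \<in> borel_measurable lborel" by simp
  qed simp
  also have "ennreal C * \<dots> < \<infinity>"
  proof -
    have "(\<integral>\<^sup>+r. ennreal (\<bar>M\<bar> ^ (k + 1)) * indicator {1/2..1::real} r \<partial>lborel) = ennreal (\<bar>M\<bar> ^ (k + 1)) * ennreal (1 - 1/2)"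
      by (subst nn_integral_cmult_indicator) simp_all
    also have "\<dots> = ennreal (\<bar>M\<bar> ^ (k + 1) * (1 - 1/2))" by (rule ennreal_mult[symmetric]) simp_all
    also have "\<dots> < top" by (rule ennreal_less_top)
    finally have b: "(\<integral>\<^sup>+r. ennreal (\<bar>M\<bar> ^ (k + 1)) * indicator {1/2..1::real} r \<partial>lborel) < top" .
    have "ennreal C * (a + b) < top" if "a < top" "b < top" for a b using that by (simp add: ennreal_mult_less_top)
    then show ?thesis
      using weight_integrable_origin[OF J] b unfolding infinity_ennreal_def by blast
  qed
  finally show "(\<integral>\<^sup>+x. ennreal (?w (norm x)) \<partial>(lborel :: (real^'n) measure)) < \<infinity>" .
qed

text \<open>On compact subsets of the punctured ball the weight is bounded, and the form is therefore continuous
  with respect to convergence in \<open>H\<^sup>1\<close>.\<close>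

lemma J_nonneg_H1_punctured:
  fixes f :: "real^'n \<Rightarrow> real"
  assumes J: J_nonneg and fG: "has_weak_grad B1 f G"
    and f2: "integrable (lebesgue_on B1) (\<lambda>x. (f x)\<^sup>2)" and G2: "integrable (lebesgue_on B1) (\<lambda>x. (norm (G x))\<^sup>2)"
    and K: "compact K" "K \<subseteq> B1 - {0}" and supp: "AE x in lebesgue. x \<in> B1 \<longrightarrow> x \<notin> K \<longrightarrow> f x = 0"
  shows "0 \<le> (LINT x|lebesgue_on B1. q (norm x) ^ (k + 1) * ((x \<bullet> G x)\<^sup>2 + 2 * \<beta> * f x * (x \<bullet> G x) - \<gamma> * (f x)\<^sup>2))"
proof -
  obtain f0 G0 F C where A: "H1_approximates (B1 - {0}) K f G f0 G0 F C"
    by (rule H1_approximation[OF fG f2 G2 K(1,2) open_punctured_ball _ supp]) auto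
  have [measurable]: "f0 \<in> borel_measurable borel" "(\<lambda>x. G0 x $ i) \<in> borel_measurable borel" for i
    using A unfolding H1_approximates_def by blast+
  have ae: "AE x in lebesgue. x \<in> B1 \<longrightarrow> f x = f0 x" "AE x in lebesgue. x \<in> B1 \<longrightarrow> G x = G0 x"
    using A unfolding H1_approximates_def by blast+
  have z: "x \<notin> K \<Longrightarrow> f0 x = 0" "x \<notin> K \<Longrightarrow> G0 x = 0" for x
    using A unfolding H1_approximates_def by blast+
  have lim: "L2_lim lborel F f0" "L2_lim lborel (\<lambda>m. partial i (F m)) (\<lambda>x. G0 x $ i)" for i
    using A unfolding H1_approximates_def by blast+
  have F: "C1_c (B1 - {0}) (F m)" and C: "compact C" "C \<subseteq> B1 - {0}" "x \<notin> C \<Longrightarrow> F m x = 0" for m x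
    using A unfolding H1_approximates_def by blast+
  define D where "D = C \<union> K"
  have D: "compact D" "D \<subseteq> B1 - {0}" using C K by (auto simp: D_def)
  define w where "w x = indicator D x * q (norm x) ^ (k + 1)" for x :: "real^'n"
  have cw: "continuous_on (B1 - {0} :: (real^'n) set) (\<lambda>x. q (norm x) ^ (k + 1))"
    by (rule continuous_on_norm_compose[OF continuous_weight])
  have wm[measurable]: "w \<in> borel_measurable borel"
  proof -
    have "(\<lambda>x. indicator D x *\<^sub>R q (norm x) ^ (k + 1)) \<in> borel_measurable borel"
      by (rule borel_measurable_continuous_on_indicator[OF borel_compact[OF D(1)] continuous_on_subset[OF cw D(2)]])
    then show ?thesis by (simp add: w_def[abs_def])
  qed
  have "bounded ((\<lambda>x. q (norm x) ^ (k + 1)) ` D)"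
    by (intro compact_imp_bounded compact_continuous_image continuous_on_subset[OF cw] D)
  then obtain M where M: "\<forall>y\<in>(\<lambda>x. q (norm x) ^ (k + 1)) ` D. norm y \<le> M" unfolding bounded_iff by blast
  have wb: "\<bar>w x\<bar> \<le> \<bar>M\<bar>" for x
  proof (cases "x \<in> D")
    case True
    then have "norm (q (norm x) ^ (k + 1)) \<le> M" using M by blast
    then show ?thesis using True by (simp add: w_def)
  qed (simp add: w_def)
  have xb: "\<bar>w x * (x $ i)\<bar> \<le> \<bar>M\<bar>" "\<bar>w x * (x $ i * x $ j)\<bar> \<le> \<bar>M\<bar>" for x i j
  proof -
    have c: "\<bar>w x * t\<bar> \<le> \<bar>M\<bar>" if "x \<in> D \<Longrightarrow> \<bar>t\<bar> \<le> 1" for t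
    proof (cases "x \<in> D")
      case True
      have "\<bar>w x\<bar> * \<bar>t\<bar> \<le> \<bar>M\<bar> * 1" using wb that[OF True] by (intro mult_mono) auto
      then show ?thesis by (simp add: abs_mult)
    qed (simp add: w_def)
    have n1: "\<bar>x $ i\<bar> \<le> 1" if "x \<in> D" for i
      using component_le_norm_cart[of x i] that D(2) by auto
    show "\<bar>w x * (x $ i)\<bar> \<le> \<bar>M\<bar>" by (rule c[OF n1])
    show "\<bar>w x * (x $ i * x $ j)\<bar> \<le> \<bar>M\<bar>"
      by (rule c) (use n1 in \<open>simp add: abs_mult mult_le_one\<close>)
  qed
  define \<Phi> where "\<Phi> h H = (\<Sum>i\<in>UNIV. \<Sum>j\<in>UNIV. \<integral>x. H i x * H j x * (w x * (x $ i * x $ j)) \<partial>lborel)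
     + 2 * \<beta> * (\<Sum>i\<in>UNIV. \<integral>x. h x * H i x * (w x * x $ i) \<partial>lborel) - \<gamma> * (\<integral>x. h x * h x * w x \<partial>lborel)"
    for h :: "real^'n \<Rightarrow> real" and H :: "'n \<Rightarrow> real^'n \<Rightarrow> real"
  have \<Phi>_eq: "\<Phi> h H = (\<integral>x. w x * ((\<Sum>i\<in>UNIV. x $ i * H i x)\<^sup>2 + 2 * \<beta> * h x * (\<Sum>i\<in>UNIV. x $ i * H i x) - \<gamma> * (h x)\<^sup>2) \<partial>lborel)"
    if "\<And>i j. integrable lborel (\<lambda>x. H i x * H j x * (w x * (x $ i * x $ j)))"
      "\<And>i. integrable lborel (\<lambda>x. h x * H i x * (w x * x $ i))" "integrable lborel (\<lambda>x. h x * h x * w x)"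
    for h :: "real^'n \<Rightarrow> real" and H :: "'n \<Rightarrow> real^'n \<Rightarrow> real"
  proof -
    have "(\<integral>x. w x * ((\<Sum>i\<in>UNIV. x $ i * H i x)\<^sup>2 + 2 * \<beta> * h x * (\<Sum>i\<in>UNIV. x $ i * H i x) - \<gamma> * (h x)\<^sup>2) \<partial>lborel)
      = (\<integral>x. (\<Sum>i\<in>UNIV. \<Sum>j\<in>UNIV. H i x * H j x * (w x * (x $ i * x $ j))) + 2 * \<beta> * (\<Sum>i\<in>UNIV. h x * H i x * (w x * x $ i)) - \<gamma> * (h x * h x * w x) \<partial>lborel)"
    proof (rule Bochner_Integration.integral_cong[OF refl])
      fix x
      have "(\<Sum>i\<in>UNIV. \<Sum>j\<in>UNIV. H i x * H j x * (w x * (x $ i * x $ j))) = w x * (\<Sum>i\<in>UNIV. x $ i * H i x)\<^sup>2"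
        by (simp add: power2_eq_square sum_product sum_distrib_left mult_ac)
      moreover have "(\<Sum>i\<in>UNIV. h x * H i x * (w x * x $ i)) = w x * (h x * (\<Sum>i\<in>UNIV. x $ i * H i x))"
        by (simp add: sum_distrib_left mult_ac)
      ultimately show "w x * ((\<Sum>i\<in>UNIV. x $ i * H i x)\<^sup>2 + 2 * \<beta> * h x * (\<Sum>i\<in>UNIV. x $ i * H i x) - \<gamma> * (h x)\<^sup>2)
         = (\<Sum>i\<in>UNIV. \<Sum>j\<in>UNIV. H i x * H j x * (w x * (x $ i * x $ j))) + 2 * \<beta> * (\<Sum>i\<in>UNIV. h x * H i x * (w x * x $ i)) - \<gamma> * (h x * h x * w x)"
        by (simp add: power2_eq_square algebra_simps)
    qed
    then show ?thesis unfolding \<Phi>_def using that by simp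
  qed
  note L = L2_lim_product[OF lim(2) lim(2) _ xb(2)] L2_lim_product[OF lim(1) lim(2) _ xb(1)] L2_lim_product[OF lim(1) lim(1) _ wb]
  have "(\<lambda>m. \<Phi> (F m) (\<lambda>i. partial i (F m))) \<longlonglongrightarrow> \<Phi> f0 (\<lambda>i x. G0 x $ i)"
    unfolding \<Phi>_def by (intro tendsto_intros L; measurable)
  moreover have "0 \<le> \<Phi> (F m) (\<lambda>i. partial i (F m))" for m
  proof -
    have "\<Phi> (F m) (\<lambda>i. partial i (F m)) = (\<integral>x. Jn (F m) x \<partial>lborel)"
    proof -
      have i: "integrable lborel (\<lambda>x. partial i (F m) x * partial j (F m) x * (w x * (x $ i * x $ j)))"
        "integrable lborel (\<lambda>x. F m x * partial i (F m) x * (w x * x $ i))" "integrable lborel (\<lambda>x. F m x * F m x * w x)" for i j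
        by (intro L; measurable)+
      show ?thesis
        unfolding \<Phi>_eq[OF i]
      proof (rule Bochner_Integration.integral_cong[OF refl])
        fix x
        have s: "(\<Sum>i\<in>UNIV. x $ i * partial i (F m) x) = x \<bullet> grad (F m) x"
          by (simp add: inner_vec_def grad_def)
        have CF: "C1_with (F m) (grad (F m))" using C1_cE[OF F] by metis
        have "grad (F m) x = 0" if "x \<notin> C"
          by (rule C1_with_zero[OF CF compact_imp_closed[OF C(1)] _ that]) (rule C(3))
        then show "w x * ((\<Sum>i\<in>UNIV. x $ i * partial i (F m) x)\<^sup>2 + 2 * \<beta> * F m x * (\<Sum>i\<in>UNIV. x $ i * partial i (F m) x) - \<gamma> * (F m x)\<^sup>2) = Jn (F m) x"
          unfolding s Jn_def w_def using C(3)[of x m] by (cases "x \<in> C") (auto simp: D_def)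
      qed
    qed
    then show ?thesis using rays_nonneg(2)[OF F J] by simp
  qed
  ultimately have "0 \<le> \<Phi> f0 (\<lambda>i x. G0 x $ i)" by (intro LIMSEQ_le_const) auto
  also have "\<Phi> f0 (\<lambda>i x. G0 x $ i) = (\<integral>x. w x * ((x \<bullet> G0 x)\<^sup>2 + 2 * \<beta> * f0 x * (x \<bullet> G0 x) - \<gamma> * (f0 x)\<^sup>2) \<partial>lborel)"
  proof -
    have i: "integrable lborel (\<lambda>x. G0 x $ i * G0 x $ j * (w x * (x $ i * x $ j)))"
      "integrable lborel (\<lambda>x. f0 x * G0 x $ i * (w x * x $ i))" "integrable lborel (\<lambda>x. f0 x * f0 x * w x)" for i j
      by (intro L; measurable)+
    show ?thesis unfolding \<Phi>_eq[OF i] by (simp add: inner_vec_def)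
  qed
  also have "\<dots> = (LINT x|lebesgue_on B1. q (norm x) ^ (k + 1) * ((x \<bullet> G x)\<^sup>2 + 2 * \<beta> * f x * (x \<bullet> G x) - \<gamma> * (f x)\<^sup>2))"
  proof (rule lebesgue_on_transfer(2)[symmetric])
    show "AE x in lebesgue. x \<in> B1 \<longrightarrow> q (norm x) ^ (k + 1) * ((x \<bullet> G x)\<^sup>2 + 2 * \<beta> * f x * (x \<bullet> G x) - \<gamma> * (f x)\<^sup>2)
       = w x * ((x \<bullet> G0 x)\<^sup>2 + 2 * \<beta> * f0 x * (x \<bullet> G0 x) - \<gamma> * (f0 x)\<^sup>2)"
      using ae
    proof eventually_elim
      case (elim x)
      show ?case using elim z[of x] by (cases "x \<in> K") (auto simp: w_def D_def)
    qed
    show "w x * ((x \<bullet> G0 x)\<^sup>2 + 2 * \<beta> * f0 x * (x \<bullet> G0 x) - \<gamma> * (f0 x)\<^sup>2) = 0" if "x \<notin> B1" for x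
      using that D(2) by (auto simp: w_def indicator_def)
    show "(\<lambda>x. w x * ((x \<bullet> G0 x)\<^sup>2 + 2 * \<beta> * f0 x * (x \<bullet> G0 x) - \<gamma> * (f0 x)\<^sup>2)) \<in> borel_measurable borel"
      unfolding inner_vec_def by measurable
  qed auto
  finally show ?thesis .
qed

end

lemma integral_nonneg_transfer:
  fixes h h0 :: "'a::euclidean_space \<Rightarrow> real"
  assumes "W \<in> sets lebesgue" "h0 \<in> borel_measurable borel" "\<And>x. x \<notin> W \<Longrightarrow> h0 x = 0"
    and ae: "AE x in lebesgue. x \<in> W \<longrightarrow> h x = h0 x"
  shows "integral_nonneg (lebesgue_on W) h \<longleftrightarrow> integral_nonneg lborel h0"
proof -
  have ae': "AE x in lebesgue. x \<in> W \<longrightarrow> - h x = - h0 x" using ae by eventually_elim auto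
  show ?thesis
    unfolding integral_nonneg_def
    using lebesgue_on_transfer(1,4)[OF assms] lebesgue_on_transfer(4)[OF assms(1) _ _ ae'] assms(2,3) by simp
qed

lemma integral_nonneg_integrable:
  "integrable M f \<Longrightarrow> integral_nonneg M f \<longleftrightarrow> 0 \<le> integral\<^sup>L M f"
  unfolding integral_nonneg_def using nn_integral_neg_le_iff[of M f] borel_measurable_integrable[of M f] by blast

lemma integrable_if_nn_integrals_finite:
  fixes f :: "'a \<Rightarrow> real"
  assumes [measurable]: "f \<in> borel_measurable M" and "(\<integral>\<^sup>+x. ennreal (f x) \<partial>M) < \<infinity>" "(\<integral>\<^sup>+x. ennreal (- f x) \<partial>M) < \<infinity>"
  shows "integrable M f"
proof (rule integrableI_bounded)
  have "(\<integral>\<^sup>+x. ennreal (norm (f x)) \<partial>M) = (\<integral>\<^sup>+x. ennreal (f x) + ennreal (- f x) \<partial>M)"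
    by (rule nn_integral_cong) (auto simp: ennreal_neg abs_if)
  also have "\<dots> < \<infinity>" using assms(2,3) by (subst nn_integral_add) auto
  finally show "(\<integral>\<^sup>+x. ennreal (norm (f x)) \<partial>M) < \<infinity>" .
qed simp

lemma norm_square_components:
  fixes x :: "real^'n::finite"
  shows "(norm x)\<^sup>2 = (\<Sum>i\<in>UNIV. (x $ i)\<^sup>2)"
proof -
  have "(norm x)\<^sup>2 = (\<Sum>i\<in>UNIV. x $ i * x $ i)" by (simp add: power2_norm_eq_inner inner_vec_def)
  then show ?thesis by (simp add: power2_eq_square[of "_ $ _"])
qed

text \<open>Completing the square. The first bound controls the negative part of the integrand by
  \<open>f\<^sup>2\<close> alone; by the second one, the integral of \<open>s\<^sup>2\<close> is finite whenever that of the whole form is.\<close>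

lemma quadratic_bounds:
  fixes a b f s \<beta> \<gamma> :: real
  assumes "\<bar>a\<bar> \<le> s"
  shows "- (s\<^sup>2 + 2 * \<beta> * f * a - \<gamma> * f\<^sup>2) \<le> (\<beta>\<^sup>2 + \<gamma>) * f\<^sup>2"
    "s\<^sup>2 \<le> 2 * (s\<^sup>2 + 2 * \<beta> * f * a - \<gamma> * f\<^sup>2) + (4 * \<beta>\<^sup>2 + 2 * \<gamma>) * f\<^sup>2"
proof -
  have as: "a\<^sup>2 \<le> s\<^sup>2" using assms by (simp add: abs_le_square_iff[symmetric])
  have "0 \<le> (a + \<beta> * f)\<^sup>2" "0 \<le> (a + 2 * \<beta> * f)\<^sup>2" by simp_all
  then show "- (s\<^sup>2 + 2 * \<beta> * f * a - \<gamma> * f\<^sup>2) \<le> (\<beta>\<^sup>2 + \<gamma>) * f\<^sup>2"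
    "s\<^sup>2 \<le> 2 * (s\<^sup>2 + 2 * \<beta> * f * a - \<gamma> * f\<^sup>2) + (4 * \<beta>\<^sup>2 + 2 * \<gamma>) * f\<^sup>2"
    using as by (simp_all add: power2_eq_square algebra_simps)
qed

lemma quadratic_bound_cutoff:
  fixes a f \<theta> X \<beta> \<gamma> :: real
  assumes "0 \<le> \<theta>" "\<theta> \<le> 1" "0 \<le> X" "X \<le> 1" "0 \<le> \<beta>" "\<beta> \<le> 1" "0 \<le> \<gamma>"
  shows "\<bar>(\<theta> * a + X * f)\<^sup>2 + 2 * \<beta> * (\<theta> * f) * (\<theta> * a + X * f) - \<gamma> * (\<theta> * f)\<^sup>2\<bar> \<le> 3 * a\<^sup>2 + (5 + \<gamma>) * f\<^sup>2"
proof -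
  have t: "\<bar>\<theta> * a\<bar> \<le> \<bar>a\<bar>" "\<bar>X * f\<bar> \<le> \<bar>f\<bar>" "\<bar>\<theta> * f\<bar> \<le> \<bar>f\<bar>" "\<bar>\<beta> * (\<theta> * f)\<bar> \<le> \<bar>f\<bar>"
    using assms by (auto simp: abs_mult intro!: mult_left_le_one_le mult_le_one) 
      (metis abs_ge_zero mult.assoc mult_le_one mult_left_le_one_le mult_nonneg_nonneg)
  have p: "\<bar>\<theta> * a + X * f\<bar> \<le> \<bar>a\<bar> + \<bar>f\<bar>" using t(1,2) by linarith
  have s: "(\<theta> * a + X * f)\<^sup>2 \<le> (\<bar>a\<bar> + \<bar>f\<bar>)\<^sup>2" using p by (simp add: abs_le_square_iff[symmetric])
  have "\<bar>\<beta> * (\<theta> * f)\<bar> * \<bar>\<theta> * a + X * f\<bar> \<le> \<bar>f\<bar> * (\<bar>a\<bar> + \<bar>f\<bar>)" using t(4) p by (intro mult_mono) auto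
  then have m: "\<bar>2 * \<beta> * (\<theta> * f) * (\<theta> * a + X * f)\<bar> \<le> 2 * (\<bar>f\<bar> * (\<bar>a\<bar> + \<bar>f\<bar>))" by (simp add: abs_mult mult.assoc)
  have "(\<theta> * f)\<^sup>2 \<le> f\<^sup>2" using t(3) by (simp add: abs_le_square_iff[symmetric])
  then have l: "\<gamma> * (\<theta> * f)\<^sup>2 \<le> \<gamma> * f\<^sup>2" "0 \<le> \<gamma> * (\<theta> * f)\<^sup>2" using assms(7) by (auto intro: mult_left_mono)
  have am: "2 * (\<bar>a\<bar> * \<bar>f\<bar>) \<le> a\<^sup>2 + f\<^sup>2" using sum_squares_bound[of "\<bar>a\<bar>" "\<bar>f\<bar>"] by (simp add: mult.assoc)
  have e: "(\<bar>a\<bar> + \<bar>f\<bar>)\<^sup>2 = a\<^sup>2 + 2 * (\<bar>a\<bar> * \<bar>f\<bar>) + f\<^sup>2" "2 * (\<bar>f\<bar> * (\<bar>a\<bar> + \<bar>f\<bar>)) = 2 * (\<bar>a\<bar> * \<bar>f\<bar>) + 2 * f\<^sup>2"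
    by (simp_all add: power2_eq_square algebra_simps)
  have "\<bar>(\<theta> * a + X * f)\<^sup>2 + 2 * \<beta> * (\<theta> * f) * (\<theta> * a + X * f) - \<gamma> * (\<theta> * f)\<^sup>2\<bar>
      \<le> (\<bar>a\<bar> + \<bar>f\<bar>)\<^sup>2 + 2 * (\<bar>f\<bar> * (\<bar>a\<bar> + \<bar>f\<bar>)) + \<gamma> * f\<^sup>2"
    using s m l zero_le_power2[of "\<theta> * a + X * f"] by linarith
  also have "\<dots> \<le> 3 * a\<^sup>2 + (5 + \<gamma>) * f\<^sup>2" unfolding e using am by (simp add: algebra_simps)
  finally show ?thesis .
qed

lemma cutoff_in_limit:
  assumes "r > 0"
  shows "(\<lambda>m. cutoff_in (1 / Suc m) r) \<longlonglongrightarrow> 1" "(\<lambda>m. cutoff_in_deriv (1 / Suc m) r) \<longlonglongrightarrow> 0"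
proof -
  have d: "(\<lambda>m. 1 / real (Suc m) / r) \<longlonglongrightarrow> 0 / r" by (intro tendsto_divide LIMSEQ_Suc[OF lim_1_over_n] tendsto_const) (use assms in auto)
  have "(\<lambda>m. (max 0 (1 - 1 / real (Suc m) / r))\<^sup>2) \<longlonglongrightarrow> (max 0 (1 - 0 / r))\<^sup>2" by (intro tendsto_intros d)
  then show "(\<lambda>m. cutoff_in (1 / Suc m) r) \<longlonglongrightarrow> 1" by (simp add: cutoff_in_def pos_sq_def)
  have "(\<lambda>m. 2 * max 0 (1 - 1 / real (Suc m) / r) * (1 / real (Suc m) / r)) \<longlonglongrightarrow> 2 * max 0 (1 - 0 / r) * (0 / r)" by (intro tendsto_intros d)
  then show "(\<lambda>m. cutoff_in_deriv (1 / Suc m) r) \<longlonglongrightarrow> 0" by (simp add: cutoff_in_deriv_def)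
qed

context radial_core
begin

text \<open>The cut-offs \<open>\<theta>\<close> at the origin are harmless: \<open>x \<bullet> \<nabla>\<theta>\<close> is bounded and tends to zero, and the
  weight \<open>q\<^sup>k\<^sup>+\<^sup>1\<close> is integrable. This is where boundedness of \<open>f\<close> enters.\<close>

lemma weighted_form_nonneg:
  fixes f h :: "real^'n \<Rightarrow> real"
  assumes J: J_nonneg and fG: "has_weak_grad B1 f G"
    and f2: "integrable (lebesgue_on B1) (\<lambda>x. (f x)\<^sup>2)" and G2: "integrable (lebesgue_on B1) (\<lambda>x. (norm (G x))\<^sup>2)"
    and K: "compact K" "K \<subseteq> B1" and supp: "AE x in lebesgue. x \<in> B1 \<longrightarrow> x \<notin> K \<longrightarrow> f x = 0"
    and M: "AE x in lebesgue. x \<in> B1 \<longrightarrow> \<bar>f x\<bar> \<le> M"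
    and h: "AE x in lebesgue. x \<in> B1 \<longrightarrow> h x = q (norm x) ^ (k + 1) * ((norm x * norm (G x))\<^sup>2 + 2 * \<beta> * f x * (x \<bullet> G x) - \<gamma> * (f x)\<^sup>2)"
  shows "integral_nonneg (lebesgue_on B1) h"
proof -
  obtain f0 G0 F C where A: "H1_approximates B1 K f G f0 G0 F C"
    by (rule H1_approximation[OF fG f2 G2 K open_ball order_refl supp])
  have [measurable]: "f0 \<in> borel_measurable borel" "(\<lambda>x. G0 x $ i) \<in> borel_measurable borel" for i
    using A unfolding H1_approximates_def by blast+
  have ae: "AE x in lebesgue. x \<in> B1 \<longrightarrow> f x = f0 x" "AE x in lebesgue. x \<in> B1 \<longrightarrow> G x = G0 x"
    using A unfolding H1_approximates_def by blast+
  have z: "x \<notin> K \<Longrightarrow> f0 x = 0" "x \<notin> K \<Longrightarrow> G0 x = 0" for x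
    using A unfolding H1_approximates_def by blast+
  have lim: "L2_lim lborel F f0" "L2_lim lborel (\<lambda>m. partial i (F m)) (\<lambda>x. G0 x $ i)" for i
    using A unfolding H1_approximates_def by blast+
  have sq: "integrable lborel (\<lambda>x. (f0 x)\<^sup>2)" "integrable lborel (\<lambda>x. (G0 x $ i)\<^sup>2)" for i
    using lim by (auto simp: L2_lim_def)
  have ne0: "AE x in lebesgue. x \<noteq> (0 :: real^'n)" by (rule AE_completion[OF AE_lborel_singleton])
  obtain R where R: "0 < R" "R < 1" "\<And>x. x \<in> K \<Longrightarrow> norm x \<le> R"
  proof (cases "K = {}")
    case True
    then show ?thesis using that[of "1/2"] by auto
  next
    case False
    then obtain y where "y \<in> K" "\<forall>x\<in>K. norm x \<le> norm y"
      using continuous_attains_sup[OF K(1), of norm] by (auto intro: continuous_intros)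
    then show ?thesis using that[of "max (1/2) (norm y)"] K(2) by force
  qed
  define w where "w x = indicator {0<..R} (norm x) * q (norm x) ^ (k + 1)" for x :: "real^'n"
  have wi: "integrable lborel w" unfolding w_def by (rule weight_integrable[OF J R(1,2)])
  have [measurable]: "w \<in> borel_measurable borel" using wi by auto
  have w0: "0 \<le> w x" for x using R q_pos[of "norm x"] by (auto simp: w_def indicator_def)
  have wK: "w x = q (norm x) ^ (k + 1)" if "x \<in> K" "x \<noteq> 0" for x using that R(3) by (simp add: w_def)
  have bd: "AE x in lborel. (f0 x)\<^sup>2 \<le> M\<^sup>2"
  proof -
    have "AE x in lebesgue. (f0 x)\<^sup>2 \<le> M\<^sup>2"
      using ae(1) M
    proof eventually_elim
      case (elim x)
      show ?case
      proof (cases "x \<in> B1")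
        case True
        then have "\<bar>f0 x\<bar> \<le> M" using elim by auto
        then have "\<bar>f0 x\<bar>\<^sup>2 \<le> M\<^sup>2" by (rule power_mono) simp
        then show ?thesis by simp
      next
        case False
        then have "x \<notin> K" using K(2) by blast
        then show ?thesis using z(1) by simp
      qed
    qed
    then show ?thesis by (simp add: AE_completion_iff)
  qed
  define a where "a x = x \<bullet> G0 x" for x
  define s where "s x = norm x * norm (G0 x)" for x
  have as: "\<bar>a x\<bar> \<le> s x" for x unfolding a_def s_def by (rule Cauchy_Schwarz_ineq2)
  have am[measurable]: "a \<in> borel_measurable borel" unfolding a_def[abs_def] inner_vec_def by measurable
  have nG: "(norm (G0 x))\<^sup>2 = (\<Sum>i\<in>UNIV. (G0 x $ i)\<^sup>2)" for x
    by (rule norm_square_components)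
  have sm[measurable]: "(\<lambda>x. (s x)\<^sup>2) \<in> borel_measurable borel" unfolding s_def power_mult_distrib nG by measurable
  define I where "I x = w x * ((s x)\<^sup>2 + 2 * \<beta> * f0 x * a x - \<gamma> * (f0 x)\<^sup>2)" for x
  have Im[measurable]: "I \<in> borel_measurable borel" unfolding I_def[abs_def] by measurable
  \<comment> \<open>\<open>I\<close> has the full gradient and \<open>I'\<close> below the radial derivative only, to which the cut-off argument applies\<close>
  have "integral_nonneg lborel I"
  proof -
    have negI: "- I x \<le> w x * ((\<beta>\<^sup>2 + \<gamma>) * (f0 x)\<^sup>2)" for x
      using mult_left_mono[OF quadratic_bounds(1)[OF as, of x \<beta> "f0 x" \<gamma>] w0[of x]] by (simp add: I_def algebra_simps)
    have wf: "integrable lborel (\<lambda>x. w x * (f0 x)\<^sup>2)"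
    proof (rule Bochner_Integration.integrable_bound)
      show "integrable lborel (\<lambda>x. w x * M\<^sup>2)" using wi by simp
      show "AE x in lborel. norm (w x * (f0 x)\<^sup>2) \<le> norm (w x * M\<^sup>2)"
        using bd by eventually_elim (simp add: abs_mult mult_left_mono w0)
    qed measurable
    have negfin: "(\<integral>\<^sup>+x. ennreal (- I x) \<partial>lborel) < \<infinity>"
    proof -
      have i: "integrable lborel (\<lambda>x. (\<beta>\<^sup>2 + \<gamma>) * (w x * (f0 x)\<^sup>2))" using wf by simp
      have "(\<integral>\<^sup>+x. ennreal (- I x) \<partial>lborel) \<le> (\<integral>\<^sup>+x. ennreal (norm ((\<beta>\<^sup>2 + \<gamma>) * (w x * (f0 x)\<^sup>2))) \<partial>lborel)"
      proof (intro nn_integral_mono ennreal_leI)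
        fix x
        have "- I x \<le> (\<beta>\<^sup>2 + \<gamma>) * (w x * (f0 x)\<^sup>2)" using negI[of x] by (simp add: mult_ac)
        then show "- I x \<le> norm ((\<beta>\<^sup>2 + \<gamma>) * (w x * (f0 x)\<^sup>2))" by simp
      qed
      also have "\<dots> < \<infinity>" using i unfolding integrable_iff_bounded by blast
      finally show ?thesis .
    qed
    show ?thesis
    proof (cases "(\<integral>\<^sup>+x. ennreal (I x) \<partial>lborel) = \<infinity>")
      case True
      then show ?thesis using negfin Im unfolding integral_nonneg_def by simp
    next
      case False
      then have posfin: "(\<integral>\<^sup>+x. ennreal (I x) \<partial>lborel) < \<infinity>" by (simp add: less_top)
      have Ii: "integrable lborel I" by (rule integrable_if_nn_integrals_finite[OF _ posfin negfin]) simp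
      have ws: "integrable lborel (\<lambda>x. w x * (s x)\<^sup>2)"
      proof (rule Bochner_Integration.integrable_bound)
        show "integrable lborel (\<lambda>x. 2 * I x + (4 * \<beta>\<^sup>2 + 2 * \<gamma>) * (w x * (f0 x)\<^sup>2))" using Ii wf by simp
        have "w x * (s x)\<^sup>2 \<le> 2 * I x + (4 * \<beta>\<^sup>2 + 2 * \<gamma>) * (w x * (f0 x)\<^sup>2)" for x
          using mult_left_mono[OF quadratic_bounds(2)[OF as, of x \<beta> "f0 x" \<gamma>] w0[of x]] by (simp add: I_def algebra_simps)
        then show "AE x in lborel. norm (w x * (s x)\<^sup>2) \<le> norm (2 * I x + (4 * \<beta>\<^sup>2 + 2 * \<gamma>) * (w x * (f0 x)\<^sup>2))"
          using w0 by (intro AE_I2) (simp add: order_trans[OF _ abs_ge_self])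
      qed measurable
      have asq: "(a x)\<^sup>2 \<le> (s x)\<^sup>2" for x using power_mono[OF as[of x], of 2] by simp
      have wa: "integrable lborel (\<lambda>x. w x * (a x)\<^sup>2)"
        by (rule Bochner_Integration.integrable_bound[OF ws]) (auto intro!: mult_left_mono simp: abs_mult w0 asq)
      define I' where "I' x = w x * ((a x)\<^sup>2 + 2 * \<beta> * f0 x * a x - \<gamma> * (f0 x)\<^sup>2)" for x
      define \<theta> T where "\<theta> m x = indicator {0<..} (norm x) * cutoff_in (1 / Suc m) (norm x)"
        and "T m x = (cutoff_in_deriv (1 / Suc m) (norm x) / (norm x)\<^sup>2) *\<^sub>R x" for m and x :: "real^'n"
      have \<theta>T: "C1_with (\<theta> m) (T m)" for m
        using pos_sq_cutoff_C1[of "1 / Suc m", where 'n='n] unfolding \<theta>_def[abs_def] T_def[abs_def] by simp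
      have \<theta>c: "continuous_on UNIV (\<theta> m)" "continuous_on UNIV (\<lambda>x. T m x $ i)" for m i
        using C1_with_continuous[OF \<theta>T] \<theta>T unfolding C1_with_def by (auto intro!: continuous_intros)
      have [measurable]: "\<theta> m \<in> borel_measurable borel" "(\<lambda>x. T m x $ i) \<in> borel_measurable borel" for m i
        using \<theta>c by (auto intro: borel_measurable_continuous_onI)
      define X where "X m x = cutoff_in_deriv (1 / Suc m) (norm x)" for m and x :: "real^'n"
      have \<theta>X: "0 \<le> \<theta> m x" "\<theta> m x \<le> 1" "0 \<le> X m x" "X m x \<le> 1" if "x \<noteq> 0" for m x
        using cutoff_in_bounds[of "norm x" "1 / Suc m"] that by (auto simp: \<theta>_def X_def)
      have xT: "x \<bullet> T m x = X m x" if "x \<noteq> 0" for m x using that by (simp add: T_def X_def dot_square_norm)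
      have Tb: "norm (T m x) \<le> Suc m" for m x
      proof (cases "norm x \<le> 1 / Suc m")
        case True
        then show ?thesis using cutoff_in_eq_0[of "norm x" "1 / Suc m"] by (cases "x = 0") (auto simp: T_def)
      next
        case False
        then have x: "x \<noteq> 0" "1 \<le> norm x * Suc m" by (auto simp: field_simps)
        have "norm (T m x) = X m x / norm x" using \<theta>X(3)[OF x(1), of m] x(1) by (simp add: T_def X_def power2_eq_square)
        also have "\<dots> \<le> 1 / norm x" using \<theta>X(4)[OF x(1), of m] by (intro divide_right_mono) auto
        also have "\<dots> \<le> Suc m" using x by (simp add: field_simps)
        finally show ?thesis .
      qed
      define Im where "Im m x = w x * ((\<theta> m x * a x + X m x * f0 x)\<^sup>2 + 2 * \<beta> * (\<theta> m x * f0 x) * (\<theta> m x * a x + X m x * f0 x) - \<gamma> * (\<theta> m x * f0 x)\<^sup>2)" for m x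
      have [measurable]: "X m \<in> borel_measurable borel" for m
        unfolding X_def cutoff_in_deriv_def by measurable
      have w00: "w 0 = 0" by (simp add: w_def)
      have lim: "(\<lambda>m. Im m x) \<longlonglongrightarrow> I' x" for x
      proof (cases "x = 0")
        case False
        have "(\<lambda>m. \<theta> m x) \<longlonglongrightarrow> 1" "(\<lambda>m. X m x) \<longlonglongrightarrow> 0"
          using cutoff_in_limit[of "norm x"] False by (simp_all add: \<theta>_def X_def)
        then have "(\<lambda>m. Im m x) \<longlonglongrightarrow> w x * ((1 * a x + 0 * f0 x)\<^sup>2 + 2 * \<beta> * (1 * f0 x) * (1 * a x + 0 * f0 x) - \<gamma> * (1 * f0 x)\<^sup>2)"
          unfolding Im_def by (intro tendsto_intros)
        then show ?thesis by (simp add: I'_def)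
      qed (simp add: Im_def I'_def w00)
      have dom: "norm (Im m x) \<le> 3 * (w x * (a x)\<^sup>2) + (5 + \<gamma>) * (w x * (f0 x)\<^sup>2)" for m x
      proof (cases "x = 0")
        case False
        have "\<bar>(\<theta> m x * a x + X m x * f0 x)\<^sup>2 + 2 * \<beta> * (\<theta> m x * f0 x) * (\<theta> m x * a x + X m x * f0 x) - \<gamma> * (\<theta> m x * f0 x)\<^sup>2\<bar>
            \<le> 3 * (a x)\<^sup>2 + (5 + \<gamma>) * (f0 x)\<^sup>2"
          by (rule quadratic_bound_cutoff) (rule \<theta>X[OF False] \<beta>_bounds \<gamma>_nonneg)+
        then have "norm (Im m x) \<le> w x * (3 * (a x)\<^sup>2 + (5 + \<gamma>) * (f0 x)\<^sup>2)"
          unfolding Im_def real_norm_def abs_mult using w0[of x] by (simp add: mult_left_mono)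
        then show ?thesis by (simp add: algebra_simps)
      qed (simp add: Im_def w00)
      have Imm[measurable]: "Im m \<in> borel_measurable borel" "I' \<in> borel_measurable borel" for m
        unfolding Im_def[abs_def] I'_def[abs_def] by measurable
      have dc: "integrable lborel I'" "(\<lambda>m. integral\<^sup>L lborel (Im m)) \<longlonglongrightarrow> integral\<^sup>L lborel I'"
      proof -
        let ?w = "\<lambda>x. 3 * (w x * (a x)\<^sup>2) + (5 + \<gamma>) * (w x * (f0 x)\<^sup>2)"
        have wi': "integrable lborel ?w" using wa wf by simp
        have m: "I' \<in> borel_measurable lborel" "Im m \<in> borel_measurable lborel" for m by simp_all
        have l: "AE x in lborel. (\<lambda>m. Im m x) \<longlonglongrightarrow> I' x" using lim by blast
        have d: "AE x in lborel. norm (Im m x) \<le> ?w x" for m using dom by blast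
        show "integrable lborel I'" by (rule integrable_dominated_convergence[OF m wi' l d])
        show "(\<lambda>m. integral\<^sup>L lborel (Im m)) \<longlonglongrightarrow> integral\<^sup>L lborel I'" by (rule integral_dominated_convergence[OF m wi' l d])
      qed
      have "0 \<le> integral\<^sup>L lborel (Im m)" for m
      proof -
        let ?f = "\<lambda>x. f x * \<theta> m x" and ?G = "\<lambda>x. \<theta> m x *\<^sub>R G x + f x *\<^sub>R T m x"
        let ?K = "K - ball 0 (1 / Suc m)"
        have g: "has_weak_grad B1 ?f ?G" by (rule has_weak_grad_mult_C1[OF open_ball fG \<theta>T])
        have th1: "(\<theta> m x)\<^sup>2 \<le> 1" for x
          using \<theta>X(1,2)[of x m] by (cases "x = 0") (auto simp: \<theta>_def power_le_one)
        have f2i: "integrable lborel (\<lambda>x. (f0 x * \<theta> m x)\<^sup>2)"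
          by (rule Bochner_Integration.integrable_bound[OF sq(1)]) (auto simp: power_mult_distrib th1 mult_left_le)
        have f2e: "integrable (lebesgue_on B1) (\<lambda>x. (?f x)\<^sup>2) \<longleftrightarrow> integrable lborel (\<lambda>x. (f0 x * \<theta> m x)\<^sup>2)"
        proof (rule lebesgue_on_transfer(3))
          show "AE x in lebesgue. x \<in> B1 \<longrightarrow> (?f x)\<^sup>2 = (f0 x * \<theta> m x)\<^sup>2" using ae(1) by eventually_elim auto
          show "(f0 x * \<theta> m x)\<^sup>2 = 0" if "x \<notin> B1" for x
          proof -
            have "x \<notin> K" using that K(2) by blast
            then show ?thesis using z by simp
          qed
        qed auto
        have G2i: "integrable lborel (\<lambda>x. \<Sum>i\<in>UNIV. (\<theta> m x * G0 x $ i + f0 x * T m x $ i)\<^sup>2)"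
        proof (intro Bochner_Integration.integrable_sum)
          fix i
          show "integrable lborel (\<lambda>x. (\<theta> m x * G0 x $ i + f0 x * T m x $ i)\<^sup>2)"
          proof (rule Bochner_Integration.integrable_bound)
            show "integrable lborel (\<lambda>x. 2 * (G0 x $ i)\<^sup>2 + 2 * ((real (Suc m))\<^sup>2 * (f0 x)\<^sup>2))" using sq by simp
            have "(\<theta> m x * G0 x $ i + f0 x * T m x $ i)\<^sup>2 \<le> 2 * (G0 x $ i)\<^sup>2 + 2 * ((real (Suc m))\<^sup>2 * (f0 x)\<^sup>2)" for x
            proof -
              have "(\<theta> m x * G0 x $ i + f0 x * T m x $ i)\<^sup>2 \<le> 2 * (\<theta> m x * G0 x $ i)\<^sup>2 + 2 * (f0 x * T m x $ i)\<^sup>2"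
                using sum_squares_bound[of "\<theta> m x * G0 x $ i" "f0 x * T m x $ i"] by (simp add: power2_sum)
              also have "(\<theta> m x * G0 x $ i)\<^sup>2 \<le> (G0 x $ i)\<^sup>2"
                using th1[of x] by (simp add: power_mult_distrib mult_left_le_one_le)
              also have "(f0 x * T m x $ i)\<^sup>2 \<le> (real (Suc m))\<^sup>2 * (f0 x)\<^sup>2"
              proof -
                have "\<bar>T m x $ i\<bar> \<le> Suc m" using component_le_norm_cart[of "T m x" i] Tb[of m x] by simp
                then have "\<bar>T m x $ i\<bar>\<^sup>2 \<le> (real (Suc m))\<^sup>2" by (rule power_mono) simp
                then have "(T m x $ i)\<^sup>2 * (f0 x)\<^sup>2 \<le> (real (Suc m))\<^sup>2 * (f0 x)\<^sup>2" by (intro mult_right_mono) auto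
                then show ?thesis by (simp add: power_mult_distrib mult.commute)
              qed
              finally show ?thesis by simp
            qed
            then show "AE x in lborel. norm ((\<theta> m x * G0 x $ i + f0 x * T m x $ i)\<^sup>2) \<le> norm (2 * (G0 x $ i)\<^sup>2 + 2 * ((real (Suc m))\<^sup>2 * (f0 x)\<^sup>2))"
              by (intro AE_I2) simp
          qed measurable
        qed
        have G2e: "integrable (lebesgue_on B1) (\<lambda>x. (norm (?G x))\<^sup>2) \<longleftrightarrow> integrable lborel (\<lambda>x. \<Sum>i\<in>UNIV. (\<theta> m x * G0 x $ i + f0 x * T m x $ i)\<^sup>2)"
        proof (rule lebesgue_on_transfer(3))
          show "AE x in lebesgue. x \<in> B1 \<longrightarrow> (norm (?G x))\<^sup>2 = (\<Sum>i\<in>UNIV. (\<theta> m x * G0 x $ i + f0 x * T m x $ i)\<^sup>2)"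
            using ae by eventually_elim (auto simp: norm_square_components)
          show "(\<Sum>i\<in>UNIV. (\<theta> m x * G0 x $ i + f0 x * T m x $ i)\<^sup>2) = 0" if "x \<notin> B1" for x
          proof -
            have "x \<notin> K" using that K(2) by blast
            then show ?thesis using z by simp
          qed
        qed auto
        have K': "compact ?K" "?K \<subseteq> B1 - {0}" using K by (auto intro: compact_diff)
        have supp': "AE x in lebesgue. x \<in> B1 \<longrightarrow> x \<notin> ?K \<longrightarrow> ?f x = 0"
          using supp
        proof eventually_elim
          case (elim x)
          have "\<theta> m x = 0" if "norm x < 1 / Suc m"
            using cutoff_in_eq_0[of "norm x" "1 / Suc m"] that by (cases "x = 0") (auto simp: \<theta>_def)
          then show ?case using elim by auto
        qed
        have "0 \<le> (LINT x|lebesgue_on B1. q (norm x) ^ (k + 1) * ((x \<bullet> ?G x)\<^sup>2 + 2 * \<beta> * ?f x * (x \<bullet> ?G x) - \<gamma> * (?f x)\<^sup>2))"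
          by (rule J_nonneg_H1_punctured[OF J g f2e[THEN iffD2, OF f2i] G2e[THEN iffD2, OF G2i] K' supp'])
        also have "\<dots> = integral\<^sup>L lborel (Im m)"
        proof (rule lebesgue_on_transfer(2))
          show "AE x in lebesgue. x \<in> B1 \<longrightarrow> q (norm x) ^ (k + 1) * ((x \<bullet> ?G x)\<^sup>2 + 2 * \<beta> * ?f x * (x \<bullet> ?G x) - \<gamma> * (?f x)\<^sup>2) = Im m x"
            using ae ne0
          proof eventually_elim
            case (elim x)
            show ?case
            proof
              assume "x \<in> B1"
              then have e: "f x = f0 x" "G x = G0 x" using elim by auto
              have x: "x \<bullet> ?G x = \<theta> m x * a x + X m x * f0 x" using xT[OF elim(3), of m] by (simp add: e inner_add_right a_def)
              show "q (norm x) ^ (k + 1) * ((x \<bullet> ?G x)\<^sup>2 + 2 * \<beta> * ?f x * (x \<bullet> ?G x) - \<gamma> * (?f x)\<^sup>2) = Im m x"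
                unfolding e x[unfolded e] Im_def
                using wK[OF _ elim(3)] z[of x] by (cases "x \<in> K") (auto simp: mult.commute a_def)
            qed
          qed
          show "Im m x = 0" if "x \<notin> B1" for x using that R(2) by (auto simp: Im_def w_def indicator_def)
        qed auto
        finally show ?thesis .
      qed
      then have "0 \<le> integral\<^sup>L lborel I'" by (intro LIMSEQ_le_const[OF dc(2)]) auto
      also have "\<dots> \<le> integral\<^sup>L lborel I"
        by (rule integral_mono[OF dc(1) Ii]) (auto simp: I_def I'_def asq intro!: mult_left_mono w0)
      finally show ?thesis unfolding integral_nonneg_integrable[OF Ii] .
    qed
  qed
  moreover have "AE x in lebesgue. x \<in> B1 \<longrightarrow> h x = I x"
    using h ae ne0
  proof eventually_elim
    case (elim x)
    show ?case
    proof
      assume "x \<in> B1"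
      then have e: "h x = q (norm x) ^ (k + 1) * ((norm x * norm (G0 x))\<^sup>2 + 2 * \<beta> * f0 x * (x \<bullet> G0 x) - \<gamma> * (f0 x)\<^sup>2)"
        using elim by auto
      show "h x = I x"
        unfolding e I_def using wK[OF _ elim(4)] z[of x] by (cases "x \<in> K") (auto simp: a_def s_def)
    qed
  qed
  moreover have "I x = 0" if "x \<notin> B1" for x using that R(2) by (auto simp: I_def w_def indicator_def)
  ultimately show ?thesis using integral_nonneg_transfer[of B1 I h] by simp
qed

text \<open>For the implication from right to left, \<open>C\<^sup>1\<close> functions with compact support in the punctured ball are
  admissible, and for radial ones \<open>|x| |\<nabla>\<eta>| = |(x, \<nabla>\<eta>)|\<close>.\<close>

lemma weighted_condition_iff_J_nonneg:
  "J_nonneg \<longleftrightarrow> (\<forall>\<eta> :: real^'n \<Rightarrow> real. \<eta> \<in> H1_c B1 \<inter> Linf_loc B1 \<and> radially_symmetric B1 \<eta> \<longrightarrow>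
       integral_nonneg (lebesgue_on B1) (\<lambda>x.
         (deriv v (norm x) / norm x) ^ (k + 1) *
         ((norm (norm x *\<^sub>R weak_grad B1 \<eta> x))\<^sup>2
          + (real k - 1) / (real k + 1) * (x \<bullet> weak_grad B1 (\<lambda>y. (\<eta> y)\<^sup>2) x)
          - (2 * real n - real k - 1) / (real k + 1) * (\<eta> x)\<^sup>2)))" (is "_ \<longleftrightarrow> (\<forall>\<eta>. _ \<longrightarrow> integral_nonneg _ (?h \<eta>))")
proof -
  have ne0: "AE x in lebesgue. x \<noteq> (0 :: real^'n)" by (rule AE_completion[OF AE_lborel_singleton])
  have h: "AE x in lebesgue. x \<in> B1 \<longrightarrow> ?h \<eta> x = q (norm x) ^ (k + 1) * ((norm x * norm (G x))\<^sup>2 + 2 * \<beta> * \<eta> x * (x \<bullet> G x) - \<gamma> * (\<eta> x)\<^sup>2)"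
    if \<eta>: "has_weak_grad B1 \<eta> G" "has_weak_grad B1 (\<lambda>x. (\<eta> x)\<^sup>2) (\<lambda>x. (2 * \<eta> x) *\<^sub>R G x)" for \<eta> :: "real^'n \<Rightarrow> real" and G
    using weak_grad_AE_eq[OF open_ball \<eta>(1)] weak_grad_AE_eq[OF open_ball \<eta>(2)] ne0
  proof eventually_elim
    case (elim x)
    show ?case
    proof
      assume x: "x \<in> B1"
      then have r: "0 < norm x" "norm x < 1" using elim(3) by auto
      have d: "deriv v (norm x) / norm x = q (norm x)" using DERIV_imp_deriv[OF v'[OF r]] r by simp
      have e: "weak_grad B1 \<eta> x = G x" "weak_grad B1 (\<lambda>x. (\<eta> x)\<^sup>2) x = (2 * \<eta> x) *\<^sub>R G x" using elim(1,2) x by auto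
      show "?h \<eta> x = q (norm x) ^ (k + 1) * ((norm x * norm (G x))\<^sup>2 + 2 * \<beta> * \<eta> x * (x \<bullet> G x) - \<gamma> * (\<eta> x)\<^sup>2)"
        unfolding d e \<beta>_def \<gamma>_def by simp
    qed
  qed
  show ?thesis
  proof (intro iffI allI impI)
    fix \<eta> :: "real^'n \<Rightarrow> real"
    assume J: J_nonneg and \<eta>: "\<eta> \<in> H1_c B1 \<inter> Linf_loc B1 \<and> radially_symmetric B1 \<eta>"
    then obtain G where G: "has_weak_grad B1 \<eta> G" "integrable (lebesgue_on B1) (\<lambda>x. (\<eta> x)\<^sup>2)"
        "integrable (lebesgue_on B1) (\<lambda>x. (norm (G x))\<^sup>2)"
      unfolding H1_c_def H1_def by auto
    from \<eta> obtain K where K: "compact K" "K \<subseteq> B1" "AE x in lebesgue_on B1. x \<notin> K \<longrightarrow> \<eta> x = 0"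
      unfolding H1_c_def by auto
    have supp: "AE x in lebesgue. x \<in> B1 \<longrightarrow> x \<notin> K \<longrightarrow> \<eta> x = 0"
      using K(3) by (simp add: AE_restrict_space_iff)
    obtain M where "AE x in lebesgue_on K. \<bar>\<eta> x\<bar> \<le> M" using \<eta> K(1,2) unfolding Linf_loc_def by blast
    moreover have "K \<in> sets lebesgue" using K(1) by (simp add: borel_compact)
    ultimately have M: "AE x in lebesgue. x \<in> K \<longrightarrow> \<bar>\<eta> x\<bar> \<le> M" by (simp add: AE_restrict_space_iff)
    have M': "AE x in lebesgue. x \<in> B1 \<longrightarrow> \<bar>\<eta> x\<bar> \<le> \<bar>M\<bar>" using supp M by eventually_elim force
    show "integral_nonneg (lebesgue_on B1) (?h \<eta>)"
      by (rule weighted_form_nonneg[OF J G K(1,2) supp M' h[OF G(1) has_weak_grad_square[OF G K(1,2) supp]]])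
  next
    assume *: "\<forall>\<eta>. \<eta> \<in> H1_c B1 \<inter> Linf_loc B1 \<and> radially_symmetric B1 \<eta> \<longrightarrow> integral_nonneg (lebesgue_on B1) (?h \<eta>)"
    show J_nonneg
      unfolding J_nonneg_def
    proof (intro allI impI)
      fix f f' assume t: "test1 f f'"
      let ?\<eta> = "\<lambda>x :: real^'n. f (norm x)"
      note C0 = C1_c_radial(1)[OF t, where 'n='n]
      have g: "C1_with ?\<eta> (grad ?\<eta>)" using C0 unfolding C1_c_iff by blast
      have C: "C1_c B1 ?\<eta>" using C0 unfolding C1_c_iff by blast
      have w: "has_weak_grad B1 ?\<eta> (grad ?\<eta>)" by (rule has_weak_grad_C1[OF open_ball g])
      have "has_weak_grad B1 (\<lambda>x. ?\<eta> x * ?\<eta> x) (\<lambda>x. ?\<eta> x *\<^sub>R grad ?\<eta> x + ?\<eta> x *\<^sub>R grad ?\<eta> x)"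
        by (rule has_weak_grad_C1[OF open_ball C1_with_mult[OF g g]])
      moreover have e: "t *\<^sub>R z + t *\<^sub>R z = (2 * t) *\<^sub>R z" for t and z :: "real^'n" by (simp only: mult_2 scaleR_add_left)
      ultimately have w2: "has_weak_grad B1 (\<lambda>x. (?\<eta> x)\<^sup>2) (\<lambda>x. (2 * ?\<eta> x) *\<^sub>R grad ?\<eta> x)"
        by (simp only: e power2_eq_square)
      have "integral_nonneg (lebesgue_on B1) (?h ?\<eta>)"
      proof (rule *[rule_format], intro conjI IntI)
        show "radially_symmetric B1 ?\<eta>" unfolding radially_symmetric_def by blast
      qed (use C1_c_in_H1_c[OF C] in blast)+
      moreover have "integral_nonneg (lebesgue_on B1) (?h ?\<eta>) \<longleftrightarrow> integral_nonneg lborel (Jn ?\<eta>)"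
      proof (rule integral_nonneg_transfer)
        show "AE x in lebesgue. x \<in> B1 \<longrightarrow> ?h ?\<eta> x = Jn ?\<eta> x"
          using h[OF w w2]
        proof (rule eventually_mono)
          fix x
          have "(norm x * norm (grad ?\<eta> x))\<^sup>2 = (x \<bullet> grad ?\<eta> x)\<^sup>2"
            unfolding C1_c_radial(2)[OF t] by (simp add: dot_square_norm power2_eq_square power_mult_distrib)
          then show "x \<in> B1 \<longrightarrow> ?h ?\<eta> x = q (norm x) ^ (k + 1) * ((norm x * norm (grad ?\<eta> x))\<^sup>2 + 2 * \<beta> * ?\<eta> x * (x \<bullet> grad ?\<eta> x) - \<gamma> * (?\<eta> x)\<^sup>2)
             \<Longrightarrow> x \<in> B1 \<longrightarrow> ?h ?\<eta> x = Jn ?\<eta> x"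
            by (simp add: Jn_def)
        qed
        show "Jn ?\<eta> \<in> borel_measurable borel" using Qn_Jn_integrable(2)[OF C0] by auto
      qed (use Qn_Jn_integrable(4)[OF C0] in auto)
      ultimately have "0 \<le> (\<integral>x. Jn ?\<eta> x \<partial>lborel)"
        unfolding integral_nonneg_integrable[OF Qn_Jn_integrable(2)[OF C0]] by blast
      then show "0 \<le> (\<integral>r. indicator {0<..} r * (J_form f f' r * r ^ (n - 1)) \<partial>lborel)"
        by (rule radial_nonneg_imp(2)[OF t])
    qed
  qed
qed

end

section \<open>Classical radial solutions\<close>

lemma C1_on_UNIV_real:
  fixes g :: "real \<Rightarrow> real"
  assumes "g C1_differentiable_on UNIV"
  obtains g' where "\<And>t. (g has_real_derivative g' t) (at t)" "continuous_on UNIV g'"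
proof -
  from assms obtain D where "\<forall>t\<in>UNIV. (g has_vector_derivative D t) (at t)" "continuous_on UNIV D"
    unfolding C1_differentiable_on_def by (elim exE conjE)
  then show ?thesis by (intro that[of D]) (simp_all add: has_real_derivative_iff_has_vector_derivative)
qed

lemma has_derivative_along_axis:
  fixes f :: "real^'n::finite \<Rightarrow> real"
  assumes "f differentiable (at (r *\<^sub>R axis i 1))"
  shows "((\<lambda>r. f (r *\<^sub>R axis i 1)) has_real_derivative partial i f (r *\<^sub>R axis i 1)) (at r)"
proof -
  have f: "(f has_derivative (\<lambda>h. grad f (r *\<^sub>R axis i 1) \<bullet> h)) (at (r *\<^sub>R axis i 1))" by (rule has_derivative_grad[OF assms])
  have l: "((\<lambda>r. r *\<^sub>R (axis i 1 :: real^'n)) has_derivative (\<lambda>h. h *\<^sub>R axis i 1)) (at r)" by (auto intro!: derivative_eq_intros)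
  have "((\<lambda>r. f (r *\<^sub>R axis i 1)) has_derivative (\<lambda>h. grad f (r *\<^sub>R axis i 1) \<bullet> (h *\<^sub>R axis i 1))) (at r)"
    by (rule has_derivative_compose[OF l f])
  moreover have "(\<lambda>h. grad f (r *\<^sub>R axis i 1) \<bullet> (h *\<^sub>R axis i 1)) = (*) (partial i f (r *\<^sub>R axis i 1))"
    by (auto simp: inner_axis grad_def mult.commute)
  ultimately show ?thesis unfolding has_field_derivative_def by simp
qed

text \<open>A radial function is even along an axis, so that \<open>u'(0) = 0\<close> and the flux vanishes at the origin. It is
  nonnegative and strictly increasing, which upgrades \<open>u' \<ge> 0\<close> to \<open>q > 0\<close>.\<close>

lemma radial_core_classical:
  fixes u :: "real^'n::finite \<Rightarrow> real"
  assumes n: "n = CARD('n)" and k: "1 \<le> k" "k \<le> n" and g_pos: "\<And>t. g t > 0"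
    and g': "\<And>t. (g has_real_derivative g' t) (at t)" "continuous_on UNIV g'"
    and u: "radial_profile u v" and cl: "classical_solution k g u"
    and mono: "\<forall>r\<in>{0<..<1}. v differentiable (at r) \<longrightarrow> deriv v r \<ge> 0"
  shows "\<exists>q q'. radial_core u v g g' q q' n k"
proof -
  have uv: "u x = v (norm x)" if "x \<in> B1" for x using u that unfolding radial_profile_def by blast
  define i :: 'n where "i = undefined"
  let ?e = "axis i 1 :: real^'n"
  define U where "U r = u (r *\<^sub>R ?e)" for r
  define d1 where "d1 r = partial i u (r *\<^sub>R ?e)" for r
  define d2 where "d2 r = partial i (partial i u) (r *\<^sub>R ?e)" for r
  have inB: "r *\<^sub>R ?e \<in> B1" if "\<bar>r\<bar> < 1" for r using that by simp
  have dif: "u differentiable (at x)" "partial i u differentiable (at x)" if "x \<in> B1" for x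
    using cl that unfolding classical_solution_def C2_on_def C1_on_def by blast+
  have U': "(U has_real_derivative d1 r) (at r)" and d1': "(d1 has_real_derivative d2 r) (at r)" if "\<bar>r\<bar> < 1" for r
    unfolding U_def d1_def d2_def using has_derivative_along_axis dif inB[OF that] by blast+
  have v': "(v has_real_derivative d1 r) (at r)" if "0 < r" "r < 1" for r
  proof (rule has_field_derivative_transform_within_open[OF U', of r "{0<..<1}"])
    fix s :: real assume "s \<in> {0<..<1}"
    then show "U s = v s" using uv[OF inB[of s]] by (simp add: U_def)
  qed (use that in auto)
  define q where "q r = d1 r / r" for r
  define q' where "q' r = (d2 r * r - d1 r) / (r * r)" for r
  have q'd: "(q has_real_derivative q' r) (at r)" if "0 < r" "r < 1" for r
    unfolding q_def q'_def using that by (auto intro!: derivative_eq_intros d1')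
  have rq: "r * q r = d1 r" if "0 < r" for r using that by (simp add: q_def)
  have v'q: "(v has_real_derivative r * q r) (at r)" if "0 < r" "r < 1" for r using v'[OF that] rq that by simp
  have c: "c_nk n k > 0" using k by (simp add: c_nk_def zero_less_binomial)
  have ode: "c_nk n k * (real n * q r ^ k + real k * q r ^ (k - 1) * (r * q' r)) = g (v r)" if r: "0 < r" "r < 1" for r
  proof -
    let ?x = "r *\<^sub>R ?e"
    have x: "?x \<in> B1" "?x \<noteq> 0" "norm ?x = r" using r inB[of r] by auto
    have H: "hessian u ?x = radial_matrix (q r) (r * q' r) ((1 / r) *\<^sub>R ?x)"
      using hessian_radial[OF uv v'q q'd x(1,2)] unfolding x(3) .
    have e: "((1 / r) *\<^sub>R ?x) \<bullet> ((1 / r) *\<^sub>R ?x) = 1" using r by (simp add: inner_axis)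
    have "g (u ?x) = S k (hessian u ?x)" using cl x(1) unfolding classical_solution_def by metis
    also have "\<dots> = c_nk n k * (real n * q r ^ k + real k * q r ^ (k - 1) * (r * q' r))"
      unfolding H n by (rule S_radial_matrix[OF k(1) _ e]) (use k n in simp)
    finally show ?thesis using uv[OF x(1)] x(3) by simp
  qed
  have d10: "d1 0 = 0"
  proof -
    have r: "((\<lambda>r. U (- r)) has_real_derivative d1 (- 0) * (- 1)) (at 0)"
      by (rule DERIV_chain2[OF U']) (auto intro!: derivative_eq_intros)
    have "((\<lambda>r. U r) has_real_derivative d1 (- 0) * (- 1)) (at 0)"
    proof (rule has_field_derivative_transform_within_open[OF r, of "{-1<..<1}"])
      fix s :: real assume "s \<in> {-1<..<1}"
      then have "\<bar>s\<bar> < 1" by auto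
      then show "U (- s) = U s" unfolding U_def using uv[OF inB[of s]] uv[OF inB[of "- s"]] by simp
    qed auto
    then have "d1 (- 0) * (- 1) = d1 0" by (rule DERIV_unique) (use U'[of 0] in simp)
    then show ?thesis by simp
  qed
  have nz: "r ^ n * q r ^ k = r ^ (n - k) * d1 r ^ k" if "0 < r" for r
  proof -
    have "r ^ n = r ^ (n - k) * r ^ k" using k by (simp flip: power_add)
    then show ?thesis using that by (simp add: q_def power_divide)
  qed
  have q_nonneg: "0 \<le> q r" if "0 < r" "r < 1" for r
  proof -
    have "0 \<le> deriv v r" using mono v'[OF that] that unfolding differentiable_def has_field_derivative_def by auto
    then have "0 \<le> d1 r" using DERIV_imp_deriv[OF v'[OF that]] by simp
    then show ?thesis using that by (simp add: q_def)
  qed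
  have q_pos: "0 < q r" if r: "0 < r" "r < 1" for r
  proof -
    have lt: "r / 2 < r" using r by simp
    have "(\<lambda>r. r ^ n * q r ^ k) (r / 2) < (\<lambda>r. r ^ n * q r ^ k) r"
    proof (rule DERIV_pos_imp_increasing[OF lt])
      fix x assume "r / 2 \<le> x" "x \<le> r"
      then have x: "0 < x" "x < 1" using r by auto
      show "\<exists>y. ((\<lambda>r. r ^ n * q r ^ k) has_real_derivative y) (at x) \<and> 0 < y"
        using flux_has_derivative[OF _ k(1) _ q'd[OF x] ode[OF x]] k c g_pos[of "v x"] x
        by (intro exI[of _ "x ^ (n - 1) * g (v x) / c_nk n k"] conjI) auto
    qed
    moreover have "0 \<le> (r / 2) ^ n * q (r / 2) ^ k" using q_nonneg[of "r / 2"] r by simp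
    ultimately have "0 < r ^ n * q r ^ k" by linarith
    then have "q r \<noteq> 0" using k by (intro notI) (simp add: power_0_left)
    then show ?thesis using q_nonneg[OF r] by simp
  qed
  have c1: "continuous_on {-1<..<1} d1"
    by (rule DERIV_continuous_on[where D=d2]) (auto intro!: DERIV_subset[OF d1'])
  have "((\<lambda>r. r ^ (n - k) * d1 r ^ k) \<longlongrightarrow> 0 ^ (n - k) * d1 0 ^ k) (at_right 0)"
  proof (intro tendsto_intros)
    show "(d1 \<longlongrightarrow> d1 0) (at_right 0)" using DERIV_isCont[OF d1'[of 0]] by (simp add: isCont_def filterlim_at_split)
  qed
  then have lim: "((\<lambda>r. r ^ (n - k) * d1 r ^ k) \<longlongrightarrow> 0) (at_right 0)" using d10 k by (simp add: power_0_left)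
  have flux_lim: "((\<lambda>r. r ^ n * q r ^ k) \<longlongrightarrow> 0) (at_right 0)"
    by (rule Lim_transform_eventually[OF lim]) (auto simp: nz eventually_at_filter)
  have energy: "(\<integral>\<^sup>+r. indicator {0<..<1/2} r * ennreal (r ^ (n + 1) * q r ^ (k + 1)) \<partial>lborel) < \<infinity>"
  proof -
    have "bounded (d1 ` {0..1/2})"
      by (intro compact_imp_bounded compact_continuous_image continuous_on_subset[OF c1]) auto
    then obtain M where M: "\<forall>y\<in>d1 ` {0..1/2}. norm y \<le> M" unfolding bounded_iff by blast
    have "r ^ (n + 1) * q r ^ (k + 1) \<le> \<bar>M\<bar> ^ (k + 1)" if r: "0 < r" "r < 1/2" for r
    proof -
      have "0 \<le> r * q r" using q_nonneg[of r] r by simp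
      moreover have "norm (d1 r) \<le> M" using M r by auto
      ultimately have d: "0 \<le> d1 r" "d1 r \<le> \<bar>M\<bar>" using rq[OF r(1)] by auto
      have "r ^ (n + 1) * q r ^ (k + 1) = r ^ n * q r ^ k * d1 r" using rq[OF r(1)] by (simp add: mult_ac)
      also have "\<dots> = r ^ (n - k) * (d1 r ^ k * d1 r)" unfolding nz[OF r(1)] by simp
      also have "\<dots> \<le> 1 * (\<bar>M\<bar> ^ k * \<bar>M\<bar>)" using d r by (intro mult_mono power_mono power_le_one) auto
      finally show ?thesis by (simp add: mult.commute)
    qed
    then have "(\<integral>\<^sup>+r. indicator {0<..<1/2} r * ennreal (r ^ (n + 1) * q r ^ (k + 1)) \<partial>lborel)
        \<le> (\<integral>\<^sup>+r. ennreal (\<bar>M\<bar> ^ (k + 1)) * indicator {0<..<1/2::real} r \<partial>lborel)"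
      by (intro nn_integral_mono) (simp add: indicator_def ennreal_leI)
    also have "\<dots> = ennreal (\<bar>M\<bar> ^ (k + 1)) * ennreal (1/2 - 0)" by (subst nn_integral_cmult_indicator) simp_all
    also have "\<dots> = ennreal (\<bar>M\<bar> ^ (k + 1) * (1/2 - 0))" by (rule ennreal_mult[symmetric]) simp_all
    also have "\<dots> < \<infinity>" by simp
    finally show ?thesis .
  qed
  have "radial_core u v g g' q q' n k"
    by unfold_locales (fact n k uv v'q q'd q_pos g' g_pos ode flux_lim energy)+
  then show ?thesis by blast
qed

section \<open>Radial integrals and null sets\<close>

lemma integrable_radial_iff:
  fixes f :: "real \<Rightarrow> real"
  assumes [measurable]: "f \<in> borel_measurable borel"
  shows "integrable lborel (\<lambda>x :: 'a::euclidean_space. f (norm x)) \<longleftrightarrow> integrable lborel (\<lambda>r. indicator {0<..} r * (f r * r ^ (DIM('a) - 1)))"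
proof -
  obtain C :: real where C: "C > 0"
    "\<And>h. h \<in> borel_measurable borel \<Longrightarrow> (\<integral>\<^sup>+x. h (norm x) \<partial>(lborel :: 'a measure))
       = ennreal C * (\<integral>\<^sup>+r. indicator {0<..} r * h r * ennreal (r ^ (DIM('a) - 1)) \<partial>lborel)"
    using nn_integral_radial by blast
  have m: "(\<lambda>r. ennreal (norm (f r))) \<in> borel_measurable borel" by measurable
  have "(\<integral>\<^sup>+x. ennreal (norm (f (norm x))) \<partial>(lborel :: 'a measure))
     = ennreal C * (\<integral>\<^sup>+r. indicator {0<..} r * ennreal (norm (f r)) * ennreal (r ^ (DIM('a) - 1)) \<partial>lborel)"
    by (rule C(2)[OF m])
  also have "(\<lambda>r. indicator {0<..} r * ennreal (norm (f r)) * ennreal (r ^ (DIM('a) - 1)))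
     = (\<lambda>r. ennreal (norm (indicator {0<..} r * (f r * r ^ (DIM('a) - 1)))))"
    by (rule ext) (auto simp: indicator_def abs_mult ennreal_mult)
  finally have "(\<integral>\<^sup>+x. ennreal (norm (f (norm x))) \<partial>(lborel :: 'a measure)) < \<infinity> \<longleftrightarrow>
     (\<integral>\<^sup>+r. ennreal (norm (indicator {0<..} r * (f r * r ^ (DIM('a) - 1)))) \<partial>lborel) < \<infinity>"
    using C(1) by (auto simp: ennreal_mult_less_top ennreal_zero_less_mult_iff)
  then show ?thesis unfolding integrable_iff_bounded by simp
qed

lemma integral_radial_eq_0:
  fixes f :: "real \<Rightarrow> real"
  assumes [measurable]: "f \<in> borel_measurable borel"
    and F: "integrable lborel (\<lambda>x :: 'a::euclidean_space. f (norm x))" and z: "(\<integral>x. f (norm (x :: 'a)) \<partial>lborel) = 0"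
  shows "(\<integral>r. indicator {0<..} r * (f r * r ^ (DIM('a) - 1)) \<partial>lborel) = 0"
proof (rule antisym)
  have i: "integrable lborel (\<lambda>r. indicator {0<..} r * (f r * r ^ (DIM('a) - 1)))" using F integrable_radial_iff[OF assms(1), where 'a='a] by blast
  show "0 \<le> (\<integral>r. indicator {0<..} r * (f r * r ^ (DIM('a) - 1)) \<partial>lborel)"
    by (rule integral_radial_nonneg[OF _ F _ i]) (use z in auto)
  have "0 \<le> (\<integral>r. indicator {0<..} r * (- f r * r ^ (DIM('a) - 1)) \<partial>lborel)"
    by (rule integral_radial_nonneg[where f="\<lambda>r. - f r" and 'a='a]) (use F z i in auto)
  then show "(\<integral>r. indicator {0<..} r * (f r * r ^ (DIM('a) - 1)) \<partial>lborel) \<le> 0" by simp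
qed

lemma AE_radial:
  assumes "AE r in lebesgue. r > 0 \<longrightarrow> P (r :: real)"
  shows "AE x in lebesgue. x \<noteq> (0 :: 'a::euclidean_space) \<longrightarrow> P (norm x)"
proof -
  have "AE r in lborel. r > 0 \<longrightarrow> P r" using assms by (simp add: AE_completion_iff)
  then obtain N where N: "{r \<in> space lborel. \<not> (r > 0 \<longrightarrow> P r)} \<subseteq> N" "N \<in> null_sets lborel"
    unfolding eventually_ae_filter by blast
  have [measurable]: "N \<in> sets borel" using N(2) by (auto simp: null_sets_def)
  obtain C :: real where C: "C > 0"
    "\<And>h. h \<in> borel_measurable borel \<Longrightarrow> (\<integral>\<^sup>+x. h (norm x) \<partial>(lborel :: 'a measure))
       = ennreal C * (\<integral>\<^sup>+r. indicator {0<..} r * h r * ennreal (r ^ (DIM('a) - 1)) \<partial>lborel)"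
    using nn_integral_radial by blast
  have m: "(\<lambda>r. indicator N r :: ennreal) \<in> borel_measurable borel" by measurable
  have "AE r in lborel. indicator {0<..} r * indicator N r * ennreal (r ^ (DIM('a) - 1)) = 0"
    using AE_not_in[OF N(2)] by eventually_elim simp
  then have "(\<integral>\<^sup>+r. indicator {0<..} r * indicator N r * ennreal (r ^ (DIM('a) - 1)) \<partial>lborel) = 0"
    by (subst nn_integral_0_iff_AE) auto
  then have "(\<integral>\<^sup>+x. indicator N (norm (x :: 'a)) \<partial>lborel) = 0" using C(2)[OF m] by simp
  then have "AE x in lborel. indicator N (norm (x :: 'a)) = (0 :: ennreal)" by (subst (asm) nn_integral_0_iff_AE) auto
  then have "AE x in lborel. x \<noteq> (0 :: 'a) \<longrightarrow> P (norm x)"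
  proof eventually_elim
    case (elim x)
    then have "norm x \<notin> N" by (auto simp: indicator_def split: if_splits)
    then have "norm x \<notin> {r \<in> space lborel. \<not> (r > 0 \<longrightarrow> P r)}" using N(1) by blast
    then show ?case by auto
  qed
  then show ?thesis by (simp add: AE_completion_iff)
qed

section \<open>Weak radial solutions\<close>

lemma radial_test_function_from_derivative:
  fixes \<psi> :: "real \<Rightarrow> real"
  assumes ab: "0 < a" "a < b" "b < 1" and \<psi>: "continuous_on UNIV \<psi>" "\<And>r. r \<notin> {a..b} \<Longrightarrow> \<psi> r = 0"
  shows "\<exists>\<zeta>. (\<forall>r. (\<zeta> has_real_derivative \<psi> r) (at r)) \<and> (\<forall>r\<ge>b. \<zeta> r = 0)"
proof -
  define Z where "Z r = integral {0..r} \<psi>" for r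
  have Z0: "Z r = 0" if "r < a" for r
  proof -
    have "integral {0..r} \<psi> = integral {0..r} (\<lambda>_. 0)" by (rule integral_cong) (use that \<psi>(2) in auto)
    then show ?thesis by (simp add: Z_def)
  qed
  have Z': "(Z has_real_derivative \<psi> r) (at r)" for r
  proof (cases "r < a")
    case True
    have "((\<lambda>_. 0) has_real_derivative 0) (at r)" by simp
    then have "(Z has_real_derivative 0) (at r)"
      by (rule has_field_derivative_transform_within_open[of _ _ _ "{..<a}"]) (use True Z0 in auto)
    then show ?thesis using \<psi>(2)[of r] True by simp
  next
    case False
    have "((\<lambda>x. integral {0..x} \<psi>) has_real_derivative \<psi> r) (at r within {0..r + 1})"
      by (rule integral_has_real_derivative[OF continuous_on_subset[OF \<psi>(1)]]) (use False ab in auto)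
    moreover have "at r within {0..r + 1} = at r" by (rule at_within_Icc_at) (use False ab in auto)
    ultimately show ?thesis by (simp add: Z_def[abs_def])
  qed
  have Zb: "Z r - Z b = 0" if "b \<le> r" for r
  proof (cases "b = r")
    case False
    have "Z r = Z b"
    proof (rule DERIV_isconst_end[where f=Z and a=b and b=r])
      show "b < r" using False that by simp
      show "continuous_on {b..r} Z" by (rule DERIV_continuous_on[where D=\<psi>]) (rule DERIV_subset[OF Z'], simp)
      show "(Z has_real_derivative 0) (at x)" if "b < x" "x < r" for x using Z'[of x] \<psi>(2)[of x] that by simp
    qed
    then show ?thesis by simp
  qed simp
  have "((\<lambda>r. Z r - Z b) has_real_derivative \<psi> r) (at r)" for r using Z'[of r] by (auto intro!: derivative_eq_intros)
  with Zb show ?thesis by (intro exI[of _ "\<lambda>r. Z r - Z b"]) blast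
qed

lemma C1_c_radial_constant_near_origin:
  assumes ab: "0 < a" "b < 1" and \<psi>: "continuous_on UNIV \<psi>" "\<And>r. r \<notin> {a..b} \<Longrightarrow> \<psi> r = 0"
    and \<zeta>: "\<And>r. (\<zeta> has_real_derivative \<psi> r) (at r)" "\<And>r. b \<le> r \<Longrightarrow> \<zeta> r = 0"
  shows "C1_c B1 (\<lambda>x :: real^'n::finite. \<zeta> (norm x))"
    and "grad (\<lambda>x :: real^'n::finite. \<zeta> (norm x)) x = (\<psi> (norm x) / norm x) *\<^sub>R x"
proof -
  let ?T = "\<lambda>x :: real^'n. (\<psi> (norm x) / norm x) *\<^sub>R x"
  have const: "\<zeta> 0 = \<zeta> r" if r: "0 \<le> r" "r < a" for r
  proof (cases "r = 0")
    case False
    have "\<zeta> r = \<zeta> 0"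
    proof (rule DERIV_isconst_end[where f=\<zeta> and a=0 and b=r])
      show "0 < r" using False r by simp
      show "continuous_on {0..r} \<zeta>" by (rule DERIV_continuous_on[where D=\<psi>]) (rule DERIV_subset[OF \<zeta>(1)], simp)
      show "(\<zeta> has_real_derivative 0) (at x)" if "0 < x" "x < r" for x using \<zeta>(1)[of x] \<psi>(2)[of x] that r by simp
    qed
    then show ?thesis by simp
  qed simp
  have d: "((\<lambda>x. \<zeta> (norm x)) has_derivative (\<lambda>h. ?T x \<bullet> h)) (at x)" for x
  proof (cases "x = 0")
    case False
    then show ?thesis using has_derivative_radial[OF False \<zeta>(1)] by simp
  next
    case True
    have "((\<lambda>x. \<zeta> 0) has_derivative (\<lambda>h. 0)) (at x)" by simp
    then have "((\<lambda>x. \<zeta> (norm x)) has_derivative (\<lambda>h. 0)) (at x)"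
      by (rule has_derivative_transform_within_open[of _ _ _ UNIV "ball 0 a"]) (use True ab in simp, use True ab in simp, rule const, simp_all)
    then show ?thesis using True by simp
  qed
  have "continuous_on UNIV ?T"
  proof -
    have "continuous_on (- {0}) ?T" by (intro continuous_intros continuous_on_compose2[OF \<psi>(1)]) auto
    moreover have "continuous_on (ball 0 a) ?T" by (rule continuous_on_eq[of _ "\<lambda>_. 0"]) (use \<psi>(2) in auto)
    moreover have "- {0} \<union> ball 0 a = (UNIV :: (real^'n) set)" using ab by auto
    ultimately show ?thesis using continuous_on_open_Un[of "- {0}" "ball 0 a" ?T] by (simp add: open_Compl)
  qed
  then have C: "C1_with (\<lambda>x. \<zeta> (norm x)) ?T" using d unfolding C1_with_def by blast
  show "C1_c B1 (\<lambda>x :: real^'n. \<zeta> (norm x))"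
    by (rule C1_cI[OF C, of "cball 0 b"]) (use ab \<zeta>(2) in auto)
  show "grad (\<lambda>x :: real^'n. \<zeta> (norm x)) x = (\<psi> (norm x) / norm x) *\<^sub>R x"
    using C1_with_grad[OF C] by simp
qed

lemma loc_abs_continuous_imp_continuous:
  assumes v: "loc_abs_continuous {0<..<1} v"
  shows "continuous_on {0<..<1} v"
proof (rule continuous_at_imp_continuous_on, rule ballI)
  fix x :: real assume x: "x \<in> {0<..<1}"
  define a b where "a = x / 2" and "b = (1 + x) / 2"
  have ab: "0 < a" "a < x" "x < b" "b < 1" using x by (auto simp: a_def b_def)
  have *: "set_integrable lebesgue {a..y} (deriv v)" "v y - v a = integral {a..y} (deriv v)" if "y \<in> {a..b}" for y
  proof -
    have i: "set_integrable lebesgue {a..y} (deriv v)" "v y - v a = (LINT t:{a..y}|lebesgue. deriv v t)"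
    proof -
      have "a \<le> y" "{a..y} \<subseteq> {0<..<1}" using that ab by auto
      then show "set_integrable lebesgue {a..y} (deriv v)" "v y - v a = (LINT t:{a..y}|lebesgue. deriv v t)"
        using v unfolding loc_abs_continuous_def by blast+
    qed
    then show "set_integrable lebesgue {a..y} (deriv v)" "v y - v a = integral {a..y} (deriv v)"
      using set_lebesgue_integral_eq_integral(2)[OF i(1)] by auto
  qed
  have "deriv v integrable_on {a..b}" by (rule set_lebesgue_integral_eq_integral(1)[OF *(1)]) (use ab in auto)
  then have "continuous_on {a..b} (\<lambda>y. v a + integral {a..y} (deriv v))"
    by (intro continuous_intros indefinite_integral_continuous_1)
  then have "continuous_on {a..b} v" by (rule continuous_on_eq) (use *(2) in fastforce)
  then show "isCont v x" using continuous_on_interior[of "{a..b}" v x] ab by simp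
qed

text \<open>The flux is controlled by the energy because \<open>E\<^sup>k \<le> 1 + E\<^sup>k\<^sup>+\<^sup>1\<close>; away from the origin the
  power of \<open>r\<close> is immaterial.\<close>

lemma flux_test_integrable:
  fixes E \<psi> :: "real \<Rightarrow> real"
  assumes [measurable]: "E \<in> borel_measurable borel" and E: "\<And>r. 0 \<le> E r" and ab: "0 < a" "b < 1"
    and energy: "integrable lborel (\<lambda>r. indicator {0<..<1} r * (r ^ (n + 1) * E r ^ (k + 1)))"
    and \<psi>: "continuous_on UNIV \<psi>"
  shows "integrable lborel (\<lambda>r. indicator {a..b} r * (E r ^ k * r ^ n * \<psi> r))"
proof -
  have [measurable]: "\<psi> \<in> borel_measurable borel" by (rule borel_measurable_continuous_onI[OF \<psi>])
  have "bounded (\<psi> ` {a..b})"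
    by (intro compact_imp_bounded compact_continuous_image continuous_on_subset[OF \<psi>]) auto
  then obtain M where M: "\<forall>y\<in>\<psi> ` {a..b}. norm y \<le> M" unfolding bounded_iff by blast
  show ?thesis
  proof (rule Bochner_Integration.integrable_bound)
    have "integrable lborel (indicat_real {a..b})"
      by (rule integrable_real_indicator) (simp_all add: emeasure_lborel_Icc_eq)
    then show "integrable lborel (\<lambda>r. \<bar>M\<bar> * (indicator {a..b} r + 1 / a * (indicator {0<..<1} r * (r ^ (n + 1) * E r ^ (k + 1)))))"
      by (intro integrable_mult_right Bochner_Integration.integrable_add energy)
    show "AE r in lborel. norm (indicator {a..b} r * (E r ^ k * r ^ n * \<psi> r))
        \<le> norm (\<bar>M\<bar> * (indicator {a..b} r + 1 / a * (indicator {0<..<1} r * (r ^ (n + 1) * E r ^ (k + 1)))))"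
    proof (rule AE_I2)
      fix r
      show "norm (indicator {a..b} r * (E r ^ k * r ^ n * \<psi> r))
        \<le> norm (\<bar>M\<bar> * (indicator {a..b} r + 1 / a * (indicator {0<..<1} r * (r ^ (n + 1) * E r ^ (k + 1)))))"
      proof (cases "r \<in> {a..b}")
        case True
        then have r: "0 < r" "r < 1" "a \<le> r" using ab by auto
        have Ek: "E r ^ k \<le> 1 + E r ^ (k + 1)"
        proof (cases "E r \<le> 1")
          case True
          then show ?thesis using E[of r] power_le_one[OF E True, of k] by (simp add: add_increasing2)
        next
          case False
          then have "E r ^ k \<le> E r ^ (k + 1)" by (intro power_increasing) auto
          then show ?thesis by simp
        qed
        have "E r ^ k * r ^ n \<le> (1 + E r ^ (k + 1)) * r ^ n" using Ek r by (intro mult_right_mono) auto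
        also have "\<dots> \<le> 1 + 1 / a * (r ^ (n + 1) * E r ^ (k + 1))"
        proof -
          have "1 \<le> r / a" using r ab by simp
          then have "(E r ^ (k + 1) * r ^ n) * 1 \<le> (E r ^ (k + 1) * r ^ n) * (r / a)" using E r by (intro mult_left_mono) auto
          moreover have "r ^ n \<le> 1" using r by (simp add: power_le_one)
          ultimately show ?thesis by (simp add: algebra_simps)
        qed
        finally have *: "E r ^ k * r ^ n \<le> 1 + 1 / a * (r ^ (n + 1) * E r ^ (k + 1))" .
        have "norm (\<psi> r) \<le> M" using M True by blast
        then have "(E r ^ k * r ^ n) * \<bar>\<psi> r\<bar> \<le> (1 + 1 / a * (r ^ (n + 1) * E r ^ (k + 1))) * \<bar>M\<bar>"
          using * E r ab by (intro mult_mono) auto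
        moreover have "0 \<le> 1 + 1 / a * (r ^ (n + 1) * E r ^ (k + 1))" using E r ab by simp
        ultimately show ?thesis using True r E by (simp add: abs_mult mult.commute)
      qed (use ab in simp)
    qed
  qed measurable
qed

lemma source_test_integrable:
  fixes G \<zeta> :: "real \<Rightarrow> real"
  assumes G: "integrable lborel G" "\<And>r. r \<notin> {0<..<1} \<Longrightarrow> G r = 0" and \<zeta>: "continuous_on UNIV \<zeta>"
  shows "integrable lborel (\<lambda>r. G r * \<zeta> r)"
proof -
  have [measurable]: "\<zeta> \<in> borel_measurable borel" "G \<in> borel_measurable borel"
    using borel_measurable_continuous_onI[OF \<zeta>] G(1) by auto
  have "bounded (\<zeta> ` {0..1})"
    by (intro compact_imp_bounded compact_continuous_image continuous_on_subset[OF \<zeta>]) auto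
  then obtain M where M: "\<forall>y\<in>\<zeta> ` {0..1}. norm y \<le> M" unfolding bounded_iff by blast
  show ?thesis
  proof (rule Bochner_Integration.integrable_bound)
    show "integrable lborel (\<lambda>r. \<bar>M\<bar> * G r)" using G by simp
    have "norm (G r * \<zeta> r) \<le> norm (\<bar>M\<bar> * G r)" for r
    proof (cases "r \<in> {0<..<1}")
      case True
      then have "\<zeta> r \<in> \<zeta> ` {0..1}" by auto
      then have "norm (\<zeta> r) \<le> M" using M by blast
      then have "\<bar>G r\<bar> * \<bar>\<zeta> r\<bar> \<le> \<bar>G r\<bar> * \<bar>M\<bar>" by (intro mult_left_mono) auto
      then show ?thesis by (simp add: abs_mult mult.commute)
    qed (simp add: G(2))
    then show "AE r in lborel. norm (G r * \<zeta> r) \<le> norm (\<bar>M\<bar> * G r)" by simp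
  qed measurable
qed

lemma integral_lborel_unit_interval:
  fixes f :: "real \<Rightarrow> real"
  assumes "integrable lborel f" "\<And>x. x \<notin> {0..1} \<Longrightarrow> f x = 0" "(f has_integral i) {0..1}"
  shows "integral\<^sup>L lborel f = i"
proof -
  have "(\<lambda>x. if x \<in> {0..1} then f x else 0) = f" using assms(2) by auto
  then have "(f has_integral integral\<^sup>L lborel f) {0..1}"
    using has_integral_integral_lborel[OF assms(1)] has_integral_restrict_UNIV[of "{0..1}" f] by simp
  then show ?thesis using assms(3) has_integral_unique by blast
qed

text \<open>Testing with primitives shows that the flux \<open>c r\<^sup>n E\<^sup>k\<close>, where \<open>E = u'/r\<close> is known almost everywhere
  only, agrees with the continuously differentiable function \<open>\<Gamma>(r) = \<integral>\<^sub>0\<^sup>r s\<^sup>n\<^sup>-\<^sup>1 g(v(s)) ds\<close>; there is no constant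
  of integration because test functions need not vanish at the origin.\<close>

lemma flux_eq_source_primitive:
  fixes v g E :: "real \<Rightarrow> real" and c :: real and n k :: nat
  defines "G \<equiv> \<lambda>r. indicator {0<..<1} r * (r ^ (n - 1) * g (v r))"
  assumes vc: "continuous_on {0<..<1} v" and gc: "continuous_on UNIV g"
    and E[measurable]: "E \<in> borel_measurable borel" and E0: "\<And>r. 0 \<le> E r"
    and energy: "integrable lborel (\<lambda>r. indicator {0<..<1} r * (r ^ (n + 1) * E r ^ (k + 1)))"
    and source: "integrable lborel G"
    and weak: "\<And>a b \<psi> \<zeta>. 0 < a \<Longrightarrow> a < b \<Longrightarrow> b < 1 \<Longrightarrow> continuous_on UNIV \<psi> \<Longrightarrow> (\<And>r. r \<notin> {a..b} \<Longrightarrow> \<psi> r = 0) \<Longrightarrow>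
       (\<And>r. (\<zeta> has_real_derivative \<psi> r) (at r)) \<Longrightarrow> (\<And>r. b \<le> r \<Longrightarrow> \<zeta> r = 0) \<Longrightarrow>
       (\<integral>r. c * (indicator {a..b} r * (E r ^ k * r ^ n * \<psi> r)) + G r * \<zeta> r \<partial>lborel) = 0"
  shows "continuous_on {0..1} (\<lambda>r. integral {0..r} G)"
    and "\<And>r. 0 < r \<Longrightarrow> r < 1 \<Longrightarrow> ((\<lambda>r. integral {0..r} G) has_real_derivative r ^ (n - 1) * g (v r)) (at r)"
    and "AE r in lebesgue. r \<in> {0<..<1} \<longrightarrow> c * E r ^ k * r ^ n - integral {0..r} G = 0"
proof -
  define \<Gamma> where "\<Gamma> r = integral {0..r} G" for r
  have Gi: "G integrable_on {0..1}"
    using has_integral_integral_lborel[OF source] by (intro integrable_on_subinterval[of G UNIV]) auto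
  show \<Gamma>c: "continuous_on {0..1} (\<lambda>r. integral {0..r} G)" by (rule indefinite_integral_continuous_1[OF Gi])
  have Gcont: "continuous_on {0<..<1} G"
  proof (rule continuous_on_eq)
    show "continuous_on {0<..<1} (\<lambda>r. r ^ (n - 1) * g (v r))"
      by (intro continuous_intros continuous_on_compose2[OF gc vc]) auto
  qed (simp add: G_def)
  show \<Gamma>': "((\<lambda>r. integral {0..r} G) has_real_derivative r ^ (n - 1) * g (v r)) (at r)" if r: "0 < r" "r < 1" for r
  proof -
    have "continuous (at r within {0..1} - {}) G"
    proof (rule continuous_at_imp_continuous_at_within)
      show "isCont G r" using continuous_on_interior[OF Gcont, of r] r by simp
    qed
    then have "((\<lambda>u. integral {0..u} G) has_vector_derivative G r) (at r within {0..1} - {})"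
      by (intro integral_has_vector_derivative_continuous_at[OF Gi]) (use r in auto)
    moreover have "at r within {0..1} = at r" by (rule at_within_Icc_at) (use r in auto)
    ultimately show ?thesis using r by (simp add: has_real_derivative_iff_has_vector_derivative G_def)
  qed
  show "AE r in lebesgue. r \<in> {0<..<1} \<longrightarrow> c * E r ^ k * r ^ n - integral {0..r} G = 0"
  proof (rule fundamental_lemma[OF open_greaterThanLessThan])
    fix K :: "real set" assume K: "compact K" "K \<subseteq> {0<..<1}"
    obtain a b where ab: "0 < a" "b < 1" "K \<subseteq> {a..b}"
    proof (cases "K = {}")
      case True
      then show ?thesis using that[of 1 0] by simp
    next
      case False
      obtain a b where "a \<in> K" "\<forall>t\<in>K. a \<le> t" "b \<in> K" "\<forall>t\<in>K. t \<le> b"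
        using compact_attains_inf[OF K(1) False] compact_attains_sup[OF K(1) False] by blast
      moreover from this have "0 < a" "b < 1" "K \<subseteq> {a..b}" using K(2) by auto
      ultimately show ?thesis by (intro that[of a b])
    qed
    have i1: "integrable lborel (\<lambda>r. indicator {a..b} r * (E r ^ k * r ^ n * 1))"
      by (rule flux_test_integrable[OF E E0 ab(1,2) energy]) simp
    have "set_integrable lborel {a..b} \<Gamma>"
      by (rule borel_integrable_atLeastAtMost') (use ab in \<open>auto simp: \<Gamma>_def intro!: continuous_on_subset[OF \<Gamma>c]\<close>)
    then have i2: "integrable lborel (\<lambda>r. indicator {a..b} r * \<Gamma> r)" by (simp add: set_integrable_def)
    have "integrable lborel (\<lambda>r. c * (indicator {a..b} r * (E r ^ k * r ^ n * 1)) - indicator {a..b} r * \<Gamma> r)"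
      using i1 i2 by simp
    also have "(\<lambda>r. c * (indicator {a..b} r * (E r ^ k * r ^ n * 1)) - indicator {a..b} r * \<Gamma> r)
       = (\<lambda>r. indicator {a..b} r *\<^sub>R (c * E r ^ k * r ^ n - integral {0..r} G))"
      by (rule ext) (simp add: \<Gamma>_def algebra_simps)
    finally have i: "integrable lborel (\<lambda>r. indicator {a..b} r *\<^sub>R (c * E r ^ k * r ^ n - integral {0..r} G))" .
    then have "set_integrable lebesgue {a..b} (\<lambda>r. c * E r ^ k * r ^ n - integral {0..r} G)"
      unfolding set_integrable_def by (subst integrable_completion) auto
    then show "set_integrable lebesgue K (\<lambda>r. c * E r ^ k * r ^ n - integral {0..r} G)"
      by (rule set_integrable_subset) (use K ab in \<open>simp_all add: borel_compact\<close>)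
  next
    fix x \<epsilon> :: real assume \<epsilon>: "\<epsilon> > 0" "cball x \<epsilon> \<subseteq> {0<..<1}"
    define a b where "a = x - \<epsilon>" and "b = x + \<epsilon>"
    have "a \<in> cball x \<epsilon>" "b \<in> cball x \<epsilon>" using \<epsilon>(1) by (auto simp: a_def b_def dist_real_def)
    then have "a \<in> {0<..<1}" "b \<in> {0<..<1}" using \<epsilon>(2) by blast+
    then have ab: "0 < a" "a < b" "b < 1" using \<epsilon>(1) by (auto simp: a_def b_def)
    define \<psi> where "\<psi> y = mollifier \<epsilon> (x - y)" for y
    have \<psi>c: "continuous_on UNIV \<psi>" unfolding \<psi>_def by (intro continuous_intros)
    have \<psi>0: "\<psi> r = 0" if "r \<notin> {a..b}" for r
      unfolding \<psi>_def by (rule mollifier_eq_0) (use that \<epsilon>(1) in \<open>auto simp: a_def b_def\<close>)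
    obtain \<zeta> where \<zeta>: "\<And>r. (\<zeta> has_real_derivative \<psi> r) (at r)" "\<And>r. b \<le> r \<Longrightarrow> \<zeta> r = 0"
      using radial_test_function_from_derivative[OF ab \<psi>c \<psi>0] by blast
    have \<zeta>c: "continuous_on A \<zeta>" for A by (rule DERIV_continuous_on[where D=\<psi>]) (rule DERIV_subset[OF \<zeta>(1)], simp)
    define P1 where "P1 r = c * (indicator {a..b} r * (E r ^ k * r ^ n * \<psi> r))" for r
    define P3 where "P3 r = indicator {a..b} r * (\<Gamma> r * \<psi> r)" for r
    have I1: "integrable lborel P1" unfolding P1_def
      by (rule integrable_mult_right[OF flux_test_integrable[OF E E0 ab(1,3) energy \<psi>c]])
    have I2: "integrable lborel (\<lambda>r. G r * \<zeta> r)" by (rule source_test_integrable[OF source _ \<zeta>c]) (simp add: G_def)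
    have "set_integrable lborel {a..b} (\<lambda>r. \<Gamma> r * \<psi> r)"
      by (rule borel_integrable_atLeastAtMost')
        (use ab in \<open>auto simp: \<Gamma>_def intro!: continuous_intros continuous_on_subset[OF \<Gamma>c] continuous_on_subset[OF \<psi>c]\<close>)
    then have I3: "integrable lborel P3" by (simp add: set_integrable_def P3_def[abs_def])
    have "(\<integral>r. P3 r + G r * \<zeta> r \<partial>lborel) = \<zeta> 1 * \<Gamma> 1 - \<zeta> 0 * \<Gamma> 0"
    proof (rule integral_lborel_unit_interval)
      show "integrable lborel (\<lambda>r. P3 r + G r * \<zeta> r)" using I2 I3 by simp
      show "P3 r + G r * \<zeta> r = 0" if "r \<notin> {0..1}" for r using that ab by (auto simp: P3_def G_def)
      show "((\<lambda>r. P3 r + G r * \<zeta> r) has_integral \<zeta> 1 * \<Gamma> 1 - \<zeta> 0 * \<Gamma> 0) {0..1}"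
      proof (rule fundamental_theorem_of_calculus_interior)
        show "continuous_on {0..1} (\<lambda>r. \<zeta> r * \<Gamma> r)" unfolding \<Gamma>_def by (intro continuous_intros \<zeta>c \<Gamma>c)
        fix r :: real assume r: "r \<in> {0<..<1}"
        have "((\<lambda>r. \<zeta> r * \<Gamma> r) has_real_derivative \<psi> r * \<Gamma> r + (r ^ (n - 1) * g (v r)) * \<zeta> r) (at r)"
          unfolding \<Gamma>_def by (rule DERIV_mult[OF \<zeta>(1) \<Gamma>']) (use r in auto)
        moreover have "\<psi> r * \<Gamma> r + (r ^ (n - 1) * g (v r)) * \<zeta> r = P3 r + G r * \<zeta> r"
          using \<psi>0[of r] r by (cases "r \<in> {a..b}") (auto simp: P3_def G_def)
        ultimately show "((\<lambda>r. \<zeta> r * \<Gamma> r) has_vector_derivative P3 r + G r * \<zeta> r) (at r)"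
          by (simp add: has_real_derivative_iff_has_vector_derivative)
      qed simp
    qed
    then have "(\<integral>r. P3 r + G r * \<zeta> r \<partial>lborel) = 0" using \<zeta>(2)[of 1] ab by (simp add: \<Gamma>_def)
    moreover have "(\<integral>r. P1 r + G r * \<zeta> r \<partial>lborel) = 0" unfolding P1_def by (rule weak[OF ab \<psi>c \<psi>0 \<zeta>])
    ultimately have eq: "(\<integral>r. P1 r - P3 r \<partial>lborel) = 0" using I1 I2 I3 by simp
    have "(LINT y|lebesgue_on {0<..<1}. (c * E y ^ k * y ^ n - integral {0..y} G) * mollifier \<epsilon> (x - y)) = (\<integral>r. P1 r - P3 r \<partial>lborel)"
    proof (rule lebesgue_on_transfer(2))
      show "(\<lambda>r. P1 r - P3 r) \<in> borel_measurable borel" using borel_measurable_integrable[OF Bochner_Integration.integrable_diff[OF I1 I3]] by simp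
      show "AE y in lebesgue. y \<in> {0<..<1} \<longrightarrow> (c * E y ^ k * y ^ n - integral {0..y} G) * mollifier \<epsilon> (x - y) = P1 y - P3 y"
      proof (rule AE_I2, rule impI)
        fix y
        show "(c * E y ^ k * y ^ n - integral {0..y} G) * mollifier \<epsilon> (x - y) = P1 y - P3 y"
          using \<psi>0[of y] by (cases "y \<in> {a..b}") (simp_all add: P1_def P3_def \<Gamma>_def algebra_simps flip: \<psi>_def)
      qed
      show "P1 r - P3 r = 0" if "r \<notin> {0<..<1}" for r using that ab by (auto simp: P1_def P3_def indicator_def)
    qed simp
    then show "(LINT y|lebesgue_on {0<..<1}. (c * E y ^ k * y ^ n - integral {0..y} G) * mollifier \<epsilon> (x - y)) = 0" using eq by simp
  qed
qed

text \<open>The flux determines \<open>q\<close> at every point, and not only almost everywhere. Absolute continuity then turns \<open>u' = r q\<close> almost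
  everywhere into a derivative everywhere, since \<open>r q\<close> is continuous.\<close>

lemma weak_profile_regular:
  fixes u :: "real^'n::finite \<Rightarrow> real" and v g g' E :: "real \<Rightarrow> real" and n k :: nat
  assumes n: "n = CARD('n)" and k: "1 \<le> k" "k \<le> n" and g_pos: "\<And>t. g t > 0"
    and g': "\<And>t. (g has_real_derivative g' t) (at t)" "continuous_on UNIV g'"
    and u: "\<And>x. x \<in> B1 \<Longrightarrow> u x = v (norm x)"
    and lac: "loc_abs_continuous {0<..<1} v"
    and E[measurable]: "E \<in> borel_measurable borel" and E0: "\<And>r. 0 \<le> E r"
    and Ev: "AE r in lebesgue. r \<in> {0<..<1} \<longrightarrow> deriv v r = r * E r"
    and energy: "integrable lborel (\<lambda>r. indicator {0<..<1} r * (r ^ (n + 1) * E r ^ (k + 1)))"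
    and source: "integrable lborel (\<lambda>r. indicator {0<..<1} r * (r ^ (n - 1) * g (v r)))"
    and weak: "\<And>a b \<psi> \<zeta>. 0 < a \<Longrightarrow> a < b \<Longrightarrow> b < 1 \<Longrightarrow> continuous_on UNIV \<psi> \<Longrightarrow> (\<And>r. r \<notin> {a..b} \<Longrightarrow> \<psi> r = 0) \<Longrightarrow>
       (\<And>r. (\<zeta> has_real_derivative \<psi> r) (at r)) \<Longrightarrow> (\<And>r. b \<le> r \<Longrightarrow> \<zeta> r = 0) \<Longrightarrow>
       (\<integral>r. c_nk n k * (indicator {a..b} r * (E r ^ k * r ^ n * \<psi> r)) + indicator {0<..<1} r * (r ^ (n - 1) * g (v r)) * \<zeta> r \<partial>lborel) = 0"
  shows "\<exists>q q'. radial_core u v g g' q q' n k"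
proof -
  have c: "c_nk n k > 0" using k by (simp add: c_nk_def zero_less_binomial)
  have gc: "continuous_on UNIV g" by (rule DERIV_continuous_on[where D=g']) (rule DERIV_subset[OF g'(1)], simp)
  note fl = flux_eq_source_primitive[OF loc_abs_continuous_imp_continuous[OF lac] gc E E0 energy source weak]
  define \<Gamma> where "\<Gamma> r = integral {0..r} (\<lambda>r. indicator {0<..<1} r * (r ^ (n - 1) * g (v r)))" for r
  have \<Gamma>c: "continuous_on {0..1} \<Gamma>" unfolding \<Gamma>_def[abs_def] by (rule fl(1))
  have \<Gamma>': "(\<Gamma> has_real_derivative r ^ (n - 1) * g (v r)) (at r)" if "0 < r" "r < 1" for r
    unfolding \<Gamma>_def[abs_def] by (rule fl(2)[OF _ _ _ _ _ _ _ that])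
  have \<Gamma>E: "AE r in lebesgue. r \<in> {0<..<1} \<longrightarrow> c_nk n k * E r ^ k * r ^ n - \<Gamma> r = 0"
    unfolding \<Gamma>_def[abs_def] by (rule fl(3))
  have \<Gamma>0: "\<Gamma> 0 = 0" by (simp add: \<Gamma>_def)
  have \<Gamma>pos: "\<Gamma> r > 0" if r: "0 < r" "r < 1" for r
  proof -
    have "\<Gamma> 0 < \<Gamma> r"
    proof (rule DERIV_pos_imp_increasing_open[OF r(1)])
      show "continuous_on {0..r} \<Gamma>" by (rule continuous_on_subset[OF \<Gamma>c]) (use r in auto)
      fix x assume x: "0 < x" "x < r"
      then show "\<exists>y. (\<Gamma> has_real_derivative y) (at x) \<and> 0 < y"
        using \<Gamma>'[of x] r g_pos[of "v x"] by (intro exI[of _ "x ^ (n - 1) * g (v x)"]) auto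
    qed
    then show ?thesis by (simp add: \<Gamma>0)
  qed
  define q where "q r = root k (\<Gamma> r / (c_nk n k * r ^ n))" for r
  have arg_pos: "0 < \<Gamma> r / (c_nk n k * r ^ n)" if "0 < r" "r < 1" for r using \<Gamma>pos[OF that] c that by simp
  have q_pos: "0 < q r" if "0 < r" "r < 1" for r
    unfolding q_def using arg_pos[OF that] k by simp
  have qk: "q r ^ k = \<Gamma> r / (c_nk n k * r ^ n)" if "0 < r" "r < 1" for r
    unfolding q_def using less_imp_le[OF arg_pos[OF that]] k by (intro real_root_pow_pos2) auto
  have flux: "c_nk n k * (r ^ n * q r ^ k) = \<Gamma> r" if "0 < r" "r < 1" for r
    unfolding qk[OF that] using c that by simp
  have Eq: "AE r in lebesgue. r \<in> {0<..<1} \<longrightarrow> E r = q r"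
    using \<Gamma>E
  proof eventually_elim
    case (elim r)
    show ?case
    proof
      assume r: "r \<in> {0<..<1}"
      then have "E r ^ k = \<Gamma> r / (c_nk n k * r ^ n)" using elim c by (simp add: field_simps)
      then have "q r = root k (E r ^ k)" by (simp add: q_def)
      also have "\<dots> = E r" by (rule real_root_power_cancel) (use k E0 in auto)
      finally show "E r = q r" by simp
    qed
  qed
  have "\<exists>D. (q has_real_derivative D) (at r)" if r: "0 < r" "r < 1" for r
  proof -
    have a: "((\<lambda>r. \<Gamma> r / (c_nk n k * r ^ n)) has_real_derivative
       (r ^ (n - 1) * g (v r) * (c_nk n k * r ^ n) - \<Gamma> r * (c_nk n k * (real n * r ^ (n - 1)))) / ((c_nk n k * r ^ n) * (c_nk n k * r ^ n))) (at r)"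
      using c r by (intro DERIV_divide \<Gamma>' DERIV_cmult) (auto intro!: derivative_eq_intros)
    have "0 < k" using k by simp
    show ?thesis
      unfolding q_def by (rule exI) (rule DERIV_chain2[OF DERIV_real_root[OF \<open>0 < k\<close> arg_pos[OF r]] a])
  qed
  then obtain q' where q': "\<And>r. 0 < r \<Longrightarrow> r < 1 \<Longrightarrow> (q has_real_derivative q' r) (at r)" by metis
  have ode: "c_nk n k * (real n * q r ^ k + real k * q r ^ (k - 1) * (r * q' r)) = g (v r)" if r: "0 < r" "r < 1" for r
  proof -
    let ?G = "c_nk n k * (real n * q r ^ k + real k * q r ^ (k - 1) * (r * q' r))"
    have "((\<lambda>r. r ^ n * q r ^ k) has_real_derivative r ^ (n - 1) * ?G / c_nk n k) (at r)"
      by (rule flux_has_derivative[OF _ k(1) _ q'[OF r] refl]) (use k c in auto)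
    then have "((\<lambda>r. c_nk n k * (r ^ n * q r ^ k)) has_real_derivative c_nk n k * (r ^ (n - 1) * ?G / c_nk n k)) (at r)"
      by (rule DERIV_cmult)
    then have "(\<Gamma> has_real_derivative c_nk n k * (r ^ (n - 1) * ?G / c_nk n k)) (at r)"
      by (rule has_field_derivative_transform_within_open[of _ _ _ "{0<..<1}"]) (use r flux in auto)
    then have "c_nk n k * (r ^ (n - 1) * ?G / c_nk n k) = r ^ (n - 1) * g (v r)" by (rule DERIV_unique) (rule \<Gamma>'[OF r])
    moreover have "c_nk n k * (r ^ (n - 1) * ?G / c_nk n k) = r ^ (n - 1) * ?G" using c by (simp only: nonzero_mult_div_cancel_left times_divide_eq_right)
    ultimately have "r ^ (n - 1) * ?G = r ^ (n - 1) * g (v r)" by (simp only:)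
    moreover have "r ^ (n - 1) \<noteq> 0" using r by simp
    ultimately show ?thesis using mult_left_cancel by blast
  qed
  have qc: "continuous_on {0<..<1} q"
    by (rule DERIV_continuous_on[where D=q']) (auto intro: DERIV_subset q')
  have v': "(v has_real_derivative r * q r) (at r)" if r: "0 < r" "r < 1" for r
  proof -
    define a b where "a = r / 2" and "b = (1 + r) / 2"
    have ab: "0 < a" "a < r" "r < b" "b < 1" using r by (auto simp: a_def b_def)
    have tqc: "continuous_on A (\<lambda>t. t * q t)" if "A \<subseteq> {0<..<1}" for A
      by (intro continuous_intros continuous_on_subset[OF qc that])
    have *: "v a + integral {a..x} (\<lambda>t. t * q t) = v x" if x: "x \<in> {a<..<b}" for x
    proof -
      have s: "a \<le> x" "{a..x} \<subseteq> {0<..<1}" using x ab by auto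
      have i: "set_integrable lebesgue {a..x} (deriv v)" "v x - v a = (LINT t:{a..x}|lebesgue. deriv v t)"
        using lac s unfolding loc_abs_continuous_def by blast+
      have "set_integrable lborel {a..x} (\<lambda>t. t * q t)" by (rule borel_integrable_atLeastAtMost'[OF tqc[OF s(2)]])
      then have j: "set_integrable lebesgue {a..x} (\<lambda>t. t * q t)"
        unfolding set_integrable_def by (subst integrable_completion) auto
      have "(LINT t:{a..x}|lebesgue. deriv v t) = (LINT t:{a..x}|lebesgue. t * q t)"
        unfolding set_lebesgue_integral_def
      proof (rule integral_cong_AE)
        show "(\<lambda>t. indicator {a..x} t *\<^sub>R deriv v t) \<in> borel_measurable lebesgue" "(\<lambda>t. indicator {a..x} t *\<^sub>R (t * q t)) \<in> borel_measurable lebesgue"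
          using i(1) j unfolding set_integrable_def by (blast intro: borel_measurable_integrable)+
        show "AE t in lebesgue. indicator {a..x} t *\<^sub>R deriv v t = indicator {a..x} t *\<^sub>R (t * q t)"
          using Ev Eq
        proof eventually_elim
          case (elim t)
          then show ?case using s(2) by (cases "t \<in> {a..x}") auto
        qed
      qed
      also have "\<dots> = integral {a..x} (\<lambda>t. t * q t)" by (rule set_lebesgue_integral_eq_integral(2)[OF j])
      finally show ?thesis using i(2) by simp
    qed
    have "((\<lambda>x. integral {a..x} (\<lambda>t. t * q t)) has_real_derivative r * q r) (at r within {a..b})"
      by (rule integral_has_real_derivative[OF tqc]) (use ab in auto)
    moreover have "at r within {a..b} = at r" by (rule at_within_Icc_at) (use ab in auto)
    ultimately have "((\<lambda>x. v a + integral {a..x} (\<lambda>t. t * q t)) has_real_derivative r * q r) (at r)"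
      by (auto intro!: derivative_eq_intros)
    then show ?thesis
      by (rule has_field_derivative_transform_within_open[of _ _ _ "{a<..<b}"]) (use ab * in auto)
  qed
  have flux_lim: "((\<lambda>r. r ^ n * q r ^ k) \<longlongrightarrow> 0) (at_right 0)"
  proof -
    have "(\<Gamma> \<longlongrightarrow> \<Gamma> 0) (at 0 within {0..1})" using \<Gamma>c unfolding continuous_on_def by auto
    then have "(\<Gamma> \<longlongrightarrow> 0) (at_right 0)" by (simp add: \<Gamma>0 at_within_Icc_at_right)
    then have "((\<lambda>r. \<Gamma> r / c_nk n k) \<longlongrightarrow> 0 / c_nk n k) (at_right 0)" using c by (intro tendsto_divide tendsto_const) auto
    then have l: "((\<lambda>r. \<Gamma> r / c_nk n k) \<longlongrightarrow> 0) (at_right 0)" by simp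
    have "\<forall>\<^sub>F r in at_right 0. \<Gamma> r / c_nk n k = r ^ n * q r ^ k"
    proof (rule eventually_mono[OF eventually_at_right_real[of 0 1]])
      show "\<Gamma> r / c_nk n k = r ^ n * q r ^ k" if "r \<in> {0<..<1}" for r using flux[of r, symmetric] that c by simp
    qed simp
    then show ?thesis by (rule Lim_transform_eventually[OF l])
  qed
  have en: "(\<integral>\<^sup>+r. indicator {0<..<1/2} r * ennreal (r ^ (n + 1) * q r ^ (k + 1)) \<partial>lborel) < \<infinity>"
  proof -
    have "AE r in lborel. r \<in> {0<..<1} \<longrightarrow> E r = q r" using Eq by (simp add: AE_completion_iff)
    then have "(\<integral>\<^sup>+r. indicator {0<..<1/2} r * ennreal (r ^ (n + 1) * q r ^ (k + 1)) \<partial>lborel)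
       \<le> (\<integral>\<^sup>+r. ennreal (norm (indicator {0<..<1} r * (r ^ (n + 1) * E r ^ (k + 1)))) \<partial>lborel)"
    proof (intro nn_integral_mono_AE, elim eventually_mono)
      fix r assume r: "r \<in> {0<..<1} \<longrightarrow> E r = q r"
      show "indicator {0<..<1/2} r * ennreal (r ^ (n + 1) * q r ^ (k + 1)) \<le> ennreal (norm (indicator {0<..<1} r * (r ^ (n + 1) * E r ^ (k + 1))))"
      proof (cases "r \<in> {0<..<1/2}")
        case True
        then have "indicator {0<..<1} r * (r ^ (n + 1) * E r ^ (k + 1)) = r ^ (n + 1) * q r ^ (k + 1)" using r by simp
        then show ?thesis using True by (simp add: ennreal_leI)
      qed simp
    qed
    also have "\<dots> < \<infinity>" using energy unfolding integrable_iff_bounded by blast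
    finally show ?thesis .
  qed
  have "radial_core u v g g' q q' n k"
    by unfold_locales (fact n k u v' q' q_pos g' g_pos ode flux_lim en)+
  then show ?thesis by blast
qed

lemma deriv_loc_abs_continuous_measurable:
  assumes v: "loc_abs_continuous {0<..<1} v"
  shows "(\<lambda>r. indicator {0<..<1} r * deriv v r) \<in> borel_measurable lebesgue"
proof (rule borel_measurable_LIMSEQ_real)
  let ?a = "\<lambda>m. 1 / real (Suc (Suc m))"
  let ?F = "\<lambda>m r. indicator {?a m..1 - ?a m} r *\<^sub>R deriv v r"
  show "?F m \<in> borel_measurable lebesgue" for m
  proof -
    have "0 < ?a m" "?a m \<le> 1 / 2" by (simp_all add: field_simps)
    moreover have "p \<le> 1 - p" "{p..1 - p} \<subseteq> {0<..<1}" if "0 < p" "p \<le> 1 / 2" for p :: real using that by auto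
    ultimately have "?a m \<le> 1 - ?a m" "{?a m..1 - ?a m} \<subseteq> {0<..<1}" by blast+
    then have "set_integrable lebesgue {?a m..1 - ?a m} (deriv v)"
      using v unfolding loc_abs_continuous_def by blast
    then show ?thesis unfolding set_integrable_def by (rule borel_measurable_integrable)
  qed
  show "(\<lambda>m. ?F m r) \<longlonglongrightarrow> indicator {0<..<1} r * deriv v r" for r
  proof (cases "r \<in> {0<..<1}")
    case True
    have a: "?a \<longlonglongrightarrow> 0" by (rule LIMSEQ_Suc[OF LIMSEQ_Suc[OF lim_1_over_n]])
    have "\<forall>\<^sub>F m in sequentially. ?a m < min r (1 - r)" by (rule order_tendstoD(2)[OF a]) (use True in auto)
    then have "\<forall>\<^sub>F m in sequentially. ?F m r = indicator {0<..<1} r * deriv v r"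
      by eventually_elim (use True in auto)
    then show ?thesis by (rule tendsto_eventually)
  next
    case False
    have "r \<notin> {?a m..1 - ?a m}" for m
    proof
      assume "r \<in> {?a m..1 - ?a m}"
      moreover have "0 < ?a m" by simp
      ultimately show False using False by (simp only: atLeastAtMost_iff greaterThanLessThan_iff) linarith
    qed
    then show ?thesis using False by simp
  qed
qed

text \<open>In polar coordinates the integrability conditions become conditions on \<open>(0,1)\<close>, and
  the weak equation is used for radial test functions that are constant near the origin.\<close>

lemma radial_core_weak:
  fixes u :: "real^'n::finite \<Rightarrow> real"
  assumes n: "n = CARD('n)" and k: "1 \<le> k" "k \<le> n" and g_pos: "\<And>t. g t > 0"
    and g': "\<And>t. (g has_real_derivative g' t) (at t)" "continuous_on UNIV g'"
    and u: "radial_profile u v" and w: "weak_radial_solution k g u v"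
    and mono: "\<forall>r\<in>{0<..<1}. v differentiable (at r) \<longrightarrow> deriv v r \<ge> 0"
  shows "\<exists>q q'. radial_core u v g g' q q' n k"
proof -
  let ?I = "{0<..<1::real}"
  have uv: "u x = v (norm x)" if "x \<in> B1" for x using u that unfolding radial_profile_def by blast
  have lac: "loc_abs_continuous ?I v" using w unfolding weak_radial_solution_def by blast
  have c: "c_nk n k > 0" using k by (simp add: c_nk_def zero_less_binomial)
  have kc: "real k * c_nk n k > 0" using c k by simp
  have d: "DIM(real^'n) - 1 = n - 1" by (simp add: n)
  obtain d0 where d0[measurable]: "d0 \<in> borel_measurable borel" "AE r in lebesgue. indicator ?I r * deriv v r = d0 r"
    by (rule borel_representative[OF deriv_loc_abs_continuous_measurable[OF lac]])
  define E where "E r = indicator ?I r * max 0 (d0 r) / r" for r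
  have E[measurable]: "E \<in> borel_measurable borel" unfolding E_def[abs_def] by measurable
  have E0: "0 \<le> E r" for r by (simp add: E_def indicator_def)
  have Eoff: "E r = 0" if "r \<notin> ?I" for r using that by (simp add: E_def)
  have Ev: "AE r in lebesgue. r \<in> ?I \<longrightarrow> deriv v r = r * E r"
  proof -
    have "AE t in lebesgue_on ?I. v differentiable (at t)" using lac unfolding loc_abs_continuous_def by blast
    then have "AE t in lebesgue. t \<in> ?I \<longrightarrow> v differentiable (at t)" by (simp add: AE_restrict_space_iff)
    then show ?thesis
      using d0(2)
    proof eventually_elim
      case (elim r)
      show ?case
      proof
        assume r: "r \<in> ?I"
        then have "0 \<le> deriv v r" using elim(1) mono by blast
        moreover have "deriv v r = d0 r" using elim(2) r by simp
        ultimately show "deriv v r = r * E r" using r by (simp add: E_def)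
      qed
    qed
  qed
  have Evn: "AE x in lebesgue. x \<in> B1 \<longrightarrow> x \<noteq> (0 :: real^'n) \<longrightarrow> deriv v (norm x) = norm x * E (norm x)"
  proof -
    have "AE r in lebesgue. r > 0 \<longrightarrow> (r < 1 \<longrightarrow> deriv v r = r * E r)" using Ev by eventually_elim auto
    from AE_radial[where 'a="real^'n", OF this] show ?thesis by eventually_elim simp
  qed
  have ne0: "AE x in lebesgue. x \<noteq> (0 :: real^'n)" by (rule AE_completion[OF AE_lborel_singleton])
  have rn: "r ^ (n + 1) = r ^ (n - 1) * r\<^sup>2" for r :: real
    using k by (simp flip: power_add)
  have Ek: "E r ^ (k + 1) = E r ^ (k - 1) * (E r)\<^sup>2" for r
    using k by (simp flip: power_add)
  have energy: "integrable lborel (\<lambda>r. indicator ?I r * (r ^ (n + 1) * E r ^ (k + 1)))"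
  proof -
    define F where "F r = real k * c_nk n k * E r ^ (k - 1) * (r * E r)\<^sup>2" for r
    have Fm[measurable]: "F \<in> borel_measurable borel" unfolding F_def[abs_def] by measurable
    have "integrable (lebesgue_on (B1 :: (real^'n) set)) (\<lambda>x. k * c_nk CARD('n) k * (deriv v (norm x) / norm x) ^ (k - 1) * (deriv v (norm x))\<^sup>2)"
      using w unfolding weak_radial_solution_def by blast
    moreover have "integrable (lebesgue_on (B1 :: (real^'n) set)) (\<lambda>x. k * c_nk CARD('n) k * (deriv v (norm x) / norm x) ^ (k - 1) * (deriv v (norm x))\<^sup>2)
       \<longleftrightarrow> integrable lborel (\<lambda>x :: real^'n. F (norm x))"
    proof (rule lebesgue_on_transfer(3))
      show "AE x in lebesgue. x \<in> B1 \<longrightarrow> k * c_nk CARD('n) k * (deriv v (norm x) / norm x) ^ (k - 1) * (deriv v (norm x))\<^sup>2 = F (norm (x :: real^'n))"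
        using Evn ne0 by eventually_elim (auto simp: F_def n)
      show "F (norm x) = 0" if "x \<notin> B1" for x :: "real^'n" using that Eoff[of "norm x"] by (auto simp: F_def)
    qed auto
    ultimately have "integrable lborel (\<lambda>r. indicator {0<..} r * (F r * r ^ (n - 1)))"
      using integrable_radial_iff[where 'a="real^'n", OF Fm] unfolding d by blast
    then have "integrable lborel (\<lambda>r. (1 / (real k * c_nk n k)) * (indicator {0<..} r * (F r * r ^ (n - 1))))"
      by (rule integrable_mult_right)
    moreover have "(1 / (real k * c_nk n k)) * (indicator {0<..} r * (F r * r ^ (n - 1))) = indicator ?I r * (r ^ (n + 1) * E r ^ (k + 1))" for r
    proof (cases "r \<in> ?I")
      case True
      then have "(1 / (real k * c_nk n k)) * (indicator {0<..} r * (F r * r ^ (n - 1))) = E r ^ (k - 1) * (r * E r)\<^sup>2 * r ^ (n - 1)"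
        using c k by (simp add: F_def)
      also have "\<dots> = r ^ (n + 1) * E r ^ (k + 1)" unfolding rn Ek power_mult_distrib by (simp only: mult_ac)
      finally show ?thesis using True by simp
    qed (simp add: F_def Eoff)
    ultimately show ?thesis by simp
  qed
  have vc: "continuous_on ?I (\<lambda>r. g (v r))"
    by (rule continuous_on_compose2[OF _ loc_abs_continuous_imp_continuous[OF lac], of UNIV])
      (auto intro!: DERIV_continuous_on[where D=g'] DERIV_subset[OF g'(1)])
  define F2 where "F2 r = indicator ?I r * g (v r)" for r
  have F2m[measurable]: "F2 \<in> borel_measurable borel"
  proof -
    have "(\<lambda>r. indicator ?I r *\<^sub>R g (v r)) \<in> borel_measurable borel"
      by (rule borel_measurable_continuous_on_indicator[OF _ vc]) simp
    then show ?thesis by (simp add: F2_def[abs_def])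
  qed
  have F2n: "AE x in lebesgue. x \<in> B1 \<longrightarrow> g (u x) = F2 (norm (x :: real^'n))"
    using ne0 by eventually_elim (auto simp: F2_def uv)
  have F2eq: "indicator {0<..} r * (F2 r * r ^ (n - 1)) = indicator ?I r * (r ^ (n - 1) * g (v r))" for r
    by (auto simp: F2_def indicator_def)
  have source: "integrable lborel (\<lambda>r. indicator ?I r * (r ^ (n - 1) * g (v r)))"
  proof -
    have "integrable (lebesgue_on (B1 :: (real^'n) set)) (\<lambda>x. g (u x))" using w unfolding weak_radial_solution_def by blast
    moreover have "integrable (lebesgue_on (B1 :: (real^'n) set)) (\<lambda>x. g (u x)) \<longleftrightarrow> integrable lborel (\<lambda>x :: real^'n. F2 (norm x))"
    proof (rule lebesgue_on_transfer(3)[OF _ _ _ F2n])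
      show "(\<lambda>x :: real^'n. F2 (norm x)) \<in> borel_measurable borel" by measurable
    qed (auto simp: F2_def)
    ultimately show ?thesis
      using integrable_radial_iff[where 'a="real^'n", OF F2m] unfolding d F2eq by blast
  qed
  show ?thesis
  proof (rule weak_profile_regular[OF n k g_pos g' uv lac E E0 Ev energy source])
    fix a b :: real and \<psi> \<zeta> :: "real \<Rightarrow> real"
    assume ab: "0 < a" "a < b" "b < 1" and \<psi>: "continuous_on UNIV \<psi>" "\<And>r. r \<notin> {a..b} \<Longrightarrow> \<psi> r = 0"
      and \<zeta>: "\<And>r. (\<zeta> has_real_derivative \<psi> r) (at r)" "\<And>r. b \<le> r \<Longrightarrow> \<zeta> r = 0"
    let ?\<eta> = "\<lambda>x :: real^'n. \<zeta> (norm x)"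
    have \<zeta>c: "continuous_on UNIV \<zeta>" by (rule DERIV_continuous_on[where D=\<psi>]) (rule DERIV_subset[OF \<zeta>(1)], simp)
    have [measurable]: "\<psi> \<in> borel_measurable borel" "\<zeta> \<in> borel_measurable borel"
      by (rule borel_measurable_continuous_onI, fact)+
    note C = C1_c_radial_constant_near_origin[where 'n='n, OF ab(1,3) \<psi> \<zeta>]
    define F3 where "F3 r = c_nk n k * (E r ^ k * (r * \<psi> r)) + F2 r * \<zeta> r" for r
    have F3m[measurable]: "F3 \<in> borel_measurable borel" unfolding F3_def[abs_def] by measurable
    have eq: "indicator {0<..} r * (F3 r * r ^ (n - 1)) = c_nk n k * (indicator {a..b} r * (E r ^ k * r ^ n * \<psi> r)) + indicator ?I r * (r ^ (n - 1) * g (v r)) * \<zeta> r" for r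
    proof -
      have rn1: "r ^ n = r * r ^ (n - 1)" using k by (simp add: power_eq_if)
      have "indicator {0<..} r * (E r ^ k * (r * \<psi> r) * r ^ (n - 1)) = indicator {a..b} r * (E r ^ k * r ^ n * \<psi> r)"
        unfolding rn1 using \<psi>(2)[of r] ab by (cases "r \<in> {a..b}") (simp_all add: mult_ac)
      moreover have "indicator {0<..} r * (F3 r * r ^ (n - 1)) = c_nk n k * (indicator {0<..} r * (E r ^ k * (r * \<psi> r) * r ^ (n - 1))) + (indicator {0<..} r * (F2 r * r ^ (n - 1))) * \<zeta> r"
        by (simp add: F3_def algebra_simps)
      ultimately show ?thesis unfolding F2eq by simp
    qed
    have "integrable lborel (\<lambda>r. c_nk n k * (indicator {a..b} r * (E r ^ k * r ^ n * \<psi> r)) + indicator ?I r * (r ^ (n - 1) * g (v r)) * \<zeta> r)"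
      by (intro Bochner_Integration.integrable_add integrable_mult_right flux_test_integrable[OF E E0 ab(1,3) energy \<psi>(1)]
          source_test_integrable[OF source _ \<zeta>c]) simp
    then have F3i: "integrable lborel (\<lambda>x :: real^'n. F3 (norm x))"
      using integrable_radial_iff[where 'a="real^'n", OF F3m] unfolding d eq by blast
    have "0 = (LINT x|lebesgue_on B1. 1 / k * (k * c_nk CARD('n) k * (deriv v (norm x) / norm x) ^ k * (x \<bullet> grad ?\<eta> x)) + g (u x) * ?\<eta> x)"
      using w C(1) unfolding weak_radial_solution_def by (elim conjE allE[of _ ?\<eta>]) simp
    also have "\<dots> = (\<integral>x. F3 (norm (x :: real^'n)) \<partial>lborel)"
    proof (rule lebesgue_on_transfer(2))
      show "AE x in lebesgue. x \<in> B1 \<longrightarrow> 1 / k * (k * c_nk CARD('n) k * (deriv v (norm x) / norm x) ^ k * (x \<bullet> grad ?\<eta> x)) + g (u x) * ?\<eta> x = F3 (norm x)"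
        using Evn ne0 F2n
      proof eventually_elim
        case (elim x)
        show ?case
        proof
          assume "x \<in> B1"
          then have e: "deriv v (norm x) / norm x = E (norm x)" "g (u x) = F2 (norm x)" using elim by auto
          have gr: "grad ?\<eta> x = (\<psi> (norm x) / norm x) *\<^sub>R x" by (rule C(2))
          have x: "x \<bullet> grad ?\<eta> x = norm x * \<psi> (norm x)" unfolding gr using elim(2) by (simp add: dot_square_norm power2_eq_square)
          show "1 / k * (k * c_nk CARD('n) k * (deriv v (norm x) / norm x) ^ k * (x \<bullet> grad ?\<eta> x)) + g (u x) * ?\<eta> x = F3 (norm x)"
            unfolding e x F3_def using k by (simp add: n)
        qed
      qed
      show "F3 (norm x) = 0" if "x \<notin> B1" for x :: "real^'n"
        using that Eoff[of "norm x"] k by (auto simp: F3_def F2_def power_0_left)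
    qed auto
    finally have "(\<integral>r. indicator {0<..} r * (F3 r * r ^ (n - 1)) \<partial>lborel) = 0"
      using integral_radial_eq_0[where 'a="real^'n", OF F3m F3i] unfolding d by simp
    then show "(\<integral>r. c_nk n k * (indicator {a..b} r * (E r ^ k * r ^ n * \<psi> r)) + indicator ?I r * (r ^ (n - 1) * g (v r)) * \<zeta> r \<partial>lborel) = 0"
      unfolding eq .
  qed
qed

theorem corollary1p8:
  fixes u :: "real^'n::finite \<Rightarrow> real" and v g :: "real \<Rightarrow> real" and k n :: nat
  assumes "n = CARD('n)" and "1 \<le> k" and "k \<le> n"
    and "\<forall>t. g t > 0" and "g C1_differentiable_on UNIV"
    and "radial_solution k g u v"
  shows "semistable k g u \<longleftrightarrow>
    (\<forall>\<eta> :: real^'n \<Rightarrow> real.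
       \<eta> \<in> H1_c B1 \<inter> Linf_loc B1 \<and> radially_symmetric B1 \<eta> \<longrightarrow>
       integral_nonneg (lebesgue_on B1) (\<lambda>x.
         (deriv v (norm x) / norm x) ^ (k + 1) *
         ((norm (norm x *\<^sub>R weak_grad B1 \<eta> x))\<^sup>2
          + (real k - 1) / (real k + 1) * (x \<bullet> weak_grad B1 (\<lambda>y. (\<eta> y)\<^sup>2) x)
          - (2 * real n - real k - 1) / (real k + 1) * (\<eta> x)\<^sup>2)))"
proof -
  obtain g' where g': "\<And>t. (g has_real_derivative g' t) (at t)" "continuous_on UNIV g'"
    using C1_on_UNIV_real[OF assms(5)] by metis
  have g_pos: "\<And>t. g t > 0" using assms(4) by blast
  have u: "radial_profile u v" and mono: "\<forall>r\<in>{0<..<1}. v differentiable (at r) \<longrightarrow> deriv v r \<ge> 0"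
    and sol: "classical_solution k g u \<or> weak_radial_solution k g u v"
    using assms(6) unfolding radial_solution_def by blast+
  have "\<exists>q q'. radial_core u v g g' q q' n k"
    using sol
  proof
    assume "classical_solution k g u"
    then show ?thesis by (rule radial_core_classical[OF assms(1-3) g_pos g' u _ mono])
  next
    assume "weak_radial_solution k g u v"
    then show ?thesis by (rule radial_core_weak[OF assms(1-3) g_pos g' u _ mono])
  qed
  then obtain q q' where "radial_core u v g g' q q' n k" by blast
  then interpret radial_core u v g g' q q' n k .
  show ?thesis
    unfolding semistable_iff_Q_nonneg Q_nonneg_iff_J_nonneg by (rule weighted_condition_iff_J_nonneg)
qed

end
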